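(* Every degenerated parabolic $(3,5,6)$-distribution $D$ on a 6-dimensional manifold is locally equivalent (that is, near every point, by a local diffeomorphism carrying one distribution onto the other) to the canonical Cartan distribution on the mixed jet space $J^{2,1}(\mathbb{R},\mathbb{R}^2)$. In the natural coordinates $(t,u,v,u_1,u_2,v_1)$ on $J^{2,1}(\mathbb{R},\mathbb{R}^2)\cong\mathbb{R}^6$ this Cartan distribution is the rank 3 distribution annihilated by the one-forms $$du-u_1\,dt,\qquad du_1-u_2\,dt,\qquad dv-v_1\,dt.$$ In particular, all degenerated parabolic $(3,5,6)$-distributions are locally equivalent to each other.
   Context: All objects are smooth. For distributions $A,B$ on a manifold, $[A,B]$ denotes the distribution spanned by $A$, $B$ and all Lie brackets of sections of $A$ with sections of $B$. A $(3,5,6)$-distribution is a rank 3 distribution $D$ on a 6-dimensional manifold $M$ with $\mathrm{rk}\,[D,D]=5$ and $[D,[D,D]]=TM$. Put $D_5=[D,D]$. The Lie bracket induces at each $x$ a surjection $D(x)\wedge D(x)\to D_5(x)/D(x)$ with one-dimensional kernel spanned by a decomposable bivector; hence there is a unique rank 2 subdistribution $D_2\subset D$ with $[D_2,D_2]\subset D$. Standing assumption: $D_2$ is integrable. Let $(X_1,X_2)$ be a local frame of $D_2$, let $Y$ complete it to a local frame of $D$, put $Y_i=[Y,X_i]$ (so $(X_1,X_2,Y,Y_1,Y_2)$ is a local frame of $D_5$), and let $Z$ complete this to a local frame of $TM$. Define functions $a_{ij}$ by $[X_i,Y_j]=a_{ij}Z \mod D_5$. The matrix $(a_{ij})$ is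 symmetric and defines at each point a symmetric bilinear form on $D_2(x)$, well defined up to multiplication by a non-zero number. $D$ is called degenerated parabolic if $(a_{ij})$ vanishes identically (has rank 0 at every point). *)

theory Defs
  imports "HOL-Analysis.Analysis"
begin

section \<open>Smooth maps between open subsets of Euclidean spaces\<close>

primrec Ck_on :: "nat \<Rightarrow> 'a set \<Rightarrow> ('a::euclidean_space \<Rightarrow> 'b::real_normed_vector) \<Rightarrow> bool" where
  "Ck_on 0 S f \<longleftrightarrow> continuous_on S f"
| "Ck_on (Suc k) S f \<longleftrightarrow>
     (\<forall>x\<in>S. f differentiable (at x)) \<and>
     (\<forall>v. Ck_on k S (\<lambda>x. frechet_derivative f (at x) v))"

text \<open>Only meaningful for open \<open>S\<close>, since derivatives are taken \<open>at x\<close>.\<close>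

definition smooth_on :: "'a set \<Rightarrow> ('a::euclidean_space \<Rightarrow> 'b::real_normed_vector) \<Rightarrow> bool" where
  "smooth_on S f \<longleftrightarrow> (\<forall>k. Ck_on k S f)"

section \<open>Distributions on open subsets of a Euclidean space\<close>

type_synonym 'e vfield = "'e \<Rightarrow> 'e"
type_synonym 'e distrib = "'e \<Rightarrow> 'e set"

definition lie_bracket :: "'e::euclidean_space vfield \<Rightarrow> 'e vfield \<Rightarrow> 'e vfield" where
  "lie_bracket X Y = (\<lambda>x. frechet_derivative Y (at x) (X x) - frechet_derivative X (at x) (Y x))"

definition section_on :: "'e::euclidean_space set \<Rightarrow> 'e distrib \<Rightarrow> 'e vfield \<Rightarrow> bool" where
  "section_on U E X \<longleftrightarrow> smooth_on U X \<and> (\<forall>x\<in>U. X x \<in> E x)"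

text \<open>A list of vector fields whose values form a basis of \<open>E x\<close> at every point \<open>x\<close> of \<open>U\<close>
  (distinctness excludes repeated vectors, which the set of values would hide).\<close>

definition local_frame :: "'e::euclidean_space set \<Rightarrow> 'e distrib \<Rightarrow> 'e vfield list \<Rightarrow> bool" where
  "local_frame U E Xs \<longleftrightarrow> open U \<and> (\<forall>X\<in>set Xs. smooth_on U X) \<and>
     (\<forall>x\<in>U. distinct (map (\<lambda>X. X x) Xs) \<and>
            independent (set (map (\<lambda>X. X x) Xs)) \<and>
            span (set (map (\<lambda>X. X x) Xs)) = E x)"

definition distribution_on :: "nat \<Rightarrow> 'e::euclidean_space set \<Rightarrow> 'e distrib \<Rightarrow> bool" where
  "distribution_on k \<Omega> E \<longleftrightarrow>
     (\<forall>x\<in>\<Omega>. \<exists>U Xs. x \<in> U \<and> U \<subseteq> \<Omega> \<and> local_frame U E Xs \<and> length Xs = k)"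

text \<open>The distribution spanned by \<open>A\<close>, \<open>B\<close> and all brackets of local sections, pointwise.\<close>

definition dist_bracket :: "'e::euclidean_space distrib \<Rightarrow> 'e distrib \<Rightarrow> 'e distrib" where
  "dist_bracket A B = (\<lambda>x. span (A x \<union> B x \<union>
     {lie_bracket X Y x | X Y U. open U \<and> x \<in> U \<and> section_on U A X \<and> section_on U B Y}))"

definition distribution_356_on :: "'e::euclidean_space set \<Rightarrow> 'e distrib \<Rightarrow> bool" where
  "distribution_356_on \<Omega> D \<longleftrightarrow> distribution_on 3 \<Omega> D \<and>
     (\<forall>x\<in>\<Omega>. dim (dist_bracket D D x) = 5) \<and>
     (\<forall>x\<in>\<Omega>. dist_bracket D (dist_bracket D D) x = UNIV)"

text \<open>\<open>D2\<close> is the rank 2 subdistribution of \<open>D\<close> with \<open>[D2, D2] \<subseteq> D\<close>;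
  for a \<open>(3,5,6)\<close>-distribution it exists and is unique on \<open>\<Omega>\<close>.\<close>

definition is_D2_on :: "'e::euclidean_space set \<Rightarrow> 'e distrib \<Rightarrow> 'e distrib \<Rightarrow> bool" where
  "is_D2_on \<Omega> D D2 \<longleftrightarrow> distribution_on 2 \<Omega> D2 \<and>
     (\<forall>x\<in>\<Omega>. D2 x \<subseteq> D x) \<and> (\<forall>x\<in>\<Omega>. dist_bracket D2 D2 x \<subseteq> D x)"

text \<open>Integrability of a rank 2 distribution: an integral surface passes through every point.
  The parametrisation \<open>\<sigma>\<close> is an immersion because its differential has the
  two-dimensional image \<open>E (\<sigma> s)\<close>.\<close>

definition integrable2_on :: "'e::euclidean_space set \<Rightarrow> 'e distrib \<Rightarrow> bool" where
  "integrable2_on \<Omega> E \<longleftrightarrow>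
     (\<forall>x\<in>\<Omega>. \<exists>(W :: (real^2) set) \<sigma>. open W \<and> 0 \<in> W \<and> smooth_on W \<sigma> \<and> \<sigma> ` W \<subseteq> \<Omega> \<and> \<sigma> 0 = x \<and>
        (\<forall>s\<in>W. range (frechet_derivative \<sigma> (at s)) = E (\<sigma> s)))"

definition adapted_frame ::
  "'e::euclidean_space set \<Rightarrow> 'e distrib \<Rightarrow> 'e distrib \<Rightarrow> (2 \<Rightarrow> 'e vfield) \<Rightarrow> 'e vfield \<Rightarrow> 'e vfield \<Rightarrow> bool"
where
  "adapted_frame U D D2 X Y Z \<longleftrightarrow>
     local_frame U D2 [X 1, X 2] \<and>
     local_frame U D [X 1, X 2, Y] \<and>
     local_frame U (\<lambda>x. UNIV) [X 1, X 2, Y, lie_bracket Y (X 1), lie_bracket Y (X 2), Z]"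

text \<open>The entries are determined by \<open>[X i, Y j] = a i j Z mod D5\<close>, where \<open>Y j = [Y, X j]\<close> and
  \<open>D5 = [D, D]\<close>; the number is unique because \<open>Z x\<close> spans a complement of \<open>D5 x\<close>.\<close>

definition structure_matrix ::
  "'e::euclidean_space distrib \<Rightarrow> (2 \<Rightarrow> 'e vfield) \<Rightarrow> 'e vfield \<Rightarrow> 'e vfield \<Rightarrow> 'e \<Rightarrow> real^2^2" where
  "structure_matrix D X Y Z x =
     (\<chi> i j. THE a. lie_bracket (X i) (lie_bracket Y (X j)) x - a *\<^sub>R Z x \<in> dist_bracket D D x)"

definition degenerated_parabolic_on :: "'e::euclidean_space set \<Rightarrow> 'e distrib \<Rightarrow> bool" where
  "degenerated_parabolic_on \<Omega> D \<longleftrightarrow> distribution_356_on \<Omega> D \<and>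
     (\<exists>D2. is_D2_on \<Omega> D D2 \<and> integrable2_on \<Omega> D2 \<and>
        (\<forall>U X Y Z. U \<subseteq> \<Omega> \<longrightarrow> adapted_frame U D D2 X Y Z \<longrightarrow>
           (\<forall>x\<in>U. structure_matrix D X Y Z x = 0)))"

section \<open>Smooth manifolds\<close>

datatype ('m, 'e) chart = Chart (chart_dom: "'m set") (chart_map: "'m \<Rightarrow> 'e")

definition chart_inv :: "('m, 'e) chart \<Rightarrow> 'e \<Rightarrow> 'm" where
  "chart_inv c = inv_into (chart_dom c) (chart_map c)"

definition chart_img :: "('m, 'e) chart \<Rightarrow> 'e set" where
  "chart_img c = chart_map c ` chart_dom c"

definition is_chart :: "('m::topological_space, 'e::euclidean_space) chart \<Rightarrow> bool" where
  "is_chart c \<longleftrightarrow> open (chart_dom c) \<and> open (chart_img c) \<and>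
     homeomorphism (chart_dom c) (chart_img c) (chart_map c) (chart_inv c)"

definition transition :: "('m, 'e) chart \<Rightarrow> ('m, 'e) chart \<Rightarrow> 'e \<Rightarrow> 'e" where
  "transition c c' = chart_map c' \<circ> chart_inv c"

definition smooth_atlas :: "('m::topological_space, 'e::euclidean_space) chart set \<Rightarrow> bool" where
  "smooth_atlas A \<longleftrightarrow> (\<forall>c\<in>A. is_chart c) \<and>
     (\<forall>c\<in>A. \<forall>c'\<in>A. smooth_on (chart_map c ` (chart_dom c \<inter> chart_dom c')) (transition c c'))"

text \<open>The manifold given by an atlas is the union of its chart domains, an open subspace of the
  ambient type; Hausdorff and second countable are imposed on that type where it is used.\<close>

definition carrier :: "('m, 'e) chart set \<Rightarrow> 'm set" where
  "carrier A = (\<Union>c\<in>A. chart_dom c)"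

text \<open>A tangent vector at \<open>p\<close> assigns to each chart of the atlas around \<open>p\<close> a coordinate vector,
  transforming by the Jacobians of the transition maps; at other arguments it is \<open>0\<close> by convention.\<close>

type_synonym ('m, 'e) tvector = "('m, 'e) chart \<Rightarrow> 'e"

definition tangent_space ::
  "('m, 'e::euclidean_space) chart set \<Rightarrow> 'm \<Rightarrow> ('m, 'e) tvector set" where
  "tangent_space A p = {v.
     (\<forall>c. c \<notin> A \<or> p \<notin> chart_dom c \<longrightarrow> v c = 0) \<and>
     (\<forall>c\<in>A. \<forall>c'\<in>A. p \<in> chart_dom c \<inter> chart_dom c' \<longrightarrow>
        v c' = frechet_derivative (transition c c') (at (chart_map c p)) (v c))}"

text \<open>The expression in the chart \<open>c\<close> of a field \<open>D\<close> of subsets of the tangent spaces,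
  as a field of subsets of the model space over \<open>chart_img c\<close>.\<close>

definition in_chart ::
  "('m \<Rightarrow> ('m, 'e) tvector set) \<Rightarrow> ('m, 'e) chart \<Rightarrow> 'e distrib" where
  "in_chart D c = (\<lambda>y. (\<lambda>v. v c) ` D (chart_inv c y))"

definition degenerated_parabolic ::
  "('m, 'e::euclidean_space) chart set \<Rightarrow> ('m \<Rightarrow> ('m, 'e) tvector set) \<Rightarrow> bool" where
  "degenerated_parabolic A D \<longleftrightarrow>
     (\<forall>p\<in>carrier A. D p \<subseteq> tangent_space A p) \<and>
     (\<forall>c\<in>A. degenerated_parabolic_on (chart_img c) (in_chart D c))"

section \<open>Local equivalence\<close>

definition smooth_map_on ::
  "('m, 'e::euclidean_space) chart set \<Rightarrow> ('n, 'e) chart set \<Rightarrow> 'm set \<Rightarrow> ('m \<Rightarrow> 'n) \<Rightarrow> bool" where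
  "smooth_map_on A A' U F \<longleftrightarrow>
     (\<forall>c\<in>A. \<forall>c'\<in>A'. smooth_on (chart_map c ` {p \<in> U \<inter> chart_dom c. F p \<in> chart_dom c'})
        (chart_map c' \<circ> F \<circ> chart_inv c))"

definition diffeo_between ::
  "('m::topological_space, 'e::euclidean_space) chart set \<Rightarrow> ('n::topological_space, 'e) chart set \<Rightarrow>
   'm set \<Rightarrow> 'n set \<Rightarrow> ('m \<Rightarrow> 'n) \<Rightarrow> bool" where
  "diffeo_between A A' U V F \<longleftrightarrow>
     (\<exists>G. homeomorphism U V F G \<and> smooth_map_on A A' U F \<and> smooth_map_on A' A V G)"

text \<open>\<open>dF (D p) = D' (F p)\<close> for \<open>p\<close> in \<open>U\<close>, expressed in charts around \<open>p\<close> and \<open>F p\<close>.\<close>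

definition carries_on ::
  "('m, 'e::euclidean_space) chart set \<Rightarrow> ('m \<Rightarrow> ('m, 'e) tvector set) \<Rightarrow>
   ('n, 'e) chart set \<Rightarrow> ('n \<Rightarrow> ('n, 'e) tvector set) \<Rightarrow> 'm set \<Rightarrow> ('m \<Rightarrow> 'n) \<Rightarrow> bool" where
  "carries_on A D A' D' U F \<longleftrightarrow>
     (\<forall>p\<in>U. \<forall>c\<in>A. \<forall>c'\<in>A'. p \<in> chart_dom c \<longrightarrow> F p \<in> chart_dom c' \<longrightarrow>
        frechet_derivative (chart_map c' \<circ> F \<circ> chart_inv c) (at (chart_map c p)) ` (\<lambda>v. v c) ` D p =
        (\<lambda>w. w c') ` D' (F p))"

text \<open>The germs of \<open>D\<close> and \<open>D'\<close> at any two points correspond under a local diffeomorphism.\<close>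

definition locally_equivalent ::
  "('m::topological_space, 'e::euclidean_space) chart set \<Rightarrow> ('m \<Rightarrow> ('m, 'e) tvector set) \<Rightarrow>
   ('n::topological_space, 'e) chart set \<Rightarrow> ('n \<Rightarrow> ('n, 'e) tvector set) \<Rightarrow> bool" where
  "locally_equivalent A D A' D' \<longleftrightarrow>
     (\<forall>p\<in>carrier A. \<forall>q\<in>carrier A'. \<exists>U V F.
        open U \<and> p \<in> U \<and> U \<subseteq> carrier A \<and> open V \<and> V \<subseteq> carrier A' \<and>
        diffeo_between A A' U V F \<and> F p = q \<and> carries_on A D A' D' U F)"

section \<open>The Cartan distribution on the mixed jet space\<close>

text \<open>\<open>J\<^sup>2\<^sup>,\<^sup>1(\<real>, \<real>\<^sup>2)\<close> is \<open>real^6\<close> with its standard chart; the coordinates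
  \<open>(t, u, v, u1, u2, v1)\<close> are the components \<open>1, \<dots>, 6\<close> (the index \<open>6 :: 6\<close> equals \<open>0\<close>).\<close>

definition jet_chart :: "(real^6, real^6) chart" where
  "jet_chart = Chart UNIV (\<lambda>x. x)"

definition jet_atlas :: "(real^6, real^6) chart set" where
  "jet_atlas = {jet_chart}"

text \<open>The kernel of the one-forms \<open>du - u1 dt\<close>, \<open>du1 - u2 dt\<close> and \<open>dv - v1 dt\<close>.\<close>

definition cartan_kernel :: "(real^6) distrib" where
  "cartan_kernel x =
     (let u1 = x $ 4; u2 = x $ 5; v1 = x $ 6 in
      {w. let dt = w $ 1; du = w $ 2; dv = w $ 3; du1 = w $ 4 in
          du - u1 * dt = 0 \<and> du1 - u2 * dt = 0 \<and> dv - v1 * dt = 0})"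

definition cartan_distribution :: "real^6 \<Rightarrow> (real^6, real^6) tvector set" where
  "cartan_distribution p = {v \<in> tangent_space jet_atlas p. v jet_chart \<in> cartan_kernel p}"

end

theory Submission
  imports Defs
begin

text \<open>Write \<open>Y\<^sub>i = [Y, X\<^sub>i]\<close> and let \<open>\<theta>\<close> be a one-form with kernel \<open>D\<^sub>5 = [D, D]\<close>. Vanishing of \<open>(a\<^sub>i\<^sub>j)\<close>
  makes \<open>X\<^sub>1\<close>, \<open>X\<^sub>2\<close> Cauchy characteristics of \<open>D\<^sub>5\<close>, and since the skew form induced by \<open>\<theta> [A, B]\<close> on the
  three-dimensional quotient by them has rank two, there is exactly one further characteristic
  direction \<open>V\<close>. The characteristics are involutive; a first integral \<open>t\<close> of them with \<open>Y t \<noteq> 0\<close>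
  allows us to rescale \<open>Y\<close> to \<open>Y t = 1\<close>. Then \<open>V t = 0\<close> forces \<open>\<theta> [Y\<^sub>1, Y\<^sub>2] = 0\<close>, so \<open>X\<^sub>1, X\<^sub>2, Y\<^sub>1, Y\<^sub>2\<close>
  span an involutive distribution. It has a first integral \<open>u\<close> independent of \<open>t\<close>, and the integrable
  \<open>D\<^sub>2\<close> has a further one \<open>v\<close>; by construction \<open>(t, u, v, Y u, Y (Y u), Y v)\<close> are jet coordinates carrying
  \<open>D\<close> to the Cartan distribution. Adding polynomials in \<open>t\<close> to \<open>u\<close> and \<open>v\<close> moves the base point to any
  prescribed jet.

  First integrals come from Frobenius' theorem, whose integral manifolds are obtained by solving an
  integral equation along the rays from the origin.\<close>

section \<open>Smooth calculus\<close>

text \<open>Why the six functions are coordinates: since \<open>u\<close> is constant along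
  \<open>X_i\<close> and \<open>Y_i\<close>, also \<open>X_i (Y u) = - Y_i u = 0\<close>; as
  \<open>v\<close> is constant along \<open>X_i\<close>, the pulled back Cartan forms vanish on
  \<open>D\<close>. Independence rests on \<open>[D, D5]\<close> being everything: some
  \<open>Z = [Y, Y_k]\<close> leaves \<open>D5\<close>, and \<open>Y_k (Y u) = - Z u\<close> is
  nonzero at the base point. Then \<open>v\<close> can be chosen so that the determinant of
  \<open>(Y u, v)\<close> along \<open>(Y1, Y2)\<close> is nonzero there; commuting \<open>Y\<close>
  past \<open>X_i\<close> shows that the determinant of \<open>(Y (Y u), Y v)\<close> along
  \<open>(X1, X2)\<close> is the same number.

  Rescaling \<open>Y\<close> changes the fields \<open>Y_i\<close> but not \<open>D5\<close>. So the
  frame and its coframe are built twice, and the field \<open>V\<close> found in the first frame is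
  recognised as characteristic in the second.

  Rays replace flows in Frobenius' theorem: one integral equation over the unit interval contains
  the transverse parameters as well, so a single regularity result covers the leaves and their
  dependence on the initial point. Integrability enters only to pass from the ray direction to all
  directions.\<close>

abbreviation fder :: "('a::real_normed_vector \<Rightarrow> 'b::real_normed_vector) \<Rightarrow> 'a \<Rightarrow> 'a \<Rightarrow> 'b" where
  "fder f x \<equiv> frechet_derivative f (at x)"

lemma fder_works: "f differentiable (at x) \<Longrightarrow> (f has_derivative fder f x) (at x)"
  by (simp add: frechet_derivative_works)

lemma fder_eq: "(f has_derivative f') (at x) \<Longrightarrow> fder f x = f'"
  by (metis frechet_derivative_at)

lemma linear_fder: "f differentiable (at x) \<Longrightarrow> linear (fder f x)"
  by (rule linear_frechet_derivative)

lemma has_derivative_cong_open: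
  assumes "open S" "x \<in> S" "\<And>y. y \<in> S \<Longrightarrow> f y = g y"
  shows "(f has_derivative f') (at x) \<longleftrightarrow> (g has_derivative f') (at x)"
  using assms has_derivative_transform_within_open[of f f' x UNIV S g]
    has_derivative_transform_within_open[of g f' x UNIV S f] by auto

lemma fder_cong_open:
  assumes "open S" "x \<in> S" "\<And>y. y \<in> S \<Longrightarrow> f y = g y"
  shows "fder f x = fder g x"
  unfolding frechet_derivative_def by (simp add: has_derivative_cong_open[OF assms])

lemma differentiable_cong_open:
  assumes "open S" "x \<in> S" "\<And>y. y \<in> S \<Longrightarrow> f y = g y" "f differentiable (at x)"
  shows "g differentiable (at x)"
  using assms has_derivative_cong_open[OF assms(1-3)] unfolding differentiable_def by auto

lemma Ck_on_cong:
  assumes "open S" "\<And>x. x \<in> S \<Longrightarrow> f x = g x" "Ck_on k S f"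
  shows "Ck_on k S g"
  using assms(2,3)
proof (induction k arbitrary: f g)
  case 0
  then show ?case using continuous_on_cong by (metis Ck_on.simps(1))
next
  case (Suc k)
  show ?case
    unfolding Ck_on.simps
  proof (intro conjI ballI allI)
    fix x assume "x \<in> S"
    then show "g differentiable (at x)"
      using differentiable_cong_open[OF \<open>open S\<close> _ Suc.prems(1)] Suc.prems(2) by auto
  next
    fix v
    have "Ck_on k S (\<lambda>x. fder f x v)" using Suc.prems(2) by simp
    then show "Ck_on k S (\<lambda>x. fder g x v)"
      by (rule Suc.IH[rotated]) (simp add: fder_cong_open[OF \<open>open S\<close> _ Suc.prems(1)])
  qed
qed

lemma Ck_on_subset: "Ck_on k S f \<Longrightarrow> T \<subseteq> S \<Longrightarrow> Ck_on k T f"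
  by (induction k arbitrary: f) (auto intro: continuous_on_subset)

lemma Ck_on_SucD: "Ck_on (Suc k) S f \<Longrightarrow> Ck_on k S f"
proof (induction k arbitrary: f)
  case 0
  then show ?case
    by (auto intro!: continuous_at_imp_continuous_on differentiable_imp_continuous_within)
next
  case (Suc k)
  then show ?case by (metis Ck_on.simps(2))
qed

text \<open>The usual way to raise the order: a derivative obtained from the calculus rules may
  stand in for \<open>fder f\<close>.\<close>

lemma Ck_on_SucI:
  assumes "open S" "\<And>x. x \<in> S \<Longrightarrow> (f has_derivative f' x) (at x)"
    "\<And>v. Ck_on k S (\<lambda>x. f' x v)"
  shows "Ck_on (Suc k) S f"
  unfolding Ck_on.simps
proof (intro conjI ballI allI)
  fix x assume "x \<in> S"
  then show "f differentiable (at x)" using assms(2) differentiable_def by blast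
next
  fix v
  show "Ck_on k S (\<lambda>x. fder f x v)"
    by (rule Ck_on_cong[OF assms(1) _ assms(3)[of v]]) (simp add: fder_eq[OF assms(2)])
qed

lemma Ck_on_Suc_fder: "Ck_on (Suc k) S f \<Longrightarrow> Ck_on k S (\<lambda>x. fder f x v)"
  by simp

lemma Ck_on_const: "Ck_on k S (\<lambda>x. c)"
  by (induction k arbitrary: c) auto

lemma Ck_on_linear_image:
  assumes f: "bounded_linear f" and "open S" "Ck_on k S g"
  shows "Ck_on k S (\<lambda>x. f (g x))"
  using assms(3)
proof (induction k arbitrary: g)
  case 0
  then show ?case by (auto intro: bounded_linear.continuous_on[OF f])
next
  case (Suc k)
  show ?case
    using Suc by (intro Ck_on_SucI[OF \<open>open S\<close> bounded_linear.has_derivative[OF f]])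
      (auto intro!: fder_works)
qed

lemma Ck_on_ident: "open S \<Longrightarrow> Ck_on k S (\<lambda>x. x)"
  by (cases k) (auto intro!: Ck_on_SucI Ck_on_const derivative_eq_intros)

lemma Ck_on_add:
  assumes "open S" "Ck_on k S f" "Ck_on k S g"
  shows "Ck_on k S (\<lambda>x. f x + g x)"
  using assms(2,3)
proof (induction k arbitrary: f g)
  case 0
  then show ?case by (auto intro: continuous_intros)
next
  case (Suc k)
  show ?case
    using Suc by (intro Ck_on_SucI[OF \<open>open S\<close> has_derivative_add]) (auto intro!: fder_works)
qed

lemma Ck_on_Pair:
  assumes "open S" "Ck_on k S f" "Ck_on k S g"
  shows "Ck_on k S (\<lambda>x. (f x, g x))"
  using assms(2,3)
proof (induction k arbitrary: f g)
  case 0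
  then show ?case by (auto intro: continuous_intros)
next
  case (Suc k)
  show ?case
    using Suc by (intro Ck_on_SucI[OF \<open>open S\<close> has_derivative_Pair]) (auto intro!: fder_works)
qed

lemma Ck_on_bilinear:
  assumes bil: "bounded_bilinear h" and "open S" "Ck_on k S f" "Ck_on k S g"
  shows "Ck_on k S (\<lambda>x. h (f x) (g x))"
  using assms(3,4)
proof (induction k arbitrary: f g)
  case 0
  then show ?case by (auto intro: bounded_bilinear.continuous_on[OF bil])
next
  case (Suc k)
  have "Ck_on k S f" "Ck_on k S g" using Suc.prems Ck_on_SucD by blast+
  with Suc show ?case
    by (intro Ck_on_SucI[OF \<open>open S\<close> bounded_bilinear.FDERIV[OF bil]])
      (auto intro!: Ck_on_add[OF \<open>open S\<close>] fder_works)
qed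

lemmas Ck_on_scaleR = Ck_on_bilinear[OF bounded_bilinear_scaleR]
lemmas Ck_on_mult = Ck_on_bilinear[OF bounded_bilinear_mult]
lemmas Ck_on_inner = Ck_on_bilinear[OF bounded_bilinear_inner]

lemma Ck_on_minus: "open S \<Longrightarrow> Ck_on k S f \<Longrightarrow> Ck_on k S (\<lambda>x. - f x)"
  using Ck_on_linear_image[OF bounded_linear_minus[OF bounded_linear_ident]] by blast

lemma Ck_on_diff:
  "open S \<Longrightarrow> Ck_on k S f \<Longrightarrow> Ck_on k S g \<Longrightarrow> Ck_on k S (\<lambda>x. f x - g x)"
  using Ck_on_add[of S k f "\<lambda>x. - g x"] Ck_on_minus[of S k g] by simp

lemma Ck_on_sum:
  assumes "open S" "\<And>i. i \<in> I \<Longrightarrow> Ck_on k S (f i)"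
  shows "Ck_on k S (\<lambda>x. \<Sum>i\<in>I. f i x)"
  using assms(2)
  by (induction I rule: infinite_finite_induct) (auto intro!: Ck_on_const Ck_on_add[OF \<open>open S\<close>])

lemma linear_basis_expansion:
  fixes f :: "'a::euclidean_space \<Rightarrow> 'b::real_vector"
  assumes "linear f"
  shows "f v = (\<Sum>b\<in>Basis. (v \<bullet> b) *\<^sub>R f b)"
proof -
  interpret linear f by fact
  have "f v = f (\<Sum>b\<in>Basis. (v \<bullet> b) *\<^sub>R b)" by (simp add: euclidean_representation)
  then show ?thesis by (simp add: sum scaleR)
qed

text \<open>Families of linear maps are handled through their values at fixed vectors, so that
  smoothness of operator-valued maps never has to be considered. Expanding \<open>g y\<close> in the
  basis allows a moving argument.\<close>

lemma Ck_on_apply_linear: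
  fixes L :: "'p::euclidean_space \<Rightarrow> 'a::euclidean_space \<Rightarrow> 'b::real_normed_vector"
  assumes "open S" "\<And>y. y \<in> S \<Longrightarrow> linear (L y)" "\<And>v. Ck_on k S (\<lambda>y. L y v)" "Ck_on k S g"
  shows "Ck_on k S (\<lambda>y. L y (g y))"
proof (rule Ck_on_cong[OF \<open>open S\<close>])
  show "Ck_on k S (\<lambda>y. \<Sum>b\<in>Basis. (g y \<bullet> b) *\<^sub>R L y b)"
    by (intro Ck_on_sum Ck_on_scaleR Ck_on_inner Ck_on_const assms)
qed (simp add: linear_basis_expansion[OF assms(2), symmetric])

text \<open>By the chain rule the derivative is \<open>fder f (g x)\<close> applied to
  \<open>fder g x v\<close>. The induction hypothesis is needed only for the new outer functions
  \<open>\<lambda>z. fder f z w\<close>, so \<open>g\<close> stays fixed in the induction.\<close>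

lemma Ck_on_compose:
  fixes g :: "'a::euclidean_space \<Rightarrow> 'b::euclidean_space"
  assumes "open S" "Ck_on k S g" "Ck_on k T f" "g ` S \<subseteq> T"
  shows "Ck_on k S (\<lambda>x. f (g x))"
  using assms(2,3)
proof (induction k arbitrary: f)
  case 0
  then show ?case using assms(4) by (auto intro: continuous_on_compose2)
next
  case (Suc k)
  have gk: "Ck_on k S g" using Suc.prems Ck_on_SucD by blast
  show ?case
  proof (rule Ck_on_SucI[OF \<open>open S\<close>])
    fix x assume "x \<in> S"
    then show "((\<lambda>x. f (g x)) has_derivative (\<lambda>v. fder f (g x) (fder g x v))) (at x)"
      using Suc.prems assms(4)
      by (intro has_derivative_compose[where f=g and g=f] fder_works) auto
  next
    fix v
    show "Ck_on k S (\<lambda>x. fder f (g x) (fder g x v))"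
    proof (rule Ck_on_apply_linear[OF \<open>open S\<close>])
      fix y assume "y \<in> S"
      then show "linear (fder f (g y))" using Suc.prems assms(4) by (intro linear_fder) auto
    next
      fix w
      show "Ck_on k S (\<lambda>y. fder f (g y) w)"
        by (rule Suc.IH[of "\<lambda>z. fder f z w"]) (use gk Suc.prems in auto)
    qed (use Suc.prems in auto)
  qed
qed

lemma Ck_on_inverse:
  fixes f :: "'a::euclidean_space \<Rightarrow> real"
  assumes "open S" "Ck_on k S f" "\<And>x. x \<in> S \<Longrightarrow> f x \<noteq> 0"
  shows "Ck_on k S (\<lambda>x. inverse (f x))"
  using assms(2)
proof (induction k)
  case 0
  then show ?case using assms by (auto intro: continuous_intros)
next
  case (Suc k)
  have "Ck_on k S (\<lambda>x. inverse (f x))" using Suc Ck_on_SucD by blast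
  then show ?case
    using Suc.prems assms
    by (intro Ck_on_SucI[OF \<open>open S\<close> has_derivative_inverse'[THEN has_derivative_compose[rotated]]])
      (auto intro!: Ck_on_minus Ck_on_mult fder_works)
qed

section \<open>Smooth families of invertible linear maps and the inverse function theorem\<close>

lemma linear_norm_le_sum_Basis:
  fixes f :: "'a::euclidean_space \<Rightarrow> 'b::real_normed_vector"
  assumes "linear f"
  shows "norm (f v) \<le> (\<Sum>b\<in>Basis. norm (f b)) * norm v"
proof -
  have "norm (f v) \<le> (\<Sum>b\<in>Basis. norm ((v \<bullet> b) *\<^sub>R f b))"
    by (subst linear_basis_expansion[OF assms]) (rule norm_sum)
  also have "\<dots> \<le> (\<Sum>b\<in>Basis. norm (f b) * norm v)"
    by (intro sum_mono) (metis Basis_le_norm mult.commute mult_left_mono norm_ge_zero norm_scaleR)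
  finally show ?thesis by (simp add: sum_distrib_right)
qed

lemma linear_inverse_of_bij: "linear f \<Longrightarrow> bij f \<Longrightarrow> linear (inv f)"
  for f :: "'a::real_vector \<Rightarrow> 'b::real_vector"
  by (intro linearI; rule inv_f_eq; simp add: bij_is_inj linear_add linear_cmul bij_is_surj surj_f_inv_f)

lemma injective_near:
  fixes L :: "'p::topological_space \<Rightarrow> 'a::euclidean_space \<Rightarrow> 'b::euclidean_space"
  assumes "open S" "x0 \<in> S" "\<And>y. y \<in> S \<Longrightarrow> linear (L y)"
    "\<And>v. continuous_on S (\<lambda>y. L y v)" "inj (L x0)"
  obtains T c where "open T" "x0 \<in> T" "T \<subseteq> S" "c > 0" "\<And>y v. y \<in> T \<Longrightarrow> c * norm v \<le> norm (L y v)"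
proof -
  obtain c where c: "c > 0" "\<And>v. c * norm v \<le> norm (L x0 v)"
    using linear_inj_bounded_below_pos[OF assms(3)[OF assms(2)] assms(5)] by metis
  \<comment> \<open>This bounds the operator norm of \<open>L y - L x0\<close>; where it is below
    \<open>c/2\<close>, half of the lower bound at \<open>x0\<close> survives.\<close>
  define e where "e y = (\<Sum>b\<in>Basis. norm (L y b - L x0 b))" for y
  have "continuous_on S e"
    unfolding e_def by (intro continuous_intros assms)
  then have "open (e -` {..<c/2} \<inter> S)"
    using \<open>open S\<close> continuous_on_open_vimage by (metis open_lessThan)
  then have T: "open {y\<in>S. e y < c/2}"
    by (simp add: vimage_def Collect_conj_eq Int_commute lessThan_def)
  moreover have "c/2 * norm v \<le> norm (L y v)" if "y \<in> S" "e y < c/2" for y v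
  proof -
    have "linear (\<lambda>v. L y v - L x0 v)"
      using assms(3)[OF that(1)] assms(3)[OF assms(2)] by (rule linear_compose_sub)
    from linear_norm_le_sum_Basis[OF this, of v]
    have "norm (L y v - L x0 v) \<le> e y * norm v" by (simp add: e_def)
    also have "\<dots> \<le> c/2 * norm v" using that(2) by (intro mult_right_mono) auto
    finally have "norm (L y v - L x0 v) \<le> c/2 * norm v" .
    with c(2)[of v] norm_triangle_ineq2[of "L x0 v" "L x0 v - L y v"] show ?thesis
      by (simp add: norm_minus_commute)
  qed
  moreover have "e x0 < c/2" using c by (simp add: e_def)
  ultimately show ?thesis
    using that[of "{y\<in>S. e y < c/2}" "c/2"] assms(2) c(1) by auto
qed

lemma inj_of_bounded_below:
  assumes "linear f" "c > 0" "\<And>v. c * norm v \<le> norm (f v)"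
  shows "inj f"
  unfolding linear_injective_0[OF assms(1)]
  using assms(2,3) by (metis mult_le_0_iff norm_le_zero_iff norm_zero not_le)

text \<open>The estimate comes from the identity \<open>inv (L y) - inv (L y0) = inv (L y) o (L y0 -
  L y) o inv (L y0)\<close>, in which both inverses are bounded by \<open>1/c\<close>; this explains
  the form of \<open>e\<close>.\<close>

lemma inverse_linear_family_near:
  fixes L :: "'p::euclidean_space \<Rightarrow> 'a::euclidean_space \<Rightarrow> 'b::euclidean_space"
  assumes "open S" "y0 \<in> S" and lin: "\<And>y. y \<in> S \<Longrightarrow> linear (L y)" and bij: "\<And>y. y \<in> S \<Longrightarrow> bij (L y)"
    and cont: "\<And>v. continuous_on S (\<lambda>y. L y v)"
  obtains T C e where "open T" "y0 \<in> T" "T \<subseteq> S" "C > 0"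
    "\<And>y w. y \<in> T \<Longrightarrow> norm (inv (L y) w) \<le> C * norm w"
    "continuous_on S e" "e y0 = (0::real)"
    "\<And>y w. y \<in> T \<Longrightarrow> norm (inv (L y) w - inv (L y0) w) \<le> e y * norm w"
proof -
  obtain T c where T: "open T" "y0 \<in> T" "T \<subseteq> S" "c > 0"
    and c: "\<And>y v. y \<in> T \<Longrightarrow> c * norm v \<le> norm (L y v)"
    using injective_near[OF assms(1,2) lin cont] bij[OF assms(2)] bij_is_inj by metis
  define a where "a y = (\<Sum>b\<in>Basis. norm (L y b - L y0 b))" for y
  have LG: "L y (inv (L y) w) = w" if "y \<in> S" for y w
    using bij[OF that] by (simp add: bij_is_surj surj_f_inv_f)
  have GL: "inv (L y) (L y w) = w" if "y \<in> S" for y w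
    using bij[OF that] by (simp add: bij_is_inj)
  have G: "norm (inv (L y) w) \<le> (1/c) * norm w" if "y \<in> T" for y w
    using c[OF that, of "inv (L y) w"] LG[of y w] that T by (auto simp: field_simps)
  have linG: "linear (inv (L y))" if "y \<in> S" for y
    using linear_inverse_of_bij lin bij that by blast
  define e where "e y = (1/c) * a y * (1/c)" for y
  have diff: "norm (inv (L y) w - inv (L y0) w) \<le> e y * norm w" if "y \<in> T" for y w
  proof -
    let ?u = "inv (L y0) w"
    have yS: "y \<in> S" using that T by auto
    have "inv (L y) w - ?u = inv (L y) (L y0 ?u - L y ?u)"
      using GL[OF yS, of ?u] LG[OF \<open>y0 \<in> S\<close>, of w] linear_diff[OF linG[OF yS]] by simp
    then have "norm (inv (L y) w - ?u) \<le> (1/c) * norm (L y0 ?u - L y ?u)"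
      using G[OF that] by simp
    also have "norm (L y0 ?u - L y ?u) \<le> a y * norm ?u"
      using linear_norm_le_sum_Basis[OF linear_compose_sub[OF lin[OF yS] lin[OF \<open>y0 \<in> S\<close>]], of ?u]
      by (simp add: a_def norm_minus_commute)
    also have "a y * norm ?u \<le> a y * ((1/c) * norm w)"
      using G[OF T(2), of w] by (intro mult_left_mono) (auto simp: a_def intro: sum_nonneg)
    finally have "norm (inv (L y) w - ?u) \<le> (1/c) * (a y * ((1/c) * norm w))"
      using T(4) by (simp add: divide_right_mono)
    then show ?thesis by (simp add: e_def)
  qed
  have "continuous_on S e" unfolding e_def a_def by (intro continuous_intros cont)
  moreover have "e y0 = 0" by (simp add: e_def a_def)
  ultimately show ?thesis using that[of T "1/c" e] T G diff by simp
qed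

lemma inverse_linear_family_has_derivative:
  fixes L :: "'p::euclidean_space \<Rightarrow> 'a::euclidean_space \<Rightarrow> 'b::euclidean_space"
  assumes "open S" "y0 \<in> S" and lin: "\<And>y. y \<in> S \<Longrightarrow> linear (L y)" and bij: "\<And>y. y \<in> S \<Longrightarrow> bij (L y)"
    and der: "\<And>v y. y \<in> S \<Longrightarrow> (\<lambda>y. L y v) differentiable (at y)"
  shows "((\<lambda>y. inv (L y) w) has_derivative
    (\<lambda>h. - inv (L y0) (fder (\<lambda>y. L y (inv (L y0) w)) y0 h))) (at y0)"
proof -
  have cont: "continuous_on S (\<lambda>y. L y v)" for v
    by (intro continuous_at_imp_continuous_on ballI differentiable_imp_continuous_within der)
  obtain T C e where T: "open T" "y0 \<in> T" "T \<subseteq> S" "C > 0"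
    and G: "\<And>y w. y \<in> T \<Longrightarrow> norm (inv (L y) w) \<le> C * norm w"
    and e: "continuous_on S e" "e y0 = 0"
    and diff: "\<And>y w. y \<in> T \<Longrightarrow> norm (inv (L y) w - inv (L y0) w) \<le> e y * norm w"
    using inverse_linear_family_near[OF assms(1,2) lin bij cont] by metis
  have LG: "L y (inv (L y) w) = w" if "y \<in> S" for y w
    using bij[OF that] by (simp add: bij_is_surj surj_f_inv_f)
  have GL: "inv (L y) (L y w) = w" if "y \<in> S" for y w
    using bij[OF that] by (simp add: bij_is_inj)
  have linG: "linear (inv (L y))" if "y \<in> S" for y
    using linear_inverse_of_bij lin bij that by blast
  define u where "u = inv (L y0) w"
  define D where "D = fder (\<lambda>y. L y u) y0"
  have D: "((\<lambda>y. L y u) has_derivative D) (at y0)"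
    unfolding D_def by (rule fder_works) (use der assms in auto)
  then have Dlin: "bounded_linear D" by (rule has_derivative_bounded_linear)
  obtain K where K: "K > 0" "\<And>h. norm (D h) \<le> norm h * K"
    using bounded_linear.pos_bounded[OF Dlin] by auto
  have Glin0: "bounded_linear (inv (L y0))" using linG[OF \<open>y0 \<in> S\<close>] by (simp add: linear_conv_bounded_linear)
  show ?thesis
    unfolding u_def[symmetric] D_def[symmetric] has_derivative_at_alt
  proof (intro conjI allI impI)
    show "bounded_linear (\<lambda>h. - inv (L y0) (D h))"
      by (intro bounded_linear_minus bounded_linear_compose[OF Glin0] Dlin)
    fix \<epsilon> :: real assume "\<epsilon> > 0"
    \<comment> \<open>Two errors will be added, one of size \<open>C * \<eta>\<close> and one of
      size \<open>\<eta> * K\<close> relative to \<open>norm (y - y0)\<close>.\<close>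
    define \<eta> where "\<eta> = \<epsilon> / (C + K)"
    have "C + K > 0" using T K by auto
    moreover have "(C + K) * \<eta> = \<epsilon>" using calculation by (simp add: \<eta>_def)
    ultimately have "\<eta> > 0" "C * \<eta> + \<eta> * K = \<epsilon>"
      using \<open>\<epsilon> > 0\<close> by (simp add: \<eta>_def, simp add: algebra_simps)
    obtain d1 where d1: "d1 > 0" "\<And>y. norm (y - y0) < d1 \<Longrightarrow> norm (L y u - L y0 u - D (y - y0)) \<le> \<eta> * norm (y - y0)"
      using D \<open>\<eta> > 0\<close> unfolding has_derivative_at_alt by meson
    have "isCont e y0" using e(1) assms(1,2) continuous_on_eq_continuous_at by blast
    then obtain d2 where d2: "d2 > 0" "\<And>y. norm (y - y0) < d2 \<Longrightarrow> norm (e y) < \<eta>"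
      using \<open>\<eta> > 0\<close> e(2) unfolding continuous_at_eps_delta
      by (metis dist_norm dist_0_norm dist_commute)
    obtain d3 where d3: "d3 > 0" "ball y0 d3 \<subseteq> T" using T open_contains_ball by blast
    show "\<exists>d>0. \<forall>y. norm (y - y0) < d \<longrightarrow>
      norm (inv (L y) w - u - - inv (L y0) (D (y - y0))) \<le> \<epsilon> * norm (y - y0)"
    proof (intro exI[of _ "min d1 (min d2 d3)"] conjI allI impI)
      show "min d1 (min d2 d3) > 0" using d1 d2 d3 by auto
      fix y assume y: "norm (y - y0) < min d1 (min d2 d3)"
      then have yT: "y \<in> T" using d3 by (auto simp: dist_norm norm_minus_commute subset_iff)
      have yS: "y \<in> S" using yT T by auto
      let ?R = "L y u - L y0 u - D (y - y0)"
      have L0u: "L y0 u = w" unfolding u_def using LG assms by blast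
      \<comment> \<open>With \<open>w = L y0 u\<close> the error splits in two: the first-order
        remainder of \<open>y \<mapsto> L y u\<close>, seen through \<open>inv (L y)\<close>, and
        the replacement of \<open>inv (L y)\<close> by \<open>inv (L y0)\<close> on
        \<open>D (y - y0)\<close>.\<close>
      have "inv (L y) w - u - - inv (L y0) (D (y - y0))
        = - inv (L y) ?R - (inv (L y) (D (y - y0)) - inv (L y0) (D (y - y0)))"
        by (simp add: linear_diff[OF linG[OF yS]] GL[OF yS] L0u)
      also have "norm \<dots> \<le> norm (inv (L y) ?R) + norm (inv (L y) (D (y - y0)) - inv (L y0) (D (y - y0)))"
        by (metis norm_minus_cancel norm_triangle_ineq4)
      also have "norm (inv (L y) ?R) \<le> C * (\<eta> * norm (y - y0))"
        using G[OF yT, of ?R] d1(2)[of y] y T(4)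
        by (meson less_imp_le min_less_iff_conj mult_left_mono order_trans)
      also have "norm (inv (L y) (D (y - y0)) - inv (L y0) (D (y - y0))) \<le> e y * norm (D (y - y0))"
        by (rule diff[OF yT])
      also have "e y * norm (D (y - y0)) \<le> \<eta> * (norm (y - y0) * K)"
        using d2(2)[of y] y K(2)[of "y - y0"] \<open>\<eta> > 0\<close> by (intro mult_mono) auto
      also have "C * (\<eta> * norm (y - y0)) + \<eta> * (norm (y - y0) * K) = (C * \<eta> + \<eta> * K) * norm (y - y0)"
        by (simp add: algebra_simps)
      finally show "norm (inv (L y) w - u - - inv (L y0) (D (y - y0))) \<le> \<epsilon> * norm (y - y0)"
        using \<open>C * \<eta> + \<eta> * K = \<epsilon>\<close> by simp
    qed
  qed
qed

text \<open>The derivative of the inverse is built from the inverse itself and the derivative of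
  \<open>L\<close>, so each step gains one order. The induction ranges over all \<open>w\<close>
  because the inverse gets applied to moving vectors.\<close>

lemma Ck_on_inverse_linear_family:
  fixes L :: "'p::euclidean_space \<Rightarrow> 'a::euclidean_space \<Rightarrow> 'b::euclidean_space"
  assumes "open S" and lin: "\<And>y. y \<in> S \<Longrightarrow> linear (L y)" and bij: "\<And>y. y \<in> S \<Longrightarrow> bij (L y)"
    and "\<And>v. Ck_on k S (\<lambda>y. L y v)"
  shows "Ck_on k S (\<lambda>y. inv (L y) w)"
  using assms(4)
proof (induction k arbitrary: w)
  case 0
  have "isCont (\<lambda>y. inv (L y) w) y0" if y0: "y0 \<in> S" for y0
  proof -
    have cont: "continuous_on S (\<lambda>y. L y v)" for v using 0 by simp
    obtain T C e where T: "open T" "y0 \<in> T" "T \<subseteq> S" "C > 0"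
      and "\<And>y w. y \<in> T \<Longrightarrow> norm (inv (L y) w) \<le> C * norm w"
      and e: "continuous_on S e" "e y0 = 0"
      and diff: "\<And>y w. y \<in> T \<Longrightarrow> norm (inv (L y) w - inv (L y0) w) \<le> e y * norm w"
      using inverse_linear_family_near[OF assms(1) y0 lin bij cont] by metis
    have "isCont e y0" using e(1) assms(1) y0 continuous_on_eq_continuous_at by blast
    then have "(e \<longlongrightarrow> 0) (at y0)" using e(2) by (simp add: isCont_def)
    then have "((\<lambda>y. e y * norm w) \<longlongrightarrow> 0) (at y0)" by (rule tendsto_mult_left_zero)
    then have "((\<lambda>y. inv (L y) w - inv (L y0) w) \<longlongrightarrow> 0) (at y0)"
      by (rule Lim_null_comparison[rotated])
        (use T diff in \<open>auto intro!: eventually_at_in_open'[THEN eventually_mono]\<close>)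
    then show ?thesis by (simp add: isCont_def LIM_zero_iff)
  qed
  then show ?case by (simp add: continuous_at_imp_continuous_on)
next
  case (Suc k)
  have k: "Ck_on k S (\<lambda>y. L y v)" for v using Suc.prems Ck_on_SucD by blast
  have IH: "Ck_on k S (\<lambda>y. inv (L y) w)" for w using Suc.IH k by blast
  have der: "(\<lambda>y. L y v) differentiable (at y)" if "y \<in> S" for v y
    using Suc.prems that by auto
  have linG: "linear (inv (L y))" if "y \<in> S" for y
    using linear_inverse_of_bij lin bij that by blast
  show ?case
  proof (rule Ck_on_SucI[OF \<open>open S\<close> inverse_linear_family_has_derivative[OF \<open>open S\<close> _ lin bij der]])
    fix v
    \<comment> \<open>The argument is frozen while differentiating but depends on \<open>y\<close>
      afterwards; the basis expansion separates the two dependences.\<close>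
    have "fder (\<lambda>z. L z (inv (L y) w)) y v = (\<Sum>b\<in>Basis. (inv (L y) w \<bullet> b) *\<^sub>R fder (\<lambda>z. L z b) y v)"
      if "y \<in> S" for y
    proof -
      let ?u = "inv (L y) w"
      have "((\<lambda>z. \<Sum>b\<in>Basis. (?u \<bullet> b) *\<^sub>R L z b) has_derivative (\<lambda>h. \<Sum>b\<in>Basis. (?u \<bullet> b) *\<^sub>R fder (\<lambda>z. L z b) y h)) (at y)"
        by (intro has_derivative_sum has_derivative_scaleR_right fder_works der that)
      then have "((\<lambda>z. L z ?u) has_derivative (\<lambda>h. \<Sum>b\<in>Basis. (?u \<bullet> b) *\<^sub>R fder (\<lambda>z. L z b) y h)) (at y)"
        by (subst has_derivative_cong_open[OF \<open>open S\<close> that]) (auto simp: linear_basis_expansion[OF lin, symmetric])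
      then show ?thesis by (simp add: fder_eq)
    qed
    moreover have "Ck_on k S (\<lambda>y. - inv (L y) (\<Sum>b\<in>Basis. (inv (L y) w \<bullet> b) *\<^sub>R fder (\<lambda>z. L z b) y v))"
    proof (rule Ck_on_minus[OF \<open>open S\<close> Ck_on_apply_linear[OF \<open>open S\<close> linG IH]])
      show "Ck_on k S (\<lambda>y. \<Sum>b\<in>Basis. (inv (L y) w \<bullet> b) *\<^sub>R fder (\<lambda>z. L z b) y v)"
        using Suc.prems by (intro Ck_on_sum Ck_on_scaleR Ck_on_inner Ck_on_const IH \<open>open S\<close>) auto
    qed
    ultimately show "Ck_on k S (\<lambda>y. - inv (L y) (fder (\<lambda>z. L z (inv (L y) w)) y v))"
      by (auto intro: Ck_on_cong[OF \<open>open S\<close>, rotated])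
  qed
qed

section \<open>Closure properties of smooth maps\<close>

lemma smooth_on_cong:
  "open S \<Longrightarrow> (\<And>x. x \<in> S \<Longrightarrow> f x = g x) \<Longrightarrow> smooth_on S f \<Longrightarrow> smooth_on S g"
  unfolding smooth_on_def using Ck_on_cong by blast

lemma smooth_on_subset: "smooth_on S f \<Longrightarrow> T \<subseteq> S \<Longrightarrow> smooth_on T f"
  unfolding smooth_on_def using Ck_on_subset by blast

lemma smooth_on_const: "smooth_on S (\<lambda>x. c)"
  unfolding smooth_on_def using Ck_on_const by blast

lemma smooth_on_ident: "open S \<Longrightarrow> smooth_on S (\<lambda>x. x)"
  unfolding smooth_on_def using Ck_on_ident by blast

lemma smooth_on_linear_image:
  "bounded_linear f \<Longrightarrow> open S \<Longrightarrow> smooth_on S g \<Longrightarrow> smooth_on S (\<lambda>x. f (g x))"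
  unfolding smooth_on_def by (auto intro: Ck_on_linear_image[where f=f and g=g])

lemma smooth_on_bounded_linear: "bounded_linear f \<Longrightarrow> open S \<Longrightarrow> smooth_on S f"
  using smooth_on_linear_image[OF _ _ smooth_on_ident] .

lemma smooth_on_add: "open S \<Longrightarrow> smooth_on S f \<Longrightarrow> smooth_on S g \<Longrightarrow> smooth_on S (\<lambda>x. f x + g x)"
  unfolding smooth_on_def by (auto intro!: Ck_on_add)

lemma smooth_on_diff: "open S \<Longrightarrow> smooth_on S f \<Longrightarrow> smooth_on S g \<Longrightarrow> smooth_on S (\<lambda>x. f x - g x)"
  unfolding smooth_on_def by (auto intro!: Ck_on_diff)

lemma smooth_on_minus: "open S \<Longrightarrow> smooth_on S f \<Longrightarrow> smooth_on S (\<lambda>x. - f x)"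
  unfolding smooth_on_def by (auto intro!: Ck_on_minus)

lemma smooth_on_sum: "open S \<Longrightarrow> (\<And>i. i \<in> I \<Longrightarrow> smooth_on S (f i)) \<Longrightarrow> smooth_on S (\<lambda>x. \<Sum>i\<in>I. f i x)"
  unfolding smooth_on_def by (auto intro!: Ck_on_sum)

lemma smooth_on_scaleR: "open S \<Longrightarrow> smooth_on S f \<Longrightarrow> smooth_on S g \<Longrightarrow> smooth_on S (\<lambda>x. f x *\<^sub>R g x)"
  unfolding smooth_on_def by (auto intro!: Ck_on_scaleR)

lemma smooth_on_mult:
  fixes f g :: "_ \<Rightarrow> real"
  shows "open S \<Longrightarrow> smooth_on S f \<Longrightarrow> smooth_on S g \<Longrightarrow> smooth_on S (\<lambda>x. f x * g x)"
  unfolding smooth_on_def by (auto intro!: Ck_on_mult)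

lemma smooth_on_inner: "open S \<Longrightarrow> smooth_on S f \<Longrightarrow> smooth_on S g \<Longrightarrow> smooth_on S (\<lambda>x. f x \<bullet> g x)"
  unfolding smooth_on_def by (auto intro!: Ck_on_inner)

lemma smooth_on_Pair: "open S \<Longrightarrow> smooth_on S f \<Longrightarrow> smooth_on S g \<Longrightarrow> smooth_on S (\<lambda>x. (f x, g x))"
  unfolding smooth_on_def by (auto intro!: Ck_on_Pair)

lemma smooth_on_inverse:
  fixes f :: "_ \<Rightarrow> real"
  shows "open S \<Longrightarrow> smooth_on S f \<Longrightarrow> (\<And>x. x \<in> S \<Longrightarrow> f x \<noteq> 0) \<Longrightarrow> smooth_on S (\<lambda>x. inverse (f x))"
  unfolding smooth_on_def by (auto intro!: Ck_on_inverse)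

lemma smooth_on_compose:
  fixes g :: "'a::euclidean_space \<Rightarrow> 'b::euclidean_space"
  shows "open S \<Longrightarrow> smooth_on S g \<Longrightarrow> smooth_on T f \<Longrightarrow> g ` S \<subseteq> T \<Longrightarrow> smooth_on S (\<lambda>x. f (g x))"
  unfolding smooth_on_def by (intro allI Ck_on_compose[where g=g and f=f and T=T]) auto

lemma smooth_on_apply_linear:
  fixes L :: "'p::euclidean_space \<Rightarrow> 'a::euclidean_space \<Rightarrow> 'b::real_normed_vector"
  shows "open S \<Longrightarrow> (\<And>y. y \<in> S \<Longrightarrow> linear (L y)) \<Longrightarrow> (\<And>v. smooth_on S (\<lambda>y. L y v)) \<Longrightarrow> smooth_on S g
    \<Longrightarrow> smooth_on S (\<lambda>y. L y (g y))"
  unfolding smooth_on_def by (intro allI Ck_on_apply_linear[where L=L and g=g]) auto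

lemma smooth_on_inverse_linear_family:
  fixes L :: "'p::euclidean_space \<Rightarrow> 'a::euclidean_space \<Rightarrow> 'b::euclidean_space"
  shows "open S \<Longrightarrow> (\<And>y. y \<in> S \<Longrightarrow> linear (L y)) \<Longrightarrow> (\<And>y. y \<in> S \<Longrightarrow> bij (L y)) \<Longrightarrow>
    (\<And>v. smooth_on S (\<lambda>y. L y v)) \<Longrightarrow> smooth_on S (\<lambda>y. inv (L y) w)"
  unfolding smooth_on_def by (intro allI Ck_on_inverse_linear_family[where L=L]) auto

lemma smooth_on_differentiable: "smooth_on S f \<Longrightarrow> x \<in> S \<Longrightarrow> f differentiable (at x)"
  unfolding smooth_on_def by (metis Ck_on.simps(2))

lemma smooth_on_has_derivative: "smooth_on S f \<Longrightarrow> x \<in> S \<Longrightarrow> (f has_derivative fder f x) (at x)"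
  by (simp add: smooth_on_differentiable fder_works)

lemma smooth_on_linear_fder: "smooth_on S f \<Longrightarrow> x \<in> S \<Longrightarrow> linear (fder f x)"
  by (simp add: smooth_on_differentiable linear_fder)

lemma smooth_on_imp_continuous_on: "smooth_on S f \<Longrightarrow> continuous_on S f"
  unfolding smooth_on_def by (metis Ck_on.simps(1))

lemma smooth_on_fder_const: "smooth_on S f \<Longrightarrow> smooth_on S (\<lambda>x. fder f x v)"
  unfolding smooth_on_def by (metis Ck_on.simps(2))

lemma smooth_on_fder:
  "open S \<Longrightarrow> smooth_on S f \<Longrightarrow> smooth_on S X \<Longrightarrow> smooth_on S (\<lambda>x. fder f x (X x))"
  by (rule smooth_on_apply_linear) (auto intro: smooth_on_fder_const smooth_on_linear_fder)

text \<open>The inverse function theorem gives a differentiable local inverse \<open>g\<close>. Its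
  derivative is the inverse of \<open>fder f\<close> at \<open>g y\<close>, hence as regular as
  \<open>g\<close> is already known to be, and induction on the order gives smoothness.\<close>

lemma smooth_inverse_function:
  fixes f :: "'a::euclidean_space \<Rightarrow> 'a"
  assumes "open U" "x0 \<in> U" and f: "smooth_on U f" and inj: "inj (fder f x0)"
  obtains U' V g where "open U'" "U' \<subseteq> U" "x0 \<in> U'" "open V" "homeomorphism U' V f g"
    "smooth_on V g" "\<And>x. x \<in> U' \<Longrightarrow> bij (fder f x)" "\<And>y. y \<in> V \<Longrightarrow> fder g y = inv (fder f (g y))"
proof -
  \<comment> \<open>The inverse function theorem asks for continuity in the operator norm. In finite
    dimension this follows from continuity of each \<open>\<lambda>x. fder f x v\<close>.\<close>
  define f' where "f' x = Blinfun (fder f x)" for x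
  have lin: "linear (fder f x)" if "x \<in> U" for x using smooth_on_linear_fder f that by blast
  have f': "blinfun_apply (f' x) = fder f x" if "x \<in> U" for x
    unfolding f'_def using lin[OF that] by (simp add: bounded_linear_Blinfun_apply linear_conv_bounded_linear)
  have "continuous_on U f'"
  proof (rule continuous_on_blinfun_componentwise)
    fix i
    show "continuous_on U (\<lambda>x. blinfun_apply (f' x) i)"
      using smooth_on_imp_continuous_on[OF smooth_on_fder_const[OF f, of i]]
      by (rule continuous_on_eq) (simp add: f')
  qed
  moreover obtain g0 where g0: "linear g0" "g0 \<circ> fder f x0 = id"
    using linear_injective_left_inverse[OF lin[OF assms(2)] inj] by blast
  have "Blinfun g0 o\<^sub>L f' x0 = id_blinfun"
    by (rule blinfun_eqI) (use g0 in \<open>simp add: f' assms(2) bounded_linear_Blinfun_apply linear_conv_bounded_linear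
        pointfree_idE\<close>)
  ultimately obtain U' V g g' where *: "open U'" "U' \<subseteq> U" "x0 \<in> U'" "open V" "f x0 \<in> V" "homeomorphism U' V f g"
    "\<And>y. y \<in> V \<Longrightarrow> (g has_derivative (g' y)) (at y)"
    "\<And>y. y \<in> V \<Longrightarrow> g' y = inv (blinfun_apply (f'(g y)))"
    "\<And>y. y \<in> V \<Longrightarrow> bij (blinfun_apply (f'(g y)))"
    using inverse_function_theorem[of U f f' x0 "Blinfun g0"] assms f' smooth_on_has_derivative[OF f]
    by metis
  have gV: "g y \<in> U'" if "y \<in> V" for y using *(6) that by (auto simp: homeomorphism_def)
  have gU: "g y \<in> U" if "y \<in> V" for y using gV that *(2) by auto
  have bij: "bij (fder f (g y))" if "y \<in> V" for y using *(9)[OF that] f' gU that by simp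
  have der: "(g has_derivative inv (fder f (g y))) (at y)" if "y \<in> V" for y
    using *(7,8)[OF that] f' gU that by simp
  have "Ck_on k V g" for k
  proof (induction k)
    case 0
    show ?case using *(6) by (auto simp: homeomorphism_def)
  next
    case (Suc k)
    show ?case
    proof (rule Ck_on_SucI[OF *(4) der])
      fix v
      show "Ck_on k V (\<lambda>y. inv (fder f (g y)) v)"
      proof (rule Ck_on_inverse_linear_family[OF *(4) _ bij])
        fix w
        show "Ck_on k V (\<lambda>y. fder f (g y) w)"
          by (rule Ck_on_compose[OF *(4) Suc, of U "\<lambda>x. fder f x w"])
            (use smooth_on_fder_const[OF f] gU in \<open>auto simp: smooth_on_def\<close>)
      qed (auto intro: lin gU)
    qed auto
  qed
  then have "smooth_on V g" by (simp add: smooth_on_def)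
  moreover have "bij (fder f x)" if "x \<in> U'" for x
    using bij[of "f x"] *(6) that by (auto simp: homeomorphism_def)
  ultimately show ?thesis using that[OF *(1,2,3,4,6)] fder_eq[OF der] by blast
qed

text \<open>At \<open>x0\<close> a dual family \<open>\<psi>\<close> exists by linear algebra. It is
  carried to nearby points by the inverse of \<open>L x\<close>, a smooth family of linear maps with
  \<open>L x0\<close> the identity and \<open>L x (\<xi> j x0) = \<xi> j x\<close>.\<close>

lemma dual_coframe:
  fixes \<xi> :: "'i \<Rightarrow> 'e::euclidean_space \<Rightarrow> 'e"
  assumes "finite I" "open U" "x0 \<in> U" and smooth: "\<And>i. i \<in> I \<Longrightarrow> smooth_on U (\<xi> i)"
    and indep': "\<forall>c. (\<Sum>i\<in>I. c i *\<^sub>R \<xi> i x0) = 0 \<longrightarrow> (\<forall>i\<in>I. c i = 0)"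
  obtains N \<phi> where "open N" "x0 \<in> N" "N \<subseteq> U"
    "\<And>i x. x \<in> N \<Longrightarrow> linear (\<phi> i x :: 'e \<Rightarrow> real)" "\<And>i v. smooth_on N (\<lambda>x. \<phi> i x v)"
    "\<And>i j x. i \<in> I \<Longrightarrow> j \<in> I \<Longrightarrow> x \<in> N \<Longrightarrow> \<phi> i x (\<xi> j x) = (if i = j then 1 else 0)"
proof -
  note indep = indep'[rule_format]
  have inj: "inj_on (\<lambda>i. \<xi> i x0) I"
  proof (rule inj_onI, rule ccontr)
    fix i j assume ij: "i \<in> I" "j \<in> I" "\<xi> i x0 = \<xi> j x0" "i \<noteq> j"
    define c where "c k = (if k = i then 1 else if k = j then -1 else (0::real))" for k
    have "(\<Sum>k\<in>I. c k *\<^sub>R \<xi> k x0) = (\<Sum>k\<in>{i,j}. c k *\<^sub>R \<xi> k x0)"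
      by (rule sum.mono_neutral_right) (use ij assms(1) in \<open>auto simp: c_def\<close>)
    also have "\<dots> = 0" using ij by (simp add: c_def)
    finally show False using indep[of c i] ij by (simp add: c_def)
  qed
  define B where "B = (\<lambda>i. \<xi> i x0) ` I"
  have "independent B"
  proof (rule independent_if_scalars_zero)
    show "finite B" using assms(1) by (simp add: B_def)
    fix f x assume "(\<Sum>x\<in>B. f x *\<^sub>R x) = 0" "x \<in> B"
    then show "f x = 0"
      using indep[of "\<lambda>i. f (\<xi> i x0)"] by (auto simp: B_def sum.reindex[OF inj])
  qed
  then have "\<exists>g. linear g \<and> (\<forall>x\<in>B. g x = (if x = \<xi> i x0 then 1 else (0::real)))" for i
    by (rule real_vector.linear_independent_extend[unfolded real_scaleR_def[abs_def, symmetric]])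
  then obtain \<psi> where \<psi>: "\<And>i. linear (\<psi> i)" "\<And>i x. x \<in> B \<Longrightarrow> \<psi> i x = (if x = \<xi> i x0 then 1 else (0::real))"
    by metis
  have \<psi>\<delta>: "\<psi> i (\<xi> j x0) = (if i = j then 1 else 0)" if "i \<in> I" "j \<in> I" for i j
    using \<psi>(2)[of "\<xi> j x0" i] that inj by (auto simp: B_def dest: inj_onD)
  define L where "L x v = v + (\<Sum>i\<in>I. \<psi> i v *\<^sub>R (\<xi> i x - \<xi> i x0))" for x v
  have linL: "linear (L x)" for x
    unfolding L_def
    by (intro linearI)
      (simp_all add: linear_add[OF \<psi>(1)] linear_cmul[OF \<psi>(1)] scaleR_add_left sum.distrib
        scaleR_add_right scaleR_sum_right)
  have smoothL: "smooth_on U (\<lambda>x. L x v)" for v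
    unfolding L_def
    by (intro smooth_on_add smooth_on_const smooth_on_sum smooth_on_scaleR smooth_on_diff smooth assms(2))
  have "inj (L x0)" by (auto simp: L_def inj_on_def)
  then obtain N c where N: "open N" "x0 \<in> N" "N \<subseteq> U" "c > 0"
    and c: "\<And>y v. y \<in> N \<Longrightarrow> c * norm v \<le> norm (L y v)"
    using injective_near[OF assms(2,3) linL smooth_on_imp_continuous_on[OF smoothL]] by metis
  have bij: "bij (L y)" if "y \<in> N" for y
    using inj_of_bounded_below[OF linL N(4) c[OF that]] linear_injective_imp_surjective[OF linL]
    by (auto simp: bij_def)
  define \<phi> where "\<phi> i x v = \<psi> i (inv (L x) v)" for i x v
  show ?thesis
  proof (rule that[of N \<phi>])
    show "linear (\<phi> i x)" if "x \<in> N" for i x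
      unfolding \<phi>_def using linear_compose[OF linear_inverse_of_bij[OF linL bij[OF that]] \<psi>(1)]
      by (simp add: o_def)
    show "smooth_on N (\<lambda>x. \<phi> i x v)" for i v
      unfolding \<phi>_def
      using \<psi>(1)[of i]
      by (intro smooth_on_linear_image[where f="\<psi> i", OF _ N(1)]
          smooth_on_inverse_linear_family[OF N(1)] linL bij smooth_on_subset[OF smoothL N(3)])
        (simp_all add: linear_conv_bounded_linear)
    show "\<phi> i x (\<xi> j x) = (if i = j then 1 else 0)" if "i \<in> I" "j \<in> I" "x \<in> N" for i j x
    proof -
      have "L x (\<xi> j x0) = \<xi> j x0 + (\<Sum>i\<in>I. if i = j then \<xi> i x - \<xi> i x0 else 0)"
        unfolding L_def by (intro arg_cong2[where f="(+)"] sum.cong) (auto simp: \<psi>\<delta> that)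
      then have "L x (\<xi> j x0) = \<xi> j x" using that assms(1) by (simp add: sum.delta)
      then have "inv (L x) (\<xi> j x) = \<xi> j x0"
        using bij[OF that(3)] by (metis bij_is_inj inv_f_f)
      then show ?thesis using \<psi>\<delta> that by (simp add: \<phi>_def)
    qed
  qed (use N in auto)
qed

section \<open>Symmetry of second derivatives\<close>

lemma smooth_on_curve_derivative:
  fixes f :: "'a::euclidean_space \<Rightarrow> real"
  assumes "smooth_on S f" "(c has_vector_derivative v) (at s)" "c s \<in> S"
  shows "((\<lambda>s. f (c s)) has_real_derivative fder f (c s) v) (at s)"
proof -
  have "((\<lambda>s. f (c s)) has_derivative (\<lambda>r. fder f (c s) (r *\<^sub>R v))) (at s)"
    using has_derivative_compose[OF assms(2)[unfolded has_vector_derivative_def]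
        smooth_on_has_derivative[OF assms(1,3)]] .
  moreover have "(\<lambda>r. fder f (c s) (r *\<^sub>R v)) = (*) (fder f (c s) v)"
    using linear_cmul[OF smooth_on_linear_fder[OF assms(1,3)]] by (auto simp: mult.commute)
  ultimately show ?thesis by (simp add: has_field_derivative_def)
qed

lemma isCont_tendsto_of_dist_le:
  fixes f :: "'a::metric_space \<Rightarrow> 'b::topological_space"
  assumes "isCont f x" "\<And>n::nat. dist (\<xi> n) x \<le> K * inverse (real (Suc n))"
  shows "(\<lambda>n. f (\<xi> n)) \<longlonglongrightarrow> f x"
proof (rule isCont_tendsto_compose[OF assms(1)])
  have "(\<lambda>n. K * inverse (real (Suc n))) \<longlonglongrightarrow> K * 0"
    by (intro tendsto_mult tendsto_const LIMSEQ_inverse_real_of_nat)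
  then have "(\<lambda>n. K * inverse (real (Suc n))) \<longlonglongrightarrow> 0" by simp
  then show "\<xi> \<longlonglongrightarrow> x"
    unfolding tendsto_dist_iff[of \<xi>]
    by (rule real_tendsto_sandwich[OF always_eventually always_eventually tendsto_const, rotated -1])
      (use assms(2) in auto)
qed

text \<open>Applying the mean value theorem in both directions to the second difference of \<open>f\<close>
  at scale \<open>h\<close> exhibits it as a mixed derivative at a point close to \<open>x\<close>.\<close>

lemma second_difference_mean_value:
  fixes f :: "'a::euclidean_space \<Rightarrow> real"
  assumes f: "smooth_on S f" and h: "h > 0" and S: "cball x (h * (norm v + norm w)) \<subseteq> S"
  shows "\<exists>\<xi>. dist \<xi> x \<le> h * (norm v + norm w) \<and>
    f (x + h *\<^sub>R v + h *\<^sub>R w) - f (x + h *\<^sub>R v) - (f (x + h *\<^sub>R w) - f x)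
    = h * h * fder (\<lambda>y. fder f y v) \<xi> w"
proof -
  have mem: "dist (x + s *\<^sub>R v + t *\<^sub>R w) x \<le> h * (norm v + norm w)" if "0 \<le> s" "s \<le> h" "0 \<le> t" "t \<le> h" for s t
  proof -
    have "norm (s *\<^sub>R v + t *\<^sub>R w) \<le> s * norm v + t * norm w"
      by (rule norm_triangle_le) (use that in auto)
    also have "\<dots> \<le> h * norm v + h * norm w" by (intro add_mono mult_right_mono that) auto
    finally show ?thesis by (simp add: dist_norm algebra_simps)
  qed
  then have memS: "x + s *\<^sub>R v + t *\<^sub>R w \<in> S" if "0 \<le> s" "s \<le> h" "0 \<le> t" "t \<le> h" for s t
    using S that by (auto simp: dist_commute subset_iff)
  let ?\<phi> = "\<lambda>s. f (x + s *\<^sub>R v + h *\<^sub>R w) - f (x + s *\<^sub>R v)"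
  have d: "(?\<phi> has_real_derivative fder f (x + s *\<^sub>R v + h *\<^sub>R w) v - fder f (x + s *\<^sub>R v) v) (at s)"
    if "0 \<le> s" "s \<le> h" for s
  proof -
    have "((\<lambda>s. f (x + s *\<^sub>R v + t *\<^sub>R w)) has_real_derivative fder f (x + s *\<^sub>R v + t *\<^sub>R w) v) (at s)"
      if t: "0 \<le> t" "t \<le> h" for t
      by (rule smooth_on_curve_derivative[OF f])
        (use memS \<open>0 \<le> s\<close> \<open>s \<le> h\<close> t in \<open>auto intro!: derivative_eq_intros\<close>)
    from DERIV_diff[OF this[of h] this[of 0]] h show ?thesis by simp
  qed
  obtain s where s: "0 < s" "s < h"
    and s': "?\<phi> h - ?\<phi> 0 = h * (fder f (x + s *\<^sub>R v + h *\<^sub>R w) v - fder f (x + s *\<^sub>R v) v)"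
    using MVT2[of 0 h ?\<phi>, OF h d] by auto
  have d2: "((\<lambda>t. fder f (x + s *\<^sub>R v + t *\<^sub>R w) v) has_real_derivative
      fder (\<lambda>y. fder f y v) (x + s *\<^sub>R v + t *\<^sub>R w) w) (at t)" if "0 \<le> t" "t \<le> h" for t
    by (rule smooth_on_curve_derivative[OF smooth_on_fder_const[OF f]])
      (use memS s that in \<open>auto intro!: derivative_eq_intros\<close>)
  obtain t where t: "0 < t" "t < h"
    and t': "fder f (x + s *\<^sub>R v + h *\<^sub>R w) v - fder f (x + s *\<^sub>R v + 0 *\<^sub>R w) v
      = h * fder (\<lambda>y. fder f y v) (x + s *\<^sub>R v + t *\<^sub>R w) w"
    using MVT2[of 0 h "\<lambda>t. fder f (x + s *\<^sub>R v + t *\<^sub>R w) v", OF h d2] by auto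
  show ?thesis
    by (rule exI[of _ "x + s *\<^sub>R v + t *\<^sub>R w"]) (use s t s' t' mem in auto)
qed

text \<open>The second difference is symmetric in \<open>v\<close> and \<open>w\<close>. At every
  scale it therefore equates the two mixed derivatives at points close to \<open>x\<close>, and
  continuity passes to the limit.\<close>

lemma symmetric_second_derivative_real:
  fixes f :: "'a::euclidean_space \<Rightarrow> real"
  assumes "open S" "x \<in> S" "smooth_on S f"
  shows "fder (\<lambda>y. fder f y v) x w = fder (\<lambda>y. fder f y w) x v"
proof -
  obtain r where r: "r > 0" "cball x r \<subseteq> S" using assms open_contains_cball by blast
  \<comment> \<open>Chosen so that all points of the second difference stay in the ball of radius
    \<open>r\<close>; the summand 1 covers the case \<open>v = w = 0\<close>.\<close>
  define K where "K = r / (1 + norm v + norm w)"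
  have K: "K > 0" "K * (norm v + norm w) \<le> r"
    using r(1) by (auto simp: K_def field_simps add_pos_nonneg intro!: add_nonneg_nonneg)
  define h where "h n = K * inverse (real (Suc n))" for n
  have h: "h n > 0" "h n * (norm v + norm w) \<le> r * inverse (real (Suc n))" for n
    using K mult_right_mono[OF K(2), of "inverse (real (Suc n))"] by (auto simp: h_def algebra_simps)
  have "r * inverse (real (Suc n)) \<le> r" for n using r(1) by (simp add: field_simps)
  then have sub: "cball x (h n * (norm v + norm w)) \<subseteq> S" "cball x (h n * (norm w + norm v)) \<subseteq> S" for n
    using r(2) h(2)[of n] by (auto simp: add.commute intro!: order_trans[OF subset_cball r(2)] intro: order_trans)
  obtain \<xi> where \<xi>: "dist (\<xi> n) x \<le> h n * (norm v + norm w)"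
    "f (x + h n *\<^sub>R v + h n *\<^sub>R w) - f (x + h n *\<^sub>R v) - (f (x + h n *\<^sub>R w) - f x)
    = h n * h n * fder (\<lambda>y. fder f y v) (\<xi> n) w" for n
    using second_difference_mean_value[OF assms(3) h(1) sub(1)] by metis
  obtain \<zeta> where \<zeta>: "dist (\<zeta> n) x \<le> h n * (norm w + norm v)"
    "f (x + h n *\<^sub>R w + h n *\<^sub>R v) - f (x + h n *\<^sub>R w) - (f (x + h n *\<^sub>R v) - f x)
    = h n * h n * fder (\<lambda>y. fder f y w) (\<zeta> n) v" for n
    using second_difference_mean_value[OF assms(3) h(1) sub(2)] by metis
  have eq0: "h n * h n * fder (\<lambda>y. fder f y v) (\<xi> n) w = h n * h n * fder (\<lambda>y. fder f y w) (\<zeta> n) v" for n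
    unfolding \<xi>(2)[symmetric] \<zeta>(2)[symmetric] by (simp add: algebra_simps)
  have eq: "fder (\<lambda>y. fder f y v) (\<xi> n) w = fder (\<lambda>y. fder f y w) (\<zeta> n) v" for n
    using eq0[of n] h(1)[of n] by simp
  have cont: "isCont (\<lambda>y. fder (\<lambda>y. fder f y v) y w) x" for v w
    using smooth_on_imp_continuous_on[OF smooth_on_fder_const[OF smooth_on_fder_const[OF assms(3)]]]
      assms(1,2) continuous_on_eq_continuous_at by blast
  have "(\<lambda>n. fder (\<lambda>y. fder f y v) (\<xi> n) w) \<longlonglongrightarrow> fder (\<lambda>y. fder f y v) x w"
    by (rule isCont_tendsto_of_dist_le[OF cont, where K=r]) (use \<xi>(1) h(2) order_trans in blast)
  moreover have "(\<lambda>n. fder (\<lambda>y. fder f y w) (\<zeta> n) v) \<longlonglongrightarrow> fder (\<lambda>y. fder f y w) x v"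
    by (rule isCont_tendsto_of_dist_le[OF cont, where K=r])
      (use \<zeta>(1) h(2) order_trans in \<open>auto simp: add.commute intro: order_trans\<close>)
  ultimately show ?thesis using eq LIMSEQ_unique by simp
qed

lemma symmetric_second_derivative:
  fixes f :: "'a::euclidean_space \<Rightarrow> 'b::euclidean_space"
  assumes "open S" "x \<in> S" "smooth_on S f"
  shows "fder (\<lambda>y. fder f y v) x w = fder (\<lambda>y. fder f y w) x v"
proof (rule euclidean_eqI)
  fix b :: 'b assume "b \<in> Basis"
  have *: "fder (\<lambda>y. g y \<bullet> b) z u = fder g z u \<bullet> b" if "smooth_on S g" "z \<in> S" for g z u
    using has_derivative_inner_left[OF smooth_on_has_derivative[OF that], of b] by (simp add: fder_eq)
  have "fder (\<lambda>y. fder f y v) x w \<bullet> b = fder (\<lambda>y. fder (\<lambda>y. f y \<bullet> b) y v) x w" for v w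
    using *[OF smooth_on_fder_const[OF assms(3)] assms(2), of v w, symmetric]
      fder_cong_open[OF assms(1,2), of "\<lambda>y. fder f y v \<bullet> b" "\<lambda>y. fder (\<lambda>y. f y \<bullet> b) y v"] *[OF assms(3)] by simp
  then show "fder (\<lambda>y. fder f y v) x w \<bullet> b = fder (\<lambda>y. fder f y w) x v \<bullet> b"
    using symmetric_second_derivative_real[OF assms(1,2), of "\<lambda>y. f y \<bullet> b" v w]
      smooth_on_inner[OF assms(1,3) smooth_on_const] by simp
qed

section \<open>A parametrised integral equation\<close>

text \<open>Only the first component is moved towards the origin; the second is a parameter. The
  equations solved below have the form \<open>u p = integral {0..1} (\<lambda>\<sigma>. F (\<sigma>,
  p, u (shrink \<sigma> p)))\<close>, so \<open>u p\<close> depends on the values of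
  \<open>u\<close> on the ray from the origin to \<open>p\<close>.\<close>

definition shrink :: "real \<Rightarrow> 'k::euclidean_space \<times> 'm::euclidean_space \<Rightarrow> 'k \<times> 'm" where
  "shrink \<sigma> p = (\<sigma> *\<^sub>R fst p, snd p)"

definition dbox :: "real \<Rightarrow> ('k::euclidean_space \<times> 'm::euclidean_space) set" where
  "dbox r = ball 0 r \<times> ball 0 r"

lemma open_dbox: "open (dbox r)"
  by (simp add: dbox_def open_Times)

lemma shrink_shrink: "shrink \<sigma> (shrink \<tau> p) = shrink (\<sigma> * \<tau>) p"
  by (simp add: shrink_def)

lemma shrink_1 [simp]: "shrink 1 p = p"
  by (simp add: shrink_def)

lemma shrink_add: "shrink \<sigma> (p + q) = shrink \<sigma> p + shrink \<sigma> q"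
  by (simp add: shrink_def scaleR_add_right)

lemma linear_shrink: "linear (shrink \<sigma>)"
  by (intro linearI) (auto simp: shrink_def algebra_simps)

lemma norm_shrink_le: "\<sigma> \<in> {0..1} \<Longrightarrow> norm (shrink \<sigma> p) \<le> norm p"
  by (cases p) (auto simp: shrink_def norm_Pair intro!: add_mono power_mono mult_left_le_one_le)

lemma shrink_mem_dbox:
  assumes "p \<in> dbox r" "0 \<le> \<sigma>" "\<sigma> \<le> 1"
  shows "shrink \<sigma> p \<in> dbox r"
proof -
  have "\<sigma> * norm (fst p) \<le> norm (fst p)" using assms(2,3) by (intro mult_left_le_one_le) auto
  then show ?thesis using assms by (auto simp: shrink_def dbox_def)
qed

lemma shrink_mem_cball:
  assumes "p \<in> cball 0 r \<times> cball 0 r" "\<sigma> \<in> {0..1}"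
  shows "shrink \<sigma> p \<in> cball 0 r \<times> cball 0 r"
proof -
  have "\<sigma> * norm (fst p) \<le> norm (fst p)" using assms(2) by (intro mult_left_le_one_le) auto
  then show ?thesis using assms by (auto simp: shrink_def)
qed

lemma continuous_on_shrink [continuous_intros]:
  "continuous_on S f \<Longrightarrow> continuous_on S g \<Longrightarrow> continuous_on S (\<lambda>x. shrink (f x) (g x))"
  unfolding shrink_def by (intro continuous_intros)

text \<open>Substitute for Gronwall's inequality: \<open>\<phi>\<close> attains its maximum, and
  there the hypothesis with \<open>M\<close> equal to the maximum can be solved for
  \<open>M\<close>.\<close>

lemma sup_contraction_bound:
  fixes \<phi> :: "real \<Rightarrow> real"
  assumes cont: "continuous_on {0..1} \<phi>" and c: "c < 1"
    and le: "\<And>\<tau> M. \<tau> \<in> {0..1} \<Longrightarrow> (\<And>s. s \<in> {0..1} \<Longrightarrow> \<phi> s \<le> M) \<Longrightarrow> \<phi> \<tau> \<le> a + c * M"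
    and t: "t \<in> {0..1}"
  shows "\<phi> t \<le> a / (1 - c)"
proof -
  obtain x where x: "x \<in> {0..1}" "\<And>s. s \<in> {0..1} \<Longrightarrow> \<phi> s \<le> \<phi> x"
    using continuous_attains_sup[OF _ _ cont] by fastforce
  have "\<phi> x \<le> a + c * \<phi> x" by (rule le[OF x])
  then have "\<phi> x \<le> a / (1 - c)" using c by (simp add: pos_le_divide_eq algebra_simps)
  then show ?thesis using x(2)[OF t] by simp
qed

lemma norm_integral_unit_le:
  fixes f :: "real \<Rightarrow> 'a::banach"
  assumes "continuous_on {0..1} f" "\<And>t. t \<in> {0..1} \<Longrightarrow> norm (f t) \<le> B"
  shows "norm (integral {0..1} f) \<le> B"
  using integral_bound[of 0 1 f B] assms by simp

text \<open>Picard iteration started at 0. The Lipschitz constant 1/2 makes the increments decay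
  geometrically, uniformly on each closed box \<open>C \<rho>\<close> with
  \<open>\<rho> < r\<close>; these boxes are stable under \<open>shrink\<close> and their interiors
  cover \<open>dbox r\<close>. The assumption \<open>mean\<close> keeps the iterates in
  \<open>V\<close>.\<close>

lemma integral_equation_solution:
  fixes F :: "real \<times> ('k::euclidean_space \<times> 'm::euclidean_space) \<times> 'n::euclidean_space \<Rightarrow> 'n"
  assumes contF: "continuous_on ({0..1} \<times> dbox r \<times> V) F"
    and lip: "\<And>\<sigma> p z z'. \<lbrakk>\<sigma> \<in> {0..1}; p \<in> dbox r; z \<in> V; z' \<in> V\<rbrakk> \<Longrightarrow> norm (F (\<sigma>, p, z) - F (\<sigma>, p, z')) \<le> 1/2 * norm (z - z')"
    and V: "closed V" "0 \<in> V"
    and mean: "\<And>p g. \<lbrakk>p \<in> dbox r; continuous_on {0..1} g; g ` {0..1} \<subseteq> V\<rbrakk>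
      \<Longrightarrow> integral {0..1} (\<lambda>\<sigma>. F (\<sigma>, p, g \<sigma>)) \<in> V"
  obtains u where "continuous_on (dbox r) u" "u ` dbox r \<subseteq> V"
    "\<And>p. p \<in> dbox r \<Longrightarrow> u p = integral {0..1} (\<lambda>\<sigma>. F (\<sigma>, p, u (shrink \<sigma> p)))"
proof -
  define T where "T u p = integral {0..1} (\<lambda>\<sigma>. F (\<sigma>, p, u (shrink \<sigma> p)))" for u p
  define U where "U n = (T ^^ n) (\<lambda>_. 0)" for n
  have U_Suc: "U (Suc n) = T (U n)" for n by (simp add: U_def)
  have contI: "continuous_on {0..1} (\<lambda>\<sigma>. F (\<sigma>, p, u (shrink \<sigma> p)))"
    if "continuous_on (dbox r) u" "u ` dbox r \<subseteq> V" "p \<in> dbox r" for u p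
    by (intro continuous_on_compose2[OF contF] continuous_intros continuous_on_compose2[OF that(1)])
      (use that in \<open>auto intro!: shrink_mem_dbox subsetD[OF that(2)] imageI\<close>)
  have contT: "continuous_on (dbox r) (T u)" if "continuous_on (dbox r) u" "u ` dbox r \<subseteq> V" for u
  proof -
    have "continuous_on (dbox r \<times> cbox 0 1) (\<lambda>(p,\<sigma>). F (\<sigma>, p, u (shrink \<sigma> p)))"
      unfolding split_beta
      by (intro continuous_on_compose2[OF contF] continuous_intros continuous_on_compose2[OF that(1)])
        (use that in \<open>auto intro!: shrink_mem_dbox subsetD[OF that(2)] imageI\<close>)
    then show ?thesis unfolding T_def using integral_continuous_on_param by fastforce
  qed
  have TV: "T u ` dbox r \<subseteq> V" if "continuous_on (dbox r) u" "u ` dbox r \<subseteq> V" for u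
    unfolding T_def
    by (rule image_subsetI, rule mean)
      (use that in \<open>auto intro!: continuous_intros continuous_on_compose2[OF that(1)] shrink_mem_dbox
        subsetD[OF that(2)] imageI\<close>)
  have U: "continuous_on (dbox r) (U n) \<and> U n ` dbox r \<subseteq> V" for n
  proof (induction n)
    case 0
    then show ?case using V by (auto simp: U_def)
  next
    case (Suc n)
    then show ?case unfolding U_Suc using contT TV by blast
  qed
  have Tdiff: "norm (T u p - T w p) \<le> 1/2 * M"
    if "continuous_on (dbox r) u" "u ` dbox r \<subseteq> V" "continuous_on (dbox r) w" "w ` dbox r \<subseteq> V" "p \<in> dbox r"
      "\<And>\<sigma>. \<sigma> \<in> {0..1} \<Longrightarrow> norm (u (shrink \<sigma> p) - w (shrink \<sigma> p)) \<le> M" for u w p M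
  proof -
    note c = contI[OF that(1,2,5)] contI[OF that(3,4,5)]
    have "T u p - T w p = integral {0..1} (\<lambda>\<sigma>. F (\<sigma>, p, u (shrink \<sigma> p)) - F (\<sigma>, p, w (shrink \<sigma> p)))"
      unfolding T_def using c by (intro integral_diff[symmetric] integrable_continuous_real)
    also have "norm \<dots> \<le> 1/2 * M"
    proof (rule norm_integral_unit_le)
      fix \<sigma> :: real assume \<sigma>: "\<sigma> \<in> {0..1}"
      then have "norm (F (\<sigma>, p, u (shrink \<sigma> p)) - F (\<sigma>, p, w (shrink \<sigma> p))) \<le> 1/2 * norm (u (shrink \<sigma> p) - w (shrink \<sigma> p))"
        using that(2,4,5) shrink_mem_dbox[OF that(5), of \<sigma>] by (intro lip) auto
      then show "norm (F (\<sigma>, p, u (shrink \<sigma> p)) - F (\<sigma>, p, w (shrink \<sigma> p))) \<le> 1/2 * M"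
        using that(6)[OF \<sigma>] by linarith
    qed (intro continuous_intros c)
    finally show ?thesis .
  qed
  define C where "C \<rho> = (cball 0 \<rho> \<times> cball 0 \<rho> :: ('k \<times> 'm) set)" for \<rho>
  have C: "compact (C \<rho>)" "\<rho> < r \<Longrightarrow> C \<rho> \<subseteq> dbox r" for \<rho>
    by (auto simp: C_def dbox_def intro!: compact_Times)
  have conv: "uniform_limit (C \<rho>) U (\<lambda>p. lim (\<lambda>n. U n p)) sequentially" if \<rho>r: "\<rho> < r" for \<rho>
  proof -
    obtain B where B: "B \<ge> 0" "\<And>p. p \<in> C \<rho> \<Longrightarrow> norm (U 1 p) \<le> B"
      using continuous_on_compact_bound[OF C(1) continuous_on_subset[OF conjunct1[OF U] C(2)[OF \<rho>r]]] by metis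
    have step: "norm (U (Suc n) p - U n p) \<le> B * (1/2)^n" if "p \<in> C \<rho>" for n p
      using that
    proof (induction n arbitrary: p)
      case 0
      then show ?case using B(2) by (simp add: U_def)
    next
      case (Suc n)
      have "norm (T (U (Suc n)) p - T (U n) p) \<le> 1/2 * (B * (1/2)^n)"
      proof (rule Tdiff)
        fix \<sigma> :: real assume "\<sigma> \<in> {0..1}"
        then show "norm (U (Suc n) (shrink \<sigma> p) - U n (shrink \<sigma> p)) \<le> B * (1/2)^n"
          using Suc shrink_mem_cball[of p \<rho> \<sigma>] by (auto simp: C_def)
      qed (use U Suc.prems C(2)[OF \<open>\<rho> < r\<close>] in auto)
      then show ?case by (simp add: U_Suc)
    qed
    have "uniform_limit (C \<rho>) (\<lambda>n p. \<Sum>i<n. U (Suc i) p - U i p) (\<lambda>p. suminf (\<lambda>i. U (Suc i) p - U i p)) sequentially"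
    proof (rule Weierstrass_m_test_ev)
      show "summable (\<lambda>i. B * (1/2)^i :: real)" by (intro summable_mult summable_geometric) simp
    qed (use step in auto)
    moreover have "(\<Sum>i<n. U (Suc i) p - U i p) = U n p" for n p
      by (subst sum_lessThan_telescope) (simp add: U_def)
    ultimately have "uniformly_convergent_on (C \<rho>) U"
      unfolding uniformly_convergent_on_def by auto
    then show ?thesis by (simp add: uniformly_convergent_uniform_limit_iff)
  qed
  define u where "u p = lim (\<lambda>n. U n p)" for p
  have memC: "\<exists>\<rho><r. p \<in> interior (C \<rho>)" if "p \<in> dbox r" for p
  proof -
    obtain \<rho> where \<rho>: "max (norm (fst p)) (norm (snd p)) < \<rho>" "\<rho> < r"
      using dense[of "max (norm (fst p)) (norm (snd p))" r] \<open>p \<in> dbox r\<close> by (auto simp: dbox_def)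
    then have "p \<in> ball 0 \<rho> \<times> ball 0 \<rho>" by (cases p) auto
    moreover have "ball 0 \<rho> \<times> ball 0 \<rho> \<subseteq> interior (C \<rho>)"
      by (rule interior_maximal) (auto simp: C_def intro: open_Times)
    ultimately show ?thesis using \<rho>(2) by blast
  qed
  have contu: "continuous_on (dbox r) u"
  proof (rule continuous_at_imp_continuous_on, rule ballI)
    fix p :: "'k \<times> 'm" assume "p \<in> dbox r"
    then obtain \<rho> where \<rho>: "\<rho> < r" "p \<in> interior (C \<rho>)" using memC by blast
    have "continuous_on (C \<rho>) (\<lambda>p. lim (\<lambda>n. U n p))"
      by (rule uniform_limit_theorem[OF _ conv[OF \<rho>(1)]])
        (use U C(2)[OF \<rho>(1)] in \<open>auto intro: continuous_on_subset intro!: always_eventually\<close>)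
    then show "isCont u p"
      using \<rho>(2) unfolding u_def[abs_def] by (rule continuous_on_interior)
  qed
  have lim: "(\<lambda>n. U n p) \<longlonglongrightarrow> u p" if p: "p \<in> dbox r" for p
  proof -
    obtain \<rho> where \<rho>: "\<rho> < r" "p \<in> C \<rho>" using memC[OF p] interior_subset by blast
    show ?thesis using tendsto_uniform_limitI[OF conv[OF \<rho>(1)] \<rho>(2)] by (simp add: u_def)
  qed
  have uV: "u ` dbox r \<subseteq> V"
  proof (rule image_subsetI)
    fix p :: "'k \<times> 'm" assume p: "p \<in> dbox r"
    have "U n p \<in> V" for n using U p by blast
    then show "u p \<in> V" using closed_sequentially[OF V(1) _ lim[OF p]] by blast
  qed
  have "u p = T u p" if p: "p \<in> dbox r" for p
  proof -
    obtain \<rho> where \<rho>: "\<rho> < r" "p \<in> C \<rho>" using memC[OF p] interior_subset by blast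
    have "(\<lambda>n. T (U n) p) \<longlonglongrightarrow> T u p"
    proof (rule LIMSEQ_I)
      fix e :: real assume "e > 0"
      then obtain N where N: "\<And>n q. n \<ge> N \<Longrightarrow> q \<in> C \<rho> \<Longrightarrow> dist (U n q) (u q) < e"
        using conv[OF \<rho>(1)] unfolding uniform_limit_iff eventually_sequentially u_def by blast
      have "norm (T (U n) p - T u p) \<le> 1/2 * e" if "n \<ge> N" for n
      proof (rule Tdiff)
        fix \<sigma> :: real assume "\<sigma> \<in> {0..1}"
        then show "norm (U n (shrink \<sigma> p) - u (shrink \<sigma> p)) \<le> e"
          using N[OF that, of "shrink \<sigma> p"] shrink_mem_cball[of p \<rho> \<sigma>] \<rho>(2) by (auto simp: C_def dist_norm)
      qed (use U contu uV p in auto)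
      then show "\<exists>N. \<forall>n\<ge>N. norm (T (U n) p - T u p) < e"
        using \<open>e > 0\<close> by (intro exI[of _ N]) (fastforce intro: order_le_less_trans)
    qed
    moreover have "(\<lambda>n. T (U n) p) \<longlonglongrightarrow> u p"
      using LIMSEQ_Suc[OF lim[OF p]] by (simp add: U_Suc)
    ultimately show ?thesis using LIMSEQ_unique by blast
  qed
  then show ?thesis using that contu uV unfolding T_def by blast
qed

section \<open>Differentiability of the solution of the integral equation\<close>

lemma small_near_zero_section:
  fixes g :: "'a::metric_space \<times> 'b::euclidean_space \<Rightarrow> 'c::real_normed_vector"
  assumes "compact A" "\<rho> > 0" "continuous_on (A \<times> cball 0 \<rho>) g" "\<And>x. x \<in> A \<Longrightarrow> g (x, 0) = 0" "\<epsilon> > 0"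
  obtains \<delta> where "\<delta> > 0" "\<delta> \<le> \<rho>" "\<And>x k. x \<in> A \<Longrightarrow> norm k < \<delta> \<Longrightarrow> norm (g (x, k)) < \<epsilon>"
proof -
  have "uniformly_continuous_on (A \<times> cball 0 \<rho>) g"
    using assms by (intro compact_uniformly_continuous compact_Times) auto
  then obtain d where d: "d > 0" "\<And>y y'. \<lbrakk>y \<in> A \<times> cball 0 \<rho>; y' \<in> A \<times> cball 0 \<rho>; dist y' y < d\<rbrakk> \<Longrightarrow> dist (g y') (g y) < \<epsilon>"
    using \<open>\<epsilon> > 0\<close> unfolding uniformly_continuous_on_def by metis
  show ?thesis
  proof (rule that[of "min d \<rho>"])
    fix x k assume "x \<in> A" "norm (k::'b) < min d \<rho>"
    then show "norm (g (x, k)) < \<epsilon>"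
      using d(2)[of "(x,0)" "(x,k)"] assms(2,4) by (simp add: dist_Pair_Pair dist_norm)
  qed (use d assms in auto)
qed

text \<open>The derivative is uniformly continuous near the compact set \<open>Q\<close>, and the
  mean value inequality turns its oscillation into a bound for the remainder; so one
  \<open>\<delta>\<close> serves all points of \<open>Q\<close>.\<close>

lemma compact_uniform_differentiability:
  fixes f :: "'a::euclidean_space \<Rightarrow> 'b::real_normed_vector"
  assumes "open S" "Ck_on (Suc 0) S f" "compact Q" "Q \<subseteq> S" "\<epsilon> > 0"
  obtains \<delta> where "\<delta> > 0"
    "\<And>q k. q \<in> Q \<Longrightarrow> norm k < \<delta> \<Longrightarrow> q + k \<in> S \<and> norm (f (q + k) - f q - fder f q k) \<le> \<epsilon> * norm k"
proof -
  obtain \<rho> where \<rho>: "\<rho> > 0" "(\<Union>x\<in>Q. cball x \<rho>) \<subseteq> S"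
    using compact_subset_open_imp_cball_epsilon_subset assms by metis
  have QS: "q + k \<in> S" if "q \<in> Q" "norm k \<le> \<rho>" for q k
  proof -
    have "q + k \<in> cball q \<rho>" using that by (simp add: dist_norm)
    then show ?thesis using \<rho>(2) that by blast
  qed
  define g where "g = (\<lambda>(q,k). \<Sum>b\<in>Basis. norm (fder f (q + k) b - fder f q b))"
  have contD: "continuous_on S (\<lambda>x. fder f x b)" for b using assms(2) by simp
  have "continuous_on (Q \<times> cball 0 \<rho>) g"
    unfolding g_def split_beta
    by (intro continuous_intros continuous_on_compose2[OF contD]) (use QS assms(4) in auto)
  then obtain \<delta> where \<delta>: "\<delta> > 0" "\<delta> \<le> \<rho>" "\<And>q k. q \<in> Q \<Longrightarrow> norm k < \<delta> \<Longrightarrow> norm (g (q, k)) < \<epsilon>"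
    using small_near_zero_section[OF assms(3) \<rho>(1) _ _ \<open>\<epsilon> > 0\<close>, of g] by (auto simp: g_def)
  have der: "(f has_derivative fder f x) (at x)" if "x \<in> S" for x
    using assms(2) that by (simp add: fder_works)
  have "norm (f (q + k) - f q - fder f q k) \<le> \<epsilon> * norm k" if q: "q \<in> Q" and k: "norm k < \<delta>" for q k
  proof -
    have ballS: "x \<in> S" if "x \<in> ball q \<delta>" for x
      using QS[OF q, of "x - q"] that \<delta>(2) by (auto simp: dist_norm norm_minus_commute)
    have "norm (f (q + k) - f q - fder f q (q + k - q)) \<le> norm (q + k - q) * \<epsilon>"
    proof (rule differentiable_bound_linearization[where S="ball q \<delta>"])
      fix t :: real assume "t \<in> {0..1}"
      then have "norm (t *\<^sub>R k) \<le> norm k" by (simp add: mult_left_le_one_le)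
      then show "q + t *\<^sub>R (q + k - q) \<in> ball q \<delta>" using k by (simp add: dist_norm)
    next
      fix x assume x: "x \<in> ball q \<delta>"
      show "(f has_derivative fder f x) (at x within ball q \<delta>)"
        using der[OF ballS[OF x]] by (rule has_derivative_at_withinI)
      have lin: "linear (\<lambda>v. fder f x v - fder f q v)"
        using der ballS[OF x] assms(4) q
        by (intro linear_compose_sub has_derivative_linear) auto
      have gx: "norm (g (q, x - q)) < \<epsilon>" using \<delta>(3)[OF q] x by (auto simp: dist_norm norm_minus_commute)
      show "onorm (fder f x - fder f q) \<le> \<epsilon>"
      proof (rule onorm_le)
        fix v
        have "norm ((fder f x - fder f q) v) \<le> g (q, x - q) * norm v"
          using linear_norm_le_sum_Basis[OF lin, of v] by (simp add: g_def)
        also have "\<dots> \<le> \<epsilon> * norm v" using gx by (intro mult_right_mono) auto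
        finally show "norm ((fder f x - fder f q) v) \<le> \<epsilon> * norm v" .
      qed
    qed (use \<delta> in auto)
    then show ?thesis by (simp add: mult.commute)
  qed
  then show ?thesis using that[OF \<delta>(1)] QS \<delta>(2) by force
qed

lemma lipschitz_derivative_bound:
  fixes f :: "'a::real_normed_vector \<Rightarrow> 'b::real_normed_vector"
  assumes der: "(f has_derivative f') (at x)" and "open S" "x \<in> S"
    and lip: "\<And>t. x + t *\<^sub>R w \<in> S \<Longrightarrow> norm (f (x + t *\<^sub>R w) - f x) \<le> L * norm (t *\<^sub>R w)"
  shows "norm (f' w) \<le> L * norm w"
proof (cases "w = 0")
  case True
  then show ?thesis using linear_0[OF has_derivative_linear[OF der]] by simp
next
  case False
  obtain r where r: "r > 0" "ball x r \<subseteq> S" using assms(2,3) open_contains_ball by blast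
  have "norm (f' w) \<le> L * norm w + e" if "e > 0" for e
  proof -
    obtain d where d: "d > 0"
      "\<And>y. norm (y - x) < d \<Longrightarrow> norm (f y - f x - f' (y - x)) \<le> e / norm w * norm (y - x)"
      using der divide_pos_pos[OF \<open>e > 0\<close>, of "norm w"] False unfolding has_derivative_at_alt by (metis zero_less_norm_iff)
    define t where "t = min d r / 2 / norm w"
    have t: "t > 0" "norm (t *\<^sub>R w) < d" "norm (t *\<^sub>R w) < r"
      using d(1) r(1) False by (auto simp: t_def)
    have "x + t *\<^sub>R w \<in> S" using r(2) t(3) by (auto simp: dist_norm subset_iff)
    from lip[OF this] d(2)[of "x + t *\<^sub>R w"] t(2)
    have "norm (f' (t *\<^sub>R w)) \<le> L * norm (t *\<^sub>R w) + e / norm w * norm (t *\<^sub>R w)"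
      using norm_triangle_ineq4[of "f (x + t *\<^sub>R w) - f x" "f (x + t *\<^sub>R w) - f x - f' (t *\<^sub>R w)"] by simp
    also have "\<dots> = t * (L * norm w + e)" using t(1) False by (simp add: field_simps)
    finally show ?thesis using t(1) linear_cmul[OF has_derivative_linear[OF der]] by simp
  qed
  then show ?thesis by (rule field_le_epsilon)
qed

lemma continuous_on_apply_linear:
  fixes L :: "'p::topological_space \<Rightarrow> 'a::euclidean_space \<Rightarrow> 'b::real_normed_vector"
  assumes "\<And>y. y \<in> S \<Longrightarrow> linear (L y)" "\<And>v. continuous_on S (\<lambda>y. L y v)" "continuous_on S g"
  shows "continuous_on S (\<lambda>y. L y (g y))"
proof (rule continuous_on_eq)
  show "continuous_on S (\<lambda>y. \<Sum>b\<in>Basis. (g y \<bullet> b) *\<^sub>R L y b)"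
    by (intro continuous_intros assms)
qed (simp add: linear_basis_expansion[OF assms(1), symmetric])

text \<open>Derivatives are taken at interior points, so the domain must be open:
  \<open>\<sigma>\<close> may leave the unit interval as long as the shrunk point stays in the
  box.\<close>

definition eqdom :: "real \<Rightarrow> 'n set \<Rightarrow> (real \<times> ('k::euclidean_space \<times> 'm::euclidean_space) \<times> 'n::euclidean_space) set" where
  "eqdom r V = {(\<sigma>, p, z). p \<in> dbox r \<and> shrink \<sigma> p \<in> dbox r \<and> z \<in> V}"

lemma open_eqdom:
  fixes V :: "'n::euclidean_space set"
  assumes "open V"
  shows "open (eqdom r V :: (real \<times> ('k::euclidean_space \<times> 'm::euclidean_space) \<times> 'n) set)" (is "open ?E")
proof -
  have "?E = (\<lambda>x. fst (snd x)) -` dbox r \<inter> (\<lambda>x. shrink (fst x) (fst (snd x))) -` dbox r \<inter> (\<lambda>x. snd (snd x)) -` V"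
    by (auto simp: eqdom_def)
  then show ?thesis
    using assms open_dbox by (auto intro!: open_Int open_vimage continuous_intros)
qed

lemma shrink_Basis: "b \<in> Basis \<Longrightarrow> shrink \<sigma> b = (if snd b = 0 then \<sigma> else 1) *\<^sub>R b"
  by (auto simp: Basis_prod_def shrink_def)

text \<open>The eigenvalue of \<open>shrink \<sigma>\<close> on a basis vector \<open>b\<close>; the
  condition \<open>snd b = 0\<close> singles out basis vectors of the first factor.\<close>

definition basis_factor :: "'k::euclidean_space \<times> 'm::euclidean_space \<Rightarrow> real \<Rightarrow> real" where
  "basis_factor b \<sigma> = (if snd b = 0 then \<sigma> else 1)"

text \<open>Formal differentiation of the integral equation gives a linear equation for the
  candidate derivative \<open>W\<close>. It relates the direction \<open>v\<close> to the direction
  \<open>shrink \<sigma> v\<close>; basis vectors are eigenvectors of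
  \<open>shrink \<sigma>\<close>, so the equations for the different basis directions decouple and
  each is again an integral equation of the same kind.\<close>

lemma integral_equation_linearised:
  fixes F :: "real \<times> ('k::euclidean_space \<times> 'm::euclidean_space) \<times> 'n::euclidean_space \<Rightarrow> 'n"
  assumes V: "open V" and F: "Ck_on (Suc 0) (eqdom r V) F"
    and contr: "\<And>\<sigma> p z w. \<lbrakk>\<sigma> \<in> {0..1}; p \<in> dbox r; z \<in> V\<rbrakk> \<Longrightarrow> norm (fder F (\<sigma>, p, z) (0, 0, w)) \<le> 1/2 * norm w"
    and contu: "continuous_on (dbox r) u" and uV: "u ` dbox r \<subseteq> V"
  shows "\<exists>W. (\<forall>p. linear (W p)) \<and> (\<forall>v. continuous_on (dbox r) (\<lambda>p. W p v)) \<and>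
    (\<forall>p\<in>dbox r. \<forall>v. W p v = integral {0..1} (\<lambda>\<sigma>. fder F (\<sigma>, p, u (shrink \<sigma> p)) (0, v, W (shrink \<sigma> p) (shrink \<sigma> v)))) \<and>
    (\<forall>p\<in>dbox r. \<forall>v. continuous_on {0..1} (\<lambda>\<sigma>. fder F (\<sigma>, p, u (shrink \<sigma> p)) (0, v, W (shrink \<sigma> p) (shrink \<sigma> v))))"
proof -
  have uS: "u (shrink \<sigma> p) \<in> V" if "p \<in> dbox r" "0 \<le> \<sigma>" "\<sigma> \<le> 1" for \<sigma> p
    using shrink_mem_dbox[OF that] uV by blast
  have mem: "(\<sigma>, p, u (shrink \<sigma> p)) \<in> eqdom r V" if "p \<in> dbox r" "0 \<le> \<sigma>" "\<sigma> \<le> 1" for \<sigma> p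
    using shrink_mem_dbox[OF that] uS[OF that] that by (simp add: eqdom_def)
  have linF: "linear (fder F q)" if "q \<in> eqdom r V" for q
    using F that by (intro linear_fder) auto
  have contD: "continuous_on (eqdom r V) (\<lambda>q. fder F q v)" for v using Ck_on_Suc_fder[OF F] by simp
  \<comment> \<open>Here \<open>z\<close> stands for \<open>W (shrink \<sigma> p) b\<close>, from
    which the eigenvalue of \<open>shrink \<sigma>\<close> has been pulled out.\<close>
  define G where "G b = (\<lambda>(\<sigma>, p, z). fder F (\<sigma>, p, u (shrink \<sigma> p)) (0, b, basis_factor b \<sigma> *\<^sub>R z))" for b
  have contfac: "continuous_on S (basis_factor b)" for b :: "'k \<times> 'm" and S
    by (cases "snd b = 0") (simp_all add: basis_factor_def[abs_def])
  have contG: "continuous_on ({0..1} \<times> dbox r \<times> UNIV) (G b)" for b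
    unfolding G_def split_beta
    by (rule continuous_on_apply_linear[where L="\<lambda>y. fder F (fst y, fst (snd y), u (shrink (fst y) (fst (snd y))))"
          and g="\<lambda>y. (0, b, basis_factor b (fst y) *\<^sub>R snd (snd y))"])
      (auto intro!: linF intro!: continuous_on_compose2[OF contD] continuous_intros continuous_on_compose2[OF contu]
        continuous_on_compose2[OF contfac[of UNIV]] mem shrink_mem_dbox)
  have "\<exists>w. continuous_on (dbox r) w \<and> (\<forall>p\<in>dbox r. w p = integral {0..1} (\<lambda>\<sigma>. G b (\<sigma>, p, w (shrink \<sigma> p))))" for b
  proof -
    have lip: "norm (G b (\<sigma>, p, z) - G b (\<sigma>, p, z')) \<le> 1/2 * norm (z - z')" if "\<sigma> \<in> {0..1}" "p \<in> dbox r" for \<sigma> p z z'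
    proof -
      have m: "(\<sigma>, p, u (shrink \<sigma> p)) \<in> eqdom r V" using mem that by auto
      have "G b (\<sigma>, p, z) - G b (\<sigma>, p, z') = fder F (\<sigma>, p, u (shrink \<sigma> p)) (0, 0, basis_factor b \<sigma> *\<^sub>R (z - z'))"
        unfolding G_def by (simp add: linear_diff[OF linF[OF m], symmetric] scaleR_diff_right)
      also have "norm \<dots> \<le> 1/2 * norm (basis_factor b \<sigma> *\<^sub>R (z - z'))"
        using that by (intro contr uS) auto
      also have "\<dots> \<le> 1/2 * norm (z - z')"
        using that by (auto simp: basis_factor_def mult_left_le_one_le)
      finally show ?thesis .
    qed
    obtain w where "continuous_on (dbox r) w" "w ` dbox r \<subseteq> UNIV"
      "\<And>p. p \<in> dbox r \<Longrightarrow> w p = integral {0..1} (\<lambda>\<sigma>. G b (\<sigma>, p, w (shrink \<sigma> p)))"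
      by (rule integral_equation_solution[OF contG[of b] lip]) auto
    then show ?thesis by blast
  qed
  then have "\<forall>b. \<exists>w. continuous_on (dbox r) w \<and> (\<forall>p\<in>dbox r. w p = integral {0..1} (\<lambda>\<sigma>. G b (\<sigma>, p, w (shrink \<sigma> p))))"
    by blast
  from choice[OF this] obtain w where w: "\<And>b. continuous_on (dbox r) (w b)"
    "\<And>b p. p \<in> dbox r \<Longrightarrow> w b p = integral {0..1} (\<lambda>\<sigma>. G b (\<sigma>, p, w b (shrink \<sigma> p)))"
    by blast
  define W where "W p v = (\<Sum>b\<in>Basis. (v \<bullet> b) *\<^sub>R w b p)" for p v
  have linW: "linear (W p)" for p
    by (intro linearI) (auto simp: W_def inner_add_left scaleR_add_left sum.distrib scaleR_sum_right)
  have contW: "continuous_on (dbox r) (\<lambda>p. W p v)" for v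
    unfolding W_def by (intro continuous_intros w)
  have contI: "continuous_on {0..1} (\<lambda>\<sigma>. fder F (\<sigma>, p, u (shrink \<sigma> p)) (0, v, W (shrink \<sigma> p) (shrink \<sigma> v)))"
    if "p \<in> dbox r" for p v
  proof (rule continuous_on_apply_linear[where L="\<lambda>y. fder F (y, p, u (shrink y p))"
        and g="\<lambda>y. (0, v, W (shrink y p) (shrink y v))"])
    show "linear (fder F (y, p, u (shrink y p)))" if "y \<in> {0..1}" for y
      using that \<open>p \<in> dbox r\<close> by (intro linF mem) auto
    show "continuous_on {0..1} (\<lambda>y. fder F (y, p, u (shrink y p)) v)" for v
      using that by (auto intro!: continuous_on_compose2[OF contD] continuous_intros continuous_on_compose2[OF contu] mem shrink_mem_dbox)
    have "continuous_on {0..1} (\<lambda>y. W (shrink y p) (shrink y v))"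
      by (rule continuous_on_apply_linear[where L="\<lambda>y. W (shrink y p)" and g="\<lambda>y. shrink y v", OF linW])
        (use that in \<open>auto intro!: continuous_intros continuous_on_compose2[OF contW] shrink_mem_dbox\<close>)
    then show "continuous_on {0..1} (\<lambda>y. (0, v, W (shrink y p) (shrink y v)))"
      by (intro continuous_intros)
  qed
  have "W p v = integral {0..1} (\<lambda>\<sigma>. fder F (\<sigma>, p, u (shrink \<sigma> p)) (0, v, W (shrink \<sigma> p) (shrink \<sigma> v)))"
    (is "_ = integral _ (\<lambda>\<sigma>. ?H \<sigma> v)") if p: "p \<in> dbox r" for p v
  proof -
    have Wb: "W p b = integral {0..1} (\<lambda>\<sigma>. ?H \<sigma> b)" if b: "b \<in> Basis" for b
    proof -
      have Wb: "W q b = w b q" for q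
        by (simp add: W_def inner_Basis b if_distrib[of "\<lambda>c. c *\<^sub>R _"] sum.delta cong: if_cong)
      have "W (shrink \<sigma> p) (shrink \<sigma> b) = basis_factor b \<sigma> *\<^sub>R w b (shrink \<sigma> p)" for \<sigma>
        unfolding Wb[symmetric] by (simp add: shrink_Basis[OF b] linear_cmul[OF linW] basis_factor_def)
      then show ?thesis using w(2)[OF p, of b] by (simp add: Wb G_def)
    qed
    have lin: "linear (\<lambda>v. ?H \<sigma> v)" if "\<sigma> \<in> {0..1}" for \<sigma>
    proof -
      have "linear (\<lambda>v. (0, v, W (shrink \<sigma> p) (shrink \<sigma> v)))"
        by (intro linearI) (auto simp: linear_add[OF linW] linear_cmul[OF linW] linear_add[OF linear_shrink] linear_cmul[OF linear_shrink])
      from linear_compose[OF this linF[OF mem[OF p]]] that show ?thesis by (simp add: o_def)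
    qed
    have "integral {0..1} (\<lambda>\<sigma>. ?H \<sigma> v) = integral {0..1} (\<lambda>\<sigma>. \<Sum>b\<in>Basis. (v \<bullet> b) *\<^sub>R ?H \<sigma> b)"
      by (rule integral_cong) (rule linear_basis_expansion[OF lin])
    also have "\<dots> = (\<Sum>b\<in>Basis. (v \<bullet> b) *\<^sub>R integral {0..1} (\<lambda>\<sigma>. ?H \<sigma> b))"
      using contI[OF p]
      by (subst integral_sum) (auto intro!: integrable_continuous_real continuous_intros)
    also have "\<dots> = (\<Sum>b\<in>Basis. (v \<bullet> b) *\<^sub>R W p b)" by (intro sum.cong refl) (simp add: Wb)
    also have "\<dots> = W p v" by (rule linear_basis_expansion[OF linW, symmetric])
    finally show ?thesis by simp
  qed
  then show ?thesis by (intro exI[of _ W] conjI allI ballI linW contW contI)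
qed

text \<open>Two contraction estimates along the ray to \<open>p0\<close>. The first bounds the
  increment \<open>a h\<close> by a multiple of \<open>norm h\<close>. The second compares it with
  the solution of the linearised equation; their difference \<open>R\<close> satisfies the same
  contraction with an inhomogeneity of size \<open>\<epsilon> * norm h\<close>.\<close>

lemma integral_equation_solution_has_derivative:
  fixes F :: "real \<times> ('k::euclidean_space \<times> 'm::euclidean_space) \<times> 'n::euclidean_space \<Rightarrow> 'n"
  assumes V: "open V" and F: "Ck_on (Suc 0) (eqdom r V) F"
    and contr: "\<And>\<sigma> p z w. \<lbrakk>\<sigma> \<in> {0..1}; p \<in> dbox r; z \<in> V\<rbrakk> \<Longrightarrow> norm (fder F (\<sigma>, p, z) (0, 0, w)) \<le> 1/2 * norm w"
    and contu: "continuous_on (dbox r) u" and uV: "u ` dbox r \<subseteq> V"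
    and u: "\<And>p. p \<in> dbox r \<Longrightarrow> u p = integral {0..1} (\<lambda>\<sigma>. F (\<sigma>, p, u (shrink \<sigma> p)))"
    and linW: "\<And>p. linear (W p)" and contW: "\<And>v. continuous_on (dbox r) (\<lambda>p. W p v)"
    and W: "\<And>p v. p \<in> dbox r \<Longrightarrow> W p v = integral {0..1} (\<lambda>\<sigma>. fder F (\<sigma>, p, u (shrink \<sigma> p)) (0, v, W (shrink \<sigma> p) (shrink \<sigma> v)))"
    and contI: "\<And>p v. p \<in> dbox r \<Longrightarrow> continuous_on {0..1} (\<lambda>\<sigma>. fder F (\<sigma>, p, u (shrink \<sigma> p)) (0, v, W (shrink \<sigma> p) (shrink \<sigma> v)))"
    and p0: "p0 \<in> dbox r"
  shows "(u has_derivative W p0) (at p0)"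
proof -
  have uS: "u (shrink \<sigma> p) \<in> V" if "p \<in> dbox r" "0 \<le> \<sigma>" "\<sigma> \<le> 1" for \<sigma> p
    using shrink_mem_dbox[OF that] uV by blast
  have mem: "(\<sigma>, p, u (shrink \<sigma> p)) \<in> eqdom r V" if "p \<in> dbox r" "0 \<le> \<sigma>" "\<sigma> \<le> 1" for \<sigma> p
    using shrink_mem_dbox[OF that] uS[OF that] that by (simp add: eqdom_def)
  have linF: "linear (fder F q)" if "q \<in> eqdom r V" for q
    using F that by (intro linear_fder) auto
  have contD: "continuous_on (eqdom r V) (\<lambda>q. fder F q v)" for v using Ck_on_Suc_fder[OF F] by simp
  have contF: "continuous_on (eqdom r V) F" using Ck_on_SucD[OF F] by simp
  have openO: "open (eqdom r V :: (real \<times> ('k \<times> 'm) \<times> 'n) set)" by (rule open_eqdom[OF V])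
  obtain \<rho> where \<rho>: "\<rho> > 0" "cball p0 \<rho> \<subseteq> dbox r" using open_dbox p0 open_contains_cball by blast
  have pd: "p0 + h \<in> dbox r" if "norm h \<le> \<rho>" for h
    using subsetD[OF \<rho>(2), of "p0 + h"] that by (simp add: dist_norm)
  define a where "a h \<tau> = u (shrink \<tau> (p0 + h)) - u (shrink \<tau> p0)" for h \<tau>
  \<comment> \<open>The point \<open>q (\<sigma>, \<tau>)\<close> is the argument of
    \<open>F\<close> in the equation for \<open>u (shrink \<tau> p0)\<close>. These points form a
    compact set, so one remainder estimate for \<open>F\<close> covers the whole ray.\<close>
  define q where "q = (\<lambda>(\<sigma>, \<tau>). (\<sigma>, shrink \<tau> p0, u (shrink (\<sigma> * \<tau>) p0)))"
  define Q where "Q = q ` ({0..1} \<times> {0..1})"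
  have q_mem: "q (\<sigma>, \<tau>) \<in> eqdom r V" if "0 \<le> \<sigma>" "\<sigma> \<le> 1" "0 \<le> \<tau>" "\<tau> \<le> 1" for \<sigma> \<tau>
    using mem[OF shrink_mem_dbox[OF p0 that(3,4)] that(1,2)] by (simp add: q_def shrink_shrink)
  have "continuous_on ({0..1} \<times> {0..1}) q"
    unfolding q_def split_beta
    by (auto intro!: continuous_intros continuous_on_compose2[OF contu] shrink_mem_dbox p0 mult_le_one)
  then have Q: "compact Q" "Q \<subseteq> eqdom r V"
    unfolding Q_def using q_mem by (auto intro!: compact_continuous_image compact_Times)
  obtain B where B: "B \<ge> 0" "\<And>x v. x \<in> Q \<Longrightarrow> norm (fder F x (0, v, 0)) \<le> B * norm v"
  proof -
    have cB: "continuous_on Q (\<lambda>x. \<Sum>b\<in>Basis. norm (fder F x (0, b, 0)))"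
      by (intro continuous_intros continuous_on_subset[OF contD Q(2)])
    obtain B where B: "B \<ge> 0" "\<And>x. x \<in> Q \<Longrightarrow> norm (\<Sum>b\<in>Basis. norm (fder F x (0, b, 0))) \<le> B"
      by (rule continuous_on_compact_bound[OF Q(1) cB]) blast
    have "norm (fder F x (0, v, 0)) \<le> B * norm v" if "x \<in> Q" for x v
    proof -
      have l: "linear (\<lambda>v. fder F x (0, v, 0))"
        using linear_compose[OF _ linF[OF subsetD[OF Q(2) that]], of "\<lambda>v. (0, v, 0)"]
        by (simp add: o_def linearI)
      show ?thesis
        using linear_norm_le_sum_Basis[OF l, of v] B(2)[OF that] mult_right_mono[OF _ norm_ge_zero[of v]]
        by (smt (verit, ccfv_SIG) real_norm_def)
    qed
    then show ?thesis using that B(1) by blast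
  qed
  \<comment> \<open>The contraction estimate below produces
    \<open>(B + 1/4) / (1 - 3/4) = 4 * B + 1\<close>.\<close>
  define A where "A = 4 * (B + 1)"
  have eqa: "u (shrink \<tau> p) = integral {0..1} (\<lambda>\<sigma>. F (\<sigma>, shrink \<tau> p, u (shrink (\<sigma> * \<tau>) p)))" if "p \<in> dbox r" "\<tau> \<in> {0..1}" for p \<tau>
    using u[OF shrink_mem_dbox[of p r \<tau>]] that by (simp add: shrink_shrink)
  have contFI: "continuous_on {0..1} (\<lambda>\<sigma>. F (\<sigma>, shrink \<tau> p, u (shrink (\<sigma> * \<tau>) p)))" if "p \<in> dbox r" "\<tau> \<in> {0..1}" for p \<tau>
    using that mem[OF shrink_mem_dbox[of p r \<tau>]]
    by (intro continuous_on_compose2[OF contF])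
      (auto intro!: continuous_intros continuous_on_compose2[OF contu] shrink_mem_dbox mult_le_one simp: shrink_shrink)
  have conta: "continuous_on {0..1} (a h)" if "norm h \<le> \<rho>" for h
    unfolding a_def using pd[OF that] p0
    by (auto intro!: continuous_intros continuous_on_compose2[OF contu] shrink_mem_dbox)
  have key: "\<exists>\<delta>>0. \<delta> \<le> \<rho> \<and> (\<forall>h \<tau>. norm h < \<delta> \<longrightarrow> \<tau> \<in> {0..1} \<longrightarrow>
      norm (a h \<tau>) \<le> A * norm h \<and> norm (a h \<tau> - W (shrink \<tau> p0) (shrink \<tau> h)) \<le> 2 * \<epsilon> * (1 + A) * norm h)"
    if \<epsilon>: "\<epsilon> > 0" "\<epsilon> \<le> 1/4" for \<epsilon>
  proof -
    obtain d where d: "d > 0" "\<And>x k. x \<in> Q \<Longrightarrow> norm k < d \<Longrightarrow> x + k \<in> eqdom r V \<and> norm (F (x + k) - F x - fder F x k) \<le> \<epsilon> * norm k"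
      using compact_uniform_differentiability[OF openO F Q \<epsilon>(1)] by metis
    have "continuous_on ({0..1} \<times> cball 0 \<rho>) (\<lambda>(\<tau>, h). a h \<tau>)"
      unfolding a_def split_beta
      by (auto intro!: continuous_intros continuous_on_compose2[OF contu] shrink_mem_dbox pd p0)
    then obtain \<delta>1 where \<delta>1: "\<delta>1 > 0" "\<delta>1 \<le> \<rho>" "\<And>\<tau> h. \<tau> \<in> {0..1} \<Longrightarrow> norm h < \<delta>1 \<Longrightarrow> norm (a h \<tau>) < d/2"
      using small_near_zero_section[of "{0..1::real}" \<rho> "\<lambda>(\<tau>, h). a h \<tau>" "d/2"] \<rho>(1) d(1) by (auto simp: a_def)
    define \<delta> where "\<delta> = min \<delta>1 (d/2)"
    have "norm (a h \<tau>) \<le> A * norm h \<and> norm (a h \<tau> - W (shrink \<tau> p0) (shrink \<tau> h)) \<le> 2 * \<epsilon> * (1 + A) * norm h"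
      if h: "norm h < \<delta>" and \<tau>: "\<tau> \<in> {0..1}" for h \<tau>
    proof -
      have h\<rho>: "norm h \<le> \<rho>" using h \<delta>1(2) by (simp add: \<delta>_def)
      \<comment> \<open>The displacement of the argument of \<open>F\<close> caused by replacing
        \<open>p0\<close> with \<open>p0 + h\<close>.\<close>
      define k where "k \<sigma> \<tau> = (0::real, shrink \<tau> h, a h (\<sigma> * \<tau>))" for \<sigma> \<tau>
      have unit: "\<sigma> * \<tau> \<in> {0..1}" if "\<sigma> \<in> {0..1}" "\<tau> \<in> {0..1}" for \<sigma> \<tau> :: real
        using that by (auto intro: mult_le_one)
      have qQ: "q (\<sigma>, \<tau>) \<in> Q" if "\<sigma> \<in> {0..1}" "\<tau> \<in> {0..1}" for \<sigma> \<tau>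
        using that by (auto simp: Q_def)
      have nk: "norm (k \<sigma> \<tau>) \<le> norm h + norm (a h (\<sigma> * \<tau>))" if "\<sigma> \<in> {0..1}" "\<tau> \<in> {0..1}" for \<sigma> \<tau>
        using norm_shrink_le[OF that(2), of h] sqrt_sum_squares_le_sum_abs[of "norm (shrink \<tau> h)" "norm (a h (\<sigma> * \<tau>))"]
        by (simp add: k_def norm_Pair)
      have nkd: "norm (k \<sigma> \<tau>) < d" if "\<sigma> \<in> {0..1}" "\<tau> \<in> {0..1}" for \<sigma> \<tau>
        using nk[OF that] \<delta>1(3)[OF unit[OF that], of h] h by (simp add: \<delta>_def)
      have qk: "q (\<sigma>, \<tau>) + k \<sigma> \<tau> = (\<sigma>, shrink \<tau> (p0 + h), u (shrink (\<sigma> * \<tau>) (p0 + h)))" for \<sigma> \<tau>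
        by (simp add: q_def k_def a_def shrink_add)
      have rem: "norm (F (q (\<sigma>, \<tau>) + k \<sigma> \<tau>) - F (q (\<sigma>, \<tau>)) - fder F (q (\<sigma>, \<tau>)) (k \<sigma> \<tau>))
          \<le> \<epsilon> * (norm h + norm (a h (\<sigma> * \<tau>)))" if "\<sigma> \<in> {0..1}" "\<tau> \<in> {0..1}" for \<sigma> \<tau>
        using d(2)[OF qQ[OF that] nkd[OF that]] mult_left_mono[OF nk[OF that], of \<epsilon>] \<epsilon>(1) by linarith
      have contq: "norm (fder F (q (\<sigma>, \<tau>)) (0, 0, z)) \<le> 1/2 * norm z" if "\<sigma> \<in> {0..1}" "\<tau> \<in> {0..1}" for \<sigma> \<tau> z
        using contr[OF that(1) shrink_mem_dbox[of p0 r \<tau>], of "u (shrink (\<sigma> * \<tau>) p0)" z] uS[OF p0, of "\<sigma> * \<tau>"] unit[OF that] p0 that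
        by (simp add: q_def)
      have aint: "a h \<tau> = integral {0..1} (\<lambda>\<sigma>. F (q (\<sigma>, \<tau>) + k \<sigma> \<tau>) - F (q (\<sigma>, \<tau>)))" if "\<tau> \<in> {0..1}" for \<tau>
        unfolding qk unfolding a_def eqa[OF pd[OF h\<rho>] that] eqa[OF p0 that] q_def prod.case
        by (intro integral_diff[symmetric] integrable_continuous_real contFI that pd h\<rho> p0)
      have contaI: "continuous_on {0..1} (\<lambda>\<sigma>. F (q (\<sigma>, \<tau>) + k \<sigma> \<tau>) - F (q (\<sigma>, \<tau>)))" if "\<tau> \<in> {0..1}" for \<tau>
        unfolding qk unfolding q_def prod.case
        by (intro continuous_on_diff contFI that pd h\<rho> p0)
      have linq: "linear (fder F (q (\<sigma>, \<tau>)))" if "\<sigma> \<in> {0..1}" "\<tau> \<in> {0..1}" for \<sigma> \<tau>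
        using linF Q(2) qQ[OF that] by blast
      have abound: "norm (a h \<tau>) \<le> A * norm h" if \<tau>: "\<tau> \<in> {0..1}" for \<tau>
      proof -
        \<comment> \<open>Of the factor 3/4, one half is the contraction of \<open>F\<close> in its
          last argument and one quarter absorbs the remainder, as
          \<open>\<epsilon> \<le> 1/4\<close>.\<close>
        have "norm (a h \<tau>) \<le> ((B + 1/4) * norm h) / (1 - 3/4)"
        proof (rule sup_contraction_bound[OF _ _ _ \<tau>])
          show "continuous_on {0..1} (\<lambda>x. norm (a h x))" using conta[OF h\<rho>] by (intro continuous_intros)
          fix \<tau> M :: real assume \<tau>: "\<tau> \<in> {0..1}" and M: "\<And>s. s \<in> {0..1} \<Longrightarrow> norm (a h s) \<le> M"
          show "norm (a h \<tau>) \<le> (B + 1/4) * norm h + 3/4 * M"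
            unfolding aint[OF \<tau>]
          proof (rule norm_integral_unit_le[OF contaI[OF \<tau>]])
            fix \<sigma> :: real assume \<sigma>: "\<sigma> \<in> {0..1}"
            let ?x = "q (\<sigma>, \<tau>)" and ?a = "a h (\<sigma> * \<tau>)"
            have aM: "norm ?a \<le> M" by (rule M[OF unit[OF \<sigma> \<tau>]])
            have "fder F ?x (k \<sigma> \<tau>) = fder F ?x (0, shrink \<tau> h, 0) + fder F ?x (0, 0, ?a)"
              using linear_add[OF linq[OF \<sigma> \<tau>], of "(0, shrink \<tau> h, 0)" "(0, 0, ?a)"] by (simp add: k_def)
            then have "norm (fder F ?x (k \<sigma> \<tau>)) \<le> B * norm (shrink \<tau> h) + 1/2 * norm ?a"
              using B(2)[OF qQ[OF \<sigma> \<tau>], of "shrink \<tau> h"] contq[OF \<sigma> \<tau>, of ?a] norm_triangle_ineq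
              by (smt (verit, ccfv_SIG))
            moreover have "B * norm (shrink \<tau> h) \<le> B * norm h"
              using norm_shrink_le[OF \<tau>] B(1) by (intro mult_left_mono)
            moreover have "\<epsilon> * (norm h + norm ?a) \<le> 1/4 * (norm h + norm ?a)"
              using \<epsilon>(2) by (intro mult_right_mono) auto
            ultimately show "norm (F (?x + k \<sigma> \<tau>) - F ?x) \<le> (B + 1/4) * norm h + 3/4 * M"
              using rem[OF \<sigma> \<tau>] aM norm_triangle_ineq[of "F (?x + k \<sigma> \<tau>) - F ?x - fder F ?x (k \<sigma> \<tau>)" "fder F ?x (k \<sigma> \<tau>)"]
              by (simp add: algebra_simps)
          qed
        qed simp
        also have "\<dots> \<le> A * norm h" by (simp add: A_def algebra_simps)
        finally show ?thesis .
      qed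
      define R where "R \<tau> = a h \<tau> - W (shrink \<tau> p0) (shrink \<tau> h)" for \<tau>
      have contR: "continuous_on {0..1} R"
        unfolding R_def[abs_def]
        by (rule continuous_on_diff[OF conta[OF h\<rho>] continuous_on_apply_linear[where L="\<lambda>\<tau>. W (shrink \<tau> p0)"
            and g="\<lambda>\<tau>. shrink \<tau> h", OF linW]])
          (auto intro!: continuous_intros continuous_on_compose2[OF contW] shrink_mem_dbox p0)
      \<comment> \<open>By \<open>abound\<close> the remainder of \<open>F\<close> is at most
        \<open>\<epsilon> * (1 + A) * norm h\<close>; the linear part acts on \<open>R\<close>
        itself with factor 1/2.\<close>
      have "norm (R \<tau>) \<le> (\<epsilon> * (1 + A) * norm h) / (1 - 1/2)"
      proof (rule sup_contraction_bound[OF _ _ _ \<tau>])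
        show "continuous_on {0..1} (\<lambda>x. norm (R x))" using contR by (intro continuous_intros)
        fix \<tau> M :: real assume \<tau>: "\<tau> \<in> {0..1}" and M: "\<And>s. s \<in> {0..1} \<Longrightarrow> norm (R s) \<le> M"
        let ?w = "\<lambda>\<sigma>. fder F (q (\<sigma>, \<tau>)) (0, shrink \<tau> h, W (shrink (\<sigma> * \<tau>) p0) (shrink (\<sigma> * \<tau>) h))"
        have pt: "shrink \<tau> p0 \<in> dbox r" using shrink_mem_dbox[OF p0] \<tau> by auto
        have cw: "continuous_on {0..1} ?w"
          using contI[OF pt, of "shrink \<tau> h"] by (simp add: q_def shrink_shrink)
        have Wi: "W (shrink \<tau> p0) (shrink \<tau> h) = integral {0..1} ?w"
          using W[OF pt, of "shrink \<tau> h"] by (simp add: q_def shrink_shrink)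
        have "R \<tau> = integral {0..1} (\<lambda>\<sigma>. F (q (\<sigma>, \<tau>) + k \<sigma> \<tau>) - F (q (\<sigma>, \<tau>)) - ?w \<sigma>)"
          unfolding R_def Wi aint[OF \<tau>]
          by (intro integral_diff[symmetric] integrable_continuous_real contaI \<tau> cw)
        also have "norm \<dots> \<le> \<epsilon> * (1 + A) * norm h + 1/2 * M"
        proof (rule norm_integral_unit_le[OF continuous_on_diff[OF contaI[OF \<tau>] cw]])
          fix \<sigma> :: real assume \<sigma>: "\<sigma> \<in> {0..1}"
          let ?x = "q (\<sigma>, \<tau>)"
          have "fder F ?x (k \<sigma> \<tau>) - ?w \<sigma> = fder F ?x (0, 0, R (\<sigma> * \<tau>))"
            unfolding linear_diff[OF linq[OF \<sigma> \<tau>], symmetric] by (simp add: k_def R_def)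
          then have "F (?x + k \<sigma> \<tau>) - F ?x - ?w \<sigma>
              = (F (?x + k \<sigma> \<tau>) - F ?x - fder F ?x (k \<sigma> \<tau>)) + fder F ?x (0, 0, R (\<sigma> * \<tau>))"
            by (simp flip: \<open>fder F ?x (k \<sigma> \<tau>) - ?w \<sigma> = fder F ?x (0, 0, R (\<sigma> * \<tau>))\<close>)
          then have "norm (F (?x + k \<sigma> \<tau>) - F ?x - ?w \<sigma>)
              \<le> norm (F (?x + k \<sigma> \<tau>) - F ?x - fder F ?x (k \<sigma> \<tau>)) + norm (fder F ?x (0, 0, R (\<sigma> * \<tau>)))"
            by (simp only: norm_triangle_ineq)
          moreover have "norm (fder F ?x (0, 0, R (\<sigma> * \<tau>))) \<le> 1/2 * M"
            using contq[OF \<sigma> \<tau>, of "R (\<sigma> * \<tau>)"] M[OF unit[OF \<sigma> \<tau>]] by simp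
          moreover have "\<epsilon> * (norm h + norm (a h (\<sigma> * \<tau>))) \<le> \<epsilon> * ((1 + A) * norm h)"
            using abound[OF unit[OF \<sigma> \<tau>]] \<epsilon>(1) by (intro mult_left_mono) (auto simp: algebra_simps)
          ultimately show "norm (F (?x + k \<sigma> \<tau>) - F ?x - ?w \<sigma>) \<le> \<epsilon> * (1 + A) * norm h + 1/2 * M"
            using rem[OF \<sigma> \<tau>] unfolding mult.assoc by linarith
        qed
        finally show "norm (R \<tau>) \<le> \<epsilon> * (1 + A) * norm h + 1/2 * M" .
      qed simp
      then show ?thesis using abound[OF \<tau>] by (simp add: R_def)
    qed
    moreover have "\<delta> > 0" "\<delta> \<le> \<rho>" using \<delta>1 d(1) by (auto simp: \<delta>_def)
    ultimately show ?thesis by blast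
  qed
  show ?thesis
    unfolding has_derivative_at_alt
  proof (intro conjI allI impI)
    show "bounded_linear (W p0)" using linW by (simp add: linear_conv_bounded_linear)
    fix e :: real assume "e > 0"
    have A: "A \<ge> 0" using B(1) by (simp add: A_def)
    \<comment> \<open>Solves \<open>2 * \<epsilon> * (1 + A) \<le> e\<close>, the bound delivered by
      \<open>key\<close>, subject to its restriction \<open>\<epsilon> \<le> 1/4\<close>.\<close>
    define \<epsilon> where "\<epsilon> = min (1/4) (e / (2 * (1 + A)))"
    have \<epsilon>: "\<epsilon> > 0" "\<epsilon> \<le> 1/4"
      using \<open>e > 0\<close> A unfolding \<epsilon>_def by (simp_all only: min.cobounded1, simp)
    have "\<epsilon> \<le> e / (2 * (1 + A))" by (simp add: \<epsilon>_def)
    then have \<epsilon>e: "2 * \<epsilon> * (1 + A) \<le> e" using A by (simp add: pos_le_divide_eq algebra_simps)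
    obtain \<delta> where \<delta>: "\<delta> > 0" "\<And>h. norm h < \<delta> \<Longrightarrow>
       norm (a h 1 - W (shrink 1 p0) (shrink 1 h)) \<le> 2 * \<epsilon> * (1 + A) * norm h"
      using key[OF \<epsilon>] by (meson atLeastAtMost_iff order_refl zero_le_one)
    show "\<exists>d>0. \<forall>y. norm (y - p0) < d \<longrightarrow> norm (u y - u p0 - W p0 (y - p0)) \<le> e * norm (y - p0)"
    proof (intro exI[of _ \<delta>] conjI allI impI \<delta>(1))
      fix y assume "norm (y - p0) < \<delta>"
      from \<delta>(2)[OF this] have "norm (u y - u p0 - W p0 (y - p0)) \<le> 2 * \<epsilon> * (1 + A) * norm (y - p0)"
        by (simp add: a_def)
      also have "\<dots> \<le> e * norm (y - p0)" by (rule mult_right_mono[OF \<epsilon>e]) simp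
      finally show "norm (u y - u p0 - W p0 (y - p0)) \<le> e * norm (y - p0)" .
    qed
  qed
qed

lemma fder_partial_le_of_lipschitz:
  fixes F :: "real \<times> ('k::euclidean_space \<times> 'm::euclidean_space) \<times> 'n::euclidean_space \<Rightarrow> 'n"
  assumes "open V" "F differentiable (at (\<sigma>, p, z))" "z \<in> V"
    and lip: "\<And>z'. z' \<in> V \<Longrightarrow> norm (F (\<sigma>, p, z') - F (\<sigma>, p, z)) \<le> L * norm (z' - z)"
  shows "norm (fder F (\<sigma>, p, z) (0, 0, w)) \<le> L * norm w"
proof -
  have "norm (fder F (\<sigma>, p, z) (0, 0, w)) \<le> L * norm (0::real, 0::'k \<times> 'm, w)"
  proof (rule lipschitz_derivative_bound[OF fder_works[OF assms(2)], where S="UNIV \<times> UNIV \<times> V"])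
    fix t :: real
    assume "(\<sigma>, p, z) + t *\<^sub>R (0, 0, w) \<in> UNIV \<times> UNIV \<times> V"
    then show "norm (F ((\<sigma>, p, z) + t *\<^sub>R (0, 0, w)) - F (\<sigma>, p, z)) \<le> L * norm (t *\<^sub>R (0::real, 0::'k \<times> 'm, w))"
      using lip[of "z + t *\<^sub>R w"] by (simp add: norm_Pair)
  qed (use assms in \<open>auto intro!: open_Times\<close>)
  then show ?thesis by (simp add: norm_Pair)
qed

lemma Ck_on_le: "Ck_on k S f \<Longrightarrow> j \<le> k \<Longrightarrow> Ck_on j S f"
  by (induction k) (auto simp: le_Suc_eq simp del: Ck_on.simps intro: Ck_on_SucD)

text \<open>The directional derivatives of a solution solve an equation of the same form, which is as
  smooth as the solution is known to be; this drives the induction on \<open>k\<close>.\<close>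

theorem Ck_on_integral_equation_solution:
  fixes F :: "real \<times> ('k::euclidean_space \<times> 'm::euclidean_space) \<times> 'n::euclidean_space \<Rightarrow> 'n"
  assumes "open V" "Ck_on k (eqdom r V) F"
    and "\<And>\<sigma> p z z'. \<lbrakk>\<sigma> \<in> {0..1}; p \<in> dbox r; z \<in> V; z' \<in> V\<rbrakk> \<Longrightarrow> norm (F (\<sigma>, p, z) - F (\<sigma>, p, z')) \<le> 1/2 * norm (z - z')"
    and "continuous_on (dbox r) u" "u ` dbox r \<subseteq> V"
    and "\<And>p. p \<in> dbox r \<Longrightarrow> u p = integral {0..1} (\<lambda>\<sigma>. F (\<sigma>, p, u (shrink \<sigma> p)))"
  shows "Ck_on k (dbox r) u"
  using assms
proof (induction k arbitrary: V F u)
  case 0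
  then show ?case by simp
next
  case (Suc k)
  note V = Suc.prems(1) and F = Suc.prems(2) and lip = Suc.prems(3) and contu = Suc.prems(4)
    and uV = Suc.prems(5) and u = Suc.prems(6)
  have F1: "Ck_on (Suc 0) (eqdom r V) F" by (rule Ck_on_le[OF F]) simp
  have uk: "Ck_on k (dbox r) u"
    by (rule Suc.IH[OF V Ck_on_SucD[OF F] lip contu uV u])
  have linF: "linear (fder F q)" if "q \<in> eqdom r V" for q
    using F that by (intro linear_fder) auto
  have contr: "norm (fder F (\<sigma>, p, z) (0, 0, w)) \<le> 1/2 * norm w"
    if "\<sigma> \<in> {0..1}" "p \<in> dbox r" "z \<in> V" for \<sigma> p z w
  proof (rule fder_partial_le_of_lipschitz[OF V])
    show "F differentiable at (\<sigma>, p, z)"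
    proof -
      have "(\<sigma>, p, z) \<in> eqdom r V" using that shrink_mem_dbox[of p r \<sigma>] by (simp add: eqdom_def)
      then show ?thesis using F unfolding Ck_on.simps by blast
    qed
  qed (use that lip in auto)
  have "\<exists>W. (\<forall>p. linear (W p)) \<and> (\<forall>v. continuous_on (dbox r) (\<lambda>p. W p v)) \<and>
    (\<forall>p\<in>dbox r. \<forall>v. W p v = integral {0..1} (\<lambda>\<sigma>. fder F (\<sigma>, p, u (shrink \<sigma> p)) (0, v, W (shrink \<sigma> p) (shrink \<sigma> v)))) \<and>
    (\<forall>p\<in>dbox r. \<forall>v. continuous_on {0..1} (\<lambda>\<sigma>. fder F (\<sigma>, p, u (shrink \<sigma> p)) (0, v, W (shrink \<sigma> p) (shrink \<sigma> v))))"
    by (rule integral_equation_linearised[OF V F1 contr contu uV])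
  then obtain W where *: "\<forall>p. linear (W p)" "\<forall>v. continuous_on (dbox r) (\<lambda>p. W p v)"
    "\<forall>p\<in>dbox r. \<forall>v. W p v = integral {0..1} (\<lambda>\<sigma>. fder F (\<sigma>, p, u (shrink \<sigma> p)) (0, v, W (shrink \<sigma> p) (shrink \<sigma> v)))"
    "\<forall>p\<in>dbox r. \<forall>v. continuous_on {0..1} (\<lambda>\<sigma>. fder F (\<sigma>, p, u (shrink \<sigma> p)) (0, v, W (shrink \<sigma> p) (shrink \<sigma> v)))"
    by (elim exE conjE) (rule that, assumption+)
  note linW = *(1)[rule_format] and contW = *(2)[rule_format] and W = *(3)[rule_format] and contI = *(4)[rule_format]
  have Wb: "Ck_on k (dbox r) (\<lambda>p. W p b)" if b: "b \<in> Basis" for b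
  proof -
    define q where "q = (\<lambda>(\<sigma>, p, z :: 'n). (\<sigma>, p, u (shrink \<sigma> p)))"
    \<comment> \<open>The unknown is now the directional derivative \<open>z\<close>, in which
      \<open>G\<close> is linear; \<open>u\<close> enters only as a known coefficient. So
      \<open>G\<close> is as regular as \<open>uk\<close> makes \<open>u\<close>, and no restriction
      on \<open>z\<close> remains.\<close>
    define G where "G = (\<lambda>x :: real \<times> ('k \<times> 'm) \<times> 'n. fder F (q x) (0, b, basis_factor b (fst x) *\<^sub>R snd (snd x)))"
    let ?E = "eqdom r UNIV :: (real \<times> ('k \<times> 'm) \<times> 'n) set"
    have oE: "open ?E" by (rule open_eqdom) simp
    have qE: "q ` ?E \<subseteq> eqdom r V" using uV by (auto simp: q_def eqdom_def)
    have p1: "Ck_on k ?E fst" by (rule Ck_on_linear_image[OF bounded_linear_fst oE Ck_on_ident[OF oE]])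
    have p2: "Ck_on k ?E (\<lambda>x. fst (snd x))"
      by (rule Ck_on_linear_image[OF bounded_linear_compose[OF bounded_linear_fst bounded_linear_snd] oE Ck_on_ident[OF oE]])
    have p3: "Ck_on k ?E (\<lambda>x. snd (snd x))"
      by (rule Ck_on_linear_image[OF bounded_linear_compose[OF bounded_linear_snd bounded_linear_snd] oE Ck_on_ident[OF oE]])
    have sh: "Ck_on k ?E (\<lambda>x. shrink (fst x) (fst (snd x)))"
      unfolding shrink_def
      by (intro Ck_on_Pair[OF oE] Ck_on_scaleR[OF oE] p1 Ck_on_linear_image[OF bounded_linear_fst oE p2]
          Ck_on_linear_image[OF bounded_linear_snd oE p2])
    have ush: "Ck_on k ?E (\<lambda>x. u (shrink (fst x) (fst (snd x))))"
      by (rule Ck_on_compose[OF oE sh uk]) (auto simp: eqdom_def)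
    have qk: "Ck_on k ?E q"
      unfolding q_def split_beta by (intro Ck_on_Pair[OF oE] p1 p2 ush)
    have Gk: "Ck_on k ?E G"
      unfolding G_def
    proof (rule Ck_on_apply_linear[where L="\<lambda>x. fder F (q x)" and g="\<lambda>x. (0, b, basis_factor b (fst x) *\<^sub>R snd (snd x))", OF oE])
      show "linear (fder F (q y))" if "y \<in> ?E" for y using linF qE that by blast
      show "Ck_on k ?E (\<lambda>y. fder F (q y) v)" for v
        by (rule Ck_on_compose[OF oE qk Ck_on_Suc_fder[OF F] qE])
      have "Ck_on k ?E (\<lambda>y. basis_factor b (fst y))"
        by (cases "snd b = 0") (simp_all add: basis_factor_def p1 Ck_on_const)
      then show "Ck_on k ?E (\<lambda>y. (0, b, basis_factor b (fst y) *\<^sub>R snd (snd y)))"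
        by (intro Ck_on_Pair[OF oE] Ck_on_const Ck_on_scaleR[OF oE] p3)
    qed
    show ?thesis
    proof (rule Suc.IH[OF open_UNIV Gk])
      fix \<sigma> :: real and p :: "'k \<times> 'm" and z z' :: 'n
      assume *: "\<sigma> \<in> {0..1}" "p \<in> dbox r"
      then have s: "shrink \<sigma> p \<in> dbox r" by (intro shrink_mem_dbox) auto
      then have m: "(\<sigma>, p, u (shrink \<sigma> p)) \<in> eqdom r V" using uV * by (auto simp: eqdom_def)
      have "G (\<sigma>, p, z) - G (\<sigma>, p, z') = fder F (\<sigma>, p, u (shrink \<sigma> p)) (0, 0, basis_factor b \<sigma> *\<^sub>R (z - z'))"
        unfolding G_def q_def by (simp add: linear_diff[OF linF[OF m], symmetric] scaleR_diff_right)
      also have "norm \<dots> \<le> 1/2 * norm (basis_factor b \<sigma> *\<^sub>R (z - z'))"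
        using s uV * by (intro contr) auto
      also have "\<dots> \<le> 1/2 * norm (z - z')"
        using * by (auto simp: basis_factor_def mult_left_le_one_le)
      finally show "norm (G (\<sigma>, p, z) - G (\<sigma>, p, z')) \<le> 1/2 * norm (z - z')" .
    next
      fix p :: "'k \<times> 'm" assume "p \<in> dbox r"
      moreover have "W q (shrink \<sigma> b) = basis_factor b \<sigma> *\<^sub>R W q b" for q \<sigma>
        by (simp add: shrink_Basis[OF b] linear_cmul[OF linW] basis_factor_def)
      ultimately show "W p b = integral {0..1} (\<lambda>\<sigma>. G (\<sigma>, p, W (shrink \<sigma> p) b))"
        using W[of p b] by (simp add: G_def q_def)
    qed (use contW in auto)
  qed
  show ?case
  proof (rule Ck_on_SucI[OF open_dbox])
    show "(u has_derivative W p) (at p)" if "p \<in> dbox r" for p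
      by (rule integral_equation_solution_has_derivative[OF V F1 contr contu uV u linW contW W contI that])
    show "Ck_on k (dbox r) (\<lambda>p. W p v)" for v
      by (subst linear_basis_expansion[OF linW])
        (intro Ck_on_sum[OF open_dbox] Ck_on_scaleR[OF open_dbox] Ck_on_const Wb)
  qed
qed

text \<open>Restates the linearised equation with \<open>fder u\<close> in place of the auxiliary
  solution, for the comparison in the proof of Frobenius' theorem.\<close>

lemma integral_equation_solution_fder:
  fixes F :: "real \<times> ('k::euclidean_space \<times> 'm::euclidean_space) \<times> 'n::euclidean_space \<Rightarrow> 'n"
  assumes V: "open V" and F: "Ck_on (Suc 0) (eqdom r V) F"
    and lip: "\<And>\<sigma> p z z'. \<lbrakk>\<sigma> \<in> {0..1}; p \<in> dbox r; z \<in> V; z' \<in> V\<rbrakk> \<Longrightarrow> norm (F (\<sigma>, p, z) - F (\<sigma>, p, z')) \<le> 1/2 * norm (z - z')"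
    and contu: "continuous_on (dbox r) u" and uV: "u ` dbox r \<subseteq> V"
    and u: "\<And>p. p \<in> dbox r \<Longrightarrow> u p = integral {0..1} (\<lambda>\<sigma>. F (\<sigma>, p, u (shrink \<sigma> p)))"
    and p: "p \<in> dbox r"
  shows "fder u p v = integral {0..1} (\<lambda>\<sigma>. fder F (\<sigma>, p, u (shrink \<sigma> p)) (0, v, fder u (shrink \<sigma> p) (shrink \<sigma> v)))"
    and "continuous_on {0..1} (\<lambda>\<sigma>. fder F (\<sigma>, p, u (shrink \<sigma> p)) (0, v, fder u (shrink \<sigma> p) (shrink \<sigma> v)))"
proof -
  have contr: "norm (fder F (\<sigma>, p, z) (0, 0, w)) \<le> 1/2 * norm w"
    if "\<sigma> \<in> {0..1}" "p \<in> dbox r" "z \<in> V" for \<sigma> p z w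
  proof (rule fder_partial_le_of_lipschitz[OF V])
    show "F differentiable at (\<sigma>, p, z)"
    proof -
      have "(\<sigma>, p, z) \<in> eqdom r V" using that shrink_mem_dbox[of p r \<sigma>] by (simp add: eqdom_def)
      then show ?thesis using F unfolding Ck_on.simps by blast
    qed
  qed (use that lip in auto)
  have "\<exists>W. (\<forall>p. linear (W p)) \<and> (\<forall>v. continuous_on (dbox r) (\<lambda>p. W p v)) \<and>
    (\<forall>p\<in>dbox r. \<forall>v. W p v = integral {0..1} (\<lambda>\<sigma>. fder F (\<sigma>, p, u (shrink \<sigma> p)) (0, v, W (shrink \<sigma> p) (shrink \<sigma> v)))) \<and>
    (\<forall>p\<in>dbox r. \<forall>v. continuous_on {0..1} (\<lambda>\<sigma>. fder F (\<sigma>, p, u (shrink \<sigma> p)) (0, v, W (shrink \<sigma> p) (shrink \<sigma> v))))"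
    by (rule integral_equation_linearised[OF V F contr contu uV])
  then obtain W where *: "\<forall>p. linear (W p)" "\<forall>v. continuous_on (dbox r) (\<lambda>p. W p v)"
    "\<forall>p\<in>dbox r. \<forall>v. W p v = integral {0..1} (\<lambda>\<sigma>. fder F (\<sigma>, p, u (shrink \<sigma> p)) (0, v, W (shrink \<sigma> p) (shrink \<sigma> v)))"
    "\<forall>p\<in>dbox r. \<forall>v. continuous_on {0..1} (\<lambda>\<sigma>. fder F (\<sigma>, p, u (shrink \<sigma> p)) (0, v, W (shrink \<sigma> p) (shrink \<sigma> v)))"
    by (elim exE conjE) (rule that, assumption+)
  note linW = *(1)[rule_format] and contW = *(2)[rule_format] and W = *(3)[rule_format] and contI = *(4)[rule_format]
  have "(u has_derivative W q) (at q)" if "q \<in> dbox r" for q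
    by (rule integral_equation_solution_has_derivative[OF V F contr contu uV u linW contW W contI that])
  then have eq: "fder u q = W q" if "q \<in> dbox r" for q using that by (simp add: fder_eq)
  have s: "shrink \<sigma> p \<in> dbox r" if "\<sigma> \<in> {0..1}" for \<sigma>
    using that by (intro shrink_mem_dbox p) auto
  show "continuous_on {0..1} (\<lambda>\<sigma>. fder F (\<sigma>, p, u (shrink \<sigma> p)) (0, v, fder u (shrink \<sigma> p) (shrink \<sigma> v)))"
    by (rule continuous_on_eq[OF contI[OF p, of v]]) (simp add: eq[OF s])
  show "fder u p v = integral {0..1} (\<lambda>\<sigma>. fder F (\<sigma>, p, u (shrink \<sigma> p)) (0, v, fder u (shrink \<sigma> p) (shrink \<sigma> v)))"
    unfolding eq[OF p] W[OF p, of v] by (rule integral_cong) (simp add: eq[OF s])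
qed

section \<open>The Frobenius theorem\<close>

lemma linear_family_bounded_lipschitz:
  fixes f :: "'a::euclidean_space \<Rightarrow> 'k::euclidean_space \<Rightarrow> 'b::euclidean_space"
  assumes "open S" "compact K" "convex K" "K \<subseteq> S" and lin: "\<And>q. q \<in> S \<Longrightarrow> linear (f q)"
    and smooth: "\<And>h. smooth_on S (\<lambda>q. f q h)"
  obtains C where "C \<ge> 0" "\<And>q h. q \<in> K \<Longrightarrow> norm (f q h) \<le> C * norm h"
    "\<And>q q' h. q \<in> K \<Longrightarrow> q' \<in> K \<Longrightarrow> norm (f q h - f q' h) \<le> C * norm h * norm (q - q')"
proof -
  have c1: "continuous_on K (\<lambda>q. \<Sum>b\<in>Basis. norm (f q b))"
    by (intro continuous_intros continuous_on_subset[OF smooth_on_imp_continuous_on[OF smooth] assms(4)])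
  obtain C1 where C1: "C1 \<ge> 0" "\<And>q. q \<in> K \<Longrightarrow> norm (\<Sum>b\<in>Basis. norm (f q b)) \<le> C1"
    using continuous_on_compact_bound[OF assms(2) c1] by metis
  have c2: "continuous_on K (\<lambda>q. \<Sum>c\<in>Basis. norm (fder (\<lambda>q. f q b) q c))" for b
    by (intro continuous_intros continuous_on_subset[OF smooth_on_imp_continuous_on[OF smooth_on_fder_const[OF smooth]] assms(4)])
  have "\<exists>B. B \<ge> 0 \<and> (\<forall>q\<in>K. norm (\<Sum>c\<in>Basis. norm (fder (\<lambda>q. f q b) q c)) \<le> B)" for b
    using continuous_on_compact_bound[OF assms(2) c2[of b]] by metis
  then obtain B where B: "\<And>b. B b \<ge> 0" "\<And>b q. q \<in> K \<Longrightarrow> norm (\<Sum>c\<in>Basis. norm (fder (\<lambda>q. f q b) q c)) \<le> B b"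
    by metis
  have lipb: "norm (f q b - f q' b) \<le> B b * norm (q - q')" if "q \<in> K" "q' \<in> K" for q q' b
  proof (rule differentiable_bound[OF assms(3) _ _ that])
    fix x assume x: "x \<in> K"
    then have xS: "x \<in> S" using assms(4) by auto
    show "((\<lambda>q. f q b) has_derivative fder (\<lambda>q. f q b) x) (at x within K)"
      by (rule has_derivative_at_withinI[OF smooth_on_has_derivative[OF smooth xS]])
    show "onorm (fder (\<lambda>q. f q b) x) \<le> B b"
    proof (rule onorm_le)
      fix v
      have "norm (fder (\<lambda>q. f q b) x v) \<le> (\<Sum>c\<in>Basis. norm (fder (\<lambda>q. f q b) x c)) * norm v"
        by (rule linear_norm_le_sum_Basis[OF smooth_on_linear_fder[OF smooth xS]])
      also have "\<dots> \<le> B b * norm v" using B(2)[OF x, of b] by (intro mult_right_mono) auto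
      finally show "norm (fder (\<lambda>q. f q b) x v) \<le> B b * norm v" .
    qed
  qed
  define C2 where "C2 = (\<Sum>b\<in>(Basis::'k set). B b)"
  have "C2 \<ge> 0" unfolding C2_def by (intro sum_nonneg B)
  have lip: "norm (f q h - f q' h) \<le> C2 * norm h * norm (q - q')" if q: "q \<in> K" "q' \<in> K" for q q' h
  proof -
    have l: "linear (\<lambda>h. f q h - f q' h)" using lin q assms(4) by (intro linear_compose_sub) auto
    have "norm (f q h - f q' h) \<le> (\<Sum>b\<in>Basis. norm (f q b - f q' b)) * norm h"
      by (rule linear_norm_le_sum_Basis[OF l])
    also have "\<dots> \<le> (\<Sum>b\<in>Basis. B b * norm (q - q')) * norm h"
      by (intro mult_right_mono sum_mono lipb q) auto
    also have "\<dots> = C2 * norm h * norm (q - q')" by (simp add: C2_def sum_distrib_right mult.commute mult.left_commute)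
    finally show ?thesis .
  qed
  show ?thesis
  proof (rule that[of "max C1 C2"])
    fix q h assume q: "q \<in> K"
    have "norm (f q h) \<le> (\<Sum>b\<in>Basis. norm (f q b)) * norm h"
      using lin q assms(4) by (intro linear_norm_le_sum_Basis) auto
    also have "\<dots> \<le> max C1 C2 * norm h" using C1(2)[OF q] by (intro mult_right_mono) auto
    finally show "norm (f q h) \<le> max C1 C2 * norm h" .
  next
    fix q q' :: 'a and h :: 'k assume q: "q \<in> K" "q' \<in> K"
    have "C2 * norm h * norm (q - q') \<le> max C1 C2 * norm h * norm (q - q')"
      by (intro mult_right_mono) auto
    with lip[OF q, of h] show "norm (f q h - f q' h) \<le> max C1 C2 * norm h * norm (q - q')" by linarith
  qed (use C1 in auto)
qed

text \<open>Product rule for the evaluation of a family of linear maps; in the first summand the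
  vector is frozen at \<open>c y\<close>.\<close>

lemma apply_linear_has_derivative:
  fixes f :: "'a::euclidean_space \<Rightarrow> 'k::euclidean_space \<Rightarrow> 'b::euclidean_space"
    and a :: "'y::real_normed_vector \<Rightarrow> 'a"
  assumes "open S" and lin: "\<And>q. q \<in> S \<Longrightarrow> linear (f q)" and smooth: "\<And>h. smooth_on S (\<lambda>q. f q h)"
    and a: "(a has_derivative a') (at y)" and c: "(c has_derivative c') (at y)" and "a y \<in> S"
  shows "((\<lambda>y. f (a y) (c y)) has_derivative (\<lambda>d. fder (\<lambda>q. f q (c y)) (a y) (a' d) + f (a y) (c' d))) (at y)"
proof -
  have der: "((\<lambda>q. f q b) has_derivative fder (\<lambda>q. f q b) (a y)) (at (a y))" for b
    by (rule smooth_on_has_derivative[OF smooth \<open>a y \<in> S\<close>])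
  have "((\<lambda>q. \<Sum>b\<in>Basis. (c y \<bullet> b) *\<^sub>R f q b) has_derivative (\<lambda>d. \<Sum>b\<in>Basis. (c y \<bullet> b) *\<^sub>R fder (\<lambda>q. f q b) (a y) d)) (at (a y))"
    by (intro has_derivative_sum has_derivative_scaleR_right der)
  then have "((\<lambda>q. f q (c y)) has_derivative (\<lambda>d. \<Sum>b\<in>Basis. (c y \<bullet> b) *\<^sub>R fder (\<lambda>q. f q b) (a y) d)) (at (a y))"
    by (subst has_derivative_cong_open[OF \<open>open S\<close> \<open>a y \<in> S\<close>]) (auto simp: linear_basis_expansion[OF lin, symmetric])
  then have eq: "fder (\<lambda>q. f q (c y)) (a y) = (\<lambda>d. \<Sum>b\<in>Basis. (c y \<bullet> b) *\<^sub>R fder (\<lambda>q. f q b) (a y) d)"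
    by (rule fder_eq)
  have "isCont a y" using a by (rule has_derivative_continuous)
  then obtain N where N: "open N" "y \<in> N" "\<And>z. z \<in> N \<Longrightarrow> a z \<in> S"
    using \<open>open S\<close> \<open>a y \<in> S\<close> unfolding continuous_at_open by metis
  have "((\<lambda>z. \<Sum>b\<in>Basis. (c z \<bullet> b) *\<^sub>R f (a z) b) has_derivative
      (\<lambda>d. \<Sum>b\<in>Basis. (c y \<bullet> b) *\<^sub>R fder (\<lambda>q. f q b) (a y) (a' d) + (c' d \<bullet> b) *\<^sub>R f (a y) b)) (at y)"
    by (intro has_derivative_sum has_derivative_scaleR has_derivative_inner_left c has_derivative_compose[OF a der])
  then have "((\<lambda>z. f (a z) (c z)) has_derivative
      (\<lambda>d. \<Sum>b\<in>Basis. (c y \<bullet> b) *\<^sub>R fder (\<lambda>q. f q b) (a y) (a' d) + (c' d \<bullet> b) *\<^sub>R f (a y) b)) (at y)"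
    by (subst has_derivative_cong_open[OF N(1,2)]) (auto simp: linear_basis_expansion[OF lin, symmetric] N)
  then show ?thesis
    by (rule has_derivative_eq_rhs) (simp add: eq sum.distrib linear_basis_expansion[OF lin[OF \<open>a y \<in> S\<close>], symmetric])
qed

text \<open>The fundamental theorem on the interval from 0 to \<open>\<tau>\<close>, rescaled to the
  unit interval over which all the integral equations are written.\<close>

lemma unit_interval_FTC:
  fixes G :: "real \<Rightarrow> 'a::banach"
  assumes "\<And>s. s \<in> {0..1} \<Longrightarrow> (G has_vector_derivative g s) (at s within {0..1})" "\<tau> \<in> {0..1}"
  shows "((\<lambda>\<sigma>. \<tau> *\<^sub>R g (\<sigma> * \<tau>)) has_integral (G \<tau> - G 0)) {0..1}"
proof -
  have "((\<lambda>\<sigma>. \<tau> *\<^sub>R g (\<sigma> * \<tau>)) has_integral ((G \<circ> (\<lambda>\<sigma>. \<sigma> * \<tau>)) 1 - (G \<circ> (\<lambda>\<sigma>. \<sigma> * \<tau>)) 0)) {0..1}"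
  proof (rule fundamental_theorem_of_calculus)
    fix s :: real assume s: "s \<in> {0..1}"
    show "((G \<circ> (\<lambda>\<sigma>. \<sigma> * \<tau>)) has_vector_derivative \<tau> *\<^sub>R g (s * \<tau>)) (at s within {0..1})"
    proof (rule vector_diff_chain_within)
      show "((\<lambda>\<sigma>. \<sigma> * \<tau>) has_vector_derivative \<tau>) (at s within {0..1})"
        by (auto intro!: derivative_eq_intros)
      have "s * \<tau> \<in> {0..1}" using s assms(2) by (auto intro: mult_le_one)
      from assms(1)[OF this]
      show "(G has_vector_derivative g (s * \<tau>)) (at (s * \<tau>) within (\<lambda>\<sigma>. \<sigma> * \<tau>) ` {0..1})"
        by (rule has_vector_derivative_within_subset) (use assms(2) in \<open>auto intro: mult_le_one\<close>)
    qed
  qed simp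
  then show ?thesis by simp
qed

text \<open>The integral manifold through \<open>(0, y)\<close> is the graph of \<open>x \<mapsto> y + u (x, y)\<close>, obtained by
  integrating along the rays from the origin of the \<open>x\<close> space.\<close>

lemma radial_solution:
  fixes f :: "'k::euclidean_space \<times> 'm::euclidean_space \<Rightarrow> 'k \<Rightarrow> 'm"
  assumes S: "open S" "(0, 0) \<in> S" and lin: "\<And>q. q \<in> S \<Longrightarrow> linear (f q)"
    and smooth: "\<And>h. smooth_on S (\<lambda>q. f q h)"
    and compat: "\<And>q h k. q \<in> S \<Longrightarrow> fder (\<lambda>q. f q h) q (k, f q k) = fder (\<lambda>q. f q k) q (h, f q h)"
  obtains r u where "r > 0" "smooth_on (dbox r) (u :: 'k \<times> 'm \<Rightarrow> 'm)"
    "\<And>x y. (x, y) \<in> dbox r \<Longrightarrow> (x, y + u (x, y)) \<in> S"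
    "\<And>x y h. (x, y) \<in> dbox r \<Longrightarrow> fder u (x, y) (h, 0) = f (x, y + u (x, y)) h"
    "\<And>y. (0::'k, y) \<in> dbox r \<Longrightarrow> u (0, y) = 0"
    "\<And>k. fder u (0, 0) (0, k) = 0"
proof -
  obtain e where e: "e > 0" "cball (0, 0) e \<subseteq> S" using S open_contains_cball by blast
  define \<rho> where "\<rho> = e / 2"
  define K where "K = (cball 0 \<rho> \<times> cball 0 \<rho> :: ('k \<times> 'm) set)"
  have \<rho>: "\<rho> > 0" using e by (simp add: \<rho>_def)
  have KS: "K \<subseteq> S"
  proof
    fix q assume "q \<in> K"
    then have "norm q \<le> e"
      using norm_Pair_le[of "fst q" "snd q"] by (auto simp: K_def \<rho>_def)
    then show "q \<in> S" using e(2) by (cases q) (auto simp: dist_norm subset_iff zero_prod_def[symmetric])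
  qed
  have K: "compact K" "convex K" by (auto simp: K_def intro!: compact_Times convex_Times)
  obtain C where C: "C \<ge> 0" "\<And>q h. q \<in> K \<Longrightarrow> norm (f q h) \<le> C * norm h"
    "\<And>q q' h. q \<in> K \<Longrightarrow> q' \<in> K \<Longrightarrow> norm (f q h - f q' h) \<le> C * norm h * norm (q - q')"
    using linear_family_bounded_lipschitz[OF S(1) K KS lin smooth] by metis
  \<comment> \<open>The three terms serve three purposes: arguments of \<open>f\<close> stay in
    \<open>K\<close>, integrals have norm at most \<open>\<rho> / 4\<close>, and the Lipschitz
    constant is 1/2. Using \<open>C + 1\<close> avoids division by zero.\<close>
  define r where "r = min (\<rho> / 2) (min (\<rho> / (4 * (C + 1))) (1 / (2 * (C + 1))))"
  have r: "r > 0" "r \<le> \<rho> / 2" using \<rho> C(1) unfolding r_def by (simp_all only: min.cobounded1, simp)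
  have "r \<le> \<rho> / (4 * (C + 1))" "r \<le> 1 / (2 * (C + 1))" unfolding r_def by (simp_all add: min.coboundedI2)
  then have "r * (4 * (C + 1)) \<le> \<rho>" "r * (2 * (C + 1)) \<le> 1" using C(1) by (simp_all add: pos_le_divide_eq)
  then have rC: "C * r \<le> \<rho> / 4" "C * r \<le> 1 / 2" using r(1) by (auto simp: algebra_simps)
  \<comment> \<open>For \<open>p = (x, y)\<close> this is the right-hand side of the ray equation:
    the derivative of \<open>s \<mapsto> u (s *\<^sub>R x, y)\<close> is to be
    \<open>f (s *\<^sub>R x, y + u (s *\<^sub>R x, y)) x\<close>.\<close>
  define F where "F = (\<lambda>(\<sigma>::real, p, z). f (\<sigma> *\<^sub>R fst p, snd p + z) (fst p))"
  \<comment> \<open>Regularity needs an open set of values, existence a closed one; the solution is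
    found in the closed ball of half this radius.\<close>
  define V where "V = ball (0::'m) (\<rho> / 2)"
  have memK: "(\<sigma> *\<^sub>R fst p, snd p + z) \<in> K" if "shrink \<sigma> p \<in> dbox r" "norm z \<le> \<rho> / 2" for \<sigma> p z
    using that r(2) norm_triangle_ineq[of "snd p" z] \<rho> by (auto simp: K_def dbox_def shrink_def)
  have memS: "(\<sigma> *\<^sub>R fst p, snd p + z) \<in> S" if "shrink \<sigma> p \<in> dbox r" "norm z \<le> \<rho> / 2" for \<sigma> p z
    using memK[OF that] KS by auto
  have xr: "C * norm (fst p) \<le> \<rho> / 4" "C * norm (fst p) \<le> 1/2" if "p \<in> dbox r" for p
  proof -
    have "C * norm (fst p) \<le> C * r" using that C(1) by (intro mult_left_mono) (auto simp: dbox_def)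
    then show "C * norm (fst p) \<le> \<rho> / 4" "C * norm (fst p) \<le> 1/2" using rC by auto
  qed
  have oE: "open (eqdom r V :: (real \<times> ('k \<times> 'm) \<times> 'm) set)" by (rule open_eqdom) (simp add: V_def)
  have smoothF: "smooth_on (eqdom r V) F"
    unfolding F_def split_beta
  proof (rule smooth_on_apply_linear[where L="\<lambda>y. f (fst y *\<^sub>R fst (fst (snd y)), snd (fst (snd y)) + snd (snd y))"
        and g="\<lambda>y. fst (fst (snd y))", OF oE])
    have mS: "(fst y *\<^sub>R fst (fst (snd y)), snd (fst (snd y)) + snd (snd y)) \<in> S"
      if "y \<in> eqdom r V" for y :: "real \<times> ('k \<times> 'm) \<times> 'm"
      by (rule memS) (use that in \<open>auto simp: eqdom_def V_def\<close>)
    show "linear (f (fst y *\<^sub>R fst (fst (snd y)), snd (fst (snd y)) + snd (snd y)))" if "y \<in> eqdom r V" for y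
      by (rule lin[OF mS[OF that]])
    note id = smooth_on_ident[OF oE]
    note s2 = smooth_on_linear_image[OF bounded_linear_snd oE id]
    note s21 = smooth_on_linear_image[OF bounded_linear_fst oE s2]
    note s211 = smooth_on_linear_image[OF bounded_linear_fst oE s21]
      and s212 = smooth_on_linear_image[OF bounded_linear_snd oE s21]
      and s22 = smooth_on_linear_image[OF bounded_linear_snd oE s2]
      and s1 = smooth_on_linear_image[OF bounded_linear_fst oE id]
    show "smooth_on (eqdom r V) (\<lambda>y :: real \<times> ('k \<times> 'm) \<times> 'm. fst (fst (snd y)))" by (rule s211)
    show "smooth_on (eqdom r V) (\<lambda>y :: real \<times> ('k \<times> 'm) \<times> 'm. f (fst y *\<^sub>R fst (fst (snd y)), snd (fst (snd y)) + snd (snd y)) v)" for v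
      by (rule smooth_on_compose[OF oE smooth_on_Pair[OF oE smooth_on_scaleR[OF oE s1 s211] smooth_on_add[OF oE s212 s22]] smooth])
        (use mS in auto)
  qed
  have lipF: "norm (F (\<sigma>, p, z) - F (\<sigma>, p, z')) \<le> 1/2 * norm (z - z')"
    if "\<sigma> \<in> {0..1}" "p \<in> dbox r" "norm z \<le> \<rho> / 2" "norm z' \<le> \<rho> / 2" for \<sigma> p z z'
  proof -
    have s: "shrink \<sigma> p \<in> dbox r" using that by (intro shrink_mem_dbox) auto
    have "norm (F (\<sigma>, p, z) - F (\<sigma>, p, z')) \<le> C * norm (fst p) * norm (z - z')"
      using C(3)[OF memK[OF s that(3)] memK[OF s that(4)], of "fst p"] by (simp add: F_def norm_Pair)
    also have "\<dots> \<le> 1/2 * norm (z - z')" using xr(2)[OF that(2)] by (intro mult_right_mono) auto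
    finally show ?thesis .
  qed
  have contF: "continuous_on ({0..1} \<times> dbox r \<times> cball 0 (\<rho> / 4)) F"
    by (rule continuous_on_subset[OF smooth_on_imp_continuous_on[OF smoothF]])
      (use \<rho> in \<open>auto simp: eqdom_def V_def intro: shrink_mem_dbox\<close>)
  have boundF: "norm (F (\<sigma>, p, z)) \<le> \<rho> / 4" if "\<sigma> \<in> {0..1}" "p \<in> dbox r" "norm z \<le> \<rho> / 2" for \<sigma> p z
  proof -
    have s: "shrink \<sigma> p \<in> dbox r" using that by (intro shrink_mem_dbox) auto
    show ?thesis using C(2)[OF memK[OF s that(3)], of "fst p"] xr(1)[OF that(2)] by (simp add: F_def)
  qed
  have mean: "integral {0..1} (\<lambda>\<sigma>. F (\<sigma>, p, g \<sigma>)) \<in> cball 0 (\<rho> / 4)"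
    if "p \<in> dbox r" "continuous_on {0..1} g" "g ` {0..1} \<subseteq> cball 0 (\<rho> / 4)" for p g
  proof -
    have ng: "norm (g \<sigma>) \<le> \<rho> / 4" if "\<sigma> \<in> {0..1}" for \<sigma>
      using subsetD[OF \<open>g ` {0..1} \<subseteq> _\<close> imageI[OF that]] by simp
    have "norm (integral {0..1} (\<lambda>\<sigma>. F (\<sigma>, p, g \<sigma>))) \<le> \<rho> / 4"
    proof (rule norm_integral_unit_le)
      show "continuous_on {0..1} (\<lambda>\<sigma>. F (\<sigma>, p, g \<sigma>))"
        by (intro continuous_on_compose2[OF contF] continuous_intros that(2)) (use that(1) ng in auto)
      show "norm (F (\<sigma>, p, g \<sigma>)) \<le> \<rho> / 4" if "\<sigma> \<in> {0..1}" for \<sigma>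
        using boundF[OF that \<open>p \<in> dbox r\<close>] ng[OF that] \<rho> by auto
    qed
    then show ?thesis by simp
  qed
  obtain u where contu: "continuous_on (dbox r) u" and uV4: "u ` dbox r \<subseteq> cball 0 (\<rho> / 4)"
    and u: "\<And>p. p \<in> dbox r \<Longrightarrow> u p = integral {0..1} (\<lambda>\<sigma>. F (\<sigma>, p, u (shrink \<sigma> p)))"
  proof (rule integral_equation_solution[OF contF _ _ _ mean])
    show "norm (F (\<sigma>, p, z) - F (\<sigma>, p, z')) \<le> 1/2 * norm (z - z')"
      if "\<sigma> \<in> {0..1}" "p \<in> dbox r" "z \<in> cball 0 (\<rho> / 4)" "z' \<in> cball 0 (\<rho> / 4)" for \<sigma> p z z'
      using that \<rho> by (intro lipF) auto
  qed (use \<rho> in auto)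
  have u4: "norm (u p) \<le> \<rho> / 4" if "p \<in> dbox r" for p using uV4 that by auto
  have uV: "u ` dbox r \<subseteq> V" using uV4 \<rho> by (auto simp: V_def)
  have lipV: "norm (F (\<sigma>, p, z) - F (\<sigma>, p, z')) \<le> 1/2 * norm (z - z')"
    if "\<sigma> \<in> {0..1}" "p \<in> dbox r" "z \<in> V" "z' \<in> V" for \<sigma> p z z'
    using that by (intro lipF) (auto simp: V_def)
  have oV: "open V" by (simp add: V_def)
  have smoothu: "smooth_on (dbox r) u"
    unfolding smooth_on_def
    using Ck_on_integral_equation_solution[OF oV _ lipV contu uV u] smoothF unfolding smooth_on_def by blast
  have F1: "Ck_on (Suc 0) (eqdom r V) F" using smoothF unfolding smooth_on_def by blast
  have du1: "fder u p v = integral {0..1} (\<lambda>\<sigma>. fder F (\<sigma>, p, u (shrink \<sigma> p)) (0, v, fder u (shrink \<sigma> p) (shrink \<sigma> v)))" if "p \<in> dbox r" for p v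
    by (rule integral_equation_solution_fder(1)[OF oV F1 lipV contu uV u that])
  have du2: "continuous_on {0..1} (\<lambda>\<sigma>. fder F (\<sigma>, p, u (shrink \<sigma> p)) (0, v, fder u (shrink \<sigma> p) (shrink \<sigma> v)))" if "p \<in> dbox r" for p v
    by (rule integral_equation_solution_fder(2)[OF oV F1 lipV contu uV u that])
  define Q where "Q p = (fst p, snd p + u p)" for p
  have QS: "Q p \<in> S" if "p \<in> dbox r" for p
    using memS[of 1 p "u p"] u4[OF that] that \<rho> by (simp add: Q_def)
  have Qsh: "Q (shrink \<sigma> p) = (\<sigma> *\<^sub>R fst p, snd p + u (shrink \<sigma> p))" for \<sigma> p
    by (simp add: Q_def shrink_def)
  have dF: "fder F (\<sigma>, p, u (shrink \<sigma> p)) (0, v, w) =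
      fder (\<lambda>q. f q (fst p)) (Q (shrink \<sigma> p)) (\<sigma> *\<^sub>R fst v, snd v + w) + f (Q (shrink \<sigma> p)) (fst v)"
    if "\<sigma> \<in> {0..1}" "p \<in> dbox r" for \<sigma> p v w
  proof -
    let ?y = "(\<sigma>, p, u (shrink \<sigma> p))"
    have sp: "shrink \<sigma> p \<in> dbox r" using that by (intro shrink_mem_dbox) auto
    have a: "((\<lambda>y :: real \<times> ('k \<times> 'm) \<times> 'm. (fst y *\<^sub>R fst (fst (snd y)), snd (fst (snd y)) + snd (snd y))) has_derivative
        (\<lambda>d. (fst ?y *\<^sub>R fst (fst (snd d)) + fst d *\<^sub>R fst (fst (snd ?y)), snd (fst (snd d)) + snd (snd d)))) (at ?y)"
      by (intro has_derivative_Pair has_derivative_add has_derivative_scaleR has_derivative_fst has_derivative_snd has_derivative_ident)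
    have c: "((\<lambda>y :: real \<times> ('k \<times> 'm) \<times> 'm. fst (fst (snd y))) has_derivative (\<lambda>d. fst (fst (snd d)))) (at ?y)"
      by (intro has_derivative_fst has_derivative_snd has_derivative_ident)
    have "F = (\<lambda>y. f (fst y *\<^sub>R fst (fst (snd y)), snd (fst (snd y)) + snd (snd y)) (fst (fst (snd y))))"
      by (auto simp: F_def)
    then show ?thesis
      using fder_eq[OF apply_linear_has_derivative[OF S(1) lin smooth a c]] QS[OF sp]
      by (simp add: Qsh)
  qed
  have u0: "u (0, y) = 0" if "(0::'k, y) \<in> dbox r" for y
  proof -
    have "F (\<sigma>, (0, y), u (shrink \<sigma> (0, y))) = 0" if "\<sigma> \<in> {0..1}" for \<sigma>
    proof -
      have "shrink \<sigma> (0::'k, y) \<in> dbox r" using that \<open>(0::'k, y) \<in> dbox r\<close> by (intro shrink_mem_dbox) auto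
      from linear_0[OF lin[OF QS[OF this]]] show ?thesis by (simp add: F_def Qsh)
    qed
    then have "integral {0..1} (\<lambda>\<sigma>. F (\<sigma>, (0, y), u (shrink \<sigma> (0, y)))) = 0"
      by (subst integral_cong[of _ _ "\<lambda>_. 0"]) auto
    then show ?thesis using u[OF that] by simp
  qed
  have z_mem: "(0::'k, 0::'m) \<in> dbox r" using r by (simp add: dbox_def)
  have d0: "fder u (0, 0) (0, k) = 0" for k
  proof -
    have "fder F (\<sigma>, (0, 0), u (shrink \<sigma> (0, 0))) (0, (0, k), fder u (shrink \<sigma> (0, 0)) (shrink \<sigma> (0, k))) = 0" if "\<sigma> \<in> {0..1}" for \<sigma>
    proof -
      have s: "shrink \<sigma> (0::'k, 0::'m) \<in> dbox r" using that by (intro shrink_mem_dbox z_mem) auto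
      have "fder (\<lambda>q. f q 0) (Q (shrink \<sigma> (0, 0))) = fder (\<lambda>q. 0) (Q (shrink \<sigma> (0, 0)))"
        by (rule fder_cong_open[OF S(1) QS[OF s]]) (simp add: linear_0[OF lin])
      then show ?thesis using linear_0[OF lin[OF QS[OF s]]] by (simp add: dF[OF that z_mem])
    qed
    then have "integral {0..1} (\<lambda>\<sigma>. fder F (\<sigma>, (0, 0), u (shrink \<sigma> (0, 0))) (0, (0, k), fder u (shrink \<sigma> (0, 0)) (shrink \<sigma> (0, k)))) = 0"
      by (subst integral_cong[of _ _ "\<lambda>_. 0"]) auto
    then show ?thesis using du1[OF z_mem, of "(0, k)"] by simp
  qed
  have contr: "norm (fder F (\<sigma>, p, z) (0, 0, w)) \<le> 1/2 * norm w"
    if "\<sigma> \<in> {0..1}" "p \<in> dbox r" "z \<in> V" for \<sigma> p z w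
  proof (rule fder_partial_le_of_lipschitz[OF oV])
    have "(\<sigma>, p, z) \<in> eqdom r V" using that shrink_mem_dbox[of p r \<sigma>] by (simp add: eqdom_def)
    then show "F differentiable at (\<sigma>, p, z)" by (rule smooth_on_differentiable[OF smoothF])
  qed (use that lipV in auto)
  have main: "fder u (x, y) (h, 0) = f (Q (x, y)) h" if p: "(x, y) \<in> dbox r" for x y h
  proof -
    define q where "q s = Q (shrink s (x, y))" for s
    have sp: "shrink s (x, y) \<in> dbox r" if "s \<in> {0..1}" for s
      using that by (intro shrink_mem_dbox p) auto
    have qS: "q s \<in> S" if "s \<in> {0..1}" for s unfolding q_def by (rule QS[OF sp[OF that]])
    have contq: "continuous_on {0..1} q"
      unfolding q_def Q_def
      by (auto intro!: continuous_intros continuous_on_compose2[OF contu] sp)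
    have contfq: "continuous_on {0..1} (\<lambda>s. f (q s) h)" for h
      by (rule continuous_on_compose2[OF smooth_on_imp_continuous_on[OF smooth] contq]) (use qS in auto)
    have Feq: "F (\<sigma>, shrink \<tau> (x, y), u (shrink \<sigma> (shrink \<tau> (x, y)))) = \<tau> *\<^sub>R f (q (\<sigma> * \<tau>)) x"
      if "\<sigma> \<in> {0..1}" "\<tau> \<in> {0..1}" for \<sigma> \<tau>
    proof -
      have "\<sigma> * \<tau> \<in> {0..1}" using that by (auto intro: mult_le_one)
      from linear_cmul[OF lin[OF qS[OF this]]] show ?thesis
        by (simp add: F_def q_def Q_def shrink_shrink) (simp add: shrink_def)
    qed
    define \<Phi> where "\<Phi> s = integral {0..s} (\<lambda>s. f (q s) x)" for s
    have d\<Phi>: "(\<Phi> has_vector_derivative f (q s) x) (at s within {0..1})" if "s \<in> {0..1}" for s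
      unfolding \<Phi>_def by (rule integral_has_vector_derivative[OF contfq that])
    \<comment> \<open>By homogeneity of \<open>f\<close> in its linear argument, the integral
      equation at the shrunk point says that \<open>u\<close> along the ray is a primitive. This
      yields the differential equation, but only in the direction \<open>x\<close> of the
      ray.\<close>
    have "u (shrink \<tau> (x, y)) = \<Phi> \<tau>" if "\<tau> \<in> {0..1}" for \<tau>
    proof -
      have "u (shrink \<tau> (x, y)) = integral {0..1} (\<lambda>\<sigma>. \<tau> *\<^sub>R f (q (\<sigma> * \<tau>)) x)"
        unfolding u[OF sp[OF that]] by (rule integral_cong) (rule Feq[OF _ that])
      also have "\<dots> = \<Phi> \<tau> - \<Phi> 0"
        by (rule integral_unique[OF unit_interval_FTC[OF d\<Phi> that]])
      finally show ?thesis by (simp add: \<Phi>_def)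
    qed
    then have du_ray: "((\<lambda>s. u (shrink s (x, y))) has_vector_derivative f (q s) x) (at s within {0..1})" if "s \<in> {0..1}" for s
      using has_vector_derivative_transform[OF that _ d\<Phi>[OF that]] by auto
    have dq: "(q has_vector_derivative (x, f (q s) x)) (at s within {0..1})" if "s \<in> {0..1}" for s
    proof -
      have "((\<lambda>s. (s *\<^sub>R x, y + u (shrink s (x, y)))) has_vector_derivative (x, f (q s) x)) (at s within {0..1})"
        using du_ray[OF that]
        by (auto intro!: has_vector_derivative_Pair derivative_eq_intros)
      then show ?thesis by (simp add: q_def[abs_def] Q_def shrink_def)
    qed
    have dfq: "((\<lambda>s. f (q s) h) has_vector_derivative fder (\<lambda>q. f q h) (q s) (x, f (q s) x)) (at s within {0..1})"
      if "s \<in> {0..1}" for s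
      using has_derivative_compose[OF dq[OF that, unfolded has_vector_derivative_def] smooth_on_has_derivative[OF smooth qS[OF that], of h]]
        linear_cmul[OF smooth_on_linear_fder[OF smooth qS[OF that], of h], of _ "(x, f (q s) x)"]
      by (simp add: has_vector_derivative_def)
    define G where "G s = s *\<^sub>R f (q s) h" for s
    have dG: "(G has_vector_derivative f (q s) h + s *\<^sub>R fder (\<lambda>q. f q h) (q s) (x, f (q s) x)) (at s within {0..1})"
      if "s \<in> {0..1}" for s
      unfolding G_def using dfq[OF that] by (auto intro!: derivative_eq_intros)
    \<comment> \<open>The defect of the asserted equation in the direction \<open>h\<close> at the
      point \<open>shrink \<tau> (x, y)\<close>, multiplied by \<open>\<tau>\<close>. It will solve
      a homogeneous linear integral equation that is a contraction, and hence vanish.\<close>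
    define e where "e \<tau> = fder u (shrink \<tau> (x, y)) (\<tau> *\<^sub>R h, 0) - G \<tau>" for \<tau>
    have e_int: "(\<lambda>\<sigma>. fder F (\<sigma>, shrink \<tau> (x, y), u (shrink \<sigma> (shrink \<tau> (x, y)))) (0, 0, e (\<sigma> * \<tau>))) integrable_on {0..1}"
      "e \<tau> = integral {0..1} (\<lambda>\<sigma>. fder F (\<sigma>, shrink \<tau> (x, y), u (shrink \<sigma> (shrink \<tau> (x, y)))) (0, 0, e (\<sigma> * \<tau>)))"
      if \<tau>: "\<tau> \<in> {0..1}" for \<tau>
    proof -
      let ?D = "\<lambda>\<sigma>. fder F (\<sigma>, shrink \<tau> (x, y), u (shrink \<sigma> (shrink \<tau> (x, y))))"
      let ?I = "\<lambda>\<sigma>. ?D \<sigma> (0, (\<tau> *\<^sub>R h, 0), fder u (shrink \<sigma> (shrink \<tau> (x, y))) (shrink \<sigma> (\<tau> *\<^sub>R h, 0)))"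
      let ?J = "\<lambda>\<sigma>. \<tau> *\<^sub>R (f (q (\<sigma> * \<tau>)) h + (\<sigma> * \<tau>) *\<^sub>R fder (\<lambda>q. f q h) (q (\<sigma> * \<tau>)) (x, f (q (\<sigma> * \<tau>)) x))"
      have I: "(?I has_integral fder u (shrink \<tau> (x, y)) (\<tau> *\<^sub>R h, 0)) {0..1}"
        unfolding du1[OF sp[OF \<tau>], of "(\<tau> *\<^sub>R h, 0)"]
        by (rule integrable_integral[OF integrable_continuous_real[OF du2[OF sp[OF \<tau>]]]])
      have J: "(?J has_integral G \<tau> - G 0) {0..1}" by (rule unit_interval_FTC[OF dG \<tau>])
      have e_eq: "fder u (shrink \<tau> (x, y)) (\<tau> *\<^sub>R h, 0) - (G \<tau> - G 0) = e \<tau>"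
        by (simp add: e_def G_def)
      note has_integral_diff[OF I J, unfolded e_eq]
      moreover have "?I \<sigma> - ?J \<sigma> = ?D \<sigma> (0, 0, e (\<sigma> * \<tau>))" if \<sigma>: "\<sigma> \<in> {0..1}" for \<sigma>
      proof -
        let ?s = "\<sigma> * \<tau>"
        let ?A = "fder (\<lambda>q. f q x) (q ?s)"
        have s: "?s \<in> {0..1}" using \<sigma> \<tau> by (auto intro: mult_le_one)
        have dF': "?D \<sigma> (0, v, w) = \<tau> *\<^sub>R ?A (\<sigma> *\<^sub>R fst v, snd v + w) + f (q ?s) (fst v)" for v w
        proof -
          have "((\<lambda>z. \<tau> *\<^sub>R f z x) has_derivative (\<lambda>d. \<tau> *\<^sub>R ?A d)) (at (q ?s))"
            by (intro has_derivative_scaleR_right smooth_on_has_derivative[OF smooth qS[OF s]])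
          then have "((\<lambda>z. f z (\<tau> *\<^sub>R x)) has_derivative (\<lambda>d. \<tau> *\<^sub>R ?A d)) (at (q ?s))"
            by (subst has_derivative_cong_open[OF S(1) qS[OF s]]) (auto simp: linear_cmul[OF lin])
          then have "fder (\<lambda>z. f z (\<tau> *\<^sub>R x)) (q ?s) = (\<lambda>d. \<tau> *\<^sub>R ?A d)" by (rule fder_eq)
          then show ?thesis
            using dF[OF \<sigma> sp[OF \<tau>], of v w] by (simp add: shrink_shrink flip: q_def) (simp add: shrink_def)
        qed
        have linA: "linear ?A" by (rule smooth_on_linear_fder[OF smooth qS[OF s]])
        have "e ?s = fder u (shrink ?s (x, y)) (?s *\<^sub>R h, 0) - ?s *\<^sub>R f (q ?s) h" by (simp add: e_def G_def)
        then have "?A (0, e ?s) = ?A (?s *\<^sub>R h, fder u (shrink ?s (x, y)) (?s *\<^sub>R h, 0)) - ?s *\<^sub>R ?A (h, f (q ?s) h)"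
          by (simp add: linear_diff[OF linA, symmetric] linear_cmul[OF linA, symmetric])
        \<comment> \<open>The integrability condition exchanges the ray direction \<open>x\<close>
          with the test direction \<open>h\<close>; this is what makes the equation for the defect
          homogeneous.\<close>
        also have "?A (h, f (q ?s) h) = fder (\<lambda>q. f q h) (q ?s) (x, f (q ?s) x)"
          using compat[OF qS[OF s]] by simp
        finally have Ae: "?A (0, e ?s) = ?A (?s *\<^sub>R h, fder u (shrink ?s (x, y)) (?s *\<^sub>R h, 0))
          - ?s *\<^sub>R fder (\<lambda>q. f q h) (q ?s) (x, f (q ?s) x)" .
        have fh: "f (q ?s) (\<tau> *\<^sub>R h) = \<tau> *\<^sub>R f (q ?s) h" "f (q ?s) 0 = 0"
          using linear_0[OF lin[OF qS[OF s]]] linear_cmul[OF lin[OF qS[OF s]]] by auto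
        have sh: "shrink \<sigma> (\<tau> *\<^sub>R h, 0 :: 'm) = (?s *\<^sub>R h, 0)" by (simp add: shrink_def)
        show ?thesis
          unfolding dF' by (simp add: shrink_shrink sh fh Ae scaleR_diff_right scaleR_add_right)
      qed
      ultimately have "((\<lambda>\<sigma>. ?D \<sigma> (0, 0, e (\<sigma> * \<tau>))) has_integral e \<tau>) {0..1}"
        by (rule has_integral_eq[rotated])
      then show "(\<lambda>\<sigma>. ?D \<sigma> (0, 0, e (\<sigma> * \<tau>))) integrable_on {0..1}"
        "e \<tau> = integral {0..1} (\<lambda>\<sigma>. ?D \<sigma> (0, 0, e (\<sigma> * \<tau>)))"
        by (auto simp: integral_unique has_integral_integrable)
    qed
    have conte: "continuous_on {0..1} e"
    proof (rule continuous_on_eq)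
      show "continuous_on {0..1} (\<lambda>\<tau>. \<tau> *\<^sub>R fder u (shrink \<tau> (x, y)) (h, 0) - \<tau> *\<^sub>R f (q \<tau>) h)"
        by (auto intro!: continuous_intros contfq sp
            continuous_on_compose2[OF smooth_on_imp_continuous_on[OF smooth_on_fder_const[OF smoothu]]])
      show "\<tau> *\<^sub>R fder u (shrink \<tau> (x, y)) (h, 0) - \<tau> *\<^sub>R f (q \<tau>) h = e \<tau>" if "\<tau> \<in> {0..1}" for \<tau>
        using linear_cmul[OF smooth_on_linear_fder[OF smoothu sp[OF that]], of \<tau> "(h, 0)"] by (simp add: e_def G_def)
    qed
    have "norm (e 1) \<le> 0 / (1 - 1/2)"
    proof (rule sup_contraction_bound[where \<phi>="\<lambda>\<tau>. norm (e \<tau>)"])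
      show "continuous_on {0..1} (\<lambda>\<tau>. norm (e \<tau>))" using conte by (intro continuous_intros)
      fix \<tau> M :: real assume \<tau>: "\<tau> \<in> {0..1}" and M: "\<And>s. s \<in> {0..1} \<Longrightarrow> norm (e s) \<le> M"
      have "norm (e \<tau>) \<le> integral {0..1} (\<lambda>\<sigma>::real. 1/2 * M)"
        unfolding e_int(2)[OF \<tau>]
      proof (rule integral_norm_bound_integral[OF e_int(1)[OF \<tau>]])
        fix \<sigma> :: real assume \<sigma>: "\<sigma> \<in> {0..1}"
        have "u (shrink \<sigma> (shrink \<tau> (x, y))) \<in> V"
          using uV shrink_mem_dbox[OF sp[OF \<tau>], of \<sigma>] \<sigma> by auto
        from contr[OF \<sigma> sp[OF \<tau>] this, of "e (\<sigma> * \<tau>)"]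
        show "norm (fder F (\<sigma>, shrink \<tau> (x, y), u (shrink \<sigma> (shrink \<tau> (x, y)))) (0, 0, e (\<sigma> * \<tau>))) \<le> 1/2 * M"
          using M[of "\<sigma> * \<tau>"] \<sigma> \<tau> by (force intro: mult_le_one)
      qed auto
      then show "norm (e \<tau>) \<le> 0 + 1/2 * M" by simp
    qed auto
    then show ?thesis by (simp add: e_def G_def q_def)
  qed
  show ?thesis
    by (rule that[OF r(1) smoothu]) (use QS main u0 d0 in \<open>auto simp: Q_def\<close>)
qed

text \<open>The map \<open>H\<close> sends slices of constant second component to the integral
  graphs. Its derivative at the origin is injective because \<open>u\<close> has no derivative in
  the parameter directions there, and the second component of the local inverse labels the
  leaves.\<close>

lemma frobenius_graph:
  fixes f :: "'k::euclidean_space \<times> 'm::euclidean_space \<Rightarrow> 'k \<Rightarrow> 'm"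
  assumes S: "open S" "(0, 0) \<in> S" and lin: "\<And>q. q \<in> S \<Longrightarrow> linear (f q)"
    and smooth: "\<And>h. smooth_on S (\<lambda>q. f q h)"
    and compat: "\<And>q h k. q \<in> S \<Longrightarrow> fder (\<lambda>q. f q h) q (k, f q k) = fder (\<lambda>q. f q k) q (h, f q h)"
  obtains N \<psi> where "open N" "(0, 0) \<in> N" "N \<subseteq> S" "smooth_on N (\<psi> :: 'k \<times> 'm \<Rightarrow> 'm)"
    "\<And>q v. q \<in> N \<Longrightarrow> fder \<psi> q v = 0 \<longleftrightarrow> snd v = f q (fst v)"
proof -
  obtain r u where r: "r > 0" and u: "smooth_on (dbox r) (u :: 'k \<times> 'm \<Rightarrow> 'm)"
    and uS: "\<And>x y. (x, y) \<in> dbox r \<Longrightarrow> (x, y + u (x, y)) \<in> S"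
    and du: "\<And>x y h. (x, y) \<in> dbox r \<Longrightarrow> fder u (x, y) (h, 0) = f (x, y + u (x, y)) h"
    and u0: "\<And>y. (0::'k, y) \<in> dbox r \<Longrightarrow> u (0, y) = 0"
    and du0: "\<And>k. fder u (0, 0) (0, k) = 0"
    using radial_solution[OF S lin smooth compat] by metis
  have o: "open (dbox r :: ('k \<times> 'm) set)" by (rule open_dbox)
  have z: "(0::'k, 0::'m) \<in> dbox r" using r by (simp add: dbox_def)
  define H where "H p = (fst p, snd p + u p)" for p
  have smoothH: "smooth_on (dbox r) H"
    unfolding H_def
    by (intro smooth_on_Pair[OF o] smooth_on_add[OF o] u smooth_on_linear_image[OF bounded_linear_fst o]
        smooth_on_linear_image[OF bounded_linear_snd o] smooth_on_ident o)
  have dH: "fder H p v = (fst v, snd v + fder u p v)" if "p \<in> dbox r" for p v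
  proof -
    have "(H has_derivative (\<lambda>v. (fst v, snd v + fder u p v))) (at p)"
      unfolding H_def
      by (intro has_derivative_Pair has_derivative_add has_derivative_fst has_derivative_snd
          has_derivative_ident smooth_on_has_derivative[OF u that])
    then show ?thesis by (simp add: fder_eq)
  qed
  have dHh: "fder H p (h, 0) = (h, f (H p) h)" if "p \<in> dbox r" for p h
    using du[of "fst p" "snd p" h] that by (simp add: dH[OF that] H_def)
  have "inj (fder H (0, 0))"
    unfolding linear_injective_0[OF smooth_on_linear_fder[OF smoothH z]]
  proof (intro allI impI)
    fix v :: "'k \<times> 'm" assume v: "fder H (0, 0) v = 0"
    then have "fst v = 0" using dH[OF z, of v] by (simp add: zero_prod_def)
    then have "v = (0, snd v)" by (cases v) simp
    then show "v = 0" using v dH[OF z, of v] du0[of "snd v"] by (metis add.right_neutral prod.inject snd_zero zero_prod_def)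
  qed
  from smooth_inverse_function[OF o z smoothH this]
  obtain U' N g where U': "open U'" "U' \<subseteq> dbox r" "(0, 0) \<in> U'" and N: "open N" and hom: "homeomorphism U' N H g"
    and g: "smooth_on N g" and bij: "\<And>x. x \<in> U' \<Longrightarrow> bij (fder H x)"
    and dg: "\<And>y. y \<in> N \<Longrightarrow> fder g y = inv (fder H (g y))"
    by metis
  have gU: "g q \<in> U'" "H (g q) = q" if "q \<in> N" for q
    using hom that by (auto simp: homeomorphism_def)
  show ?thesis
  proof (rule that[of N "\<lambda>q. snd (g q)"])
    have "H (0, 0) = (0, 0)" using u0[OF z] by (simp add: H_def)
    then show "(0, 0) \<in> N" using hom U'(3) by (metis homeomorphism_image1 imageI)
    show "N \<subseteq> S"
    proof
      fix q assume "q \<in> N"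
      then show "q \<in> S" using uS[of "fst (g q)" "snd (g q)"] gU[of q] U'(2) by (force simp: H_def)
    qed
    show "smooth_on N (\<lambda>q. snd (g q))" by (rule smooth_on_linear_image[OF bounded_linear_snd N g])
    fix q v assume q: "q \<in> N"
    have gq: "g q \<in> dbox r" using gU[OF q] U' by auto
    have "((\<lambda>q. snd (g q)) has_derivative (\<lambda>v. snd (fder g q v))) (at q)"
      by (rule has_derivative_snd[OF smooth_on_has_derivative[OF g q]])
    then have eq: "fder (\<lambda>q. snd (g q)) q v = snd (inv (fder H (g q)) v)" using dg[OF q] by (simp add: fder_eq)
    have b: "bij (fder H (g q))" by (rule bij[OF gU(1)[OF q]])
    show "fder (\<lambda>q. snd (g q)) q v = 0 \<longleftrightarrow> snd v = f q (fst v)"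
    proof
      assume "fder (\<lambda>q. snd (g q)) q v = 0"
      then have "inv (fder H (g q)) v = (fst (inv (fder H (g q)) v), 0)" using eq by (cases "inv (fder H (g q)) v") auto
      then have "v = fder H (g q) (fst (inv (fder H (g q)) v), 0)"
        using b by (metis bij_is_surj surj_f_inv_f)
      then show "snd v = f q (fst v)" using dHh[OF gq] gU[OF q] by (metis fst_conv snd_conv)
    next
      assume "snd v = f q (fst v)"
      then have "v = fder H (g q) (fst v, 0)" using dHh[OF gq, of "fst v"] gU(2)[OF q] by (simp add: prod_eq_iff)
      then have "inv (fder H (g q)) v = (fst v, 0)" using b by (metis bij_is_inj inv_f_f)
      then show "fder (\<lambda>q. snd (g q)) q v = 0" using eq by simp
    qed
  qed (use N in auto)
qed

section \<open>Lie brackets and Frobenius' theorem for involutive distributions\<close>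

lemma lie_bracket_skew: "lie_bracket X Y x = - lie_bracket Y X x"
  by (simp add: lie_bracket_def)

lemma lie_bracket_cong_open:
  assumes "open S" "x \<in> S" "\<And>y. y \<in> S \<Longrightarrow> X y = X' y" "\<And>y. y \<in> S \<Longrightarrow> Y y = Y' y"
  shows "lie_bracket X Y x = lie_bracket X' Y' x"
  using fder_cong_open[OF assms(1,2,3)] fder_cong_open[OF assms(1,2,4)] assms(2,3,4)
  by (simp add: lie_bracket_def)

lemma smooth_on_lie_bracket:
  "open S \<Longrightarrow> smooth_on S X \<Longrightarrow> smooth_on S Y \<Longrightarrow> smooth_on S (lie_bracket X Y)"
  unfolding lie_bracket_def by (intro smooth_on_diff smooth_on_fder)

lemma lie_bracket_sum_right:
  fixes X :: "'e::euclidean_space \<Rightarrow> 'e"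
  assumes X: "X differentiable (at x)" and c: "\<And>j. j \<in> J \<Longrightarrow> c j differentiable (at x)"
    and S: "\<And>j. j \<in> J \<Longrightarrow> S j differentiable (at x)"
  shows "lie_bracket X (\<lambda>y. \<Sum>j\<in>J. c j y *\<^sub>R S j y) x
    = (\<Sum>j\<in>J. c j x *\<^sub>R lie_bracket X (S j) x + fder (c j) x (X x) *\<^sub>R S j x)"
proof -
  have "((\<lambda>y. \<Sum>j\<in>J. c j y *\<^sub>R S j y) has_derivative
      (\<lambda>h. \<Sum>j\<in>J. c j x *\<^sub>R fder (S j) x h + fder (c j) x h *\<^sub>R S j x)) (at x)"
    by (intro has_derivative_sum has_derivative_scaleR fder_works c S)
  then have "fder (\<lambda>y. \<Sum>j\<in>J. c j y *\<^sub>R S j y) x (X x) = (\<Sum>j\<in>J. c j x *\<^sub>R fder (S j) x (X x) + fder (c j) x (X x) *\<^sub>R S j x)"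
    by (simp add: fder_eq)
  moreover have "fder X x (\<Sum>j\<in>J. c j x *\<^sub>R S j x) = (\<Sum>j\<in>J. c j x *\<^sub>R fder X x (S j x))"
    by (simp add: linear_sum[OF linear_fder[OF X]] linear_cmul[OF linear_fder[OF X]])
  ultimately show ?thesis
    by (simp add: lie_bracket_def sum_subtractf[symmetric] scaleR_diff_right algebra_simps)
qed

lemma lie_bracket_in_subspace_right:
  assumes "subspace V" "open N" "x \<in> N" "\<And>y. y \<in> N \<Longrightarrow> Y y = (\<Sum>j\<in>J. c j y *\<^sub>R S j y)"
    "X differentiable (at x)" "\<And>j. j \<in> J \<Longrightarrow> c j differentiable (at x)" "\<And>j. j \<in> J \<Longrightarrow> S j differentiable (at x)"
    "\<And>j. j \<in> J \<Longrightarrow> S j x \<in> V" "\<And>j. j \<in> J \<Longrightarrow> lie_bracket X (S j) x \<in> V"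
  shows "lie_bracket X Y x \<in> V"
proof -
  have "lie_bracket X Y x = lie_bracket X (\<lambda>y. \<Sum>j\<in>J. c j y *\<^sub>R S j y) x"
    by (rule lie_bracket_cong_open[OF assms(2,3)]) (auto simp: assms(4))
  also have "\<dots> = (\<Sum>j\<in>J. c j x *\<^sub>R lie_bracket X (S j) x + fder (c j) x (X x) *\<^sub>R S j x)"
    by (rule lie_bracket_sum_right[OF assms(5,6,7)])
  also have "\<dots> \<in> V"
    by (intro subspace_sum subspace_add subspace_scale assms)
  finally show ?thesis .
qed

text \<open>Apart from brackets of the generators, the Leibniz rule only produces multiples of the
  generators themselves. The second argument is expanded first, the first one then by skew
  symmetry.\<close>

lemma lie_bracket_in_subspace:
  assumes V: "subspace V" and N: "open N" "x \<in> N"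
    and X: "\<And>y. y \<in> N \<Longrightarrow> X y = (\<Sum>i\<in>I. b i y *\<^sub>R R i y)" and Y: "\<And>y. y \<in> N \<Longrightarrow> Y y = (\<Sum>j\<in>J. c j y *\<^sub>R S j y)"
    and b: "\<And>i. i \<in> I \<Longrightarrow> b i differentiable (at x)" and R: "\<And>i. i \<in> I \<Longrightarrow> R i differentiable (at x)"
    and c: "\<And>j. j \<in> J \<Longrightarrow> c j differentiable (at x)" and S: "\<And>j. j \<in> J \<Longrightarrow> S j differentiable (at x)"
    and mem: "\<And>i. i \<in> I \<Longrightarrow> R i x \<in> V" "\<And>j. j \<in> J \<Longrightarrow> S j x \<in> V"
      "\<And>i j. i \<in> I \<Longrightarrow> j \<in> J \<Longrightarrow> lie_bracket (R i) (S j) x \<in> V"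
  shows "lie_bracket X Y x \<in> V"
proof (rule lie_bracket_in_subspace_right[OF V N Y _ c S mem(2)])
  have "((\<lambda>y. \<Sum>i\<in>I. b i y *\<^sub>R R i y) has_derivative
      (\<lambda>h. \<Sum>i\<in>I. b i x *\<^sub>R fder (R i) x h + fder (b i) x h *\<^sub>R R i x)) (at x)"
    by (intro has_derivative_sum has_derivative_scaleR fder_works b R)
  then have "(\<lambda>y. \<Sum>i\<in>I. b i y *\<^sub>R R i y) differentiable (at x)"
    unfolding differentiable_def by blast
  then show "X differentiable (at x)" by (rule differentiable_cong_open[OF N X[symmetric], rotated])
  fix j assume j: "j \<in> J"
  have "lie_bracket (S j) X x \<in> V"
  proof (rule lie_bracket_in_subspace_right[OF V N X S[OF j] b R mem(1)])
    fix i assume "i \<in> I"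
    then show "lie_bracket (S j) (R i) x \<in> V"
      using mem(3)[OF _ j] lie_bracket_skew[of "S j" "R i" x] subspace_neg[OF V] by simp
  qed
  then show "lie_bracket X (S j) x \<in> V"
    using lie_bracket_skew[of X "S j" x] subspace_neg[OF V] by simp
qed

text \<open>\<open>\<Xi>\<close> is extended by an isomorphism onto the orthogonal complement of its
  range. The result serves as a linear coordinate change that makes the distribution horizontal at
  the base point.\<close>

lemma complement_isomorphism:
  fixes \<Xi> :: "'k::euclidean_space \<Rightarrow> 'e::euclidean_space"
  assumes "linear \<Xi>" "inj \<Xi>" "DIM('k) + DIM('m::euclidean_space) = DIM('e)"
  obtains \<Phi> :: "'k \<times> 'm::euclidean_space \<Rightarrow> 'e" where "linear \<Phi>" "bij \<Phi>" "\<And>h. \<Phi> (h, 0) = \<Xi> h"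
proof -
  define R where "R = range \<Xi>"
  have R: "subspace R" unfolding R_def by (rule linear_subspace_image[OF assms(1) subspace_UNIV])
  define P where "P = {y. \<forall>x\<in>R. orthogonal x y}"
  have P: "subspace P" unfolding P_def by (rule subspace_orthogonal_to_vectors)
  have "dim R = DIM('k)" unfolding R_def using dim_image_eq[OF assms(1), of UNIV] assms(2) by simp
  moreover have "dim P + dim R = DIM('e)"
    using dim_subspace_orthogonal_to_vectors[OF R subspace_UNIV] by (simp add: P_def)
  ultimately have "dim (UNIV :: 'm set) = dim P" using assms(3) by simp
  then obtain j :: "'m \<Rightarrow> 'e" where j: "linear j" "j ` UNIV = P" "inj_on j UNIV"
    using subspace_isomorphism[OF subspace_UNIV P] by metis
  define \<Phi> where "\<Phi> v = \<Xi> (fst v) + j (snd v)" for v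
  have lin: "linear \<Phi>"
    unfolding \<Phi>_def
    by (intro linearI) (simp_all add: linear_add[OF assms(1)] linear_add[OF j(1)] linear_cmul[OF assms(1)] linear_cmul[OF j(1)] algebra_simps)
  have "inj \<Phi>"
    unfolding linear_injective_0[OF lin]
  proof (intro allI impI)
    fix v assume v: "\<Phi> v = 0"
    have "orthogonal (\<Xi> (fst v)) (j (snd v))" using j(2) by (auto simp: P_def R_def)
    moreover have "j (snd v) = - \<Xi> (fst v)" using v by (simp add: \<Phi>_def add_eq_0_iff)
    ultimately have "\<Xi> (fst v) = 0" by (simp add: orthogonal_def)
    moreover from this have "j (snd v) = 0" using v by (simp add: \<Phi>_def)
    ultimately show "v = 0"
      using assms(1,2) j(1,3) by (simp add: linear_injective_0 prod_eq_iff)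
  qed
  moreover have "surj \<Phi>"
  proof -
    have "\<exists>v. y = \<Phi> v" for y
    proof -
      obtain a b where ab: "a \<in> span R" "\<And>w. w \<in> span R \<Longrightarrow> orthogonal b w" "y = a + b"
        using orthogonal_subspace_decomp_exists[of R y] by metis
      have "a \<in> R" using ab(1) R by (simp add: span_eq_iff[THEN iffD2])
      moreover have "b \<in> P" using ab(2) span_base by (auto simp: P_def orthogonal_commute)
      ultimately obtain h m where "a = \<Xi> h" "b = j m" using j(2) by (auto simp: R_def)
      then show ?thesis using ab(3) by (auto simp: \<Phi>_def intro: exI[of _ "(h, m)"])
    qed
    then show ?thesis by (auto simp: surj_def)
  qed
  ultimately have "bij \<Phi>" by (simp add: bij_def)
  then show ?thesis using that[OF lin] linear_0[OF j(1)] by (simp add: \<Phi>_def)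
qed

text \<open>The frame is normalised: near \<open>p\<close>, \<open>\<zeta> x h\<close> is the vector
  of the distribution whose first component, in coordinates adapted at \<open>p\<close>, is
  \<open>h\<close>. Brackets of such fields have first component zero and still lie in the
  distribution, so they vanish. This vanishing is the integrability condition of the graph equation
  with slope \<open>f\<close>.\<close>

theorem frobenius:
  fixes \<Xi> :: "'e::euclidean_space \<Rightarrow> 'k::euclidean_space \<Rightarrow> 'e"
  assumes dim: "DIM('k) + DIM('m::euclidean_space) = DIM('e)" and U: "open U" "p \<in> U"
    and lin: "\<And>x. x \<in> U \<Longrightarrow> linear (\<Xi> x)" and smooth: "\<And>h. smooth_on U (\<lambda>x. \<Xi> x h)"
    and inj: "inj (\<Xi> p)"
    and invol: "\<And>x h k. x \<in> U \<Longrightarrow> lie_bracket (\<lambda>x. \<Xi> x h) (\<lambda>x. \<Xi> x k) x \<in> range (\<Xi> x)"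
  obtains N and \<psi> :: "'e \<Rightarrow> 'm::euclidean_space" where "open N" "p \<in> N" "N \<subseteq> U" "smooth_on N \<psi>"
    "\<And>x v. x \<in> N \<Longrightarrow> fder \<psi> x v = 0 \<longleftrightarrow> v \<in> range (\<Xi> x)"
proof -
  obtain \<Phi> :: "'k \<times> 'm \<Rightarrow> 'e" where \<Phi>: "linear \<Phi>" "bij \<Phi>" "\<And>h. \<Phi> (h, 0) = \<Xi> p h"
    using complement_isomorphism[OF lin[OF U(2)] inj dim] by blast
  define \<Theta> where "\<Theta> = inv \<Phi>"
  have \<Theta>: "linear \<Theta>" unfolding \<Theta>_def by (rule linear_inverse_of_bij[OF \<Phi>(1,2)])
  have \<Theta>\<Phi>: "\<Theta> (\<Phi> q) = q" "\<Phi> (\<Theta> x) = x" for q x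
    unfolding \<Theta>_def using \<Phi>(2) by (simp_all add: bij_is_inj bij_is_surj surj_f_inv_f)
  have bl\<Theta>: "bounded_linear \<Theta>" and bl\<Phi>: "bounded_linear \<Phi>"
    using \<Theta> \<Phi> by (simp_all add: linear_conv_bounded_linear)
  have bl: "bounded_linear (\<lambda>x. fst (\<Theta> x))" "bounded_linear (\<lambda>x. snd (\<Theta> x))"
    by (auto intro: bounded_linear_compose[OF bounded_linear_fst bl\<Theta>] bounded_linear_compose[OF bounded_linear_snd bl\<Theta>])
  define A where "A x h = fst (\<Theta> (\<Xi> x h))" for x h
  have linA: "linear (A x)" if "x \<in> U" for x
    using linear_compose[OF lin[OF that] bounded_linear.linear[OF bl(1)]] by (simp add: A_def[abs_def] o_def)
  have smoothA: "smooth_on U (\<lambda>x. A x h)" for h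
    unfolding A_def by (rule smooth_on_linear_image[OF bl(1) U(1) smooth])
  have "A p h = h" for h by (simp add: A_def \<Phi>(3)[symmetric] \<Theta>\<Phi>)
  then have "inj (A p)" by (simp add: inj_on_def)
  then obtain N1 c where N1: "open N1" "p \<in> N1" "N1 \<subseteq> U" "c > 0" and c: "\<And>y v. y \<in> N1 \<Longrightarrow> c * norm v \<le> norm (A y v)"
    using injective_near[OF U linA smooth_on_imp_continuous_on[OF smoothA]] by metis
  have bijA: "bij (A x)" if "x \<in> N1" for x
    using inj_of_bounded_below[OF linA N1(4) c[OF that]] linear_injective_imp_surjective[OF linA] that N1(3)
    by (auto simp: bij_def)
  define B where "B x = inv (A x)" for x
  have AB: "A x (B x h) = h" if "x \<in> N1" for x h using bijA[OF that] by (simp add: B_def bij_is_surj surj_f_inv_f)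
  have linA1: "linear (A x)" if "x \<in> N1" for x using linA N1(3) that by auto
  have lin1: "linear (\<Xi> x)" if "x \<in> N1" for x using lin N1(3) that by auto
  have linB: "linear (B x)" if "x \<in> N1" for x unfolding B_def by (rule linear_inverse_of_bij[OF linA1[OF that] bijA[OF that]])
  have smooth1: "smooth_on N1 (\<lambda>x. \<Xi> x h)" for h by (rule smooth_on_subset[OF smooth N1(3)])
  have smoothB: "smooth_on N1 (\<lambda>x. B x h)" for h
    unfolding B_def
    by (rule smooth_on_inverse_linear_family[OF N1(1) linA1 bijA smooth_on_subset[OF smoothA N1(3)]])
  define \<zeta> where "\<zeta> x h = \<Xi> x (B x h)" for x h
  have smooth\<zeta>: "smooth_on N1 (\<lambda>x. \<zeta> x h)" for h
    unfolding \<zeta>_def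
    by (rule smooth_on_apply_linear[where L=\<Xi> and g="\<lambda>x. B x h", OF N1(1) lin1 smooth1 smoothB])
  have lin\<zeta>: "linear (\<zeta> x)" if "x \<in> N1" for x
    using linear_compose[OF linB[OF that] lin1[OF that]] by (simp add: \<zeta>_def[abs_def] o_def)
  have fst\<zeta>: "fst (\<Theta> (\<zeta> x h)) = h" if "x \<in> N1" for x h
    using AB[OF that] by (simp add: A_def \<zeta>_def)
  have \<zeta>range: "v \<in> range (\<Xi> x) \<longleftrightarrow> v = \<zeta> x (fst (\<Theta> v))" if "x \<in> N1" for x v
  proof
    assume "v \<in> range (\<Xi> x)"
    then obtain h where h: "v = \<Xi> x h" by auto
    then have "fst (\<Theta> v) = A x h" by (simp add: A_def)
    then show "v = \<zeta> x (fst (\<Theta> v))" using bijA[OF that] h by (simp add: \<zeta>_def B_def bij_is_inj)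
  qed (auto simp: \<zeta>_def)
  have bracket0: "lie_bracket (\<lambda>x. \<zeta> x h) (\<lambda>x. \<zeta> x k) x = 0" if x: "x \<in> N1" for x h k
  proof -
    have "lie_bracket (\<lambda>x. \<zeta> x h) (\<lambda>x. \<zeta> x k) x \<in> range (\<Xi> x)"
    proof -
      have exp: "\<zeta> y h = (\<Sum>b\<in>Basis. (B y h \<bullet> b) *\<^sub>R \<Xi> y b)" if "y \<in> N1" for y h
        unfolding \<zeta>_def by (rule linear_basis_expansion[OF lin1[OF that]])
      have dB: "(\<lambda>x. B x h \<bullet> b) differentiable at x" for h b
        by (rule smooth_on_differentiable[OF smooth_on_inner[OF N1(1) smoothB smooth_on_const] x])
      have d\<Xi>: "(\<lambda>x. \<Xi> x b) differentiable at x" for b by (rule smooth_on_differentiable[OF smooth1 x])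
      have sub: "subspace (range (\<Xi> x))" by (rule linear_subspace_image[OF lin1[OF x] subspace_UNIV])
      show ?thesis
        by (rule lie_bracket_in_subspace[OF sub N1(1) x exp exp dB d\<Xi> dB d\<Xi>])
          (use invol x N1(3) in auto)
    qed
    moreover have fst0: "fst (\<Theta> (fder (\<lambda>x. \<zeta> x h) x v)) = 0" for h v
    proof -
      have "((\<lambda>x. fst (\<Theta> (\<zeta> x h))) has_derivative (\<lambda>v. fst (\<Theta> (fder (\<lambda>x. \<zeta> x h) x v)))) (at x)"
        by (rule bounded_linear.has_derivative[OF bl(1) smooth_on_has_derivative[OF smooth\<zeta> x]])
      moreover have "((\<lambda>x. fst (\<Theta> (\<zeta> x h))) has_derivative (\<lambda>v. 0)) (at x)"
        by (subst has_derivative_cong_open[OF N1(1) x, of _ "\<lambda>_. h"]) (auto simp: fst\<zeta>)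
      ultimately show ?thesis using has_derivative_unique by (metis (no_types, lifting))
    qed
    have "fst (\<Theta> (lie_bracket (\<lambda>x. \<zeta> x h) (\<lambda>x. \<zeta> x k) x)) = 0"
      by (simp add: lie_bracket_def linear_diff[OF \<Theta>] fst0)
    ultimately show ?thesis
      using \<zeta>range[OF x] linear_0[OF lin\<zeta>[OF x]] by metis
  qed
  define S where "S = {q. p + \<Phi> q \<in> N1}"
  have aff: "((\<lambda>q. p + \<Phi> q) has_derivative \<Phi>) (at q)" for q
    by (auto intro!: derivative_eq_intros bounded_linear.has_derivative[OF bl\<Phi>])
  have contaff: "continuous_on UNIV (\<lambda>q. p + \<Phi> q)"
    by (intro continuous_intros bounded_linear.continuous_on[OF bl\<Phi>])
  have openS: "open S" using open_vimage[OF N1(1) contaff] by (simp add: S_def vimage_def)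
  have S0: "(0, 0) \<in> S" using N1(2) linear_0[OF \<Phi>(1)] by (simp add: S_def zero_prod_def)
  define f where "f q h = snd (\<Theta> (\<zeta> (p + \<Phi> q) h))" for q h
  have linf: "linear (f q)" if "q \<in> S" for q
    using linear_compose[OF lin\<zeta> bounded_linear.linear[OF bl(2)], of "p + \<Phi> q"] that
    by (simp add: f_def[abs_def] o_def S_def)
  have smoothaff: "smooth_on S (\<lambda>q. p + \<Phi> q)"
    by (intro smooth_on_add[OF openS] smooth_on_const smooth_on_bounded_linear[OF bl\<Phi> openS])
  have smoothf: "smooth_on S (\<lambda>q. f q h)" for h
    unfolding f_def
    by (rule smooth_on_linear_image[OF bl(2) openS smooth_on_compose[OF openS smoothaff smooth\<zeta>]]) (auto simp: S_def)
  have \<Phi>f: "\<Phi> (h, f q h) = \<zeta> (p + \<Phi> q) h" if "q \<in> S" for q h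
  proof -
    have "\<Theta> (\<zeta> (p + \<Phi> q) h) = (h, f q h)"
      using fst\<zeta>[of "p + \<Phi> q" h] that by (simp add: f_def S_def prod_eq_iff)
    then show ?thesis using \<Theta>\<Phi>(2) by metis
  qed
  have df: "fder (\<lambda>q. f q h) q v = snd (\<Theta> (fder (\<lambda>x. \<zeta> x h) (p + \<Phi> q) (\<Phi> v)))" if "q \<in> S" for q h v
  proof -
    have "((\<lambda>q. f q h) has_derivative (\<lambda>v. snd (\<Theta> (fder (\<lambda>x. \<zeta> x h) (p + \<Phi> q) (\<Phi> v))))) (at q)"
      unfolding f_def
      by (rule bounded_linear.has_derivative[OF bl(2) has_derivative_compose[OF aff smooth_on_has_derivative[OF smooth\<zeta>]]])
        (use that in \<open>simp add: S_def\<close>)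
    then show ?thesis by (simp add: fder_eq)
  qed
  \<comment> \<open>The second component of the vanishing bracket of the normalised fields.\<close>
  have compat: "fder (\<lambda>q. f q h) q (k, f q k) = fder (\<lambda>q. f q k) q (h, f q h)" if "q \<in> S" for q h k
    using bracket0[of "p + \<Phi> q" k h] that
    by (simp add: df[OF that] \<Phi>f[OF that] S_def lie_bracket_def)
  obtain N0 \<psi>0 where N0: "open N0" "(0, 0) \<in> N0" "N0 \<subseteq> S" and \<psi>0: "smooth_on N0 (\<psi>0 :: 'k \<times> 'm \<Rightarrow> 'm)"
    and ker: "\<And>q v. q \<in> N0 \<Longrightarrow> fder \<psi>0 q v = 0 \<longleftrightarrow> snd v = f q (fst v)"
    using frobenius_graph[OF openS S0 linf smoothf compat] by metis
  define N where "N = {x. \<Theta> (x - p) \<in> N0}"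
  have contN: "continuous_on UNIV (\<lambda>x. \<Theta> (x - p))"
    by (intro continuous_intros bounded_linear.continuous_on[OF bl\<Theta>])
  have openN: "open N" using open_vimage[OF N0(1) contN] by (simp add: N_def vimage_def)
  have recenter: "p + \<Phi> (\<Theta> (x - p)) = x" for x by (simp add: \<Theta>\<Phi>)
  show ?thesis
  proof (rule that[of N "\<lambda>x. \<psi>0 (\<Theta> (x - p))"])
    show "p \<in> N" using N0(2) linear_0[OF \<Theta>] by (simp add: N_def zero_prod_def)
    show "N \<subseteq> U"
    proof
      fix x assume "x \<in> N"
      then have "\<Theta> (x - p) \<in> S" using N0(3) by (auto simp: N_def)
      then show "x \<in> U" using N1(3) recenter by (auto simp: S_def)
    qed
    have "smooth_on N (\<lambda>x. \<Theta> (x - p))"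
      by (rule smooth_on_linear_image[OF bl\<Theta> openN]) (intro smooth_on_diff smooth_on_ident smooth_on_const openN)
    then show "smooth_on N (\<lambda>x. \<psi>0 (\<Theta> (x - p)))"
      by (rule smooth_on_compose[OF openN _ \<psi>0]) (auto simp: N_def)
    fix x v assume x: "x \<in> N"
    let ?q = "\<Theta> (x - p)"
    have q: "?q \<in> N0" using x by (simp add: N_def)
    have xN1: "x \<in> N1" using q N0(3) recenter by (auto simp: S_def)
    have "((\<lambda>x. \<Theta> (x - p)) has_derivative \<Theta>) (at x)"
      by (auto intro!: derivative_eq_intros bounded_linear.has_derivative[OF bl\<Theta>])
    from has_derivative_compose[OF this smooth_on_has_derivative[OF \<psi>0 q]]
    have "fder (\<lambda>x. \<psi>0 (\<Theta> (x - p))) x v = fder \<psi>0 ?q (\<Theta> v)" by (simp add: fder_eq)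
    also have "\<dots> = 0 \<longleftrightarrow> \<Theta> v = (fst (\<Theta> v), f ?q (fst (\<Theta> v)))" by (simp add: ker[OF q] prod_eq_iff)
    also have "\<dots> \<longleftrightarrow> v = \<zeta> x (fst (\<Theta> v))"
      using \<Phi>f[of ?q "fst (\<Theta> v)"] q N0(3) recenter[of x] \<Theta>\<Phi> by (metis subsetD)
    also have "\<dots> \<longleftrightarrow> v \<in> range (\<Xi> x)" using \<zeta>range[OF xN1] by simp
    finally show "fder (\<lambda>x. \<psi>0 (\<Theta> (x - p))) x v = 0 \<longleftrightarrow> v \<in> range (\<Xi> x)" .
  qed (use openN in auto)
qed

section \<open>Frames\<close>

abbreviation span_at :: "'e::euclidean_space vfield list \<Rightarrow> 'e \<Rightarrow> 'e set" where
  "span_at Xs x \<equiv> span (set (map (\<lambda>X. X x) Xs))"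

definition indep_at :: "'e::euclidean_space vfield list \<Rightarrow> 'e \<Rightarrow> bool" where
  "indep_at Xs x \<longleftrightarrow> distinct (map (\<lambda>X. X x) Xs) \<and> independent (set (map (\<lambda>X. X x) Xs))"

lemma local_frame_iff:
  "local_frame U E Xs \<longleftrightarrow> open U \<and> (\<forall>X\<in>set Xs. smooth_on U X) \<and> (\<forall>x\<in>U. indep_at Xs x \<and> span_at Xs x = E x)"
  by (auto simp: local_frame_def indep_at_def)

lemma indep_atD:
  assumes "indep_at Xs x" "(\<Sum>i<length Xs. c i *\<^sub>R (Xs ! i) x) = 0" "i < length Xs"
  shows "c i = 0"
proof -
  let ?f = "\<lambda>i. (Xs ! i) x"
  have inj: "inj_on ?f {..<length Xs}"
    using assms(1) unfolding indep_at_def distinct_conv_nth by (auto intro!: inj_onI)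
  have img: "set (map (\<lambda>X. X x) Xs) = ?f ` {..<length Xs}"
    using image_image[of "\<lambda>X. X x" "(!) Xs" "{..<length Xs}"] by (simp add: lessThan_atLeast0 nth_image)
  let ?g = "inv_into {..<length Xs} ?f"
  have "(\<Sum>v\<in>?f ` {..<length Xs}. c (?g v) *\<^sub>R v) = 0"
    using assms(2) by (simp add: sum.reindex[OF inj] inv_into_f_f[OF inj])
  then have "c (?g (?f i)) = 0"
    using assms(1,3) unfolding indep_at_def img
    by (intro independentD[where u="\<lambda>v. c (?g v)" and t="?f ` {..<length Xs}"]) auto
  then show ?thesis using assms(3) by (simp add: inv_into_f_f[OF inj])
qed

lemma indep_atI:
  assumes "\<And>c i. (\<Sum>i<length Xs. c i *\<^sub>R (Xs ! i) x) = 0 \<Longrightarrow> i < length Xs \<Longrightarrow> c i = 0"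
  shows "indep_at Xs x"
proof -
  let ?f = "\<lambda>i. (Xs ! i) x"
  let ?I = "{..<length Xs}"
  have inj: "inj_on ?f ?I"
  proof (rule inj_onI, rule ccontr)
    fix i j assume ij: "i \<in> ?I" "j \<in> ?I" "?f i = ?f j" "i \<noteq> j"
    define c where "c k = (if k = i then 1 else if k = j then -1 else (0::real))" for k
    have "(\<Sum>k\<in>?I. c k *\<^sub>R ?f k) = (\<Sum>k\<in>{i,j}. c k *\<^sub>R ?f k)"
      by (rule sum.mono_neutral_right) (use ij in \<open>auto simp: c_def\<close>)
    also have "\<dots> = 0" using ij by (simp add: c_def)
    finally show False using assms[of c i] ij by (simp add: c_def)
  qed
  have img: "set (map (\<lambda>X. X x) Xs) = ?f ` ?I"
    using image_image[of "\<lambda>X. X x" "(!) Xs" "{..<length Xs}"] by (simp add: lessThan_atLeast0 nth_image)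
  have "independent (?f ` ?I)"
  proof (rule independent_if_scalars_zero)
    fix g v assume g: "(\<Sum>v\<in>?f ` ?I. g v *\<^sub>R v) = 0" "v \<in> ?f ` ?I"
    then show "g v = 0" using assms[of "\<lambda>i. g (?f i)"] by (auto simp: sum.reindex[OF inj])
  qed simp
  moreover have "distinct (map (\<lambda>X. X x) Xs)"
    using inj by (auto simp: distinct_conv_nth inj_on_def)
  ultimately show ?thesis unfolding indep_at_def img by (rule conjI[rotated])
qed

lemma span_at_iff: "v \<in> span_at Xs x \<longleftrightarrow> (\<exists>c. v = (\<Sum>i<length Xs. c i *\<^sub>R (Xs ! i) x))"
proof (induction Xs arbitrary: v)
  case Nil
  then show ?case by simp
next
  case (Cons X Xs)
  have "v \<in> span_at (X # Xs) x \<longleftrightarrow> (\<exists>k c. v - k *\<^sub>R X x = (\<Sum>i<length Xs. c i *\<^sub>R (Xs ! i) x))"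
    using Cons.IH by (simp add: span_breakdown_eq)
  also have "\<dots> \<longleftrightarrow> (\<exists>c. v = (\<Sum>i<length (X # Xs). c i *\<^sub>R ((X # Xs) ! i) x))"
  proof
    assume "\<exists>k c. v - k *\<^sub>R X x = (\<Sum>i<length Xs. c i *\<^sub>R (Xs ! i) x)"
    then obtain k c where "v - k *\<^sub>R X x = (\<Sum>i<length Xs. c i *\<^sub>R (Xs ! i) x)" by blast
    then show "\<exists>c. v = (\<Sum>i<length (X # Xs). c i *\<^sub>R ((X # Xs) ! i) x)"
      by (intro exI[of _ "case_nat k c"]) (simp add: sum.lessThan_Suc_shift algebra_simps del: sum.lessThan_Suc)
  next
    assume "\<exists>c. v = (\<Sum>i<length (X # Xs). c i *\<^sub>R ((X # Xs) ! i) x)"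
    then obtain c where "v = (\<Sum>i<length (X # Xs). c i *\<^sub>R ((X # Xs) ! i) x)" by blast
    then show "\<exists>k c. v - k *\<^sub>R X x = (\<Sum>i<length Xs. c i *\<^sub>R (Xs ! i) x)"
      by (intro exI[of _ "c 0"] exI[of _ "\<lambda>i. c (Suc i)"])
        (simp add: sum.lessThan_Suc_shift algebra_simps del: sum.lessThan_Suc)
  qed
  finally show ?case .
qed

lemma dim_span_at: "indep_at Xs x \<Longrightarrow> dim (span_at Xs x) = length Xs"
  unfolding indep_at_def
  by (metis dim_span_eq_card_independent distinct_card length_map)

lemma dim_span_at_le: "dim (span_at Xs x) \<le> length Xs"
  by (metis List.finite_set card_length dim_le_card' dim_span length_map order_trans)

lemma indep_at_of_dim:
  assumes "dim (span_at Xs x) = length Xs"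
  shows "indep_at Xs x"
proof -
  let ?B = "set (map (\<lambda>X. X x) Xs)"
  have "length Xs \<le> card ?B" using assms dim_le_card'[of ?B] by (metis List.finite_set dim_span)
  moreover have "card ?B \<le> length Xs" by (metis card_length length_map)
  ultimately have c: "card ?B = length Xs" by simp
  then have "distinct (map (\<lambda>X. X x) Xs)" by (intro card_distinct) simp
  moreover have "independent ?B"
  proof -
    have "card ?B = dim (span ?B)" using c assms by (simp only:)
    from card_eq_dim[OF span_superset this List.finite_set] show ?thesis by blast
  qed
  ultimately show ?thesis by (simp add: indep_at_def)
qed

lemma indep_at_Cons_notin:
  assumes "indep_at Xs x" "X x \<notin> span_at Xs x"
  shows "indep_at (X # Xs) x"
proof -
  have "X x \<notin> set (map (\<lambda>X. X x) Xs)" using assms(2) span_base by blast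
  then show ?thesis using assms by (simp add: indep_at_def independent_insert)
qed

text \<open>Dual one-forms of a frame that need not span the whole space: only their values on its
  span are prescribed.\<close>

definition coframe_on :: "'e::euclidean_space set \<Rightarrow> 'e vfield list \<Rightarrow> (nat \<Rightarrow> 'e \<Rightarrow> 'e \<Rightarrow> real) \<Rightarrow> bool" where
  "coframe_on N Xs \<phi> \<longleftrightarrow> open N \<and> (\<forall>i. \<forall>x\<in>N. linear (\<phi> i x)) \<and> (\<forall>i v. smooth_on N (\<lambda>x. \<phi> i x v)) \<and>
    (\<forall>i<length Xs. \<forall>x\<in>N. \<forall>c. \<phi> i x (\<Sum>j<length Xs. c j *\<^sub>R (Xs ! j) x) = c i)"

lemma coframe_onD:
  assumes "coframe_on N Xs \<phi>"
  shows "open N" "x \<in> N \<Longrightarrow> linear (\<phi> i x)" "smooth_on N (\<lambda>x. \<phi> i x v)"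
    "i < length Xs \<Longrightarrow> x \<in> N \<Longrightarrow> \<phi> i x (\<Sum>j<length Xs. c j *\<^sub>R (Xs ! j) x) = c i"
  using assms by (auto simp: coframe_on_def)

lemma coframe_on_indep_at:
  assumes "coframe_on N Xs \<phi>" "x \<in> N"
  shows "indep_at Xs x"
proof (rule indep_atI)
  fix c i assume "(\<Sum>i<length Xs. c i *\<^sub>R (Xs ! i) x) = 0" "i < length Xs"
  then show "c i = 0"
    using coframe_onD(4)[OF assms(1) _ assms(2), of i c] linear_0[OF coframe_onD(2)[OF assms]] by metis
qed

lemma coframe_on_expansion:
  assumes "coframe_on N Xs \<phi>" "x \<in> N" "v \<in> span_at Xs x"
  shows "v = (\<Sum>i<length Xs. \<phi> i x v *\<^sub>R (Xs ! i) x)"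
proof -
  obtain c where c: "v = (\<Sum>i<length Xs. c i *\<^sub>R (Xs ! i) x)" using span_at_iff[of v x Xs] assms(3) by blast
  have "\<phi> i x v = c i" if "i < length Xs" for i unfolding c by (rule coframe_onD(4)[OF assms(1) that assms(2)])
  then show ?thesis using c by simp
qed

lemma smooth_on_coframe:
  assumes "coframe_on N Xs \<phi>" "smooth_on N X"
  shows "smooth_on N (\<lambda>x. \<phi> i x (X x))"
  by (rule smooth_on_apply_linear[where L="\<phi> i" and g=X, OF coframe_onD(1)[OF assms(1)] coframe_onD(2)[OF assms(1)]
        coframe_onD(3)[OF assms(1)] assms(2)])

lemma exists_coframe_on:
  fixes Xs :: "'e::euclidean_space vfield list"
  assumes indep: "indep_at Xs x0" and U: "open U" "x0 \<in> U" and smooth: "\<And>X. X \<in> set Xs \<Longrightarrow> smooth_on U X"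
  obtains N \<phi> where "x0 \<in> N" "N \<subseteq> U" "coframe_on N Xs \<phi>"
proof -
  have sm: "smooth_on U (Xs ! i)" if "i \<in> {..<length Xs}" for i using smooth that by auto
  have ind: "\<forall>c. (\<Sum>i\<in>{..<length Xs}. c i *\<^sub>R (Xs ! i) x0) = 0 \<longrightarrow> (\<forall>i\<in>{..<length Xs}. c i = 0)"
    using indep_atD[OF indep] by auto
  obtain N \<phi> where N: "open N" "x0 \<in> N" "N \<subseteq> U"
    and lin: "\<And>i x. x \<in> N \<Longrightarrow> linear (\<phi> i x :: 'e \<Rightarrow> real)" and s: "\<And>i v. smooth_on N (\<lambda>x. \<phi> i x v)"
    and d: "\<And>i j x. i \<in> {..<length Xs} \<Longrightarrow> j \<in> {..<length Xs} \<Longrightarrow> x \<in> N \<Longrightarrow> \<phi> i x ((Xs ! j) x) = (if i = j then 1 else 0)"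
    using dual_coframe[where \<xi>="\<lambda>i. Xs ! i" and I="{..<length Xs}", OF finite_lessThan U sm ind] by metis
  have e: "\<phi> i x (\<Sum>j<length Xs. c j *\<^sub>R (Xs ! j) x) = c i" if "i < length Xs" "x \<in> N" for i x c
  proof -
    have "\<phi> i x (\<Sum>j<length Xs. c j *\<^sub>R (Xs ! j) x) = (\<Sum>j<length Xs. c j *\<^sub>R \<phi> i x ((Xs ! j) x))"
      using that by (simp add: linear_sum[OF lin] linear_cmul[OF lin])
    also have "\<dots> = (\<Sum>j<length Xs. if i = j then c j else 0)"
      by (rule sum.cong) (use d that in auto)
    finally show ?thesis using that by simp
  qed
  show ?thesis
    by (rule that[of N \<phi>]) (use N lin s e in \<open>auto simp: coframe_on_def\<close>)
qed

text \<open>A coframe reads off the coefficients of \<open>X\<close> and \<open>Y\<close>, which are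
  thereby smooth, so that membership in \<open>V\<close> need only be checked on the
  generators.\<close>

lemma lie_bracket_frame_sections:
  assumes V: "subspace V" and U: "open U" "x \<in> U"
    and Rs: "\<And>R. R \<in> set Rs \<Longrightarrow> smooth_on U R" "indep_at Rs x"
    and Ss: "\<And>S. S \<in> set Ss \<Longrightarrow> smooth_on U S" "indep_at Ss x"
    and X: "smooth_on U X" "\<And>y. y \<in> U \<Longrightarrow> X y \<in> span_at Rs y"
    and Y: "smooth_on U Y" "\<And>y. y \<in> U \<Longrightarrow> Y y \<in> span_at Ss y"
    and mem: "\<And>R. R \<in> set Rs \<Longrightarrow> R x \<in> V" "\<And>S. S \<in> set Ss \<Longrightarrow> S x \<in> V"
      "\<And>R S. R \<in> set Rs \<Longrightarrow> S \<in> set Ss \<Longrightarrow> lie_bracket R S x \<in> V"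
  shows "lie_bracket X Y x \<in> V"
proof -
  obtain N \<phi> where N: "x \<in> N" "N \<subseteq> U" and \<phi>: "coframe_on N Rs \<phi>"
    using exists_coframe_on[OF Rs(2) U Rs(1)] by metis
  obtain M \<psi> where M: "x \<in> M" "M \<subseteq> U" and \<psi>: "coframe_on M Ss \<psi>"
    using exists_coframe_on[OF Ss(2) U Ss(1)] by metis
  show ?thesis
  proof (rule lie_bracket_in_subspace[where I="{..<length Rs}" and J="{..<length Ss}" and R="\<lambda>i. Rs ! i" and S="\<lambda>i. Ss ! i"
        and b="\<lambda>i y. \<phi> i y (X y)" and c="\<lambda>i y. \<psi> i y (Y y)" and N="N \<inter> M", OF V])
    show "X y = (\<Sum>i<length Rs. \<phi> i y (X y) *\<^sub>R (Rs ! i) y)" if "y \<in> N \<inter> M" for y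
      using coframe_on_expansion[OF \<phi> _ X(2)] that N(2) by blast
    show "Y y = (\<Sum>i<length Ss. \<psi> i y (Y y) *\<^sub>R (Ss ! i) y)" if "y \<in> N \<inter> M" for y
      using coframe_on_expansion[OF \<psi> _ Y(2)] that M(2) by blast
    show "(\<lambda>y. \<phi> i y (X y)) differentiable at x" for i
      by (rule smooth_on_differentiable[OF smooth_on_coframe[OF \<phi> smooth_on_subset[OF X(1) N(2)]] N(1)])
    show "(\<lambda>y. \<psi> i y (Y y)) differentiable at x" for i
      by (rule smooth_on_differentiable[OF smooth_on_coframe[OF \<psi> smooth_on_subset[OF Y(1) M(2)]] M(1)])
    show "open (N \<inter> M)" using coframe_onD(1)[OF \<phi>] coframe_onD(1)[OF \<psi>] by (rule open_Int)
    show "(Rs ! i) differentiable at x" if "i \<in> {..<length Rs}" for i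
      by (rule smooth_on_differentiable[OF Rs(1) U(2)]) (use that in simp)
    show "(Ss ! i) differentiable at x" if "i \<in> {..<length Ss}" for i
      by (rule smooth_on_differentiable[OF Ss(1) U(2)]) (use that in simp)
  qed (use N M mem in auto)
qed

text \<open>Let \<open>Q y\<close> be linear with kernel \<open>E y\<close>, and let
  \<open>B\<close> be its derivative in the base point at \<open>x\<close>. Differentiating
  \<open>Q X = 0\<close> and \<open>Q Y = 0\<close> expresses \<open>Q [X, Y]\<close> as
  \<open>B (Y, X) - B (X, Y)\<close>. On an integral surface the second derivatives of the
  parametrisation are symmetric, which makes \<open>B\<close> symmetric on
  \<open>E x\<close>.\<close>

lemma integrable2_involutive:
  fixes E :: "'e::euclidean_space distrib"
  assumes int: "integrable2_on \<Omega> E" and fr: "local_frame U E [X, Y]" and "U \<subseteq> \<Omega>" and x: "x \<in> U"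
  shows "lie_bracket X Y x \<in> span_at [X, Y] x"
proof -
  have U: "open U" and smooth: "smooth_on U X" "smooth_on U Y" and indep: "indep_at [X, Y] x"
    and E: "\<And>y. y \<in> U \<Longrightarrow> span_at [X, Y] y = E y"
    using fr x by (auto simp: local_frame_iff)
  have smooth': "smooth_on U Z" if "Z \<in> set [X, Y]" for Z using smooth that by auto
  obtain N \<phi> where N': "x \<in> N" "N \<subseteq> U" and cof: "coframe_on N [X, Y] \<phi>"
    using exists_coframe_on[OF indep U x smooth'] by metis
  note N = coframe_onD(1)[OF cof] N' and \<phi> = coframe_onD(2,3)[OF cof] and exp = coframe_on_expansion[OF cof]
  define Q where "Q y v = v - (\<phi> 0 y v *\<^sub>R X y + \<phi> 1 y v *\<^sub>R Y y)" for y v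
  have Q0: "Q y v = 0 \<longleftrightarrow> v \<in> E y" if "y \<in> N" for y v
  proof
    assume "Q y v = 0"
    then have "v = \<phi> 0 y v *\<^sub>R X y + \<phi> 1 y v *\<^sub>R Y y" by (simp add: Q_def)
    then have "v \<in> span_at [X, Y] y"
      by (metis insertI1 insertI2 list.simps(15) list.simps(9) span_add span_base span_scale)
    then show "v \<in> E y" using E that N(3) by auto
  next
    assume "v \<in> E y"
    then show "Q y v = 0" using exp[OF that, of v] E[of y] that N(3) by (auto simp: Q_def numeral_2_eq_2)
  qed
  have linQ: "linear (Q y)" if "y \<in> N" for y
    unfolding Q_def
    by (intro linearI) (simp_all add: linear_add[OF \<phi>(1)[OF that]] linear_cmul[OF \<phi>(1)[OF that]] algebra_simps)
  have smN: "smooth_on N X" "smooth_on N Y" using smooth smooth_on_subset N(3) by blast+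
  have smoothQ: "smooth_on N (\<lambda>y. Q y v)" for v
    unfolding Q_def by (intro smooth_on_diff smooth_on_const smooth_on_add smooth_on_scaleR \<phi> smN N)
  define B where "B u v = fder (\<lambda>y. Q y v) x u" for u v
  have dQ: "B u (Z x) + Q x (fder Z x u) = 0" if Z: "smooth_on N Z" "\<And>y. y \<in> N \<Longrightarrow> Z y \<in> E y" for Z u
  proof -
    have "((\<lambda>y. Q y (Z y)) has_derivative (\<lambda>d. fder (\<lambda>q. Q q (Z x)) x d + Q x (fder Z x d))) (at x)"
      by (rule apply_linear_has_derivative[OF N(1) linQ smoothQ has_derivative_ident smooth_on_has_derivative[OF Z(1) N(2)] N(2)])
    moreover have "((\<lambda>y. Q y (Z y)) has_derivative (\<lambda>d. 0)) (at x)"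
      by (subst has_derivative_cong_open[OF N(1,2), of _ "\<lambda>_. 0"]) (use Q0 Z in auto)
    ultimately have "(\<lambda>d. fder (\<lambda>q. Q q (Z x)) x d + Q x (fder Z x d)) = (\<lambda>d. 0)"
      by (rule has_derivative_unique)
    then show ?thesis unfolding B_def by metis
  qed
  have "x \<in> \<Omega>" using x \<open>U \<subseteq> \<Omega>\<close> by auto
  from bspec[OF int[unfolded integrable2_on_def] this]
  obtain W \<sigma> where W: "open W" "(0::real^2) \<in> W" "smooth_on W \<sigma>" "\<sigma> ` W \<subseteq> \<Omega>" "\<sigma> 0 = x"
    "\<And>s. s \<in> W \<Longrightarrow> range (fder \<sigma> s) = E (\<sigma> s)"
    by (elim exE conjE) (rule that, assumption+, drule bspec, assumption+)
  define W' where "W' = {s\<in>W. \<sigma> s \<in> N}"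
  have W': "open W'" "0 \<in> W'" "W' \<subseteq> W"
    using continuous_open_preimage[OF smooth_on_imp_continuous_on[OF W(3)] W(1) N(1)] W(2,5) N(2)
    by (auto simp: W'_def vimage_def Collect_conj_eq)
  have sW': "smooth_on W' \<sigma>" by (rule smooth_on_subset[OF W(3) W'(3)])
  have tang: "fder \<sigma> s e \<in> E (\<sigma> s)" if "s \<in> W'" for s e
    using W(6)[of s] that W'(3) by blast
  \<comment> \<open>The tangent vectors of the surface lie in \<open>E\<close>, so
    \<open>Q (\<sigma> s) (fder \<sigma> s e)\<close> vanishes identically near 0 and may be
    differentiated.\<close>
  have sym: "B (fder \<sigma> 0 d) (fder \<sigma> 0 e) + Q x (fder (\<lambda>s. fder \<sigma> s e) 0 d) = 0" for d e
  proof -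
    have "((\<lambda>s. Q (\<sigma> s) (fder \<sigma> s e)) has_derivative
        (\<lambda>d. fder (\<lambda>q. Q q (fder \<sigma> 0 e)) (\<sigma> 0) (fder \<sigma> 0 d) + Q (\<sigma> 0) (fder (\<lambda>s. fder \<sigma> s e) 0 d))) (at 0)"
      by (rule apply_linear_has_derivative[OF N(1) linQ smoothQ smooth_on_has_derivative[OF sW' W'(2)]
            smooth_on_has_derivative[OF smooth_on_fder_const[OF sW'] W'(2)]]) (use W(5) N(2) in auto)
    moreover have "((\<lambda>s. Q (\<sigma> s) (fder \<sigma> s e)) has_derivative (\<lambda>d. 0)) (at 0)"
      by (subst has_derivative_cong_open[OF W'(1,2), of _ "\<lambda>_. 0"]) (use Q0 tang in \<open>auto simp: W'_def\<close>)
    ultimately have "(\<lambda>d. fder (\<lambda>q. Q q (fder \<sigma> 0 e)) (\<sigma> 0) (fder \<sigma> 0 d) + Q (\<sigma> 0) (fder (\<lambda>s. fder \<sigma> s e) 0 d)) = (\<lambda>d. 0)"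
      by (rule has_derivative_unique)
    then show ?thesis unfolding B_def W(5) by metis
  qed
  have XE: "X y \<in> E y" "Y y \<in> E y" if "y \<in> N" for y
    using E[of y] that N(3) by (auto intro: span_base)
  obtain d e where de: "X x = fder \<sigma> 0 d" "Y x = fder \<sigma> 0 e"
    using XE[OF N(2)] W(6)[OF W(2)] W(5) by (metis image_iff)
  have "B (X x) (Y x) = B (Y x) (X x)"
    using sym[of d e] sym[of e d] symmetric_second_derivative[OF W'(1,2) sW', of d e] by (simp add: de add_eq_0_iff)
  then have "Q x (fder Y x (X x)) - Q x (fder X x (Y x)) = 0"
    using dQ[OF smN(2) XE(2), of "X x"] dQ[OF smN(1) XE(1), of "Y x"] by (simp add: add_eq_0_iff)
  then have "Q x (lie_bracket X Y x) = 0"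
    by (simp add: lie_bracket_def linear_diff[OF linQ[OF N(2)]])
  then show ?thesis using Q0[OF N(2)] E[OF x] by simp
qed

section \<open>The structure of a degenerated parabolic distribution\<close>

abbreviation five :: "'e::euclidean_space vfield \<Rightarrow> 'e vfield \<Rightarrow> 'e vfield \<Rightarrow> 'e vfield list" where
  "five X1 X2 Y \<equiv> [X1, X2, Y, lie_bracket Y X1, lie_bracket Y X2]"

text \<open>What is retained of a degenerated parabolic distribution, in terms of a frame: growth to
  rank five, involutivity of the rank two part, vanishing of the structure matrix, and, in the
  negated clause, that bracketing once more leaves the rank five distribution.\<close>

definition structural ::
  "'e::euclidean_space set \<Rightarrow> 'e vfield \<Rightarrow> 'e vfield \<Rightarrow> 'e vfield \<Rightarrow> bool" where
  "structural U X1 X2 Y \<longleftrightarrow> open U \<and> smooth_on U X1 \<and> smooth_on U X2 \<and> smooth_on U Y \<and>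
     (\<forall>x\<in>U. indep_at (five X1 X2 Y) x \<and> lie_bracket X1 X2 x \<in> span_at [X1, X2] x \<and>
        (\<forall>X\<in>{X1, X2}. \<forall>Z\<in>{X1, X2}. lie_bracket X (lie_bracket Y Z) x \<in> span_at (five X1 X2 Y) x) \<and>
        \<not> (lie_bracket Y (lie_bracket Y X1) x \<in> span_at (five X1 X2 Y) x \<and>
           lie_bracket Y (lie_bracket Y X2) x \<in> span_at (five X1 X2 Y) x))"

lemma lie_bracket_self [simp]: "lie_bracket X X x = 0"
  by (simp add: lie_bracket_def)

lemma dist_bracket_lie_bracket:
  "open U \<Longrightarrow> x \<in> U \<Longrightarrow> section_on U A X \<Longrightarrow> section_on U B Y \<Longrightarrow> lie_bracket X Y x \<in> dist_bracket A B x"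
  unfolding dist_bracket_def by (intro span_base) blast

lemma dist_bracket_subset:
  assumes "subspace V" "A x \<subseteq> V" "B x \<subseteq> V"
    "\<And>U X Y. open U \<Longrightarrow> x \<in> U \<Longrightarrow> section_on U A X \<Longrightarrow> section_on U B Y \<Longrightarrow> lie_bracket X Y x \<in> V"
  shows "dist_bracket A B x \<subseteq> V"
  unfolding dist_bracket_def by (rule span_minimal) (use assms in auto)

lemma dist_bracket_superset: "A x \<subseteq> dist_bracket A B x"
  unfolding dist_bracket_def using span_superset by fast

lemma subspace_dist_bracket: "subspace (dist_bracket A B x)"
  unfolding dist_bracket_def by (rule subspace_span)

lemma span_atI: "X \<in> set Xs \<Longrightarrow> X x \<in> span_at Xs x"
  by (auto intro: span_base)

lemma span_at_mono: "set Xs \<subseteq> set Ys \<Longrightarrow> span_at Xs x \<subseteq> span_at Ys x"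
  by (intro span_mono) auto

text \<open>Since \<open>[X1, X2]\<close> is already in \<open>D\<close>, the brackets of the frame
  of \<open>D\<close> contribute only the two fields \<open>[Y, X_i]\<close>. The five generators
  span a space of dimension five, so they are independent.\<close>

lemma dist_bracket_DD:
  assumes dim5: "dim (dist_bracket D D x) = 5"
    and D2: "dist_bracket D2 D2 x \<subseteq> D x"
    and f2: "local_frame U D2 [X1, X2]" and f3: "local_frame U D [X1, X2, Y]" and x: "x \<in> U"
  shows "dist_bracket D D x = span_at (five X1 X2 Y) x" "indep_at (five X1 X2 Y) x"
proof -
  have U: "open U" and sm: "smooth_on U X1" "smooth_on U X2" "smooth_on U Y"
    and i3: "indep_at [X1, X2, Y] x" and D: "\<And>y. y \<in> U \<Longrightarrow> D y = span_at [X1, X2, Y] y"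
    and D2': "\<And>y. y \<in> U \<Longrightarrow> D2 y = span_at [X1, X2] y"
    using f2 f3 x by (auto simp: local_frame_iff)
  let ?V = "span_at (five X1 X2 Y) x"
  have sub: "D x \<subseteq> ?V" unfolding D[OF x] by (rule span_at_mono) auto
  have sec: "section_on U D Z" if "Z \<in> {X1, X2, Y}" for Z
    unfolding section_on_def using that sm D by (auto intro: span_base)
  have sec2: "section_on U D2 Z" if "Z \<in> {X1, X2}" for Z
    unfolding section_on_def using that sm D2' by (auto intro: span_base)
  have b12: "lie_bracket X1 X2 x \<in> ?V"
    using dist_bracket_lie_bracket[OF U x sec2 sec2, of X1 X2] D2 sub by blast
  have b21: "lie_bracket X2 X1 x \<in> ?V"
    using dist_bracket_lie_bracket[OF U x sec2 sec2, of X2 X1] D2 sub by blast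
  have bY: "lie_bracket Y X1 x \<in> ?V" "lie_bracket Y X2 x \<in> ?V"
    by (auto intro: span_base)
  then have bY': "lie_bracket X1 Y x \<in> ?V" "lie_bracket X2 Y x \<in> ?V"
    unfolding lie_bracket_skew[of _ Y x] by (auto intro: span_neg)
  have "dist_bracket D D x \<subseteq> ?V"
  proof (rule dist_bracket_subset[where A=D and B=D and x=x, OF subspace_span sub sub])
    fix U' S T assume U': "open U'" "x \<in> U'" and ST: "section_on U' D S" "section_on U' D T"
    show "lie_bracket S T x \<in> ?V"
    proof (rule lie_bracket_frame_sections[OF subspace_span, where U="U \<inter> U'" and Rs="[X1, X2, Y]" and Ss="[X1, X2, Y]"])
      show "smooth_on (U \<inter> U') R" if "R \<in> set [X1, X2, Y]" for R
        using that sm smooth_on_subset by fastforce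
      then show "smooth_on (U \<inter> U') R" if "R \<in> set [X1, X2, Y]" for R using that .
      show "smooth_on (U \<inter> U') S" "smooth_on (U \<inter> U') T"
        using ST by (auto simp: section_on_def intro: smooth_on_subset)
      show "S y \<in> span_at [X1, X2, Y] y" "T y \<in> span_at [X1, X2, Y] y" if "y \<in> U \<inter> U'" for y
        using ST that D[of y] by (auto simp: section_on_def)
      show "R x \<in> ?V" if "R \<in> set [X1, X2, Y]" for R using that by (auto intro: span_base)
      then show "R x \<in> ?V" if "R \<in> set [X1, X2, Y]" for R using that .
      show "lie_bracket R S x \<in> ?V" if "R \<in> set [X1, X2, Y]" "S \<in> set [X1, X2, Y]" for R S
        using that b12 b21 bY bY' by (auto simp: span_0)
    qed (use U U' x i3 in auto)
  qed
  moreover have "?V \<subseteq> dist_bracket D D x"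
  proof (rule span_minimal[OF _ subspace_dist_bracket])
    have "Z x \<in> dist_bracket D D x" if "Z \<in> {X1, X2, Y}" for Z
      using dist_bracket_superset[of D x D] sec[OF that] x by (auto simp: section_on_def)
    moreover have "lie_bracket Y Z x \<in> dist_bracket D D x" if "Z \<in> {X1, X2}" for Z
      using that by (intro dist_bracket_lie_bracket[OF U x] sec) auto
    ultimately show "set (map (\<lambda>X. X x) (five X1 X2 Y)) \<subseteq> dist_bracket D D x" by auto
  qed
  ultimately show eq: "dist_bracket D D x = ?V" by blast
  show "indep_at (five X1 X2 Y) x" by (rule indep_at_of_dim) (use dim5 eq in simp)
qed

text \<open>The definite description carries information only after unique existence is shown:
  \<open>Z x\<close> completes the five fields to a basis, so the coefficient exists and is
  determined.\<close>

lemma structure_matrix_zero: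
  fixes D :: "(real^6) distrib" and X :: "2 \<Rightarrow> (real^6) vfield"
  assumes D5: "dist_bracket D D x = span_at (five (X 1) (X 2) Y) x"
    and fr: "indep_at [X 1, X 2, Y, lie_bracket Y (X 1), lie_bracket Y (X 2), Z] x"
    and z: "structure_matrix D X Y Z x = 0"
  shows "lie_bracket (X i) (lie_bracket Y (X j)) x \<in> span_at (five (X 1) (X 2) Y) x"
proof -
  let ?V = "span_at (five (X 1) (X 2) Y) x" and ?w = "lie_bracket (X i) (lie_bracket Y (X j)) x"
  have d6: "dim (span_at [X 1, X 2, Y, lie_bracket Y (X 1), lie_bracket Y (X 2), Z] x) = 6"
    using dim_span_at[OF fr] by simp
  then have "dim (span_at [X 1, X 2, Y, lie_bracket Y (X 1), lie_bracket Y (X 2), Z] x) = DIM(real^6)" by simp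
  then have "span_at [X 1, X 2, Y, lie_bracket Y (X 1), lie_bracket Y (X 2), Z] x = UNIV"
    unfolding dim_eq_full span_span .
  moreover have "set (map (\<lambda>X. X x) [X 1, X 2, Y, lie_bracket Y (X 1), lie_bracket Y (X 2), Z])
      = insert (Z x) (set (map (\<lambda>X. X x) (five (X 1) (X 2) Y)))" by auto
  ultimately have "?w \<in> span (insert (Z x) (set (map (\<lambda>X. X x) (five (X 1) (X 2) Y))))" by (metis UNIV_I)
  then obtain k where k: "?w - k *\<^sub>R Z x \<in> ?V" unfolding span_breakdown_eq by blast
  have "Z x \<notin> ?V"
  proof
    assume "Z x \<in> ?V"
    then have "span_at [X 1, X 2, Y, lie_bracket Y (X 1), lie_bracket Y (X 2), Z] x \<subseteq> ?V"
      by (intro span_minimal) (auto intro: span_base)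
    then have "6 \<le> dim ?V" unfolding d6[symmetric] by (rule dim_subset)
    then show False using dim_span_at_le[of x "five (X 1) (X 2) Y"] by simp
  qed
  then have uniq: "a = k" if "?w - a *\<^sub>R Z x \<in> ?V" for a
  proof (rule contrapos_np)
    assume "a \<noteq> k"
    have "(?w - k *\<^sub>R Z x) - (?w - a *\<^sub>R Z x) \<in> ?V" by (rule span_diff[OF k that])
    then have "(a - k) *\<^sub>R Z x \<in> ?V" by (simp add: algebra_simps)
    then have "inverse (a - k) *\<^sub>R ((a - k) *\<^sub>R Z x) \<in> ?V" by (rule span_scale)
    then show "Z x \<in> ?V" using \<open>a \<noteq> k\<close> by simp
  qed
  have "(THE a. ?w - a *\<^sub>R Z x \<in> ?V) = k" using k uniq by (rule the_equality)
  moreover have "(THE a. ?w - a *\<^sub>R Z x \<in> ?V) = structure_matrix D X Y Z x $ i $ j"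
    unfolding structure_matrix_def D5 by simp
  ultimately have "k = 0" using z by simp
  then show ?thesis using k by simp
qed

text \<open>The frame is arbitrary, because the result is applied both before and after the
  rescaling of \<open>Y\<close>.\<close>

theorem degenerated_parabolic_structural:
  fixes D :: "(real^6) distrib"
  assumes D: "distribution_356_on \<Omega> D" and D2: "is_D2_on \<Omega> D D2" and int: "integrable2_on \<Omega> D2"
    and par: "\<And>U X Y Z x. U \<subseteq> \<Omega> \<Longrightarrow> adapted_frame U D D2 X Y Z \<Longrightarrow> x \<in> U \<Longrightarrow> structure_matrix D X Y Z x = 0"
    and U\<Omega>: "U \<subseteq> \<Omega>" and f2: "local_frame U D2 [X1, X2]" and f3: "local_frame U D [X1, X2, Y]"
  shows "structural U X1 X2 Y"
proof -
  have U: "open U" and sm: "smooth_on U X1" "smooth_on U X2" "smooth_on U Y"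
    and Dsp: "\<And>y. y \<in> U \<Longrightarrow> D y = span_at [X1, X2, Y] y"
    using f2 f3 by (auto simp: local_frame_iff)
  let ?L = "five X1 X2 Y"
  have sm5: "smooth_on U S" if "S \<in> set ?L" for S
    using that sm smooth_on_lie_bracket[OF U] by auto
  have D5: "dist_bracket D D x = span_at ?L x" and i5: "indep_at ?L x" if "x \<in> U" for x
  proof -
    have "x \<in> \<Omega>" using that U\<Omega> by auto
    then have "dim (dist_bracket D D x) = 5" "dist_bracket D2 D2 x \<subseteq> D x"
      using D D2 by (auto simp: distribution_356_on_def is_D2_on_def)
    from dist_bracket_DD[OF this f2 f3 that]
    show "dist_bracket D D x = span_at ?L x" "indep_at ?L x" by blast+
  qed
  have F3: "lie_bracket X (lie_bracket Y Z) x \<in> span_at ?L x" if x: "x \<in> U" and XZ: "X \<in> {X1, X2}" "Z \<in> {X1, X2}" for x X Z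
  proof -
    have d5: "dim (span_at ?L x) = 5" using dim_span_at[OF i5[OF x]] by simp
    have "span_at ?L x \<noteq> UNIV"
    proof
      assume "span_at ?L x = UNIV"
      with d5 have "dim (UNIV :: (real^6) set) = 5" by (simp only:)
      then show False by simp
    qed
    \<comment> \<open>As a constant field, \<open>z\<close> completes the five fields to a frame on
      a neighbourhood of \<open>x\<close>. This gives an adapted frame there, to which
      \<open>par\<close> applies.\<close>
    then obtain z where z: "z \<notin> span_at ?L x" by blast
    let ?L6 = "[X1, X2, Y, lie_bracket Y X1, lie_bracket Y X2, \<lambda>_. z]"
    have "indep_at ((\<lambda>_. z) # ?L) x" by (rule indep_at_Cons_notin[OF i5[OF x] z])
    then have i6: "indep_at ?L6 x"
      unfolding indep_at_def by (auto simp: insert_commute)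
    have s6: "smooth_on U S" if "S \<in> set ?L6" for S
      using that sm5[of S] smooth_on_const[of U z] by auto
    obtain N \<phi> where N: "x \<in> N" "N \<subseteq> U" "coframe_on N ?L6 \<phi>"
      by (rule exists_coframe_on[OF i6 U x s6])
    have oN: "open N" by (rule coframe_onD(1)[OF N(3)])
    define X' where "X' i = (if i = (1::2) then X1 else X2)" for i
    have X': "X' 1 = X1" "X' 2 = X2" by (auto simp: X'_def)
    have "local_frame N (\<lambda>x. UNIV) ?L6"
      unfolding local_frame_iff
    proof (intro conjI ballI oN)
      show "smooth_on N S" if "S \<in> set ?L6" for S
        using that sm5[THEN smooth_on_subset[OF _ N(2)]] smooth_on_const by auto
      fix y assume y: "y \<in> N"
      show "indep_at ?L6 y" by (rule coframe_on_indep_at[OF N(3) y])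
      then have "dim (span_at ?L6 y) = DIM(real^6)" using dim_span_at by fastforce
      then show "span_at ?L6 y = UNIV" unfolding dim_eq_full span_span .
    qed
    moreover have "local_frame N D2 [X1, X2]" "local_frame N D [X1, X2, Y]"
      using f2 f3 oN N(2) smooth_on_subset[OF _ N(2)] unfolding local_frame_iff by blast+
    ultimately have "adapted_frame N D D2 X' Y (\<lambda>_. z)"
      by (simp add: adapted_frame_def X')
    from par[OF _ this N(1)] N(2) U\<Omega> have "structure_matrix D X' Y (\<lambda>_. z) x = 0" by auto
    from structure_matrix_zero[OF _ _ this] D5[OF x] i6 X'
    have "lie_bracket (X' i) (lie_bracket Y (X' j)) x \<in> span_at ?L x" for i j by simp
    from this[of 1 1] this[of 1 2] this[of 2 1] this[of 2 2] show ?thesis using XZ X' by auto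
  qed
  have F2: "lie_bracket X1 X2 x \<in> span_at [X1, X2] x" if "x \<in> U" for x
    by (rule integrable2_involutive[OF int f2 U\<Omega> that])
  \<comment> \<open>Otherwise every bracket of \<open>D\<close> with \<open>[D, D]\<close> would
    stay in a space of dimension five, contrary to generation in three steps.\<close>
  have F4: False if x: "x \<in> U" and Y: "lie_bracket Y (lie_bracket Y X1) x \<in> span_at ?L x" "lie_bracket Y (lie_bracket Y X2) x \<in> span_at ?L x" for x
  proof -
    let ?V = "span_at ?L x"
    have b12: "lie_bracket X1 X2 x \<in> ?V" using F2[OF x] span_at_mono[of "[X1, X2]" ?L x] by auto
    have b21: "lie_bracket X2 X1 x \<in> ?V" unfolding lie_bracket_skew[of X2 X1] by (rule span_neg[OF b12])
    have bY: "lie_bracket Y X1 x \<in> ?V" "lie_bracket Y X2 x \<in> ?V" by (auto intro: span_base)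
    then have bY': "lie_bracket X1 Y x \<in> ?V" "lie_bracket X2 Y x \<in> ?V"
      unfolding lie_bracket_skew[of _ Y x] by (auto intro: span_neg)
    have i3: "indep_at [X1, X2, Y] x" using f3 x by (simp add: local_frame_iff)
    have sub: "D x \<subseteq> ?V" unfolding Dsp[OF x] by (rule span_at_mono) auto
    have "dist_bracket D (dist_bracket D D) x \<subseteq> ?V"
    proof (rule dist_bracket_subset[where A=D and B="dist_bracket D D" and x=x, OF subspace_span sub])
      show "dist_bracket D D x \<subseteq> ?V" using D5[OF x] by simp
      fix U' S T assume U': "open U'" "x \<in> U'" and ST: "section_on U' D S" "section_on U' (dist_bracket D D) T"
      have s3: "smooth_on (U \<inter> U') R" if "R \<in> set [X1, X2, Y]" for R
        using that sm smooth_on_subset by fastforce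
      have s5: "smooth_on (U \<inter> U') R" if "R \<in> set ?L" for R
        using sm5[OF that] smooth_on_subset by blast
      have sST: "smooth_on (U \<inter> U') S" "smooth_on (U \<inter> U') T"
        using ST by (auto simp: section_on_def intro: smooth_on_subset)
      show "lie_bracket S T x \<in> ?V"
      proof (rule lie_bracket_frame_sections[OF subspace_span _ _ s3 i3 s5 i5[OF x] sST(1) _ sST(2)])
        show "S y \<in> span_at [X1, X2, Y] y" if "y \<in> U \<inter> U'" for y
          using ST(1) Dsp[of y] that by (auto simp: section_on_def)
        show "T y \<in> span_at ?L y" if "y \<in> U \<inter> U'" for y
          using ST(2) D5[of y] that by (auto simp: section_on_def)
        show "R x \<in> ?V" if "R \<in> set [X1, X2, Y]" for R using that by (auto intro: span_base)
        show "R x \<in> ?V" if "R \<in> set ?L" for R using that by (auto intro: span_base)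
        show "lie_bracket R S x \<in> ?V" if "R \<in> set [X1, X2, Y]" "S \<in> set ?L" for R S
          using that b12 b21 bY bY' F3[OF x] Y by (auto simp: span_0)
      qed (use U U' x in auto)
    qed
    moreover have "dist_bracket D (dist_bracket D D) x = UNIV"
      using D x U\<Omega> by (auto simp: distribution_356_on_def)
    ultimately have "dim (UNIV :: (real^6) set) \<le> dim ?V" by (intro dim_subset) auto
    then show False using dim_span_at[OF i5[OF x]] by simp
  qed
  show ?thesis
    unfolding structural_def using U sm i5 F2 F3 F4 by blast
qed

section \<open>Derivatives along vector fields\<close>

text \<open>Values may be vectors, so that vector fields can be differentiated in the same way as
  functions.\<close>

definition along :: "'e::euclidean_space vfield \<Rightarrow> ('e \<Rightarrow> 'b::euclidean_space) \<Rightarrow> 'e \<Rightarrow> 'b" where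
  "along X g = (\<lambda>x. fder g x (X x))"

lemma smooth_on_along: "open S \<Longrightarrow> smooth_on S X \<Longrightarrow> smooth_on S g \<Longrightarrow> smooth_on S (along X g)"
  unfolding along_def by (rule smooth_on_fder)

lemma along_cong_open: "open S \<Longrightarrow> x \<in> S \<Longrightarrow> (\<And>y. y \<in> S \<Longrightarrow> f y = g y) \<Longrightarrow> along X f x = along X g x"
  unfolding along_def using fder_cong_open by metis

lemma along_locally_const: "open S \<Longrightarrow> x \<in> S \<Longrightarrow> (\<And>y. y \<in> S \<Longrightarrow> g y = c) \<Longrightarrow> along X g x = 0"
  using along_cong_open[of S x g "\<lambda>_. c" X] by (simp add: along_def)

lemma lie_bracket_along: "lie_bracket X Y x = along X Y x - along Y X x"
  by (simp add: lie_bracket_def along_def)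

text \<open>The second-order terms of the iterated derivatives cancel by symmetry; what remains is
  the derivative of \<open>g\<close> along the bracket.\<close>

lemma along_lie_bracket:
  fixes g :: "'e::euclidean_space \<Rightarrow> 'b::euclidean_space"
  assumes S: "open S" "x \<in> S" and X: "smooth_on S X" and Y: "smooth_on S Y" and g: "smooth_on S g"
  shows "along (lie_bracket X Y) g x = along X (along Y g) x - along Y (along X g) x"
proof -
  have d: "fder (\<lambda>y. fder g y (Z y)) x v = fder (\<lambda>y. fder g y (Z x)) x v + fder g x (fder Z x v)"
    if "smooth_on S Z" for Z v
    using fder_eq[OF apply_linear_has_derivative[OF S(1) smooth_on_linear_fder[OF g] smooth_on_fder_const[OF g]
      has_derivative_ident smooth_on_has_derivative[OF that S(2)] S(2)]]
    by (simp add: fun_eq_iff)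
  show ?thesis
    unfolding along_def d[OF X] d[OF Y] lie_bracket_def
    using symmetric_second_derivative[OF S g, of "Y x" "X x"]
    by (simp add: linear_diff[OF smooth_on_linear_fder[OF g S(2)]])
qed

lemma along_diff:
  "f differentiable (at x) \<Longrightarrow> g differentiable (at x) \<Longrightarrow> along X (\<lambda>y. f y - g y) x = along X f x - along X g x"
  by (simp add: along_def fder_eq[OF has_derivative_diff[OF fder_works fder_works]])

text \<open>A field is also a vector valued function, so \<open>along_lie_bracket\<close> applies to
  the derivative of one field along the bracket of the other two; all iterated derivatives then
  cancel.\<close>

lemma jacobi_identity:
  assumes S: "open S" "x \<in> S" and A: "smooth_on S A" and B: "smooth_on S B" and C: "smooth_on S C"
  shows "lie_bracket (lie_bracket A B) C x = lie_bracket A (lie_bracket B C) x - lie_bracket B (lie_bracket A C) x"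
proof -
  have br: "along X (lie_bracket Y Z) x = along X (along Y Z) x - along X (along Z Y) x"
    if "smooth_on S Y" "smooth_on S Z" for X Y Z
  proof -
    have "along X (lie_bracket Y Z) x = along X (\<lambda>y. along Y Z y - along Z Y y) x"
      by (rule along_cong_open[OF S]) (simp add: lie_bracket_along)
    then show ?thesis
      using smooth_on_along[OF S(1) that] smooth_on_along[OF S(1) that(2,1)] S(2)
      by (simp add: along_diff smooth_on_differentiable)
  qed
  show ?thesis
    unfolding lie_bracket_along[of "lie_bracket A B"] lie_bracket_along[of _ "lie_bracket _ _"]
    by (simp add: br A B C along_lie_bracket[OF S])
qed

text \<open>The fields of the list become the columns of \<open>\<Xi>\<close> through an enumeration
  of the basis of \<open>'k\<close>, whose dimension encodes the rank.\<close>

theorem frobenius_list: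
  fixes Xs :: "'e::euclidean_space vfield list"
  assumes dim: "DIM('k::euclidean_space) = length Xs" "DIM('k) + DIM('m::euclidean_space) = DIM('e)"
    and U: "open U" "p \<in> U" and smooth: "\<And>X. X \<in> set Xs \<Longrightarrow> smooth_on U X" and indep: "indep_at Xs p"
    and invol: "\<And>x X Y. x \<in> U \<Longrightarrow> X \<in> set Xs \<Longrightarrow> Y \<in> set Xs \<Longrightarrow> lie_bracket X Y x \<in> span_at Xs x"
  obtains N and \<psi> :: "'e \<Rightarrow> 'm::euclidean_space" where "open N" "p \<in> N" "N \<subseteq> U" "smooth_on N \<psi>"
    "\<forall>x\<in>N. \<forall>v. fder \<psi> x v = 0 \<longleftrightarrow> v \<in> span_at Xs x"
proof -
  let ?I = "{..<length Xs}"
  obtain \<beta> where \<beta>: "bij_betw \<beta> ?I (Basis :: 'k set)"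
    using finite_same_card_bij[of ?I "Basis :: 'k set"] dim(1) by auto
  define \<Xi> where "\<Xi> x h = (\<Sum>i<length Xs. (h \<bullet> \<beta> i) *\<^sub>R (Xs ! i) x)" for x h
  have lin: "linear (\<Xi> x)" for x
    unfolding \<Xi>_def by (intro linearI) (simp_all add: inner_add_left scaleR_add_left sum.distrib scaleR_sum_right)
  have sm: "smooth_on U (\<lambda>x. \<Xi> x h)" for h
    unfolding \<Xi>_def by (intro smooth_on_sum smooth_on_scaleR smooth_on_const U smooth) auto
  have mem: "\<beta> i \<in> Basis" if "i < length Xs" for i using \<beta> that by (auto simp: bij_betw_def)
  have inj: "inj (\<Xi> p)"
    unfolding linear_injective_0[OF lin]
  proof (intro allI impI)
    fix h assume "\<Xi> p h = 0"
    then have "h \<bullet> \<beta> i = 0" if "i < length Xs" for i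
      using indep_atD[OF indep, of "\<lambda>i. h \<bullet> \<beta> i"] that by (simp add: \<Xi>_def)
    then have "h \<bullet> b = 0" if "b \<in> Basis" for b
      using \<beta> that by (metis bij_betw_iff_bijections lessThan_iff)
    then show "h = 0" using euclidean_all_zero_iff by blast
  qed
  have range: "range (\<Xi> x) = span_at Xs x" for x
  proof -
    have "\<exists>h. \<Xi> x h = (\<Sum>i<length Xs. c i *\<^sub>R (Xs ! i) x)" for c
    proof -
      define h where "h = (\<Sum>j<length Xs. c j *\<^sub>R \<beta> j)"
      have "h \<bullet> \<beta> i = c i" if "i < length Xs" for i
      proof -
        have "h \<bullet> \<beta> i = (\<Sum>j<length Xs. if j = i then c j else 0)"
          unfolding h_def inner_sum_left
          by (rule sum.cong) (use \<beta> that mem in \<open>auto simp: inner_Basis bij_betw_def inj_on_def\<close>)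
        then show ?thesis using that by simp
      qed
      then show ?thesis by (intro exI[of _ h]) (simp add: \<Xi>_def)
    qed
    then have "v \<in> range (\<Xi> x)" if "v \<in> span_at Xs x" for v
      using that unfolding span_at_iff by (metis rangeI)
    moreover have "\<Xi> x h \<in> span_at Xs x" for h
      unfolding span_at_iff \<Xi>_def by (rule exI) (rule refl)
    ultimately show ?thesis by blast
  qed
  have inv: "lie_bracket (\<lambda>x. \<Xi> x h) (\<lambda>x. \<Xi> x k) x \<in> range (\<Xi> x)" if x: "x \<in> U" for x h k
    unfolding range
  proof (rule lie_bracket_in_subspace[where I="?I" and J="?I" and R="\<lambda>i. Xs ! i" and S="\<lambda>i. Xs ! i"
        and b="\<lambda>i y. h \<bullet> \<beta> i" and c="\<lambda>i y. k \<bullet> \<beta> i", OF _ U(1) x])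
    show "(Xs ! i) differentiable at x" "(Xs ! i) differentiable at x" if "i \<in> ?I" for i
      using that smooth_on_differentiable[OF smooth x] by auto
  qed (use invol[OF x] in \<open>auto simp: \<Xi>_def intro: span_base\<close>)
  show ?thesis
    using frobenius[OF dim(2) U lin sm inj inv] that unfolding range by metis
qed

section \<open>The Cauchy characteristics of the derived distribution\<close>

text \<open>The one-form \<open>\<theta>\<close> annihilates the rank five distribution spanned by \<open>five X1 X2 Y\<close>.\<close>

locale framed =
  fixes N :: "'e::euclidean_space set" and X1 X2 Y :: "'e vfield"
    and \<phi> :: "nat \<Rightarrow> 'e \<Rightarrow> 'e \<Rightarrow> real" and \<theta> :: "'e \<Rightarrow> 'e \<Rightarrow> real"
  assumes str: "structural N X1 X2 Y" and cof: "coframe_on N (five X1 X2 Y) \<phi>"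
    and lin_lam: "x \<in> N \<Longrightarrow> linear (\<theta> x)" and smooth_lam: "smooth_on N (\<lambda>x. \<theta> x v)"
    and ker_lam: "x \<in> N \<Longrightarrow> \<theta> x v = 0 \<longleftrightarrow> v \<in> span_at (five X1 X2 Y) x"
begin

abbreviation "F \<equiv> five X1 X2 Y"
abbreviation "Y1 \<equiv> lie_bracket Y X1"
abbreviation "Y2 \<equiv> lie_bracket Y X2"

lemma open_N: "open N" and smooth_X1: "smooth_on N X1" and smooth_X2: "smooth_on N X2" and smooth_Y: "smooth_on N Y"
  using str by (auto simp: structural_def)

lemma smooth_F: "S \<in> set F \<Longrightarrow> smooth_on N S"
  using smooth_X1 smooth_X2 smooth_Y smooth_on_lie_bracket[OF open_N] by auto

lemma indep_F: "x \<in> N \<Longrightarrow> indep_at F x"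
  using str by (auto simp: structural_def)

lemma br_X1_X2: "x \<in> N \<Longrightarrow> lie_bracket X1 X2 x \<in> span_at [X1, X2] x"
  using str unfolding structural_def by blast

lemma br_X_YX: "x \<in> N \<Longrightarrow> X \<in> {X1, X2} \<Longrightarrow> Z \<in> {X1, X2} \<Longrightarrow> \<theta> x (lie_bracket X (lie_bracket Y Z) x) = 0"
  using str ker_lam unfolding structural_def by blast

lemma br_Y_YX: "x \<in> N \<Longrightarrow> \<theta> x (lie_bracket Y Y1 x) \<noteq> 0 \<or> \<theta> x (lie_bracket Y Y2 x) \<noteq> 0"
  using str ker_lam unfolding structural_def by blast

lemma lam_F: "x \<in> N \<Longrightarrow> S \<in> set F \<Longrightarrow> \<theta> x (S x) = 0"
  using ker_lam span_atI by blast

lemma lam_skew: "x \<in> N \<Longrightarrow> \<theta> x (lie_bracket A B x) = - \<theta> x (lie_bracket B A x)"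
  using linear_neg[OF lin_lam] lie_bracket_skew by metis

text \<open>On sections of the rank five distribution, \<open>B \<mapsto> \<theta> [A, B]\<close> is
  linear over functions: \<open>\<theta>\<close> kills the terms in which a coefficient is
  differentiated.\<close>

lemma lam_br_sum:
  assumes x: "x \<in> N" and "finite J" and A: "smooth_on N A" and c: "\<And>j. j \<in> J \<Longrightarrow> smooth_on N (c j)" and S: "\<And>j. j \<in> J \<Longrightarrow> S j \<in> set F"
  shows "\<theta> x (lie_bracket A (\<lambda>y. \<Sum>j\<in>J. c j y *\<^sub>R S j y) x) = (\<Sum>j\<in>J. c j x * \<theta> x (lie_bracket A (S j) x))"
proof -
  have "lie_bracket A (\<lambda>y. \<Sum>j\<in>J. c j y *\<^sub>R S j y) x
      = (\<Sum>j\<in>J. c j x *\<^sub>R lie_bracket A (S j) x + fder (c j) x (A x) *\<^sub>R S j x)"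
    by (rule lie_bracket_sum_right) (use assms smooth_F in \<open>auto intro: smooth_on_differentiable[OF _ x]\<close>)
  then show ?thesis
    using lam_F[OF x S]
    by (simp add: linear_sum[OF lin_lam[OF x]] linear_add[OF lin_lam[OF x]] linear_cmul[OF lin_lam[OF x]])
qed

definition sec :: "'e vfield \<Rightarrow> bool" where
  "sec A \<longleftrightarrow> smooth_on N A \<and> (\<forall>x\<in>N. \<theta> x (A x) = 0)"

text \<open>Cauchy characteristic fields of the rank five distribution, tested on its frame only;
  \<open>chr_sec\<close> extends the condition to all sections.\<close>

definition chr :: "'e vfield \<Rightarrow> bool" where
  "chr A \<longleftrightarrow> sec A \<and> (\<forall>S\<in>set F. \<forall>x\<in>N. \<theta> x (lie_bracket A S x) = 0)"

lemma nth_F: "j < 5 \<Longrightarrow> F ! j \<in> set F"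
  by (rule nth_mem) simp

lemma sec_expansion:
  assumes "sec B" "x \<in> N"
  shows "B x = (\<Sum>j<5. \<phi> j x (B x) *\<^sub>R (F ! j) x)"
proof -
  have "length F = 5" by simp
  moreover have "B x \<in> span_at F x" using assms ker_lam by (simp add: sec_def)
  ultimately show ?thesis using coframe_on_expansion[OF cof assms(2), of "B x"] by metis
qed

lemma lam_br_sec:
  assumes x: "x \<in> N" and A: "smooth_on N A" and B: "sec B"
  shows "\<theta> x (lie_bracket A B x) = (\<Sum>j<5. \<phi> j x (B x) * \<theta> x (lie_bracket A (F ! j) x))"
proof -
  have B': "smooth_on N B" using B by (simp add: sec_def)
  have "lie_bracket A B x = lie_bracket A (\<lambda>y. \<Sum>j<5. \<phi> j y (B y) *\<^sub>R (F ! j) y) x"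
    using sec_expansion[OF B] by (intro lie_bracket_cong_open[OF open_N x]) auto
  moreover have "\<theta> x (lie_bracket A (\<lambda>y. \<Sum>j<5. \<phi> j y (B y) *\<^sub>R (F ! j) y) x)
      = (\<Sum>j<5. \<phi> j x (B x) * \<theta> x (lie_bracket A (F ! j) x))"
    by (rule lam_br_sum[OF x finite_lessThan A smooth_on_coframe[OF cof B']]) (rule nth_F, simp)
  ultimately show ?thesis by simp
qed

lemma chr_sec: "chr A \<Longrightarrow> sec B \<Longrightarrow> x \<in> N \<Longrightarrow> \<theta> x (lie_bracket A B x) = 0"
proof -
  assume A: "chr A" and B: "sec B" and x: "x \<in> N"
  have "\<theta> x (lie_bracket A (F ! j) x) = 0" if "j < 5" for j
    using A x nth_F[OF that] unfolding chr_def by blast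
  moreover have "smooth_on N A" using A by (simp add: chr_def sec_def)
  ultimately show ?thesis unfolding lam_br_sec[OF x \<open>smooth_on N A\<close> B] by (intro sum.neutral) simp
qed

lemma sec_lie_bracket:
  assumes "chr A" "sec B"
  shows "sec (lie_bracket A B)"
proof -
  have "smooth_on N A" "smooth_on N B" using assms by (simp_all add: sec_def chr_def)
  then show ?thesis
    unfolding sec_def using smooth_on_lie_bracket[OF open_N] chr_sec[OF assms] by blast
qed

lemma sec_F: "S \<in> set F \<Longrightarrow> sec S"
  unfolding sec_def using lam_F smooth_F by blast

text \<open>By the Jacobi identity, since bracketing with a characteristic field preserves the
  sections of the rank five distribution.\<close>

lemma chr_lie_bracket:
  assumes A: "chr A" and B: "chr B"
  shows "chr (lie_bracket A B)"
proof -
  have sA: "sec A" and sB: "sec B" using A B by (auto simp: chr_def)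
  have "\<theta> x (lie_bracket (lie_bracket A B) S x) = 0" if "S \<in> set F" "x \<in> N" for S x
  proof -
    have "lie_bracket (lie_bracket A B) S x = lie_bracket A (lie_bracket B S) x - lie_bracket B (lie_bracket A S) x"
      by (rule jacobi_identity[OF open_N that(2)]) (use sA sB sec_F[OF that(1)] in \<open>auto simp: sec_def\<close>)
    then show ?thesis
      using chr_sec[OF A sec_lie_bracket[OF B sec_F[OF that(1)]] that(2)]
        chr_sec[OF B sec_lie_bracket[OF A sec_F[OF that(1)]] that(2)]
      by (simp add: linear_diff[OF lin_lam[OF that(2)]])
  qed
  then show ?thesis using sec_lie_bracket[OF A sB] by (simp add: chr_def)
qed

lemma lam_br_X1_X2: "x \<in> N \<Longrightarrow> \<theta> x (lie_bracket X1 X2 x) = 0"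
  using br_X1_X2[of x] span_at_mono[of "[X1, X2]" F x] ker_lam by auto

lemma lam_zero: "x \<in> N \<Longrightarrow> \<theta> x 0 = 0"
  using linear_0[OF lin_lam] .

text \<open>The brackets with \<open>X1\<close> and \<open>X2\<close> stay in the integrable rank
  two part, the bracket with \<open>Y\<close> is a frame field up to sign, and the brackets with
  \<open>Y1\<close> and \<open>Y2\<close> are controlled by the vanishing structure matrix.\<close>

lemma chr_X: "X \<in> {X1, X2} \<Longrightarrow> chr X"
proof -
  assume X: "X \<in> {X1, X2}"
  have "\<theta> x (lie_bracket X S x) = 0" if "x \<in> N" "S \<in> {X1, X2}" for x S
    using X that lam_br_X1_X2 lam_skew[OF that(1), of X2 X1] lam_zero by auto
  moreover have "\<theta> x (lie_bracket X Y x) = 0" if "x \<in> N" for x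
    using X lam_F[OF that, of "lie_bracket Y X"] lam_skew[OF that, of X Y] by auto
  moreover have "sec X" using X by (intro sec_F) auto
  ultimately show ?thesis using X br_X_YX by (auto simp: chr_def)
qed

text \<open>The kernel of a skew form on the span of \<open>Y\<close>, \<open>Y1\<close>, \<open>Y2\<close>, written as a cross product.\<close>

definition V :: "'e vfield" where
  "V = (\<lambda>x. \<Sum>j<3. [\<theta> x (lie_bracket Y1 Y2 x), - \<theta> x (lie_bracket Y Y2 x), \<theta> x (lie_bracket Y Y1 x)] ! j *\<^sub>R ([Y, Y1, Y2] ! j) x)"

lemma V_eq: "V x = \<theta> x (lie_bracket Y1 Y2 x) *\<^sub>R Y x - \<theta> x (lie_bracket Y Y2 x) *\<^sub>R Y1 x + \<theta> x (lie_bracket Y Y1 x) *\<^sub>R Y2 x"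
  by (simp add: V_def numeral_3_eq_3)

lemma smooth_on_lam: "smooth_on N A \<Longrightarrow> smooth_on N (\<lambda>x. \<theta> x (A x))"
  by (rule smooth_on_apply_linear[where L=\<theta> and g=A, OF open_N lin_lam smooth_lam])

lemma less_3_cases: "j < (3::nat) \<Longrightarrow> j = 0 \<or> j = 1 \<or> j = 2"
  by auto

lemma smooth_V_coeff:
  assumes "j < (3::nat)"
  shows "smooth_on N (\<lambda>x. [\<theta> x (lie_bracket Y1 Y2 x), - \<theta> x (lie_bracket Y Y2 x), \<theta> x (lie_bracket Y Y1 x)] ! j)"
  using less_3_cases[OF assms]
  by (elim disjE) (simp_all add: numeral_2_eq_2 smooth_on_minus smooth_on_lam open_N smooth_on_lie_bracket smooth_Y smooth_X1 smooth_X2)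

lemma sec_V: "sec V"
proof -
  have "smooth_on N V"
    unfolding V_eq[abs_def]
    by (intro smooth_on_add smooth_on_diff smooth_on_scaleR smooth_on_lam open_N smooth_on_lie_bracket smooth_Y smooth_X1 smooth_X2)
  then show ?thesis
    using lam_F by (auto simp: sec_def V_eq linear_add[OF lin_lam] linear_diff[OF lin_lam] linear_cmul[OF lin_lam])
qed

lemma lam_br_V:
  assumes "x \<in> N" "smooth_on N A"
  shows "\<theta> x (lie_bracket A V x) = \<theta> x (lie_bracket Y1 Y2 x) * \<theta> x (lie_bracket A Y x)
    - \<theta> x (lie_bracket Y Y2 x) * \<theta> x (lie_bracket A Y1 x) + \<theta> x (lie_bracket Y Y1 x) * \<theta> x (lie_bracket A Y2 x)"
proof -
  have "[Y, Y1, Y2] ! j \<in> set F" if "j < 3" for j using less_3_cases[OF that] by auto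
  then show ?thesis
    unfolding V_def
    by (subst lam_br_sum[OF assms(1) _ assms(2) smooth_V_coeff]) (auto simp: numeral_3_eq_3)
qed

text \<open>For \<open>S\<close> among \<open>Y\<close>, \<open>Y1\<close>, \<open>Y2\<close> the
  three terms of \<open>lam_br_V\<close> cancel in pairs by skew symmetry, as for a cross product;
  the remaining \<open>S\<close> are characteristic themselves.\<close>

lemma chr_V: "chr V"
proof -
  have "\<theta> x (lie_bracket S V x) = 0" if x: "x \<in> N" and S: "S \<in> set F" for x S
  proof (cases "S \<in> {X1, X2}")
    case True
    then show ?thesis using chr_sec[OF chr_X[OF True] sec_V x] by simp
  next
    case False
    then have "S = Y \<or> S = Y1 \<or> S = Y2" using S by auto
    then show ?thesis
      using lam_br_V[OF x smooth_F[OF S]] lam_zero[OF x] lam_skew[OF x, of Y1 Y] lam_skew[OF x, of Y2 Y] lam_skew[OF x, of Y2 Y1]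
      by (elim disjE) simp_all
  qed
  then show ?thesis using sec_V lam_skew[of _ V] by (simp add: chr_def)
qed

text \<open>The relations come from pairing \<open>A\<close> with \<open>Y\<close>,
  \<open>Y1\<close> and \<open>Y2\<close>; the components along \<open>X1\<close> and
  \<open>X2\<close> drop out, these fields being characteristic. They say that
  \<open>(y, y1, y2)\<close> lies in the kernel of the skew form.\<close>

lemma chr_expansion:
  assumes A: "chr A" and x: "x \<in> N"
  defines "y \<equiv> \<phi> 2 x (A x)" and "y1 \<equiv> \<phi> 3 x (A x)" and "y2 \<equiv> \<phi> 4 x (A x)"
  shows "A x = \<phi> 0 x (A x) *\<^sub>R X1 x + \<phi> 1 x (A x) *\<^sub>R X2 x + y *\<^sub>R Y x + y1 *\<^sub>R Y1 x + y2 *\<^sub>R Y2 x"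
    and "y1 * \<theta> x (lie_bracket Y Y1 x) + y2 * \<theta> x (lie_bracket Y Y2 x) = 0"
    and "y2 * \<theta> x (lie_bracket Y1 Y2 x) = y * \<theta> x (lie_bracket Y Y1 x)"
    and "y1 * \<theta> x (lie_bracket Y1 Y2 x) = - y * \<theta> x (lie_bracket Y Y2 x)"
proof -
  have sA: "sec A" using A by (simp add: chr_def)
  have sum5: "(\<Sum>j<(5::nat). g j) = g 0 + g 1 + g 2 + g 3 + g 4" for g :: "nat \<Rightarrow> 'a::comm_monoid_add"
    by (simp add: eval_nat_numeral)
  have "A x = (\<Sum>j<5. \<phi> j x (A x) *\<^sub>R (F ! j) x)"
    by (rule sec_expansion[OF sA x])
  then show "A x = \<phi> 0 x (A x) *\<^sub>R X1 x + \<phi> 1 x (A x) *\<^sub>R X2 x + y *\<^sub>R Y x + y1 *\<^sub>R Y1 x + y2 *\<^sub>R Y2 x"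
    unfolding sum5 by (simp add: y_def y1_def y2_def)
  have e: "0 = \<phi> 0 x (A x) * \<theta> x (lie_bracket S X1 x) + \<phi> 1 x (A x) * \<theta> x (lie_bracket S X2 x)
      + y * \<theta> x (lie_bracket S Y x) + y1 * \<theta> x (lie_bracket S Y1 x) + y2 * \<theta> x (lie_bracket S Y2 x)"
    if S: "S \<in> set F" for S
  proof -
    have "\<theta> x (lie_bracket A S x) = 0" using A S x unfolding chr_def by blast
    then have "\<theta> x (lie_bracket S A x) = 0" using lam_skew[OF x, of S A] by simp
    then show ?thesis using lam_br_sec[OF x smooth_F[OF S] sA] unfolding sum5 by (simp add: y_def y1_def y2_def)
  qed
  have X0: "\<theta> x (lie_bracket S X1 x) = 0" "\<theta> x (lie_bracket S X2 x) = 0" if S: "S \<in> set F" for S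
  proof -
    have "chr X1" "chr X2" using chr_X by auto
    then have "\<theta> x (lie_bracket X1 S x) = 0" "\<theta> x (lie_bracket X2 S x) = 0"
      using S x unfolding chr_def by blast+
    then show "\<theta> x (lie_bracket S X1 x) = 0" "\<theta> x (lie_bracket S X2 x) = 0"
      using lam_skew[OF x, of S] by simp_all
  qed
  show "y1 * \<theta> x (lie_bracket Y Y1 x) + y2 * \<theta> x (lie_bracket Y Y2 x) = 0"
    using e[of Y] X0[of Y] lam_zero[OF x] by simp
  show "y2 * \<theta> x (lie_bracket Y1 Y2 x) = y * \<theta> x (lie_bracket Y Y1 x)"
    using e[of Y1] X0[of Y1] lam_zero[OF x] lam_skew[OF x, of Y1 Y] by simp
  show "y1 * \<theta> x (lie_bracket Y1 Y2 x) = - y * \<theta> x (lie_bracket Y Y2 x)"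
    using e[of Y2] X0[of Y2] lam_zero[OF x] lam_skew[OF x, of Y2 Y] lam_skew[OF x, of Y2 Y1] by simp
qed

text \<open>By \<open>br_Y_YX\<close> the skew form on the span of \<open>Y\<close>,
  \<open>Y1\<close>, \<open>Y2\<close> is nonzero, so its kernel is the line spanned by
  \<open>V\<close>.\<close>

lemma chr_in_span:
  assumes A: "chr A" and x: "x \<in> N"
  shows "A x \<in> span_at [X1, X2, V] x"
proof -
  let ?o1 = "\<theta> x (lie_bracket Y Y1 x)" and ?o2 = "\<theta> x (lie_bracket Y Y2 x)" and ?o = "\<theta> x (lie_bracket Y1 Y2 x)"
  note e = chr_expansion[OF A x]
  \<comment> \<open>The factor is found by dividing by whichever of \<open>?o1\<close>,
    \<open>?o2\<close> does not vanish.\<close>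
  obtain \<mu> where \<mu>: "\<phi> 2 x (A x) = \<mu> * ?o" "\<phi> 3 x (A x) = - \<mu> * ?o2" "\<phi> 4 x (A x) = \<mu> * ?o1"
  proof (cases "?o1 = 0")
    case True
    then have "?o2 \<noteq> 0" using br_Y_YX[OF x] by simp
    then show ?thesis using e(2,3,4) True by (intro that[of "- \<phi> 3 x (A x) / ?o2"]) (auto simp: field_simps)
  next
    case False
    then show ?thesis using e(2,3,4) by (intro that[of "\<phi> 4 x (A x) / ?o1"]) (auto simp: field_simps)
  qed
  have "A x = \<phi> 0 x (A x) *\<^sub>R X1 x + \<phi> 1 x (A x) *\<^sub>R X2 x + \<mu> *\<^sub>R V x"
    using e(1) unfolding \<mu> V_eq by (simp add: algebra_simps)
  from this[symmetric] show ?thesis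
    by (rule ssubst[OF sym]) (intro span_add span_scale span_base; simp)
qed

text \<open>Up to sign, the components of \<open>V\<close> along \<open>Y1\<close> and
  \<open>Y2\<close> are the two numbers that cannot both vanish by \<open>br_Y_YX\<close>.\<close>

lemma V_notin: "x \<in> N \<Longrightarrow> V x \<notin> span_at [X1, X2, Y] x"
proof
  assume x: "x \<in> N" and "V x \<in> span_at [X1, X2, Y] x"
  then obtain c where c: "V x = (\<Sum>i<length [X1, X2, Y]. c i *\<^sub>R ([X1, X2, Y] ! i) x)" unfolding span_at_iff by blast
  let ?d = "\<lambda>i. if i = 0 then c 0 else if i = 1 then c 1 else if i = 2 then c 2 - \<theta> x (lie_bracket Y1 Y2 x)
    else if i = 3 then \<theta> x (lie_bracket Y Y2 x) else - \<theta> x (lie_bracket Y Y1 x)"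
  have "(\<Sum>i<length F. ?d i *\<^sub>R (F ! i) x) = 0"
    using c by (simp add: V_eq eval_nat_numeral algebra_simps)
  from indep_atD[OF indep_F[OF x] this, of 3] indep_atD[OF indep_F[OF x] this, of 4]
  show False using br_Y_YX[OF x] by simp
qed

end

section \<open>Coordinates on \<open>real^6\<close> and the Cartan kernel\<close>

lemma UNIV_6: "(UNIV :: 6 set) = {1, 2, 3, 4, 5, 6}"
proof -
  have "card {1, 2, 3, 4, 5, 6 :: 6} = card (UNIV :: 6 set)" by simp
  then show ?thesis by (metis card_subset_eq finite subset_UNIV)
qed

lemma exhaust_6: "i = 1 \<or> i = 2 \<or> i = 3 \<or> i = 4 \<or> i = 5 \<or> i = 6" for i :: 6
  using UNIV_6 by auto

text \<open>A linear combination of axis vectors, so that smoothness and derivatives follow from the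
  rules for sums.\<close>

definition vec6 :: "real \<Rightarrow> real \<Rightarrow> real \<Rightarrow> real \<Rightarrow> real \<Rightarrow> real \<Rightarrow> real^6" where
  "vec6 a b c d e f = a *\<^sub>R axis 1 1 + b *\<^sub>R axis 2 1 + c *\<^sub>R axis 3 1 + d *\<^sub>R axis 4 1 + e *\<^sub>R axis 5 1 + f *\<^sub>R axis 6 1"

lemma vec6_nth [simp]:
  "vec6 a b c d e f $ 1 = a" "vec6 a b c d e f $ 2 = b" "vec6 a b c d e f $ 3 = c"
  "vec6 a b c d e f $ 4 = d" "vec6 a b c d e f $ 5 = e" "vec6 a b c d e f $ 6 = f"
  by (simp_all add: vec6_def axis_def)

lemma vec6_eqI:
  fixes v w :: "real^6"
  assumes "v $ 1 = w $ 1" "v $ 2 = w $ 2" "v $ 3 = w $ 3" "v $ 4 = w $ 4" "v $ 5 = w $ 5" "v $ 6 = w $ 6"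
  shows "v = w"
  unfolding vec_eq_iff
proof
  fix i show "v $ i = w $ i" using exhaust_6[of i] assms by (elim disjE) simp_all
qed

lemma subspace_cartan_kernel: "subspace (cartan_kernel x)"
  unfolding cartan_kernel_def Let_def by (rule subspaceI) (auto simp: algebra_simps)

text \<open>An upper bound suffices: the kernel will be seen to contain the image of
  \<open>D\<close> under an injective linear map, which has dimension three.\<close>

lemma dim_cartan_kernel: "dim (cartan_kernel x) \<le> 3"
proof -
  let ?B = "{vec6 1 (x $ 4) (x $ 6) (x $ 5) 0 0, vec6 0 0 0 0 1 0, vec6 0 0 0 0 0 1}"
  have "w \<in> span ?B" if "w \<in> cartan_kernel x" for w
  proof -
    have "w = w $ 1 *\<^sub>R vec6 1 (x $ 4) (x $ 6) (x $ 5) 0 0 + w $ 5 *\<^sub>R vec6 0 0 0 0 1 0 + w $ 6 *\<^sub>R vec6 0 0 0 0 0 1"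
      by (rule vec6_eqI) (use that in \<open>auto simp: cartan_kernel_def Let_def algebra_simps\<close>)
    also have "\<dots> \<in> span ?B" by (intro span_add span_scale span_base) auto
    finally show ?thesis .
  qed
  then have "dim (cartan_kernel x) \<le> card ?B" by (intro dim_le_card) auto
  also have "\<dots> \<le> 3" by (simp add: card_insert_if)
  finally show ?thesis .
qed

lemma indep_at_Cons: "indep_at (X # Xs) x \<longleftrightarrow> X x \<notin> span_at Xs x \<and> indep_at Xs x"
proof -
  have "X x \<notin> set (map (\<lambda>X. X x) Xs)" if "X x \<notin> span_at Xs x" using that span_base by blast
  then show ?thesis by (auto simp: indep_at_def independent_insert)
qed

lemma indep_at_mset:
  assumes "mset Xs = mset Ys"
  shows "indep_at Xs x \<longleftrightarrow> indep_at Ys x"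
proof -
  have "mset (map (\<lambda>X. X x) Xs) = mset (map (\<lambda>X. X x) Ys)" using assms by simp
  then show ?thesis unfolding indep_at_def by (metis mset_eq_imp_distinct_iff mset_eq_setD)
qed

lemma indep_at_snoc: "indep_at (Xs @ [X]) x \<longleftrightarrow> X x \<notin> span_at Xs x \<and> indep_at Xs x"
  using indep_at_mset[of "Xs @ [X]" "X # Xs" x] indep_at_Cons[of X Xs x] by simp

section \<open>Framed neighbourhoods and the function \<open>t\<close>\<close>

lemma coframe_on_subset: "coframe_on N Xs \<phi> \<Longrightarrow> open M \<Longrightarrow> M \<subseteq> N \<Longrightarrow> coframe_on M Xs \<phi>"
  unfolding coframe_on_def using smooth_on_subset by blast

lemma structural_subset: "structural U X1 X2 Y \<Longrightarrow> open M \<Longrightarrow> M \<subseteq> U \<Longrightarrow> structural M X1 X2 Y"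
  unfolding structural_def using smooth_on_subset by (meson subsetD)

text \<open>The form \<open>\<theta>\<close> is the last member of a coframe dual to the five fields
  completed by a constant field; its kernel is the span of the other five.\<close>

lemma exists_framed:
  fixes X1 :: "(real^6) vfield"
  assumes str: "structural U X1 X2 Y" and p: "p \<in> U"
  obtains N \<phi> \<theta> where "p \<in> N" "N \<subseteq> U" "framed N X1 X2 Y \<phi> \<theta>"
proof -
  let ?L = "five X1 X2 Y"
  have U: "open U" and i5: "indep_at ?L p" using str p by (auto simp: structural_def)
  have sm5: "smooth_on U S" if "S \<in> set ?L" for S
    using that str smooth_on_lie_bracket[OF U] by (auto simp: structural_def)
  have d5: "dim (span_at ?L p) = 5" using dim_span_at[OF i5] by simp
  have "span_at ?L p \<noteq> UNIV"
  proof
    assume "span_at ?L p = UNIV"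
    with d5 have "dim (UNIV :: (real^6) set) = 5" by (simp only:)
    then show False by simp
  qed
  then obtain z where z: "z \<notin> span_at ?L p" by blast
  let ?L6 = "?L @ [\<lambda>_. z]"
  have i6: "indep_at ?L6 p" unfolding indep_at_snoc using z i5 by blast
  have s6: "smooth_on U S" if "S \<in> set ?L6" for S
    using that sm5[of S] smooth_on_const[of U z] by auto
  obtain N1 \<psi> where N1: "p \<in> N1" "N1 \<subseteq> U" "coframe_on N1 ?L6 \<psi>"
    by (rule exists_coframe_on[OF i6 U p s6])
  obtain N2 \<phi> where N2: "p \<in> N2" "N2 \<subseteq> U" "coframe_on N2 ?L \<phi>"
    by (rule exists_coframe_on[OF i5 U p sm5])
  let ?N = "N1 \<inter> N2"
  have oN: "open ?N" using coframe_onD(1)[OF N1(3)] coframe_onD(1)[OF N2(3)] by (rule open_Int)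
  have l6: "length ?L6 = 6" "length ?L = 5" by simp_all
  \<comment> \<open>Index 5 belongs to the sixth, constant field.\<close>
  have ker: "\<psi> 5 x v = 0 \<longleftrightarrow> v \<in> span_at ?L x" if x: "x \<in> N1" for x v
  proof
    assume "\<psi> 5 x v = 0"
    have "dim (span_at ?L6 x) = DIM(real^6)"
      using dim_span_at[OF coframe_on_indep_at[OF N1(3) x]] by simp
    then have "span_at ?L6 x = UNIV" unfolding dim_eq_full span_span .
    then have "v = (\<Sum>i<6. \<psi> i x v *\<^sub>R (?L6 ! i) x)"
      using coframe_on_expansion[OF N1(3) x, of v] unfolding l6 by blast
    also have "\<dots> = (\<Sum>i<5. \<psi> i x v *\<^sub>R (?L6 ! i) x)"
      using sum.lessThan_Suc[of "\<lambda>i. \<psi> i x v *\<^sub>R (?L6 ! i) x" 5] \<open>\<psi> 5 x v = 0\<close>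
      by (simp del: sum.lessThan_Suc nth_Cons_numeral)
    also have "\<dots> = (\<Sum>i<5. \<psi> i x v *\<^sub>R (?L ! i) x)"
      by (rule sum.cong) (simp_all add: nth_append del: append.simps)
    finally show "v \<in> span_at ?L x" unfolding span_at_iff l6 by (rule exI[of _ "\<lambda>i. \<psi> i x v"])
  next
    assume "v \<in> span_at ?L x"
    then obtain c where c: "v = (\<Sum>i<5. c i *\<^sub>R (?L ! i) x)" unfolding span_at_iff l6 by blast
    have "v = (\<Sum>i<length ?L6. (if i < 5 then c i else 0) *\<^sub>R (?L6 ! i) x)"
      unfolding c l6 by (simp add: eval_nat_numeral)
    then show "\<psi> 5 x v = 0" using coframe_onD(4)[OF N1(3) _ x, of 5 "\<lambda>i. if i < 5 then c i else 0"] by simp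
  qed
  have "framed ?N X1 X2 Y \<phi> (\<psi> 5)"
  proof (rule framed.intro)
    show "structural ?N X1 X2 Y" by (rule structural_subset[OF str oN]) (use N1 in auto)
    show "coframe_on ?N ?L \<phi>" by (rule coframe_on_subset[OF N2(3) oN]) auto
    show "linear (\<psi> 5 x)" if "x \<in> ?N" for x using coframe_onD(2)[OF N1(3)] that by blast
    show "smooth_on ?N (\<lambda>x. \<psi> 5 x v)" for v
      by (rule smooth_on_subset[OF coframe_onD(3)[OF N1(3)]]) auto
    show "\<psi> 5 x v = 0 \<longleftrightarrow> v \<in> span_at ?L x" if "x \<in> ?N" for x v using ker that by blast
  qed
  then show ?thesis using that[of ?N] N1 N2 by blast
qed

lemma (in framed) transverse_first_integral:
  assumes p: "p \<in> N" and dim: "DIM('e) = 6"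
  obtains M and t :: "'e \<Rightarrow> real" where "open M" "p \<in> M" "M \<subseteq> N" "smooth_on M t" "fder t p (Y p) \<noteq> 0"
    "\<forall>x\<in>M. \<forall>v\<in>span_at [X1, X2, V] x. fder t x v = 0"
proof -
  have i5: "indep_at F p" by (rule indep_F[OF p])
  have "mset F = mset [Y2, Y1, Y, X2, X1]" by simp
  then have "indep_at [Y2, Y1, Y, X2, X1] p" using i5 indep_at_mset by blast
  then have i2: "indep_at [X2, X1] p" and Ynot: "Y p \<notin> span_at [X2, X1] p"
    unfolding indep_at_Cons by blast+
  have "V p \<notin> span_at [X2, X1] p"
    using V_notin[OF p] span_at_mono[of "[X2, X1]" "[X1, X2, Y]" p] by auto
  then have "indep_at [V, X2, X1] p" using i2 by (subst indep_at_Cons) simp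
  then have i3: "indep_at [X1, X2, V] p" using indep_at_mset[of "[X1, X2, V]" "[V, X2, X1]" p] by simp
  have sm: "smooth_on N X" if "X \<in> set [X1, X2, V]" for X
    using that smooth_X1 smooth_X2 sec_V by (auto simp: sec_def)
  have chr: "chr X" if "X \<in> set [X1, X2, V]" for X
    using that chr_X chr_V by auto
  have invol: "lie_bracket A B x \<in> span_at [X1, X2, V] x"
    if "x \<in> N" "A \<in> set [X1, X2, V]" "B \<in> set [X1, X2, V]" for x A B
    by (rule chr_in_span[OF chr_lie_bracket[OF chr[OF that(2)] chr[OF that(3)]] that(1)])
  have d: "DIM(real^3) = length [X1, X2, V]" "DIM(real^3) + DIM(real^3) = DIM('e)" using dim by simp_all
  obtain M and \<psi> :: "'e \<Rightarrow> real^3" where M: "open M" "p \<in> M" "M \<subseteq> N" "smooth_on M \<psi>"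
    and ker: "\<forall>x\<in>M. \<forall>v. fder \<psi> x v = 0 \<longleftrightarrow> v \<in> span_at [X1, X2, V] x"
    by (rule frobenius_list[OF d open_N p sm i3 invol])
  \<comment> \<open>Exchange argument: otherwise \<open>V p\<close> would lie in the span of
    \<open>X1\<close>, \<open>X2\<close> and \<open>Y\<close>, contrary to
    \<open>V_notin\<close>.\<close>
  have "Y p \<notin> span_at [X1, X2, V] p"
  proof
    assume "Y p \<in> span_at [X1, X2, V] p"
    moreover have "set (map (\<lambda>X. X p) [X1, X2, V]) = insert (V p) {X2 p, X1 p}" by auto
    ultimately have "Y p \<in> span (insert (V p) {X2 p, X1 p})" by (simp only:)
    then have "V p \<in> span (insert (Y p) {X2 p, X1 p})" by (rule in_span_insert) (use Ynot in simp)
    moreover have "insert (Y p) {X2 p, X1 p} = set (map (\<lambda>X. X p) [X1, X2, Y])" by auto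
    ultimately show False using V_notin[OF p] by (simp only:)
  qed
  then have "fder \<psi> p (Y p) \<noteq> 0" using ker M(2) by simp
  then obtain i where i: "fder \<psi> p (Y p) $ i \<noteq> 0" by (auto simp: vec_eq_iff)
  have d\<psi>: "fder (\<lambda>x. \<psi> x $ i) x v = fder \<psi> x v $ i" if "x \<in> M" for x v
    using fder_eq[OF bounded_linear.has_derivative[OF bounded_linear_vec_nth smooth_on_has_derivative[OF M(4) that], of i]]
    by simp
  show ?thesis
  proof (rule that[of M "\<lambda>x. \<psi> x $ i"])
    show "smooth_on M (\<lambda>x. \<psi> x $ i)" by (rule smooth_on_linear_image[OF bounded_linear_vec_nth M(1,4)])
    show "\<forall>x\<in>M. \<forall>v\<in>span_at [X1, X2, V] x. fder (\<lambda>x. \<psi> x $ i) x v = 0"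
    proof (intro ballI)
      fix x v assume x: "x \<in> M" and "v \<in> span_at [X1, X2, V] x"
      then have "fder \<psi> x v = 0" using ker by blast
      then show "fder (\<lambda>x. \<psi> x $ i) x v = 0" by (simp add: d\<psi>[OF x])
    qed
  qed (use M i d\<psi> in auto)
qed

section \<open>Adapted functions and the normal form\<close>

text \<open>Conditions on functions \<open>t\<close>, \<open>u\<close>, \<open>v\<close> ensuring that \<open>(t, u, v, Y u, Y (Y u), Y v)\<close> are
  jet coordinates near \<open>p\<close>; \<open>Z\<close> spans a complement of the derived distribution at \<open>p\<close>.\<close>

definition (in framed) adapted :: "'e \<Rightarrow> ('e \<Rightarrow> real) \<Rightarrow> ('e \<Rightarrow> real) \<Rightarrow> ('e \<Rightarrow> real) \<Rightarrow> 'e \<Rightarrow> bool" where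
  "adapted p t u v Z \<longleftrightarrow> smooth_on N t \<and> smooth_on N u \<and> smooth_on N v \<and>
    (\<forall>x\<in>N. along Y t x = 1 \<and>
      (\<forall>X\<in>{X1, X2}. along X t x = 0 \<and> along X u x = 0 \<and> along X v x = 0 \<and> along (lie_bracket Y X) u x = 0)) \<and>
    Z \<notin> span_at F p \<and> fder t p Z = 0 \<and> fder u p Z \<noteq> 0 \<and>
    along Y2 (along Y u) p * along Y1 v p \<noteq> along Y1 (along Y u) p * along Y2 v p"

context framed
begin

text \<open>Both \<open>Y t\<close> and \<open>X t\<close> are constant on \<open>N\<close>, so each
  iterated derivative in the commutator vanishes.\<close>

lemma along_YX_t:
  assumes t: "smooth_on N t" and 1: "\<And>x. x \<in> N \<Longrightarrow> along Y t x = (1::real)"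
    and 0: "\<And>x. x \<in> N \<Longrightarrow> along X t x = 0" and X: "smooth_on N X" and x: "x \<in> N"
  shows "along (lie_bracket Y X) t x = 0"
  using along_lie_bracket[OF open_N x smooth_Y X t]
    along_locally_const[where g="along Y t" and c=1 and X=X, OF open_N x 1]
    along_locally_const[where g="along X t" and c=0 and X=Y, OF open_N x 0] by simp

text \<open>\<open>t\<close> is constant along \<open>X_i\<close> and \<open>[Y, X_i]\<close> and
  stationary in the direction \<open>Z\<close>, so adding functions of \<open>t\<close> to
  \<open>u\<close> and \<open>v\<close> changes none of the quantities in the conditions on
  them.\<close>

lemma adapted_adjust:
  assumes ad: "adapted p t u v Z" and p: "p \<in> N"
  obtains t' u' v' where "adapted p t' u' v' Z" "t' p = q $ 1" "u' p = q $ 2" "v' p = q $ 3"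
    "along Y u' p = q $ 4" "along Y (along Y u') p = q $ 5" "along Y v' p = (q :: real^6) $ 6"
proof -
  have t: "smooth_on N t" and u: "smooth_on N u" and v: "smooth_on N v"
    and Yt: "\<And>x. x \<in> N \<Longrightarrow> along Y t x = 1" and Xt: "\<And>x X. x \<in> N \<Longrightarrow> X \<in> {X1, X2} \<Longrightarrow> along X t x = 0"
    using ad by (auto simp: adapted_def)
  have YXt: "along (lie_bracket Y X) t x = 0" if "x \<in> N" "X \<in> {X1, X2}" for x X
    using along_YX_t[OF t Yt Xt[OF _ that(2)] _ that(1)] that smooth_X1 smooth_X2 by auto
  \<comment> \<open>As \<open>\<tau> p = 0\<close> and \<open>Y \<tau> = 1\<close>, the coefficients
    of the polynomials in \<open>\<tau>\<close> are simply the missing values and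
    \<open>Y\<close>-derivatives at \<open>p\<close>; \<open>u\<close> needs degree two and
    \<open>v\<close> degree one.\<close>
  define c where "c = q $ 5 - along Y (along Y u) p"
  define b where "b = q $ 4 - along Y u p"
  define a where "a = q $ 2 - u p"
  define e where "e = q $ 6 - along Y v p"
  define d where "d = q $ 3 - v p"
  define \<tau> where "\<tau> x = t x - t p" for x
  define t' where "t' x = \<tau> x + q $ 1" for x
  define u' where "u' x = u x + (a + b * \<tau> x + c / 2 * (\<tau> x * \<tau> x))" for x
  define v' where "v' x = v x + (d + e * \<tau> x)" for x
  have \<tau>: "smooth_on N \<tau>" unfolding \<tau>_def by (intro smooth_on_diff open_N t smooth_on_const)
  have d\<tau>: "(\<tau> has_derivative fder t x) (at x)" if "x \<in> N" for x
    unfolding \<tau>_def using smooth_on_has_derivative[OF t that] by (auto intro!: derivative_eq_intros)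
  have dt': "fder t' x = fder t x" if "x \<in> N" for x
    by (rule fder_eq) (use d\<tau>[OF that] in \<open>auto simp: t'_def[abs_def] intro!: derivative_eq_intros\<close>)
  have du': "fder u' x = (\<lambda>w. fder u x w + (b + c * \<tau> x) * fder t x w)" if "x \<in> N" for x
    by (rule fder_eq)
      (use d\<tau>[OF that] smooth_on_has_derivative[OF u that] in
        \<open>auto simp: u'_def[abs_def] field_simps intro!: derivative_eq_intros\<close>)
  have dv': "fder v' x = (\<lambda>w. fder v x w + e * fder t x w)" if "x \<in> N" for x
    by (rule fder_eq)
      (use d\<tau>[OF that] smooth_on_has_derivative[OF v that] in \<open>auto simp: v'_def[abs_def] intro!: derivative_eq_intros\<close>)
  have Yu': "along Y u' x = along Y u x + (b + c * \<tau> x)" if "x \<in> N" for x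
    using Yt[OF that] by (simp add: along_def du'[OF that])
  have Yus: "smooth_on N (along Y u)" by (rule smooth_on_along[OF open_N smooth_Y u])
  have dYu': "fder (along Y u') x w = fder (along Y u) x w + c * fder t x w" if "x \<in> N" for x w
  proof -
    have "fder (along Y u') x = fder (\<lambda>x. along Y u x + (b + c * \<tau> x)) x"
      by (rule fder_cong_open[OF open_N that Yu'])
    also have "\<dots> = (\<lambda>w. fder (along Y u) x w + c * fder t x w)"
      by (rule fder_eq)
        (use d\<tau>[OF that] smooth_on_has_derivative[OF Yus that] in \<open>auto intro!: derivative_eq_intros\<close>)
    finally show ?thesis by simp
  qed
  have sm: "smooth_on N t'" "smooth_on N u'" "smooth_on N v'"
    unfolding t'_def u'_def v'_def
    by (intro smooth_on_add smooth_on_mult smooth_on_const open_N \<tau> u v)+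
  have \<tau>p: "\<tau> p = 0" by (simp add: \<tau>_def)
  have Yip: "along (lie_bracket Y X) (along Y u') p = along (lie_bracket Y X) (along Y u) p"
    "along (lie_bracket Y X) v' p = along (lie_bracket Y X) v p" if "X \<in> {X1, X2}" for X
    using YXt[OF p that] unfolding along_def[of "lie_bracket Y X"] by (simp_all add: dYu'[OF p] dv'[OF p])
  have "adapted p t' u' v' Z"
    unfolding adapted_def
  proof (intro conjI ballI sm)
    fix x assume x: "x \<in> N"
    show "along Y t' x = 1" using Yt[OF x] by (simp add: along_def dt'[OF x])
    fix X assume X: "X \<in> {X1, X2}"
    have "along X u x = 0" "along X v x = 0" "along (lie_bracket Y X) u x = 0" using ad x X by (auto simp: adapted_def)
    then show "along X t' x = 0" "along X u' x = 0" "along X v' x = 0" "along (lie_bracket Y X) u' x = 0"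
      using Xt[OF x X] YXt[OF x X] by (simp_all add: along_def dt'[OF x] du'[OF x] dv'[OF x])
  next
    show "Z \<notin> span_at F p" "fder t' p Z = 0" "fder u' p Z \<noteq> 0"
      using ad by (auto simp: adapted_def dt'[OF p] du'[OF p])
    show "along Y2 (along Y u') p * along Y1 v' p \<noteq> along Y1 (along Y u') p * along Y2 v' p"
      using ad by (simp add: adapted_def Yip)
  qed
  moreover have "t' p = q $ 1" "u' p = q $ 2" "v' p = q $ 3" by (simp_all add: t'_def u'_def v'_def \<tau>p a_def d_def)
  moreover have "along Y u' p = q $ 4" using Yu'[OF p] by (simp add: \<tau>p b_def)
  moreover have "along Y (along Y u') p = q $ 5"
    using Yt[OF p] by (simp add: along_def[of Y "along Y u'"] dYu'[OF p] c_def) (simp add: along_def)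
  moreover have "along Y v' p = q $ 6"
    using Yt[OF p] by (simp add: along_def dv'[OF p] e_def)
  ultimately show ?thesis by (rule that)
qed

end

text \<open>Cramer's rule, arranged for the determinant in the definition of
  \<open>adapted\<close>.\<close>

lemma two_by_two_kernel:
  fixes a b c d x y :: real
  assumes "b * c \<noteq> a * d" "x * a + y * b = 0" "x * c + y * d = 0"
  shows "x = 0 \<and> y = 0"
proof -
  have "x * (b * c - a * d) = b * (x * c + y * d) - d * (x * a + y * b)"
    "y * (b * c - a * d) = c * (x * a + y * b) - a * (x * c + y * d)" by algebra+
  then have "x * (b * c - a * d) = 0" "y * (b * c - a * d) = 0" unfolding assms(2,3) by simp_all
  then show ?thesis using assms(1) by simp
qed

text \<open>The derivative at \<open>p\<close> is triangular with respect to \<open>X1\<close>,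
  \<open>X2\<close>, \<open>Y\<close>, \<open>Y1\<close>, \<open>Y2\<close>, \<open>Z\<close>:
  \<open>t\<close> detects the \<open>Y\<close> component, \<open>u\<close> the \<open>Z\<close>
  component, the pair \<open>(Y u, v)\<close> the components along \<open>Y1\<close>,
  \<open>Y2\<close>, and finally \<open>(Y (Y u), Y v)\<close> those along \<open>X1\<close>,
  \<open>X2\<close>.\<close>

lemma cartan_normal_form:
  fixes X1 :: "(real^6) vfield"
  assumes fr: "framed N X1 X2 Y \<phi> \<theta>" and ad: "framed.adapted N X1 X2 Y p t u v Z" and p: "p \<in> N"
    and D: "\<And>x. x \<in> N \<Longrightarrow> D x = span_at [X1, X2, Y] x"
  obtains M V g where "open M" "p \<in> M" "M \<subseteq> N" "open V"
    "homeomorphism M V (\<lambda>x. vec6 (t x) (u x) (v x) (along Y u x) (along Y (along Y u) x) (along Y v x)) g"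
    "smooth_on M (\<lambda>x. vec6 (t x) (u x) (v x) (along Y u x) (along Y (along Y u) x) (along Y v x))" "smooth_on V g"
    "\<forall>x\<in>M. fder (\<lambda>x. vec6 (t x) (u x) (v x) (along Y u x) (along Y (along Y u) x) (along Y v x)) x ` D x
       = cartan_kernel (vec6 (t x) (u x) (v x) (along Y u x) (along Y (along Y u) x) (along Y v x))"
proof -
  interpret framed N X1 X2 Y \<phi> \<theta> by (rule fr)
  define \<Psi> where "\<Psi> x = vec6 (t x) (u x) (v x) (along Y u x) (along Y (along Y u) x) (along Y v x)" for x
  have t: "smooth_on N t" and u: "smooth_on N u" and v: "smooth_on N v"
    and Yt: "\<And>x. x \<in> N \<Longrightarrow> along Y t x = 1" and Xt: "\<And>x X. x \<in> N \<Longrightarrow> X \<in> {X1, X2} \<Longrightarrow> along X t x = 0"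
    and Xu: "\<And>x X. x \<in> N \<Longrightarrow> X \<in> {X1, X2} \<Longrightarrow> along X u x = 0"
    and Xv: "\<And>x X. x \<in> N \<Longrightarrow> X \<in> {X1, X2} \<Longrightarrow> along X v x = 0"
    and YXu: "\<And>x X. x \<in> N \<Longrightarrow> X \<in> {X1, X2} \<Longrightarrow> along (lie_bracket Y X) u x = 0"
    and Z: "Z \<notin> span_at F p" "fder t p Z = 0" "fder u p Z \<noteq> 0"
    and det: "along Y2 (along Y u) p * along Y1 v p \<noteq> along Y1 (along Y u) p * along Y2 v p"
    using ad by (auto simp: adapted_def)
  have smX: "smooth_on N X" if "X \<in> {X1, X2}" for X using that smooth_X1 smooth_X2 by auto
  have YXt: "along (lie_bracket Y X) t x = 0" if "x \<in> N" "X \<in> {X1, X2}" for x X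
    using along_YX_t[OF t Yt Xt[OF _ that(2)] smX[OF that(2)] that(1)] .
  have u1: "smooth_on N (along Y u)" by (rule smooth_on_along[OF open_N smooth_Y u])
  have u2: "smooth_on N (along Y (along Y u))" by (rule smooth_on_along[OF open_N smooth_Y u1])
  have v1: "smooth_on N (along Y v)" by (rule smooth_on_along[OF open_N smooth_Y v])
  \<comment> \<open>The commutator relation, in which the term \<open>Y (X g)\<close> vanishes
    because \<open>X g = 0\<close> on all of \<open>N\<close>.\<close>
  have swap: "along X (along Y g) x = - along (lie_bracket Y X) g x"
    if X: "X \<in> {X1, X2}" and g: "smooth_on N g" "\<And>y. y \<in> N \<Longrightarrow> along X g y = (0::real)" and x: "x \<in> N" for X g x
    using along_lie_bracket[OF open_N x smooth_Y smX[OF X] g(1)] along_locally_const[where g="along X g" and c=0 and X=Y, OF open_N x g(2)] by simp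
  have Xu1: "along X (along Y u) x = 0" if "x \<in> N" "X \<in> {X1, X2}" for x X
    using swap[OF that(2) u Xu[OF _ that(2)] that(1)] YXu[OF that] by simp
  have Xu2: "along X (along Y (along Y u)) x = - along (lie_bracket Y X) (along Y u) x" if "x \<in> N" "X \<in> {X1, X2}" for x X
    by (rule swap[OF that(2) u1 Xu1[OF _ that(2)] that(1)])
  have Xv1: "along X (along Y v) x = - along (lie_bracket Y X) v x" if "x \<in> N" "X \<in> {X1, X2}" for x X
    by (rule swap[OF that(2) v Xv[OF _ that(2)] that(1)])
  have smooth\<Psi>: "smooth_on N \<Psi>"
    unfolding \<Psi>_def vec6_def by (intro smooth_on_add smooth_on_scaleR smooth_on_const open_N t u v u1 u2 v1)
  have d\<Psi>: "fder \<Psi> x w = vec6 (fder t x w) (fder u x w) (fder v x w) (fder (along Y u) x w) (fder (along Y (along Y u)) x w) (fder (along Y v) x w)"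
    if x: "x \<in> N" for x w
  proof -
    have "(\<Psi> has_derivative (\<lambda>w. vec6 (fder t x w) (fder u x w) (fder v x w) (fder (along Y u) x w) (fder (along Y (along Y u)) x w) (fder (along Y v) x w))) (at x)"
      unfolding \<Psi>_def vec6_def
      by (intro has_derivative_add has_derivative_scaleR_left smooth_on_has_derivative[OF _ x] t u v u1 u2 v1)
    then show ?thesis by (simp add: fder_eq)
  qed
  have lin: "linear (fder \<Psi> x)" if "x \<in> N" for x by (rule smooth_on_linear_fder[OF smooth\<Psi> that])
  have "inj (fder \<Psi> p)"
    unfolding linear_injective_0[OF lin[OF p]]
  proof (intro allI impI)
    fix w assume w: "fder \<Psi> p w = 0"
    have w0: "fder t p w = 0" "fder u p w = 0" "fder v p w = 0" "fder (along Y u) p w = 0"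
      "fder (along Y (along Y u)) p w = 0" "fder (along Y v) p w = 0"
      using arg_cong[OF w, of "\<lambda>z. z $ 1"] arg_cong[OF w, of "\<lambda>z. z $ 2"] arg_cong[OF w, of "\<lambda>z. z $ 3"]
        arg_cong[OF w, of "\<lambda>z. z $ 4"] arg_cong[OF w, of "\<lambda>z. z $ 5"] arg_cong[OF w, of "\<lambda>z. z $ 6"]
      by (simp_all add: d\<Psi>[OF p])
    let ?L6 = "F @ [\<lambda>_. Z]"
    have "indep_at ?L6 p" unfolding indep_at_snoc using Z(1) indep_F[OF p] by blast
    then have "dim (span_at ?L6 p) = DIM(real^6)" using dim_span_at by fastforce
    then have "span_at ?L6 p = UNIV" unfolding dim_eq_full span_span .
    then obtain c where "w = (\<Sum>i<length ?L6. c i *\<^sub>R (?L6 ! i) p)" using span_at_iff[of w p ?L6] by blast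
    then have wc: "w = c 0 *\<^sub>R X1 p + c 1 *\<^sub>R X2 p + c 2 *\<^sub>R Y p + c 3 *\<^sub>R Y1 p + c 4 *\<^sub>R Y2 p + c 5 *\<^sub>R Z"
      by (simp add: eval_nat_numeral)
    have exp: "fder g p w = c 0 * along X1 g p + c 1 * along X2 g p + c 2 * along Y g p + c 3 * along Y1 g p + c 4 * along Y2 g p + c 5 * fder g p Z"
      if g: "smooth_on N g" for g :: "real^6 \<Rightarrow> real"
      unfolding wc along_def
      by (simp add: linear_add[OF smooth_on_linear_fder[OF g p]] linear_cmul[OF smooth_on_linear_fder[OF g p]])
    have c2: "c 2 = 0" using exp[OF t] w0(1) Xt[OF p] YXt[OF p] Yt[OF p] Z(2) by simp
    have c5: "c 5 = 0" using exp[OF u] w0(2) Xu[OF p] YXu[OF p] c2 Z(3) by simp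
    have "c 3 = 0 \<and> c 4 = 0"
      by (rule two_by_two_kernel[OF det])
        (use exp[OF u1] exp[OF v] w0(3,4) Xu1[OF p] Xv[OF p] c2 c5 in simp_all)
    then have c34: "c 3 = 0" "c 4 = 0" by auto
    \<comment> \<open>By \<open>Xu2\<close> and \<open>Xv1\<close> the coefficients of this system
      are the negatives of those of the previous one, so the same determinant decides.\<close>
    have "c 0 = 0 \<and> c 1 = 0"
      by (rule two_by_two_kernel[OF det])
        (use exp[OF u2] exp[OF v1] w0(5,6) Xu2[OF p] Xv1[OF p] c2 c5 c34 in simp_all)
    then show "w = 0" using wc c2 c5 c34 by simp
  qed
  from smooth_inverse_function[OF open_N p smooth\<Psi> this]
  obtain M V g where M: "open M" "M \<subseteq> N" "p \<in> M" "open V" "homeomorphism M V \<Psi> g" "smooth_on V g"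
    and bij: "\<And>x. x \<in> M \<Longrightarrow> bij (fder \<Psi> x)" by metis
  have img: "fder \<Psi> x ` D x = cartan_kernel (\<Psi> x)" if x: "x \<in> M" for x
  proof -
    have xN: "x \<in> N" using x M(2) by auto
    have Xk: "fder \<Psi> x (X x) \<in> cartan_kernel (\<Psi> x)" if "X \<in> {X1, X2}" for X
      using Xt[OF xN that] Xu[OF xN that] Xv[OF xN that] Xu1[OF xN that]
      by (simp add: d\<Psi>[OF xN] cartan_kernel_def \<Psi>_def) (simp add: along_def)
    have Yk: "fder \<Psi> x (Y x) \<in> cartan_kernel (\<Psi> x)"
      using Yt[OF xN] by (simp add: d\<Psi>[OF xN] cartan_kernel_def \<Psi>_def) (simp add: along_def)
    have "fder \<Psi> x ` D x \<subseteq> cartan_kernel (\<Psi> x)"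
      unfolding D[OF xN] linear_span_image[OF lin[OF xN], symmetric]
      by (rule span_minimal[OF _ subspace_cartan_kernel]) (use Xk Yk in auto)
    moreover have "subspace (fder \<Psi> x ` D x)"
      unfolding D[OF xN] by (rule linear_subspace_image[OF lin[OF xN] subspace_span])
    moreover have "dim (fder \<Psi> x ` D x) = 3"
    proof -
      have "mset F = mset [Y2, Y1, X1, X2, Y]" by simp
      then have "indep_at [Y2, Y1, X1, X2, Y] x" using indep_F[OF xN] indep_at_mset by blast
      then have "indep_at [X1, X2, Y] x" unfolding indep_at_Cons[of Y2] indep_at_Cons[of Y1] by blast
      then have "dim (D x) = 3" using dim_span_at D[OF xN] by fastforce
      moreover have "inj (fder \<Psi> x)" using bij[OF x] by (rule bij_is_inj)
      ultimately show ?thesis using dim_image_eq[OF lin[OF xN], of "D x"] inj_on_subset[OF _ subset_UNIV] by metis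
    qed
    ultimately show ?thesis
      using dim_cartan_kernel[of "\<Psi> x"] subspace_dim_equal[OF _ subspace_cartan_kernel] by metis
  qed
  show ?thesis
    by (rule that[of M V g]) (use M smooth_on_subset[OF smooth\<Psi> M(2)] img in \<open>auto simp: \<Psi>_def[abs_def]\<close>)
qed

section \<open>Construction of the functions \<open>u\<close> and \<open>v\<close>\<close>

context framed
begin

lemma framed_subset:
  assumes "open M" "M \<subseteq> N"
  shows "framed M X1 X2 Y \<phi> \<theta>"
proof (rule framed.intro)
  show "structural M X1 X2 Y" by (rule structural_subset[OF str assms])
  show "coframe_on M F \<phi>" by (rule coframe_on_subset[OF cof assms])
  show "linear (\<theta> x)" if "x \<in> M" for x using lin_lam that assms(2) by blast
  show "smooth_on M (\<lambda>x. \<theta> x v)" for v by (rule smooth_on_subset[OF smooth_lam assms(2)])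
  show "\<theta> x v = 0 \<longleftrightarrow> v \<in> span_at F x" if "x \<in> M" for x v using ker_lam that assms(2) by blast
qed

text \<open>The section \<open>B\<close> exists on the smaller set \<open>M\<close> only. This form
  is needed for the fields of a second frame, which are defined on a smaller neighbourhood.\<close>

lemma chr_local_section:
  assumes A: "chr A" and M: "open M" "M \<subseteq> N" and B: "smooth_on M B" "\<And>x. x \<in> M \<Longrightarrow> B x \<in> span_at F x" and x: "x \<in> M"
  shows "lie_bracket A B x \<in> span_at F x"
proof -
  interpret M: framed M X1 X2 Y \<phi> \<theta> by (rule framed_subset[OF M])
  have "smooth_on M A" using A M(2) smooth_on_subset unfolding chr_def sec_def by blast
  then have "M.sec A" using A M(2) unfolding chr_def sec_def M.sec_def by blast
  then have "M.chr A" using A M(2) unfolding chr_def M.chr_def by blast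
  moreover have "M.sec B" using B M.ker_lam unfolding M.sec_def by blast
  ultimately show ?thesis using M.chr_sec[OF _ _ x] M.ker_lam[OF x] by blast
qed

text \<open>\<open>Y\<close> is the only field of the frame along which \<open>t\<close> changes, so
  \<open>A t = 0\<close> removes the \<open>Y\<close> component of \<open>A\<close>. If
  \<open>\<theta> [Y1, Y2]\<close> were nonzero, \<open>chr_expansion\<close> would remove the
  components along \<open>Y1\<close> and \<open>Y2\<close> as well, leaving \<open>A\<close> in the
  span of \<open>X1\<close> and \<open>X2\<close>.\<close>

lemma lam_Y1_Y2:
  assumes t: "smooth_on N t" and Yt: "\<And>x. x \<in> N \<Longrightarrow> along Y t x = (1::real)"
    and Xt: "\<And>x X. x \<in> N \<Longrightarrow> X \<in> {X1, X2} \<Longrightarrow> along X t x = 0"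
    and A: "chr A" and x: "x \<in> N" and At: "fder t x (A x) = 0" and A2: "A x \<notin> span_at [X1, X2] x"
  shows "\<theta> x (lie_bracket Y1 Y2 x) = 0"
proof (rule ccontr)
  assume o: "\<theta> x (lie_bracket Y1 Y2 x) \<noteq> 0"
  have YXt: "along Y1 t x = 0" "along Y2 t x = 0"
    using along_YX_t[OF t Yt Xt smooth_X1 x] along_YX_t[OF t Yt Xt smooth_X2 x] by auto
  note e = chr_expansion[OF A x]
  have "fder t x (A x) = \<phi> 0 x (A x) * along X1 t x + \<phi> 1 x (A x) * along X2 t x + \<phi> 2 x (A x) * along Y t x
      + \<phi> 3 x (A x) * along Y1 t x + \<phi> 4 x (A x) * along Y2 t x"
    using smooth_on_linear_fder[OF t x] by (subst e(1)) (simp add: along_def linear_add linear_cmul)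
  then have "\<phi> 2 x (A x) = 0" using At Xt[OF x] YXt Yt[OF x] by simp
  then have "\<phi> 3 x (A x) = 0" "\<phi> 4 x (A x) = 0" using e(3,4) o by auto
  with \<open>\<phi> 2 x (A x) = 0\<close> have "A x = \<phi> 0 x (A x) *\<^sub>R X1 x + \<phi> 1 x (A x) *\<^sub>R X2 x"
    using e(1) by simp
  moreover have "\<phi> 0 x (A x) *\<^sub>R X1 x + \<phi> 1 x (A x) *\<^sub>R X2 x \<in> span_at [X1, X2] x"
    by (intro span_add span_scale span_base) auto
  ultimately show False using A2 by metis
qed

abbreviation "L \<equiv> [X1, X2, Y1, Y2]"

text \<open>\<open>\<theta>\<close> leaves the five frame fields, and the differential of
  \<open>t\<close> then eliminates \<open>Y\<close>.\<close>

lemma span_L: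
  assumes t: "smooth_on N t" and Yt: "\<And>x. x \<in> N \<Longrightarrow> along Y t x = (1::real)"
    and Lt: "\<And>x X. x \<in> N \<Longrightarrow> X \<in> set L \<Longrightarrow> along X t x = 0"
    and x: "x \<in> N" and w: "\<theta> x w = 0" "fder t x w = 0"
  shows "w \<in> span_at L x"
proof -
  obtain c where "w = (\<Sum>i<length F. c i *\<^sub>R (F ! i) x)"
    using w(1) ker_lam[OF x] unfolding span_at_iff by blast
  then have wc: "w = c 0 *\<^sub>R X1 x + c 1 *\<^sub>R X2 x + c 2 *\<^sub>R Y x + c 3 *\<^sub>R Y1 x + c 4 *\<^sub>R Y2 x"
    by (simp add: eval_nat_numeral)
  have "fder t x w = c 0 * along X1 t x + c 1 * along X2 t x + c 2 * along Y t x + c 3 * along Y1 t x + c 4 * along Y2 t x"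
    using smooth_on_linear_fder[OF t x] unfolding wc along_def by (simp add: linear_add linear_cmul)
  then have "c 2 = 0" using w(2) Lt[OF x] Yt[OF x] by simp
  then have "w = c 0 *\<^sub>R X1 x + c 1 *\<^sub>R X2 x + c 3 *\<^sub>R Y1 x + c 4 *\<^sub>R Y2 x" using wc by simp
  then show ?thesis by (simp only:) (intro span_add span_scale span_base; simp)
qed

text \<open>Brackets within \<open>L\<close> are annihilated by \<open>\<theta>\<close> and by the
  differential of \<open>t\<close>, so \<open>L\<close> is involutive. Its codimension is two, which
  leaves room for a first integral \<open>u\<close> that varies in the direction \<open>Z\<close>;
  the function \<open>v\<close> only has to be constant along \<open>X1\<close> and
  \<open>X2\<close> and is selected by the determinant condition.\<close>

lemma exists_adapted:
  assumes dim: "DIM('e) = 6" and p: "p \<in> N"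
    and t: "smooth_on N t" and Yt: "\<And>x. x \<in> N \<Longrightarrow> along Y t x = (1::real)"
    and Xt: "\<And>x X. x \<in> N \<Longrightarrow> X \<in> {X1, X2} \<Longrightarrow> along X t x = 0"
    and A: "chr A" and At: "\<And>x. x \<in> N \<Longrightarrow> fder t x (A x) = 0" and A2: "\<And>x. x \<in> N \<Longrightarrow> A x \<notin> span_at [X1, X2] x"
  obtains M u v Z where "open M" "p \<in> M" "M \<subseteq> N" "framed.adapted M X1 X2 Y p t u v Z"
proof -
  have YXt: "along Y1 t x = 0" "along Y2 t x = 0" if "x \<in> N" for x
    using along_YX_t[OF t Yt Xt smooth_X1 that] along_YX_t[OF t Yt Xt smooth_X2 that] by auto
  have smY: "smooth_on N Y1" "smooth_on N Y2"
    by (intro smooth_on_lie_bracket open_N smooth_Y smooth_X1 smooth_X2)+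
  have smL: "smooth_on N S" if "S \<in> set L" for S
    using that smooth_X1 smooth_X2 smY by auto
  have Lt: "along S t x = 0" if "x \<in> N" "S \<in> set L" for x S
    using that Xt YXt by auto
  have o: "\<theta> x (lie_bracket Y1 Y2 x) = 0" if "x \<in> N" for x
    by (rule lam_Y1_Y2[OF t Yt Xt A that At[OF that] A2[OF that]])
  have lamL: "\<theta> x (lie_bracket S T x) = 0" if x: "x \<in> N" and S: "S \<in> set L" and T: "T \<in> set L" for x S T
  proof -
    have c: "\<theta> x (lie_bracket X T x) = 0" if "X \<in> {X1, X2}" "T \<in> set L" for X T
    proof -
      have "T \<in> set F" using that(2) by auto
      then show ?thesis using chr_X[OF that(1)] x unfolding chr_def by blast
    qed
    show ?thesis
    proof (cases "S \<in> {X1, X2} \<or> T \<in> {X1, X2}")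
      case True
      then show ?thesis using c[OF _ T, of S] c[OF _ S, of T] lam_skew[OF x, of S T] by auto
    next
      case False
      then have "S = Y1 \<or> S = Y2" "T = Y1 \<or> T = Y2" using S T by auto
      then show ?thesis using o[OF x] lam_skew[OF x, of Y2 Y1] lam_zero[OF x] by auto
    qed
  qed
  have brt: "fder t x (lie_bracket S T x) = 0" if x: "x \<in> N" and S: "S \<in> set L" and T: "T \<in> set L" for x S T
    using along_lie_bracket[OF open_N x smL[OF S] smL[OF T] t]
      along_locally_const[where g="along T t" and c=0 and X=S, OF open_N x Lt[OF _ T]]
      along_locally_const[where g="along S t" and c=0 and X=T, OF open_N x Lt[OF _ S]]
    by (simp add: along_def[of "lie_bracket S T"])
  have invL: "lie_bracket S T x \<in> span_at L x" if "x \<in> N" "S \<in> set L" "T \<in> set L" for x S T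
    by (rule span_L[OF t Yt Lt that(1) lamL[OF that] brt[OF that]])
  have "mset F = mset [Y, X1, X2, Y1, Y2]" by simp
  then have "indep_at [Y, X1, X2, Y1, Y2] p" using indep_F[OF p] indep_at_mset by blast
  then have iL: "indep_at L p" unfolding indep_at_Cons[of Y] by blast
  have "mset L = mset [Y1, Y2, X1, X2]" by simp
  then have "indep_at [Y1, Y2, X1, X2] p" using iL indep_at_mset by blast
  then have i2: "indep_at [X1, X2] p" unfolding indep_at_Cons[of Y1] indep_at_Cons[of Y2] by blast
  have dL: "DIM(real^4) = length L" "DIM(real^4) + DIM(real^2) = DIM('e)" using dim by simp_all
  obtain M1 and \<psi> :: "'e \<Rightarrow> real^2" where M1: "open M1" "p \<in> M1" "M1 \<subseteq> N" "smooth_on M1 \<psi>"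
    and ker1: "\<forall>x\<in>M1. \<forall>v. fder \<psi> x v = 0 \<longleftrightarrow> v \<in> span_at L x"
    by (rule frobenius_list[OF dL open_N p smL iL invL])
  \<comment> \<open>Three-step generation supplies an index for which \<open>[Y, [Y, Xk]]\<close> is
    transverse to the rank five distribution; this bracket serves as \<open>Z\<close>.\<close>
  obtain Xk where Xk: "Xk \<in> {X1, X2}" "\<theta> p (lie_bracket Y (lie_bracket Y Xk) p) \<noteq> 0"
    using br_Y_YX[OF p] by auto
  define Yk where "Yk = lie_bracket Y Xk"
  define Z where "Z = lie_bracket Y Yk p"
  have YkL: "Yk \<in> set L" using Xk by (auto simp: Yk_def)
  have ZF: "Z \<notin> span_at F p" using Xk(2) ker_lam[OF p] by (simp add: Z_def Yk_def)
  have Zt: "fder t p Z = 0"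
    using along_YX_t[OF t Yt Lt[OF _ YkL] smL[OF YkL] p] by (simp add: along_def Z_def)
  have "Z \<notin> span_at L p" using ZF span_at_mono[of L F p] by auto
  then have "fder \<psi> p Z \<noteq> 0" using ker1 M1(2) by blast
  then obtain i where i: "fder \<psi> p Z $ i \<noteq> 0" by (auto simp: vec_eq_iff)
  define u where "u x = \<psi> x $ i" for x
  have du: "fder u x w = fder \<psi> x w $ i" if "x \<in> M1" for x w
    using fder_eq[OF bounded_linear.has_derivative[OF bounded_linear_vec_nth smooth_on_has_derivative[OF M1(4) that], of i]]
    by (simp add: u_def[abs_def])
  have smu: "smooth_on M1 u" unfolding u_def by (rule smooth_on_linear_image[OF bounded_linear_vec_nth M1(1,4)])
  have Lu: "along S u x = 0" if "x \<in> M1" "S \<in> set L" for x S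
  proof -
    have "S x \<in> span_at L x" by (rule span_atI[OF that(2)])
    then have "fder \<psi> x (S x) = 0" using ker1 that(1) by blast
    then show ?thesis by (simp add: along_def du[OF that(1)])
  qed
  have uZ: "fder u p Z \<noteq> 0" using i du[OF M1(2)] by simp
  have smM1: "smooth_on M1 S" if "smooth_on N S" for S :: "'e vfield" by (rule smooth_on_subset[OF that M1(3)])
  define u1 where "u1 = along Y u"
  \<comment> \<open>Since \<open>Yk u\<close> vanishes near \<open>p\<close>, this gives
    \<open>Yk (Y u) = - Z u\<close>, which is nonzero at \<open>p\<close>.\<close>
  have "along (lie_bracket Y Yk) u p = along Y (along Yk u) p - along Yk u1 p"
    unfolding u1_def by (rule along_lie_bracket[OF M1(1,2) smM1[OF smooth_Y] smM1[OF smL[OF YkL]] smu])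
  moreover have "along Y (along Yk u) p = 0"
    by (rule along_locally_const[where c=0, OF M1(1,2) Lu[OF _ YkL]])
  ultimately have "along Yk u1 p \<noteq> 0" using uZ by (simp add: along_def[of "lie_bracket Y Yk"] Z_def)
  then have u1ne: "along Y1 u1 p \<noteq> 0 \<or> along Y2 u1 p \<noteq> 0" using Xk(1) by (auto simp: Yk_def)
  \<comment> \<open>The combination of \<open>Y1\<close> and \<open>Y2\<close> that annihilates
    \<open>Y u\<close> at \<open>p\<close>. The derivative of \<open>v\<close> in the direction
    \<open>n\<close> is the required determinant, so any first integral of \<open>X1\<close>,
    \<open>X2\<close> that varies along \<open>n\<close> will do.\<close>
  define n where "n = along Y2 u1 p *\<^sub>R Y1 p - along Y1 u1 p *\<^sub>R Y2 p"
  have n2: "n \<notin> span_at [X1, X2] p"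
  proof
    assume "n \<in> span_at [X1, X2] p"
    then obtain c where c: "n = (\<Sum>i<length [X1, X2]. c i *\<^sub>R ([X1, X2] ! i) p)" unfolding span_at_iff by blast
    let ?d = "\<lambda>i. if i = 0 then c 0 else if i = 1 then c 1 else if i = 2 then - along Y2 u1 p else along Y1 u1 p"
    have "(\<Sum>i<length L. ?d i *\<^sub>R (L ! i) p) = 0"
      using c by (simp add: n_def eval_nat_numeral algebra_simps)
    from indep_atD[OF iL this, of 2] indep_atD[OF iL this, of 3] show False using u1ne by simp
  qed
  have d2: "DIM(real^2) = length [X1, X2]" "DIM(real^2) + DIM(real^4) = DIM('e)" using dim by simp_all
  have sm2: "smooth_on N S" if "S \<in> set [X1, X2]" for S using that smooth_X1 smooth_X2 by auto
  have inv2: "lie_bracket S T x \<in> span_at [X1, X2] x" if "x \<in> N" "S \<in> set [X1, X2]" "T \<in> set [X1, X2]" for x S T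
  proof -
    have "lie_bracket X2 X1 x \<in> span_at [X1, X2] x"
      unfolding lie_bracket_skew[of X2 X1] by (rule span_neg[OF br_X1_X2[OF that(1)]])
    then show ?thesis using that br_X1_X2[OF that(1)] by (auto simp: span_0)
  qed
  obtain M2 and \<kappa> :: "'e \<Rightarrow> real^4" where M2: "open M2" "p \<in> M2" "M2 \<subseteq> N" "smooth_on M2 \<kappa>"
    and ker2: "\<forall>x\<in>M2. \<forall>v. fder \<kappa> x v = 0 \<longleftrightarrow> v \<in> span_at [X1, X2] x"
    by (rule frobenius_list[OF d2 open_N p sm2 i2 inv2])
  have "fder \<kappa> p n \<noteq> 0" using ker2 M2(2) n2 by blast
  then obtain j where j: "fder \<kappa> p n $ j \<noteq> 0" by (auto simp: vec_eq_iff)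
  define v where "v x = \<kappa> x $ j" for x
  have dv: "fder v x w = fder \<kappa> x w $ j" if "x \<in> M2" for x w
    using fder_eq[OF bounded_linear.has_derivative[OF bounded_linear_vec_nth smooth_on_has_derivative[OF M2(4) that], of j]]
    by (simp add: v_def[abs_def])
  have smv: "smooth_on M2 v" unfolding v_def by (rule smooth_on_linear_image[OF bounded_linear_vec_nth M2(1,4)])
  have Xv: "along X v x = 0" if "x \<in> M2" "X \<in> {X1, X2}" for x X
  proof -
    have "X x \<in> span_at [X1, X2] x" by (rule span_atI) (use that in auto)
    then have "fder \<kappa> x (X x) = 0" using ker2 that(1) by blast
    then show ?thesis by (simp add: along_def dv[OF that(1)])
  qed
  have "fder v p n \<noteq> 0" using j dv[OF M2(2)] by simp
  then have det: "along Y2 u1 p * along Y1 v p \<noteq> along Y1 u1 p * along Y2 v p"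
    using smooth_on_linear_fder[OF smv M2(2)]
    by (simp add: n_def linear_diff linear_cmul along_def[of _ v])
  let ?M = "M1 \<inter> M2"
  have oM: "open ?M" using M1(1) M2(1) by (rule open_Int)
  have "framed.adapted ?M X1 X2 Y p t u v Z"
    unfolding framed.adapted_def[OF framed_subset[OF oM le_infI1[OF M1(3)]]]
  proof (intro conjI ballI)
    show "smooth_on ?M t" by (rule smooth_on_subset[OF t]) (use M1 in auto)
    show "smooth_on ?M u" by (rule smooth_on_subset[OF smu]) auto
    show "smooth_on ?M v" by (rule smooth_on_subset[OF smv]) auto
    fix x assume x: "x \<in> ?M"
    then have xN: "x \<in> N" using M1(3) by auto
    show "along Y t x = 1" by (rule Yt[OF xN])
    fix X assume X: "X \<in> {X1, X2}"
    show "along X t x = 0" by (rule Xt[OF xN X])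
    have "X \<in> set L" "lie_bracket Y X \<in> set L" using X by auto
    then show "along X u x = 0" "along (lie_bracket Y X) u x = 0" using Lu x by auto
    show "along X v x = 0" using Xv x X by auto
  next
    show "along Y2 (along Y u) p * along Y1 v p \<noteq> along Y1 (along Y u) p * along Y2 v p"
      using det by (simp add: u1_def)
  qed (use ZF Zt uZ in auto)
  then show ?thesis using that[of ?M] oM M1 M2 by blast
qed

end

section \<open>Frames of \<open>D\<close> extending frames of its rank two part, and the local
  normal form\<close>

lemma exists_D_frame:
  fixes D :: "'e::euclidean_space distrib"
  assumes d2: "distribution_on 2 \<Omega> D2" and d3: "distribution_on 3 \<Omega> D" and sub: "\<And>x. x \<in> \<Omega> \<Longrightarrow> D2 x \<subseteq> D x" and p: "p \<in> \<Omega>"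
  obtains U X1 X2 Y where "p \<in> U" "U \<subseteq> \<Omega>" "local_frame U D2 [X1, X2]" "local_frame U D [X1, X2, Y]"
proof -
  obtain U1 Xs where U1: "p \<in> U1" "U1 \<subseteq> \<Omega>" "local_frame U1 D2 Xs" "length Xs = 2"
    using d2 p unfolding distribution_on_def by blast
  obtain X1 X2 where Xs: "Xs = [X1, X2]" using U1(4) by (auto simp: length_Suc_conv numeral_2_eq_2)
  obtain U2 Zs where U2: "p \<in> U2" "U2 \<subseteq> \<Omega>" "local_frame U2 D Zs" "length Zs = 3"
    using d3 p unfolding distribution_on_def by blast
  note f1 = U1(3)[unfolded local_frame_iff Xs] and f2 = U2(3)[unfolded local_frame_iff]
  \<comment> \<open>The frames of \<open>D2\<close> and \<open>D\<close> are given independently;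
    some member of the latter must leave the rank two part for reasons of dimension, and it stays
    independent near \<open>p\<close>.\<close>
  have "\<exists>Y\<in>set Zs. Y p \<notin> span_at [X1, X2] p"
  proof (rule ccontr)
    assume "\<not> ?thesis"
    then have "set (map (\<lambda>X. X p) Zs) \<subseteq> span_at [X1, X2] p" by auto
    then have "span_at Zs p \<subseteq> span_at [X1, X2] p" by (rule span_minimal[OF _ subspace_span])
    then have "dim (span_at Zs p) \<le> dim (span_at [X1, X2] p)" by (rule dim_subset)
    also have "\<dots> \<le> 2" using dim_span_at_le[of p "[X1, X2]"] by simp
    finally show False using dim_span_at[of Zs p] f2 U2(1,4) by simp
  qed
  then obtain Y where Y: "Y \<in> set Zs" "Y p \<notin> span_at [X1, X2] p" by blast
  have U12: "open (U1 \<inter> U2)" "p \<in> U1 \<inter> U2" using f1 f2 U1 U2 by auto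
  have i3: "indep_at [Y, X1, X2] p" unfolding indep_at_Cons[of Y] using Y f1 U1(1) by blast
  have sm: "smooth_on (U1 \<inter> U2) S" if "S \<in> set [Y, X1, X2]" for S
  proof -
    have "smooth_on U1 X1" "smooth_on U1 X2" "smooth_on U2 Y" using f1 f2 Y(1) by auto
    then show ?thesis using that by (auto intro: smooth_on_subset)
  qed
  obtain N \<phi> where N: "p \<in> N" "N \<subseteq> U1 \<inter> U2" "coframe_on N [Y, X1, X2] \<phi>"
    by (rule exists_coframe_on[OF i3 U12 sm])
  have oN: "open N" by (rule coframe_onD(1)[OF N(3)])
  have "local_frame N D2 [X1, X2]"
    unfolding local_frame_iff using f1 oN N(2) smooth_on_subset by blast
  moreover have "local_frame N D [X1, X2, Y]"
    unfolding local_frame_iff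
  proof (intro conjI ballI oN)
    show "smooth_on N S" if "S \<in> set [X1, X2, Y]" for S
      by (rule smooth_on_subset[OF sm N(2)]) (use that in auto)
    fix x assume x: "x \<in> N"
    have "indep_at [Y, X1, X2] x" by (rule coframe_on_indep_at[OF N(3) x])
    moreover have "mset [Y, X1, X2] = mset [X1, X2, Y]" by simp
    ultimately show ix: "indep_at [X1, X2, Y] x" using indep_at_mset by blast
    have Dx: "span_at Zs x = D x" "span_at [X1, X2] x = D2 x" "x \<in> \<Omega>" "indep_at Zs x"
      using f1 f2 x N(2) U1(2) by auto
    have "X1 x \<in> D2 x" "X2 x \<in> D2 x" unfolding Dx(2)[symmetric] by (auto intro: span_base)
    moreover have "Y x \<in> D x" unfolding Dx(1)[symmetric] by (rule span_atI[OF Y(1)])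
    ultimately have "set (map (\<lambda>X. X x) [X1, X2, Y]) \<subseteq> D x" using sub[OF Dx(3)] by auto
    then have le: "span_at [X1, X2, Y] x \<subseteq> span_at Zs x"
      unfolding Dx(1) by (rule span_minimal) (use Dx(1) subspace_span in metis)
    have "dim (span_at Zs x) \<le> dim (span_at [X1, X2, Y] x)"
      using dim_span_at[OF ix] dim_span_at[OF Dx(4)] U2(4) by simp
    from subspace_dim_equal[OF subspace_span subspace_span le this]
    show "span_at [X1, X2, Y] x = D x" using Dx(1) by simp
  qed
  ultimately show ?thesis using that[of N] N U1 by blast
qed

theorem local_normal_form:
  fixes D :: "(real^6) distrib"
  assumes deg: "degenerated_parabolic_on \<Omega> D" and p: "p \<in> \<Omega>"
  obtains M W \<Psi> g where "open M" "p \<in> M" "M \<subseteq> \<Omega>" "open W" "homeomorphism M W \<Psi> g"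
    "smooth_on M \<Psi>" "smooth_on W g" "\<Psi> p = q" "\<forall>x\<in>M. fder \<Psi> x ` D x = cartan_kernel (\<Psi> x)"
proof -
  obtain D2 where D: "distribution_356_on \<Omega> D" and D2: "is_D2_on \<Omega> D D2" and int: "integrable2_on \<Omega> D2"
    and par0: "\<forall>U X Y Z. U \<subseteq> \<Omega> \<longrightarrow> adapted_frame U D D2 X Y Z \<longrightarrow> (\<forall>x\<in>U. structure_matrix D X Y Z x = 0)"
    using deg unfolding degenerated_parabolic_on_def by auto
  have par: "\<And>U X Y Z x. U \<subseteq> \<Omega> \<Longrightarrow> adapted_frame U D D2 X Y Z \<Longrightarrow> x \<in> U \<Longrightarrow> structure_matrix D X Y Z x = 0"
    using par0 by blast
  have d2: "distribution_on 2 \<Omega> D2" and d3: "distribution_on 3 \<Omega> D" and sub: "\<And>x. x \<in> \<Omega> \<Longrightarrow> D2 x \<subseteq> D x"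
    using D D2 by (auto simp: distribution_356_on_def is_D2_on_def)
  obtain U X1 X2 Y where U: "p \<in> U" "U \<subseteq> \<Omega>" and f2: "local_frame U D2 [X1, X2]" and f3: "local_frame U D [X1, X2, Y]"
    by (rule exists_D_frame[OF d2 d3 sub p])
  have str: "structural U X1 X2 Y" by (rule degenerated_parabolic_structural[OF D D2 int par U(2) f2 f3])
  obtain N \<phi> \<theta> where N: "p \<in> N" "N \<subseteq> U" and fr: "framed N X1 X2 Y \<phi> \<theta>"
    by (rule exists_framed[OF str U(1)])
  have dim6: "DIM(real^6) = 6" by simp
  \<comment> \<open>First pass, with an arbitrary \<open>Y\<close>: it supplies the function
    \<open>t\<close> and the characteristic field \<open>A.V\<close>.\<close>
  interpret A: framed N X1 X2 Y \<phi> \<theta> by (rule fr)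
  obtain M and t :: "real^6 \<Rightarrow> real" where M: "open M" "p \<in> M" "M \<subseteq> N" and t: "smooth_on M t" and tY: "fder t p (Y p) \<noteq> 0"
    and tC: "\<forall>x\<in>M. \<forall>v\<in>span_at [X1, X2, A.V] x. fder t x v = 0"
    by (rule A.transverse_first_integral[OF N(1) dim6])
  define h where "h = along Y t"
  have smYM: "smooth_on M Y" by (rule smooth_on_subset[OF A.smooth_Y M(3)])
  have smh: "smooth_on M h" unfolding h_def by (rule smooth_on_along[OF M(1) smYM t])
  define K where "K = {x\<in>M. h x \<noteq> 0}"
  have oK: "open K"
    using continuous_open_preimage[OF smooth_on_imp_continuous_on[OF smh] M(1) open_Compl[OF closed_singleton[of 0]]]
    by (simp add: K_def vimage_def Collect_conj_eq)
  have K: "p \<in> K" "K \<subseteq> M" using M(2) tY by (auto simp: K_def h_def along_def)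
  have KU: "K \<subseteq> U" using K M N by auto
  \<comment> \<open>Since \<open>h = Y t\<close>, this field satisfies \<open>Y' t = 1\<close> on
    \<open>K\<close>, where \<open>h\<close> has no zeros.\<close>
  define Y' where "Y' x = inverse (h x) *\<^sub>R Y x" for x
  have smY': "smooth_on K Y'"
    unfolding Y'_def
    by (intro smooth_on_scaleR smooth_on_inverse oK smooth_on_subset[OF smh K(2)] smooth_on_subset[OF smYM K(2)])
      (auto simp: K_def)
  have f2': "local_frame K D2 [X1, X2]"
    using f2 oK KU smooth_on_subset unfolding local_frame_iff by blast
  have f3': "local_frame K D [X1, X2, Y']"
    unfolding local_frame_iff
  proof (intro conjI ballI oK)
    show "smooth_on K S" if "S \<in> set [X1, X2, Y']" for S
      using that smY' f2' by (auto simp: local_frame_iff)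
    fix x assume x: "x \<in> K"
    have hx: "h x \<noteq> 0" using x by (simp add: K_def)
    have Dx: "span_at [X1, X2, Y] x = D x" "indep_at [X1, X2, Y] x" using f3 x KU by (auto simp: local_frame_iff)
    have "Y x = h x *\<^sub>R Y' x" using hx by (simp add: Y'_def)
    then have "Y x \<in> span_at [X1, X2, Y'] x" by (metis span_scale[OF span_atI[of Y' "[X1, X2, Y']" x], of "h x"] list.set_intros)
    then have "span_at [X1, X2, Y] x \<subseteq> span_at [X1, X2, Y'] x"
      by (intro span_minimal) (auto intro: span_base)
    moreover have "Y' x \<in> span_at [X1, X2, Y] x" unfolding Y'_def by (rule span_scale, rule span_base) simp
    then have "span_at [X1, X2, Y'] x \<subseteq> span_at [X1, X2, Y] x"
      by (intro span_minimal) (auto intro: span_base)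
    ultimately have eq: "span_at [X1, X2, Y'] x = span_at [X1, X2, Y] x" by blast
    then show "span_at [X1, X2, Y'] x = D x" using Dx(1) by simp
    show "indep_at [X1, X2, Y'] x"
      by (rule indep_at_of_dim) (use eq dim_span_at[OF Dx(2)] in simp)
  qed
  have str': "structural K X1 X2 Y'"
    by (rule degenerated_parabolic_structural[OF D D2 int par _ f2' f3']) (use KU U(2) in auto)
  obtain N' \<phi>' \<theta>' where N': "p \<in> N'" "N' \<subseteq> K" and fr': "framed N' X1 X2 Y' \<phi>' \<theta>'"
    by (rule exists_framed[OF str' K(1)])
  interpret B: framed N' X1 X2 Y' \<phi>' \<theta>' by (rule fr')
  have N'N: "N' \<subseteq> N" and N'M: "N' \<subseteq> M" using N' K M by auto
  \<comment> \<open>The brackets with \<open>X1\<close> and \<open>X2\<close> change under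
    rescaling, but both lists of five fields span \<open>[D, D]\<close>.\<close>
  have same: "span_at (five X1 X2 Y') x = span_at (five X1 X2 Y) x" if "x \<in> K" for x
  proof -
    have "x \<in> \<Omega>" using that KU U(2) by auto
    then have "dim (dist_bracket D D x) = 5" "dist_bracket D2 D2 x \<subseteq> D x"
      using D D2 by (auto simp: distribution_356_on_def is_D2_on_def)
    from dist_bracket_DD(1)[OF this f2 f3] dist_bracket_DD(1)[OF this f2' f3'] that KU show ?thesis by auto
  qed
  have smV: "smooth_on N A.V" using A.sec_V by (simp add: A.sec_def)
  have secV: "B.sec A.V"
    unfolding B.sec_def
  proof (intro conjI ballI)
    show "smooth_on N' A.V" by (rule smooth_on_subset[OF smV N'N])
    fix x assume x: "x \<in> N'"
    then have "A.V x \<in> span_at (five X1 X2 Y) x" using A.sec_V A.ker_lam N'N by (auto simp: A.sec_def)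
    then show "\<theta>' x (A.V x) = 0" using B.ker_lam[OF x] same[of x] x N'(2) by auto
  qed
  \<comment> \<open>Being characteristic refers only to the rank five distribution, so the field
    found in the first frame keeps this property in the second, even though the cross product
    formula there would give another field.\<close>
  have chrV: "B.chr A.V"
    unfolding B.chr_def
  proof (intro conjI ballI secV)
    fix S x assume S: "S \<in> set (five X1 X2 Y')" and x: "x \<in> N'"
    have xK: "x \<in> K" if "x \<in> N'" for x using that N'(2) by auto
    have "lie_bracket A.V S x \<in> span_at (five X1 X2 Y) x"
    proof (rule A.chr_local_section[OF A.chr_V B.open_N N'N B.smooth_F[OF S] _ x])
      show "S x \<in> span_at (five X1 X2 Y) x" if "x \<in> N'" for x
        using span_atI[OF S] same[OF xK[OF that]] by blast
    qed
    then show "\<theta>' x (lie_bracket A.V S x) = 0" using B.ker_lam[OF x] same[OF xK[OF x]] by blast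
  qed
  have Vt: "fder t x (A.V x) = 0" if "x \<in> N'" for x
    by (rule tC[rule_format]) (use that N'M in \<open>auto intro: span_base\<close>)
  have V2: "A.V x \<notin> span_at [X1, X2] x" if "x \<in> N'" for x
    using A.V_notin[of x] span_at_mono[of "[X1, X2]" "[X1, X2, Y]" x] that N'N by auto
  have t': "smooth_on N' t" by (rule smooth_on_subset[OF t N'M])
  have Xt: "along X t x = 0" if "x \<in> N'" "X \<in> {X1, X2}" for x X
    unfolding along_def by (rule tC[rule_format]) (use that N'M in \<open>auto intro: span_base\<close>)
  have Yt: "along Y' t x = 1" if x: "x \<in> N'" for x
  proof -
    have "h x \<noteq> 0" using x N'(2) by (auto simp: K_def)
    then show ?thesis using linear_cmul[OF smooth_on_linear_fder[OF t' x]]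
      by (simp add: along_def Y'_def) (simp add: h_def along_def)
  qed
  obtain M1 u v Z where M1: "open M1" "p \<in> M1" "M1 \<subseteq> N'" and ad: "framed.adapted M1 X1 X2 Y' p t u v Z"
    by (rule B.exists_adapted[OF dim6 N'(1) t' Yt Xt chrV Vt V2])
  have fr1: "framed M1 X1 X2 Y' \<phi>' \<theta>'" by (rule B.framed_subset[OF M1(1,3)])
  interpret C: framed M1 X1 X2 Y' \<phi>' \<theta>' by (rule fr1)
  obtain t2 u2 v2 where ad2: "C.adapted p t2 u2 v2 Z"
    and val: "t2 p = q $ 1" "u2 p = q $ 2" "v2 p = q $ 3" "along Y' u2 p = q $ 4" "along Y' (along Y' u2) p = q $ 5" "along Y' v2 p = q $ 6"
    by (rule C.adapted_adjust[OF ad M1(2), of q])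
  have Dx: "D x = span_at [X1, X2, Y'] x" if "x \<in> M1" for x
    using f3' that M1(3) N'(2) unfolding local_frame_iff by blast
  let ?\<Psi> = "\<lambda>x. vec6 (t2 x) (u2 x) (v2 x) (along Y' u2 x) (along Y' (along Y' u2) x) (along Y' v2 x)"
  obtain M2 W g where M2: "open M2" "p \<in> M2" "M2 \<subseteq> M1" "open W" "homeomorphism M2 W ?\<Psi> g"
    "smooth_on M2 ?\<Psi>" "smooth_on W g" and img: "\<forall>x\<in>M2. fder ?\<Psi> x ` D x = cartan_kernel (?\<Psi> x)"
    by (rule cartan_normal_form[OF fr1 ad2 M1(2) Dx])
  have \<Psi>p: "?\<Psi> p = q" by (rule vec6_eqI) (simp_all add: val)
  show ?thesis
    by (rule that[OF M2(1,2) _ M2(4,5,6,7) \<Psi>p img]) (use M2(3) M1(3) N'(2) KU U(2) in blast)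
qed

section \<open>Local equivalence in charts\<close>

lemma is_chartD:
  assumes "is_chart c"
  shows "open (chart_dom c)" "open (chart_img c)"
    "x \<in> chart_dom c \<Longrightarrow> chart_inv c (chart_map c x) = x"
    "y \<in> chart_img c \<Longrightarrow> chart_map c (chart_inv c y) = y"
    "x \<in> chart_dom c \<Longrightarrow> chart_map c x \<in> chart_img c"
    "y \<in> chart_img c \<Longrightarrow> chart_inv c y \<in> chart_dom c"
    "continuous_on (chart_dom c) (chart_map c)" "continuous_on (chart_img c) (chart_inv c)"
  using assms by (auto simp: is_chart_def homeomorphism_def)

lemma open_chart_preimage:
  assumes "is_chart c" "open S"
  shows "open {x \<in> chart_dom c. chart_map c x \<in> S}"
  using continuous_open_preimage[OF is_chartD(7,1)[OF assms(1)] assms(2)]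
  by (simp add: vimage_def Collect_conj_eq)

lemma open_chart_image:
  assumes "is_chart c" "open S" "S \<subseteq> chart_dom c"
  shows "open (chart_map c ` S)"
proof -
  have "chart_map c ` S = {y \<in> chart_img c. chart_inv c y \<in> S}"
    using assms(3) is_chartD[OF assms(1)] by (force simp: image_iff)
  then show ?thesis
    using continuous_open_preimage[OF is_chartD(8,2)[OF assms(1)] assms(2)]
    by (simp add: vimage_def Collect_conj_eq)
qed

text \<open>A map between chart images, to be lifted to the manifolds. Smoothness is assumed for
  \<open>\<Theta>\<close> alone; exchanging the roles of the two sides treats the inverse.\<close>

locale chart_correspondence =
  fixes A :: "('m::topological_space, 'e::euclidean_space) chart set"
    and A' :: "('n::topological_space, 'e) chart set"
    and c c' \<Omega> \<Omega>' \<Theta> \<Xi>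
  assumes A: "smooth_atlas A" and A': "smooth_atlas A'" and c: "c \<in> A" and c': "c' \<in> A'"
    and \<Omega>: "open \<Omega>" "\<Omega> \<subseteq> chart_img c" and \<Omega>': "open \<Omega>'" "\<Omega>' \<subseteq> chart_img c'"
    and hom: "homeomorphism \<Omega> \<Omega>' \<Theta> \<Xi>" and smooth: "smooth_on \<Omega> \<Theta>"
begin

definition "U = {x \<in> chart_dom c. chart_map c x \<in> \<Omega>}"
definition "F = (\<lambda>x. chart_inv c' (\<Theta> (chart_map c x)))"

lemma charts: "d \<in> A \<Longrightarrow> is_chart d" "d' \<in> A' \<Longrightarrow> is_chart d'"
  using A A' by (auto simp: smooth_atlas_def)

lemmas ch = is_chartD[OF charts(1)[OF c]]
lemmas ch' = is_chartD[OF charts(2)[OF c']]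

lemma open_U: "open U"
  unfolding U_def by (rule open_chart_preimage[OF charts(1)[OF c] \<Omega>(1)])

lemma \<Theta>_mem: "y \<in> \<Omega> \<Longrightarrow> \<Theta> y \<in> \<Omega>'"
  using hom by (auto simp: homeomorphism_def)

lemma map_F: "x \<in> U \<Longrightarrow> chart_map c' (F x) = \<Theta> (chart_map c x)"
  unfolding F_def using ch'(4) \<Theta>_mem \<Omega>'(2) by (auto simp: U_def)

lemma F_mem: "x \<in> U \<Longrightarrow> F x \<in> chart_dom c' \<and> chart_map c' (F x) \<in> \<Omega>'"
  using map_F ch'(6) \<Theta>_mem \<Omega>'(2) by (auto simp: U_def F_def)

lemma continuous_F: "continuous_on U F"
  unfolding F_def
proof (rule continuous_on_compose2[OF ch'(8)])
  show "continuous_on U (\<lambda>x. \<Theta> (chart_map c x))"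
    by (rule continuous_on_compose2[OF smooth_on_imp_continuous_on[OF smooth] continuous_on_subset[OF ch(7)]])
      (auto simp: U_def)
qed (use \<Theta>_mem \<Omega>'(2) in \<open>auto simp: U_def\<close>)

context
  fixes d d'
  assumes d: "d \<in> A" and d': "d' \<in> A'"
begin

text \<open>Smoothness and transport of the distribution are required in all charts of the two
  atlases, whereas \<open>\<Theta>\<close> is given in the single pair \<open>c\<close>,
  \<open>c'\<close>; on this overlap another pair \<open>d\<close>, \<open>d'\<close> can be
  compared with it.\<close>

definition "Ov = {x \<in> U \<inter> chart_dom d. F x \<in> chart_dom d'}"

lemma open_image_Ov: "open (chart_map d ` Ov)"
proof (rule open_chart_image[OF charts(1)[OF d]])
  have "open (U \<inter> chart_dom d)" using open_U is_chartD(1)[OF charts(1)[OF d]] by (rule open_Int)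
  then show "open Ov"
    using continuous_open_preimage[OF continuous_on_subset[OF continuous_F] _ is_chartD(1)[OF charts(2)[OF d']], of "U \<inter> chart_dom d"]
    by (auto simp: Ov_def vimage_def Collect_conj_eq Int_assoc)
qed (auto simp: Ov_def)

lemma coordinate_expression:
  assumes "y \<in> chart_map d ` Ov"
  shows "(chart_map d' \<circ> F \<circ> chart_inv d) y = transition c' d' (\<Theta> (transition d c y))"
    "transition d c y \<in> \<Omega>" "y \<in> chart_map d ` (chart_dom d \<inter> chart_dom c)"
    "\<Theta> (transition d c y) \<in> chart_map c' ` (chart_dom c' \<inter> chart_dom d')"
proof -
  obtain x where x: "x \<in> Ov" "y = chart_map d x" using assms by auto
  have inv: "chart_inv d y = x" using x is_chartD(3)[OF charts(1)[OF d]] by (auto simp: Ov_def)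
  have xU: "x \<in> U" using x by (auto simp: Ov_def)
  then have Fx: "chart_inv c' (\<Theta> (chart_map c x)) = F x" by (simp add: F_def)
  show "(chart_map d' \<circ> F \<circ> chart_inv d) y = transition c' d' (\<Theta> (transition d c y))"
    by (simp add: transition_def inv Fx)
  show "transition d c y \<in> \<Omega>" using xU by (simp add: transition_def inv U_def)
  show "y \<in> chart_map d ` (chart_dom d \<inter> chart_dom c)" using x by (auto simp: Ov_def U_def)
  have "\<Theta> (transition d c y) = chart_map c' (F x)" using map_F[OF xU] by (simp add: transition_def inv)
  then show "\<Theta> (transition d c y) \<in> chart_map c' ` (chart_dom c' \<inter> chart_dom d')"
    using F_mem[OF xU] x by (auto simp: Ov_def)
qed

lemma smooth_transitions:
  "smooth_on (chart_map d ` Ov) (transition d c)"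
  "smooth_on (chart_map c' ` (chart_dom c' \<inter> chart_dom d')) (transition c' d')"
proof -
  have "smooth_on (chart_map d ` (chart_dom d \<inter> chart_dom c)) (transition d c)"
    using A c d by (auto simp: smooth_atlas_def)
  then show "smooth_on (chart_map d ` Ov) (transition d c)"
    by (rule smooth_on_subset) (auto simp: Ov_def U_def)
  show "smooth_on (chart_map c' ` (chart_dom c' \<inter> chart_dom d')) (transition c' d')"
    using A' c' d' by (auto simp: smooth_atlas_def)
qed

lemma smooth_coordinate_expression: "smooth_on (chart_map d ` Ov) (chart_map d' \<circ> F \<circ> chart_inv d)"
proof (rule smooth_on_cong[OF open_image_Ov coordinate_expression(1)[symmetric]])
  have "smooth_on (chart_map d ` Ov) (\<lambda>y. \<Theta> (transition d c y))"
    by (rule smooth_on_compose[OF open_image_Ov smooth_transitions(1) smooth]) (use coordinate_expression(2) in auto)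
  then show "smooth_on (chart_map d ` Ov) (\<lambda>y. transition c' d' (\<Theta> (transition d c y)))"
    by (rule smooth_on_compose[OF open_image_Ov _ smooth_transitions(2)]) (use coordinate_expression(4) in auto)
qed

lemma fder_coordinate_expression:
  assumes x: "x \<in> Ov"
  shows "fder (chart_map d' \<circ> F \<circ> chart_inv d) (chart_map d x) w =
    fder (transition c' d') (chart_map c' (F x)) (fder \<Theta> (chart_map c x) (fder (transition d c) (chart_map d x) w))"
proof -
  let ?y = "chart_map d x"
  have y: "?y \<in> chart_map d ` Ov" using x by blast
  have inv: "chart_inv d ?y = x" using x is_chartD(3)[OF charts(1)[OF d]] by (auto simp: Ov_def)
  have xU: "x \<in> U" using x by (auto simp: Ov_def)
  have T: "transition d c ?y = chart_map c x" by (simp add: transition_def inv)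
  have \<Theta>T: "\<Theta> (transition d c ?y) = chart_map c' (F x)" using map_F[OF xU] by (simp add: T)
  have 1: "(transition d c has_derivative fder (transition d c) ?y) (at ?y)"
    by (rule smooth_on_has_derivative[OF smooth_transitions(1) y])
  have 2: "(\<Theta> has_derivative fder \<Theta> (chart_map c x)) (at (transition d c ?y))"
    unfolding T[symmetric] by (rule smooth_on_has_derivative[OF smooth coordinate_expression(2)[OF y]])
  have 3: "(transition c' d' has_derivative fder (transition c' d') (chart_map c' (F x))) (at (\<Theta> (transition d c ?y)))"
    unfolding \<Theta>T[symmetric] by (rule smooth_on_has_derivative[OF smooth_transitions(2) coordinate_expression(4)[OF y]])
  have "((\<lambda>y. transition c' d' (\<Theta> (transition d c y))) has_derivative
      (\<lambda>w. fder (transition c' d') (chart_map c' (F x)) (fder \<Theta> (chart_map c x) (fder (transition d c) ?y w)))) (at ?y)"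
    by (rule has_derivative_compose[OF has_derivative_compose[OF 1 2] 3])
  then have "((chart_map d' \<circ> F \<circ> chart_inv d) has_derivative
      (\<lambda>w. fder (transition c' d') (chart_map c' (F x)) (fder \<Theta> (chart_map c x) (fder (transition d c) ?y w)))) (at ?y)"
    by (subst has_derivative_cong_open[OF open_image_Ov y coordinate_expression(1)])
  then show ?thesis by (simp add: fder_eq)
qed

end

lemma smooth_map_on_F: "smooth_map_on A A' U F"
  unfolding smooth_map_on_def
proof (intro ballI)
  fix d d' assume d: "d \<in> A" and d': "d' \<in> A'"
  show "smooth_on (chart_map d ` {p \<in> U \<inter> chart_dom d. F p \<in> chart_dom d'}) (chart_map d' \<circ> F \<circ> chart_inv d)"
    using smooth_coordinate_expression[OF d d'] by (simp add: Ov_def[OF d d'])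
qed

text \<open>Tangent vectors transform by exactly those Jacobians of transition maps which the chain
  rule puts before and after \<open>fder \<Theta>\<close>.\<close>

lemma carries_on_F:
  assumes D: "\<forall>p\<in>carrier A. D p \<subseteq> tangent_space A p" and D': "\<forall>p\<in>carrier A'. D' p \<subseteq> tangent_space A' p"
    and img: "\<And>y. y \<in> \<Omega> \<Longrightarrow> fder \<Theta> y ` in_chart D c y = in_chart D' c' (\<Theta> y)"
  shows "carries_on A D A' D' U F"
  unfolding carries_on_def
proof (intro ballI impI)
  fix x d d' assume x: "x \<in> U" and d: "d \<in> A" and d': "d' \<in> A'" and xd: "x \<in> chart_dom d" and Fd': "F x \<in> chart_dom d'"
  have xO: "x \<in> Ov d d'" using x xd Fd' by (simp add: Ov_def[OF d d'])
  have xc: "x \<in> chart_dom c" "chart_map c x \<in> \<Omega>" using x by (auto simp: U_def)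
  have Fc: "F x \<in> chart_dom c'" using F_mem[OF x] by simp
  have "x \<in> carrier A" "F x \<in> carrier A'" using c c' xc Fc by (auto simp: carrier_def)
  then have Dx: "D x \<subseteq> tangent_space A x" and DFx: "D' (F x) \<subseteq> tangent_space A' (F x)" using D D' by auto
  have vc: "v c = fder (transition d c) (chart_map d x) (v d)" if "v \<in> D x" for v
    using Dx that c d xc xd unfolding tangent_space_def by blast
  have wd': "w d' = fder (transition c' d') (chart_map c' (F x)) (w c')" if "w \<in> D' (F x)" for w
    using DFx that c' d' Fc Fd' unfolding tangent_space_def by blast
  have "fder \<Theta> (chart_map c x) ` (\<lambda>v. v c) ` D x = (\<lambda>w. w c') ` D' (F x)"
    using img[OF xc(2)] ch(3)[OF xc(1)] ch'(3)[OF Fc] map_F[OF x] by (simp add: in_chart_def)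
  then have e: "(\<lambda>v. fder \<Theta> (chart_map c x) (v c)) ` D x = (\<lambda>w. w c') ` D' (F x)"
    by (simp add: image_image)
  have "fder (chart_map d' \<circ> F \<circ> chart_inv d) (chart_map d x) ` (\<lambda>v. v d) ` D x
      = (\<lambda>v. fder (transition c' d') (chart_map c' (F x)) (fder \<Theta> (chart_map c x) (v c))) ` D x"
    unfolding image_image fder_coordinate_expression[OF d d' xO] by (rule image_cong[OF refl]) (simp add: vc)
  also have "\<dots> = fder (transition c' d') (chart_map c' (F x)) ` (\<lambda>v. fder \<Theta> (chart_map c x) (v c)) ` D x"
    by (simp add: image_image)
  also have "\<dots> = (\<lambda>w. w d') ` D' (F x)"
    unfolding e image_image by (rule image_cong[OF refl]) (simp add: wd')
  finally show "fder (chart_map d' \<circ> F \<circ> chart_inv d) (chart_map d x) ` (\<lambda>v. v d) ` D x = (\<lambda>w. w d') ` D' (F x)" .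
qed

end

lemma local_equivalence_of_chart_diffeo:
  fixes A :: "('m::topological_space, 'e::euclidean_space) chart set" and A' :: "('n::topological_space, 'e) chart set"
  assumes A: "smooth_atlas A" and A': "smooth_atlas A'" and c: "c \<in> A" and c': "c' \<in> A'"
    and D: "\<forall>p\<in>carrier A. D p \<subseteq> tangent_space A p" and D': "\<forall>p\<in>carrier A'. D' p \<subseteq> tangent_space A' p"
    and p: "p \<in> chart_dom c" "chart_map c p \<in> \<Omega>" and q: "q \<in> chart_dom c'" "\<Theta> (chart_map c p) = chart_map c' q"
    and \<Omega>: "open \<Omega>" "\<Omega> \<subseteq> chart_img c" and \<Omega>': "open \<Omega>'" "\<Omega>' \<subseteq> chart_img c'"
    and hom: "homeomorphism \<Omega> \<Omega>' \<Theta> \<Xi>" and smooth: "smooth_on \<Omega> \<Theta>" "smooth_on \<Omega>' \<Xi>"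
    and img: "\<And>y. y \<in> \<Omega> \<Longrightarrow> fder \<Theta> y ` in_chart D c y = in_chart D' c' (\<Theta> y)"
  shows "\<exists>U V F. open U \<and> p \<in> U \<and> U \<subseteq> carrier A \<and> open V \<and> V \<subseteq> carrier A' \<and>
        diffeo_between A A' U V F \<and> F p = q \<and> carries_on A D A' D' U F"
proof -
  interpret X: chart_correspondence A A' c c' \<Omega> \<Omega>' \<Theta> \<Xi>
    by standard (rule A A' c c' \<Omega> \<Omega>' hom smooth)+
  \<comment> \<open>With the roles exchanged the locale describes the inverse map.\<close>
  interpret Y: chart_correspondence A' A c' c \<Omega>' \<Omega> \<Xi> \<Theta>
    by standard (rule A A' c c' \<Omega> \<Omega>' homeomorphism_sym[THEN iffD1, OF hom] smooth)+
  have GF: "Y.F (X.F x) = x" if "x \<in> X.U" for x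
    using that X.map_F[OF that] X.ch(3) hom by (auto simp: Y.F_def X.U_def homeomorphism_def)
  have FG: "X.F (Y.F x) = x" if "x \<in> Y.U" for x
    using that Y.map_F[OF that] X.ch'(3) hom by (auto simp: X.F_def Y.U_def homeomorphism_def)
  have FU: "X.F x \<in> Y.U" if "x \<in> X.U" for x using X.F_mem[OF that] by (simp add: Y.U_def)
  have GU: "Y.F x \<in> X.U" if "x \<in> Y.U" for x using Y.F_mem[OF that] by (simp add: X.U_def)
  have "homeomorphism X.U Y.U X.F Y.F"
    by (rule homeomorphismI[OF X.continuous_F Y.continuous_F]) (use FU GU FG GF in auto)
  then have "diffeo_between A A' X.U Y.U X.F"
    unfolding diffeo_between_def using X.smooth_map_on_F Y.smooth_map_on_F by blast
  moreover have "carries_on A D A' D' X.U X.F" by (rule X.carries_on_F[OF D D' img])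
  moreover have "X.F p = q" using X.ch'(3)[OF q(1)] q(2) by (simp add: X.F_def)
  moreover have "p \<in> X.U" "X.U \<subseteq> carrier A" "Y.U \<subseteq> carrier A'"
    using p c c' by (auto simp: X.U_def Y.U_def carrier_def)
  ultimately show ?thesis using X.open_U Y.open_U by blast
qed

section \<open>The jet space as a manifold, and local equivalence\<close>

lemma chart_inv_jet_chart: "chart_inv jet_chart = (\<lambda>x. x)"
  by (auto simp: chart_inv_def jet_chart_def fun_eq_iff intro: inv_into_f_f[of "\<lambda>x. x" UNIV, simplified])

lemma jet_chart_simps [simp]:
  "chart_dom jet_chart = UNIV" "chart_map jet_chart = (\<lambda>x. x)" "chart_img jet_chart = UNIV"
  by (simp_all add: jet_chart_def chart_img_def)

lemma transition_jet_chart: "transition jet_chart jet_chart = (\<lambda>x. x)"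
  by (simp add: transition_def chart_inv_jet_chart o_def)

lemma smooth_atlas_jet_atlas: "smooth_atlas jet_atlas"
  by (simp add: smooth_atlas_def jet_atlas_def is_chart_def chart_inv_jet_chart transition_jet_chart
      smooth_on_ident homeomorphism_ident)

lemma in_chart_cartan_distribution: "in_chart cartan_distribution jet_chart x = cartan_kernel x"
proof -
  have "\<exists>v\<in>cartan_distribution x. w = v jet_chart" if "w \<in> cartan_kernel x" for w
  proof
    \<comment> \<open>A tangent vector has to be 0 at every chart outside the atlas, which fixes the
      default value.\<close>
    show "(\<lambda>c. if c = jet_chart then w else 0) \<in> cartan_distribution x"
      using that by (auto simp: cartan_distribution_def tangent_space_def jet_atlas_def transition_jet_chart)
  qed simp
  then show ?thesis
    by (auto simp: in_chart_def chart_inv_jet_chart cartan_distribution_def image_iff)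
qed

lemma degenerated_parabolic_locally_cartan:
  fixes A :: "('m::topological_space, real^6) chart set"
  assumes A: "smooth_atlas A" and D: "degenerated_parabolic A D"
  shows "locally_equivalent A D jet_atlas cartan_distribution"
  unfolding locally_equivalent_def
proof (intro ballI)
  fix p and q :: "real^6" assume "p \<in> carrier A"
  then obtain c where c: "c \<in> A" "p \<in> chart_dom c" by (auto simp: carrier_def)
  have ch: "is_chart c" using A c by (simp add: smooth_atlas_def)
  have deg: "degenerated_parabolic_on (chart_img c) (in_chart D c)" and tD: "\<forall>p\<in>carrier A. D p \<subseteq> tangent_space A p"
    using D c by (auto simp: degenerated_parabolic_def)
  obtain M W \<Psi> g where M: "open M" "chart_map c p \<in> M" "M \<subseteq> chart_img c" "open W" "homeomorphism M W \<Psi> g"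
    "smooth_on M \<Psi>" "smooth_on W g" "\<Psi> (chart_map c p) = q" "\<forall>x\<in>M. fder \<Psi> x ` in_chart D c x = cartan_kernel (\<Psi> x)"
    by (rule local_normal_form[OF deg is_chartD(5)[OF ch c(2)], of q])
  show "\<exists>U V F. open U \<and> p \<in> U \<and> U \<subseteq> carrier A \<and> open V \<and> V \<subseteq> carrier jet_atlas \<and>
        diffeo_between A jet_atlas U V F \<and> F p = q \<and> carries_on A D jet_atlas cartan_distribution U F"
    by (rule local_equivalence_of_chart_diffeo[OF A smooth_atlas_jet_atlas c(1) _ tD _ c(2) M(2) _ _ M(1,3,4) _ M(5,6,7)])
      (use M in \<open>auto simp: jet_atlas_def cartan_distribution_def in_chart_cartan_distribution\<close>)
qed

text \<open>Both base points are sent to the jet 0, and one normal form is followed by the inverse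
  of the other.\<close>

lemma degenerated_parabolic_locally_equivalent:
  fixes A :: "('m::topological_space, real^6) chart set" and A' :: "('n::topological_space, real^6) chart set"
  assumes A: "smooth_atlas A" "degenerated_parabolic A D" and A': "smooth_atlas A'" "degenerated_parabolic A' D'"
  shows "locally_equivalent A D A' D'"
  unfolding locally_equivalent_def
proof (intro ballI)
  fix p q assume "p \<in> carrier A" "q \<in> carrier A'"
  then obtain c c' where c: "c \<in> A" "p \<in> chart_dom c" and c': "c' \<in> A'" "q \<in> chart_dom c'"
    by (auto simp: carrier_def)
  have ch: "is_chart c" "is_chart c'" using A A' c c' by (simp_all add: smooth_atlas_def)
  have deg: "degenerated_parabolic_on (chart_img c) (in_chart D c)" and tD: "\<forall>p\<in>carrier A. D p \<subseteq> tangent_space A p"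
    using A c by (auto simp: degenerated_parabolic_def)
  have deg': "degenerated_parabolic_on (chart_img c') (in_chart D' c')" and tD': "\<forall>p\<in>carrier A'. D' p \<subseteq> tangent_space A' p"
    using A' c' by (auto simp: degenerated_parabolic_def)
  obtain M W \<Psi> g where M: "open M" "chart_map c p \<in> M" "M \<subseteq> chart_img c" "open W" "homeomorphism M W \<Psi> g"
    "smooth_on M \<Psi>" "smooth_on W g" "\<Psi> (chart_map c p) = 0" "\<forall>x\<in>M. fder \<Psi> x ` in_chart D c x = cartan_kernel (\<Psi> x)"
    by (rule local_normal_form[OF deg is_chartD(5)[OF ch(1) c(2)], of 0])
  obtain M' W' \<Psi>' g' where M': "open M'" "chart_map c' q \<in> M'" "M' \<subseteq> chart_img c'" "open W'" "homeomorphism M' W' \<Psi>' g'"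
    "smooth_on M' \<Psi>'" "smooth_on W' g'" "\<Psi>' (chart_map c' q) = 0" "\<forall>x\<in>M'. fder \<Psi>' x ` in_chart D' c' x = cartan_kernel (\<Psi>' x)"
    by (rule local_normal_form[OF deg' is_chartD(5)[OF ch(2) c'(2)], of 0])
  \<comment> \<open>The images of the two normal forms need not agree; each domain is cut down to
    the points whose image lies in both.\<close>
  define \<Omega> where "\<Omega> = {x \<in> M. \<Psi> x \<in> W'}"
  define \<Omega>' where "\<Omega>' = {x \<in> M'. \<Psi>' x \<in> W}"
  have o: "open \<Omega>" "open \<Omega>'"
    using continuous_open_preimage[OF smooth_on_imp_continuous_on[OF M(6)] M(1) M'(4)]
      continuous_open_preimage[OF smooth_on_imp_continuous_on[OF M'(6)] M'(1) M(4)]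
    by (simp_all add: \<Omega>_def \<Omega>'_def vimage_def Collect_conj_eq)
  have h: "g (\<Psi> x) = x" "\<Psi> x \<in> W" if "x \<in> M" for x using M(5) that by (auto simp: homeomorphism_def)
  have h2: "\<Psi> (g y) = y" "g y \<in> M" if "y \<in> W" for y using M(5) that by (auto simp: homeomorphism_def)
  have h': "g' (\<Psi>' x) = x" "\<Psi>' x \<in> W'" if "x \<in> M'" for x using M'(5) that by (auto simp: homeomorphism_def)
  have h2': "\<Psi>' (g' y) = y" "g' y \<in> M'" if "y \<in> W'" for y using M'(5) that by (auto simp: homeomorphism_def)
  define \<Theta> where "\<Theta> x = g' (\<Psi> x)" for x
  define \<Xi> where "\<Xi> x = g (\<Psi>' x)" for x
  have sm\<Omega>: "smooth_on \<Omega> \<Psi>" by (rule smooth_on_subset[OF M(6)]) (auto simp: \<Omega>_def)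
  have sm\<Omega>': "smooth_on \<Omega>' \<Psi>'" by (rule smooth_on_subset[OF M'(6)]) (auto simp: \<Omega>'_def)
  have sm: "smooth_on \<Omega> \<Theta>" "smooth_on \<Omega>' \<Xi>"
    unfolding \<Theta>_def \<Xi>_def
    by (rule smooth_on_compose[OF o(1) sm\<Omega> M'(7)], force simp: \<Omega>_def,
        rule smooth_on_compose[OF o(2) sm\<Omega>' M(7)], force simp: \<Omega>'_def)
  have hom: "homeomorphism \<Omega> \<Omega>' \<Theta> \<Xi>"
    by (rule homeomorphismI[OF smooth_on_imp_continuous_on[OF sm(1)] smooth_on_imp_continuous_on[OF sm(2)]])
      (use h h2 h' h2' in \<open>auto simp: \<Omega>_def \<Omega>'_def \<Theta>_def \<Xi>_def\<close>)
  have pq: "chart_map c p \<in> \<Omega>" "\<Theta> (chart_map c p) = chart_map c' q"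
    using M(2,8) M'(2,8) h'[OF M'(2)] by (auto simp: \<Omega>_def \<Theta>_def)
  have img: "fder \<Theta> y ` in_chart D c y = in_chart D' c' (\<Theta> y)" if y: "y \<in> \<Omega>" for y
  proof -
    have yM: "y \<in> M" "\<Psi> y \<in> W'" using y by (auto simp: \<Omega>_def)
    let ?z = "\<Theta> y"
    have z: "?z \<in> M'" "\<Psi>' ?z = \<Psi> y" using h2'[OF yM(2)] by (auto simp: \<Theta>_def)
    have "(\<Theta> has_derivative (\<lambda>v. fder g' (\<Psi> y) (fder \<Psi> y v))) (at y)"
      unfolding \<Theta>_def by (rule has_derivative_compose[OF smooth_on_has_derivative[OF M(6) yM(1)] smooth_on_has_derivative[OF M'(7) yM(2)]])
    then have d\<Theta>: "fder \<Theta> y = (\<lambda>v. fder g' (\<Psi> y) (fder \<Psi> y v))" by (rule fder_eq)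
    \<comment> \<open>Differentiating \<open>g' (\<Psi>' x) = x\<close> at \<open>?z\<close> shows
      that \<open>fder g' (\<Psi> y)\<close> undoes \<open>fder \<Psi>' ?z\<close>, and so maps the
      Cartan kernel back onto the second distribution.\<close>
    have "((\<lambda>x. g' (\<Psi>' x)) has_derivative (\<lambda>v. fder g' (\<Psi> y) (fder \<Psi>' ?z v))) (at ?z)"
      unfolding z(2)[symmetric]
      by (rule has_derivative_compose[OF smooth_on_has_derivative[OF M'(6) z(1)] smooth_on_has_derivative[OF M'(7)]])
        (use yM(2) z(2) in simp)
    moreover have "((\<lambda>x. g' (\<Psi>' x)) has_derivative (\<lambda>v. v)) (at ?z)"
      by (subst has_derivative_cong_open[OF M'(1) z(1), of _ "\<lambda>x. x"]) (auto simp: h')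
    ultimately have inv: "(\<lambda>v. fder g' (\<Psi> y) (fder \<Psi>' ?z v)) = (\<lambda>v. v)" by (rule has_derivative_unique)
    have "fder \<Theta> y ` in_chart D c y = fder g' (\<Psi> y) ` cartan_kernel (\<Psi>' ?z)"
      using M(9) yM(1) unfolding d\<Theta> z(2) by (metis image_image)
    also have "\<dots> = (\<lambda>v. fder g' (\<Psi> y) (fder \<Psi>' ?z v)) ` in_chart D' c' ?z"
      using M'(9) z(1) by (metis image_image)
    finally show ?thesis unfolding inv by simp
  qed
  show "\<exists>U V F. open U \<and> p \<in> U \<and> U \<subseteq> carrier A \<and> open V \<and> V \<subseteq> carrier A' \<and>
        diffeo_between A A' U V F \<and> F p = q \<and> carries_on A D A' D' U F"
    by (rule local_equivalence_of_chart_diffeo[OF A(1) A'(1) c(1) c'(1) tD tD' c(2) pq(1) c'(2) pq(2) o(1) _ o(2) _ hom sm img])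
      (use M(3) M'(3) in \<open>auto simp: \<Omega>_def \<Omega>'_def\<close>)
qed

theorem theorem4p2:
  fixes A :: "('m::{t2_space,second_countable_topology}, real^6) chart set"
    and D :: "'m \<Rightarrow> ('m, real^6) tvector set"
  assumes "smooth_atlas A" and "degenerated_parabolic A D"
  shows "locally_equivalent A D jet_atlas cartan_distribution \<and>
    (\<forall>(A' :: ('n::{t2_space,second_countable_topology}, real^6) chart set) D'.
       smooth_atlas A' \<longrightarrow> degenerated_parabolic A' D' \<longrightarrow> locally_equivalent A D A' D')"
  using degenerated_parabolic_locally_cartan[OF assms] degenerated_parabolic_locally_equivalent[OF assms]
  by blast

end
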